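(* Under the setting in the context, there is a constant $M_1>0$ such that, as $n\to\infty$, $$\sup_{\beta_0\in\mathcal B_0,\ \Sigma_0\in\mathcal H_0}\mathbb E_0\,\Pi\Big(\beta:\ \|X(\beta-\beta_0)\|_F^2\ge M_1 n\epsilon_n^2\ \Big|\ Y_1,\dots,Y_n\Big)\to 0,$$ $$\sup_{\beta_0\in\mathcal B_0,\ \Sigma_0\in\mathcal H_0}\mathbb E_0\,\Pi\Big(\Sigma:\ \|\Sigma-\Sigma_0\|_F^2\ge M_1 \epsilon_n^2\ \Big|\ Y_1,\dots,Y_n\Big)\to 0.$$
   Context: Model: for $i=1,\dots,n$, $Y_i=\sum_{j=1}^G X_{ij}\beta_j+\varepsilon_i = X_i\beta+\varepsilon_i$, where $Y_i$ is $1\times d$, $\varepsilon_1,\dots,\varepsilon_n$ are i.i.d. $\mathcal N(0,\Sigma)$ with $\Sigma$ an unknown $d\times d$ positive definite matrix, $\mathcal G_1,\dots,\mathcal G_G$ are given disjoint groups with $\bigcup_j\mathcal G_j=\{1,\dots,p\}$, $p_j=|\mathcal G_j|$, $p_{\max}=\max_j p_j$, $X_i=(X_{i1},\dots,X_{iG})$ is a fixed $1\times p$ row (with $X_{ij}$ of size $1\times p_j$), $X$ is the $n\times p$ design matrix with rows $X_i$, and $\beta=(\beta_1',\dots,\beta_G')'$ is $p\times d$ ($\beta_j$ of size $p_j\times d$). For a $p\times d$ matrix $\beta$, $\beta_k$ is its $k$th column, $\beta_{jk}\in\mathbb R^{p_j}$ the subvector of $\beta_k$ indexed by $\mathcal G_j$,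 $\|\beta_k\|_{2,1}=\sum_{j=1}^G\|\beta_{jk}\|$ ($\|\cdot\|$ Euclidean), $S_{\beta,k}=\{j:\beta_{jk}\neq 0\}$, $S_\beta=(S_{\beta,1},\dots,S_{\beta,d})$, $s_\beta=\sum_k|S_{\beta,k}|$. $\|\cdot\|_F$ is the Frobenius norm, $\|\cdot\|$ on matrices the spectral norm, and $\|X\|_\circ=\max_{1\le j\le G}\|X_j\|$ where $X_j$ is the $n\times p_j$ submatrix of columns in $\mathcal G_j$. True values $(\beta_0,\Sigma_0)$; $S_{0,k}=S_{\beta_0,k}$, $s_0=s_{\beta_0}$, $p_{S_0}=\sum_k\sum_{j\in S_{0,k}}p_j$; $\mathbb E_0,\mathbb P_0$ refer to the true distribution; $a\vee b=\max\{a,b\}$. Prior: $\beta$ and $\Sigma$ independent. For $\beta$: draw $s\in\{0,1,\dots,Gd\}$ from $\pi$; given $s$, draw $S=(S_1,\dots,S_d)$, $S_k\subseteq\{1,\dots,G\}$, with $\sum_k|S_k|=s$, uniformly (probability $1/\binom{Gd}{s}$); then independently for each $k$ the coordinates $\beta_{k,S_k}=(\beta_{jk})_{j\in S_k}$ have density $g_{S_k}(\beta_{k,S_k})=\prod_{j\in S_k}(\lambda_k/a_j)^{p_j}\exp(-\lambda_k\sum_{j\in S_k}\|\beta_{jk}\|)$ and $\beta_{jk}=0$ for $j\notin S_k$, where $a_j=\sqrt\pi\,(\Gamma(p_j+1)/\Gamma(p_j/2+1))^{1/p_j}$. Assumption on $\pi$: for constants $A_1,A_2,A_3,A_4>0$,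 $A_1(G\vee n^{p_{\max}})^{-A_3}\le \pi(s)/\pi(s-1)\le A_2(G\vee n^{p_{\max}})^{-A_4}$ for $s=1,\dots,Gd$. Assumption on $\lambda_k$: for constants $B_1,B_2,B_3>0$ and all $k$, $\underline\lambda\le\lambda_k\le\overline\lambda$ with $\underline\lambda=\|X\|_\circ/(B_1(G^{1/p_{\max}}\vee n)^{B_2})$, $\overline\lambda=B_3\|X\|_\circ\sqrt{\log G\vee p_{\max}\log n}$. For $\Sigma$: write $\Sigma=PDP'$ with $P$ drawn from the Haar (uniform) probability measure on the $d\times d$ orthogonal group and the diagonal entries of $D$ i.i.d. from a fixed inverse Gaussian distribution, independent of $P$. Truth sets: $\mathcal B_0=\{\beta: s_\beta=s_0,\ \sum_{k=1}^d\|\beta_k\|_{2,1}\le\overline\beta\}$ with $\overline\beta=s_0(\log G\vee p_{\max}\log n)/\max_k\lambda_k$, and $\mathcal H_0=\{\Sigma: b_1I_d\le\Sigma\le b_2I_d\}$ for fixed $b_1,b_2>0$. Rate: $\epsilon_n=\max\{\sqrt{s_0\log G/n},\sqrt{s_0p_{\max}\log n/n},\sqrt{d^2\log n/n}\}$. Asymptotics: $n\to\infty$ with $G,p,d,p_j,s_0$ allowed to depend on $n$, under the standing assumptions $p_{S_0}=o(n)$, $p_{\max}=o(n)$, $G\ge n^c$ for some $c>0$, $\log G=o(n)$, $d^2\log n=o(n)$, and $\epsilon_n\to0$. $\Pi(\cdot\mid Y_1,\dots,Y_n)$ denotes the posterior. *)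

theory Defs
  imports "HOL-Probability.Probability"
          "Jordan_Normal_Form.Determinant"
          "Jordan_Normal_Form.Gauss_Jordan_Elimination"
begin

text \<open>Matrices of varying size are functions on pairs of indices (row, column),
  with rows/columns ranging over explicit index sets {0..<m}.\<close>
type_synonym rmat = "nat \<times> nat \<Rightarrow> real"

definition mspace :: "nat set \<Rightarrow> nat set \<Rightarrow> rmat measure" where
  "mspace R C = PiM (R \<times> C) (\<lambda>_. borel)"

definition mmul :: "nat set \<Rightarrow> nat set \<Rightarrow> nat set \<Rightarrow> rmat \<Rightarrow> rmat \<Rightarrow> rmat" where
  "mmul R K C A B = restrict (\<lambda>(i,j). \<Sum>k\<in>K. A (i,k) * B (k,j)) (R \<times> C)"

definition frob2 :: "nat set \<Rightarrow> nat set \<Rightarrow> rmat \<Rightarrow> real" where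
  "frob2 R C A = (\<Sum>i\<in>R. \<Sum>j\<in>C. (A (i,j))\<^sup>2)"

definition spec_norm :: "nat set \<Rightarrow> nat set \<Rightarrow> rmat \<Rightarrow> real" where
  "spec_norm R C A = Sup {sqrt (\<Sum>i\<in>R. (\<Sum>l\<in>C. A (i,l) * v l)\<^sup>2) | v. (\<Sum>l\<in>C. (v l)\<^sup>2) = 1}"

definition pmax :: "nat \<Rightarrow> (nat \<Rightarrow> nat set) \<Rightarrow> nat" where
  "pmax G grp = Max {card (grp j) | j. j < G}"

definition circ_norm :: "nat \<Rightarrow> nat \<Rightarrow> (nat \<Rightarrow> nat set) \<Rightarrow> rmat \<Rightarrow> real" where
  "circ_norm n G grp X = Max {spec_norm {0..<n} (grp j) X | j. j < G}"

definition gnorm :: "(nat \<Rightarrow> nat set) \<Rightarrow> rmat \<Rightarrow> nat \<Rightarrow> nat \<Rightarrow> real" where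
  "gnorm grp \<beta> j k = sqrt (\<Sum>l\<in>grp j. (\<beta> (l,k))\<^sup>2)"

definition gsupp :: "nat \<Rightarrow> nat \<Rightarrow> (nat \<Rightarrow> nat set) \<Rightarrow> rmat \<Rightarrow> (nat \<times> nat) set" where
  "gsupp G d grp \<beta> = {(j,k). j < G \<and> k < d \<and> (\<exists>l\<in>grp j. \<beta> (l,k) \<noteq> 0)}"

definition a_const :: "nat \<Rightarrow> real" where
  "a_const q = sqrt pi * (Gamma (real q + 1) / Gamma (real q / 2 + 1)) powr (1 / real q)"

definition coords :: "(nat \<Rightarrow> nat set) \<Rightarrow> (nat \<times> nat) set \<Rightarrow> (nat \<times> nat) set" where
  "coords grp S = {(l,k). \<exists>j. (j,k) \<in> S \<and> l \<in> grp j}"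

definition glap_dens :: "(nat \<Rightarrow> nat set) \<Rightarrow> (nat \<Rightarrow> real) \<Rightarrow> (nat \<times> nat) set \<Rightarrow> rmat \<Rightarrow> real" where
  "glap_dens grp lam S b = (\<Prod>(j,k)\<in>S. (lam k / a_const (card (grp j))) ^ card (grp j)
        * exp (- lam k * gnorm grp b j k))"

definition beta_given_S :: "nat \<Rightarrow> nat \<Rightarrow> (nat \<Rightarrow> nat set) \<Rightarrow> (nat \<Rightarrow> real) \<Rightarrow> (nat \<times> nat) set \<Rightarrow> rmat measure" where
  "beta_given_S p d grp lam S =
     distr (density (PiM (coords grp S) (\<lambda>_. lborel)) (\<lambda>b. ennreal (glap_dens grp lam S b)))
       (mspace {0..<p} {0..<d})
       (\<lambda>b. restrict (\<lambda>lk. if lk \<in> coords grp S then b lk else 0) ({0..<p} \<times> {0..<d}))"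

definition supp_pmf :: "nat pmf \<Rightarrow> nat \<Rightarrow> nat \<Rightarrow> (nat \<times> nat) set pmf" where
  "supp_pmf pr G d = bind_pmf pr (\<lambda>s. pmf_of_set {S. S \<subseteq> {0..<G} \<times> {0..<d} \<and> card S = s})"

definition prior_beta :: "nat pmf \<Rightarrow> nat \<Rightarrow> nat \<Rightarrow> nat \<Rightarrow> (nat \<Rightarrow> nat set) \<Rightarrow> (nat \<Rightarrow> real) \<Rightarrow> rmat measure" where
  "prior_beta pr G p d grp lam = measure_pmf (supp_pmf pr G d) \<bind> (\<lambda>S. beta_given_S p d grp lam S)"

definition orth :: "nat \<Rightarrow> rmat set" where
  "orth d = {P \<in> extensional ({0..<d} \<times> {0..<d}).
      \<forall>i<d. \<forall>l<d. (\<Sum>k<d. P (k,i) * P (k,l)) = (if i = l then 1 else 0)}"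

definition haar_orth :: "nat \<Rightarrow> rmat measure \<Rightarrow> bool" where
  "haar_orth d H \<longleftrightarrow> prob_space H \<and> sets H = sets (mspace {0..<d} {0..<d}) \<and>
     emeasure H (orth d) = 1 \<and>
     (\<forall>Q\<in>orth d. distr H (mspace {0..<d} {0..<d}) (mmul {0..<d} {0..<d} {0..<d} Q) = H)"

definition ig_dens :: "real \<Rightarrow> real \<Rightarrow> real \<Rightarrow> real" where
  "ig_dens mu nu x = (if x > 0 then sqrt (nu / (2 * pi * x ^ 3)) * exp (- nu * (x - mu)\<^sup>2 / (2 * mu\<^sup>2 * x)) else 0)"

definition prior_Sigma :: "nat \<Rightarrow> rmat measure \<Rightarrow> real \<Rightarrow> real \<Rightarrow> rmat measure" where
  "prior_Sigma d H mu nu =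
     distr (H \<Otimes>\<^sub>M PiM {0..<d} (\<lambda>_. density lborel (\<lambda>x. ennreal (ig_dens mu nu x))))
       (mspace {0..<d} {0..<d})
       (\<lambda>(P, D). restrict (\<lambda>(i,l). \<Sum>k<d. P (i,k) * D k * P (l,k)) ({0..<d} \<times> {0..<d}))"

definition gauss_dens :: "nat \<Rightarrow> (nat \<Rightarrow> real) \<Rightarrow> rmat \<Rightarrow> (nat \<Rightarrow> real) \<Rightarrow> real" where
  "gauss_dens d m Sig y =
     (let S = mat d d Sig; r = vec d (\<lambda>k. y k - m k) in
      case mat_inverse S of
        None \<Rightarrow> 0
      | Some Sinv \<Rightarrow> (2 * pi) powr (- real d / 2) * det S powr (- 1 / 2) * exp (- (r \<bullet> (Sinv *\<^sub>v r)) / 2))"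

definition lik :: "nat \<Rightarrow> nat \<Rightarrow> nat \<Rightarrow> rmat \<Rightarrow> rmat \<Rightarrow> rmat \<Rightarrow> rmat \<Rightarrow> real" where
  "lik n p d X \<beta> Sig Y = (\<Prod>i<n. gauss_dens d (\<lambda>k. \<Sum>l<p. X (i,l) * \<beta> (l,k)) Sig (\<lambda>k. Y (i,k)))"

definition data_dist :: "nat \<Rightarrow> nat \<Rightarrow> nat \<Rightarrow> rmat \<Rightarrow> rmat \<Rightarrow> rmat \<Rightarrow> rmat measure" where
  "data_dist n p d X \<beta>0 Sig0 =
     density (PiM ({0..<n} \<times> {0..<d}) (\<lambda>_. lborel)) (\<lambda>Y. ennreal (lik n p d X \<beta>0 Sig0 Y))"

definition posterior :: "(rmat \<times> rmat) measure \<Rightarrow> (rmat \<times> rmat \<Rightarrow> rmat \<Rightarrow> real) \<Rightarrow> (rmat \<times> rmat) set \<Rightarrow> rmat \<Rightarrow> real" where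
  "posterior Pr L A Y =
     enn2real (\<integral>\<^sup>+ \<theta>. indicator A \<theta> * ennreal (L \<theta> Y) \<partial>Pr) / enn2real (\<integral>\<^sup>+ \<theta>. ennreal (L \<theta> Y) \<partial>Pr)"

definition B0_set :: "nat \<Rightarrow> nat \<Rightarrow> nat \<Rightarrow> nat \<Rightarrow> (nat \<Rightarrow> nat set) \<Rightarrow> (nat \<Rightarrow> real) \<Rightarrow> nat \<Rightarrow> rmat set" where
  "B0_set n G p d grp lam s0 =
     {\<beta> \<in> extensional ({0..<p} \<times> {0..<d}). card (gsupp G d grp \<beta>) = s0 \<and>
        (\<Sum>k<d. \<Sum>j<G. gnorm grp \<beta> j k)
          \<le> real s0 * max (ln (real G)) (real (pmax G grp) * ln (real n)) / Max (lam ` {0..<d})}"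

definition H0_set :: "nat \<Rightarrow> real \<Rightarrow> real \<Rightarrow> rmat set" where
  "H0_set d b1 b2 =
     {S \<in> extensional ({0..<d} \<times> {0..<d}). (\<forall>i<d. \<forall>l<d. S (i,l) = S (l,i)) \<and>
        (\<forall>v :: nat \<Rightarrow> real.
           b1 * (\<Sum>i<d. (v i)\<^sup>2) \<le> (\<Sum>i<d. \<Sum>l<d. v i * S (i,l) * v l) \<and>
           (\<Sum>i<d. \<Sum>l<d. v i * S (i,l) * v l) \<le> b2 * (\<Sum>i<d. (v i)\<^sup>2))}"

definition pS0 :: "nat \<Rightarrow> nat \<Rightarrow> (nat \<Rightarrow> nat set) \<Rightarrow> rmat \<Rightarrow> nat" where
  "pS0 G d grp \<beta> = (\<Sum>(j,k)\<in>gsupp G d grp \<beta>. card (grp j))"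

definition eps_rate :: "nat \<Rightarrow> nat \<Rightarrow> nat \<Rightarrow> nat \<Rightarrow> nat \<Rightarrow> real" where
  "eps_rate n s0 G pm d =
     max (sqrt (real s0 * ln (real G) / real n))
         (max (sqrt (real s0 * real pm * ln (real n) / real n))
              (sqrt ((real d)\<^sup>2 * ln (real n) / real n)))"

end

theory Submission
  imports Defs
begin

text \<open>Write \<open>r = n \<epsilon>\<^sub>n\<^sup>2\<close>. The prior puts mass at least \<open>exp (- C r)\<close> on parameters whose likelihood is, for
  every sample, at least \<open>exp (- C r)\<close> times the likelihood of the truth: \<open>\<beta>\<close> is taken very close to \<open>\<beta>\<^sub>0\<close>
  and \<open>\<Sigma>\<close> slightly larger than \<open>\<Sigma>\<^sub>0\<close> in the Loewner order, and then the Gaussian densities are comparable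
  pointwise. This bounds the denominator of the posterior deterministically from below. Outside a sieve of
  sparse \<open>\<beta>\<close> with polynomially bounded entries and \<open>\<Sigma>\<close> with polynomially bounded spectrum the prior mass is
  exponentially small. The sieve is covered by \<open>exp (C r)\<close> cells on each of which the likelihood is dominated
  by a multiple of a single Gaussian likelihood, and the Hellinger affinity of the latter with the truth is at
  most \<open>exp (- c M r)\<close> if the cell contains a point at distance \<open>M r\<close>. As the posterior mass \<open>x\<close> of the far part
  satisfies \<open>x \<le> min 1 q \<le> sqrt q\<close> for the likelihood ratio \<open>q\<close>, affinities suffice to bound its expectation.\<close>

section \<open>Symmetric matrices and orthogonal diagonalisation\<close>

text \<open>The obstacle is that the spectrum of \<Sigma> is unbounded under the prior, while a
  difference of means separates two Gaussian laws only relative to their covariances. Affinities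
  settle this by a case distinction: a covariance far from the truth is detected by the variance
  part alone, at a rate that saturates at a constant per observation; a covariance within Frobenius
  distance \<open>b2\<close> of the truth has its spectrum bounded above by \<open>2 * b2\<close>,
  and then the mean part applies. Because of the saturation, \<open>M * r\<close> has to stay below
  a multiple of n, which is where the rate tending to 0 enters. The constants are chosen in the
  order evidence exponent \<open>C2\<close>, sieve size \<open>K\<close>, radius \<open>M\<close>:
  \<open>K\<close> makes the prior mass outside the sieve negligible against the evidence, and
  \<open>M\<close> then beats the number of cells, whose exponent grows with \<open>K\<close>. The
  mass of one inverse Gaussian factor enters through a bound \<open>CI\<close>; since
  \<open>d \<le> r\<close>, the power \<open>CI ^ d\<close> costs one more factor
  \<open>exp (ln CI * r)\<close>. Rescaling \<beta> by the design norm makes all coverings and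
  neighbourhoods polynomial in n, whatever the scale of X.\<close>

definition bf :: "nat \<Rightarrow> rmat \<Rightarrow> (nat \<Rightarrow> real) \<Rightarrow> (nat \<Rightarrow> real) \<Rightarrow> real" where
  "bf d S u v = (\<Sum>i<d. \<Sum>l<d. u i * S (i,l) * v l)"

definition sq :: "nat \<Rightarrow> (nat \<Rightarrow> real) \<Rightarrow> real" where
  "sq d v = (\<Sum>i<d. (v i)\<^sup>2)"

definition symm :: "nat \<Rightarrow> rmat \<Rightarrow> bool" where
  "symm d S \<longleftrightarrow> (\<forall>i<d. \<forall>l<d. S (i,l) = S (l,i))"

text \<open>Coercivity with a constant: eigenvalues are values of the form at unit vectors, so the
  constant bounds them away from 0 at once.\<close>

definition spd :: "nat \<Rightarrow> rmat \<Rightarrow> bool" where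
  "spd d S \<longleftrightarrow> symm d S \<and> (\<exists>a>0. \<forall>v. a * sq d v \<le> bf d S v v)"

definition mv :: "nat \<Rightarrow> rmat \<Rightarrow> (nat \<Rightarrow> real) \<Rightarrow> nat \<Rightarrow> real" where
  "mv d A v i = (\<Sum>l<d. A (i,l) * v l)"

definition tr :: "rmat \<Rightarrow> rmat" where
  "tr A = (\<lambda>(i,l). A (l,i))"

lemma tr_apply [simp]: "tr A (i,l) = A (l,i)"
  by (simp add: tr_def)

lemma bf_lin_left: "bf d S (\<lambda>r. a * u r + b * w r) v = a * bf d S u v + b * bf d S w v"
  unfolding bf_def sum_distrib_left sum.distrib[symmetric] by (intro sum.cong refl) (simp add: algebra_simps)

lemma bf_lin_right: "bf d S u (\<lambda>r. a * v r + b * w r) = a * bf d S u v + b * bf d S u w"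
  unfolding bf_def sum_distrib_left sum.distrib[symmetric] by (intro sum.cong refl) (simp add: algebra_simps)

lemma bf_sym: assumes "symm d S" shows "bf d S u v = bf d S v u"
proof -
  have "bf d S u v = (\<Sum>l<d. \<Sum>i<d. u i * S (i,l) * v l)"
    unfolding bf_def by (rule sum.swap)
  also have "\<dots> = bf d S v u" unfolding bf_def using assms
    by (intro sum.cong refl) (auto simp: symm_def)
  finally show ?thesis .
qed

lemma sq_nonneg [simp]: "0 \<le> sq d v"
  by (simp add: sq_def sum_nonneg)

text \<open>Matrices are functions on all index pairs, so the topology is the product topology and
  compactness comes from Tychonoff. Unit columns put every entry into [-1,1]; outside the index
  square the factor is the singleton \<open>undefined\<close>, which encodes extensionality. The
  orthogonality equations are closed conditions on finitely many coordinates.\<close>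

lemma compact_orth: "compact (orth d)"
proof -
  define S :: "nat \<times> nat \<Rightarrow> real set" where
    "S = (\<lambda>x. if x \<in> {0..<d} \<times> {0..<d} then {-1..1} else {undefined})"
  have "compactin (product_topology (\<lambda>_. euclidean) UNIV) (PiE UNIV S)"
    unfolding compactin_PiE by (auto simp: S_def)
  then have K: "compact (PiE UNIV S)"
    by (simp add: euclidean_product_topology)
  have cl: "closed {P :: rmat. \<forall>i<d. \<forall>l<d. (\<Sum>k<d. P (k,i) * P (k,l)) = (if i = l then 1 else 0)}"
    by (intro closed_Collect_all closed_Collect_imp open_Collect_const closed_Collect_eq
        continuous_intros continuous_on_product_coordinates)
  have le1: "P (i,l) \<in> {-1..1}" if P: "P \<in> orth d" and il: "i < d" "l < d" for P :: rmat and i l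
  proof -
    have "(P (i,l))\<^sup>2 \<le> (\<Sum>k<d. P (k,l) * P (k,l))"
      using il by (subst power2_eq_square) (rule member_le_sum, auto)
    also have "\<dots> = 1" using P il by (auto simp: orth_def)
    finally have "\<bar>P (i,l)\<bar> \<le> 1" by (simp add: abs_square_le_1)
    then show ?thesis by auto
  qed
  have "orth d = PiE UNIV S \<inter> {P. \<forall>i<d. \<forall>l<d. (\<Sum>k<d. P (k,i) * P (k,l)) = (if i = l then 1 else 0)}"
  proof (intro Set.set_eqI iffI)
    fix P assume P: "P \<in> orth d"
    have "P x \<in> S x" for x
      using le1[OF P] P by (cases x) (auto simp: S_def orth_def extensional_def)
    then show "P \<in> PiE UNIV S \<inter> {P. \<forall>i<d. \<forall>l<d. (\<Sum>k<d. P (k,i) * P (k,l)) = (if i = l then 1 else 0)}"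
      using P by (auto simp: orth_def)
  next
    fix P assume P: "P \<in> PiE UNIV S \<inter> {P. \<forall>i<d. \<forall>l<d. (\<Sum>k<d. P (k,i) * P (k,l)) = (if i = l then 1 else 0)}"
    then have "P x \<in> S x" for x by auto
    then have "P x = undefined" if "x \<notin> {0..<d} \<times> {0..<d}" for x
      using that by (metis S_def singletonD)
    then show "P \<in> orth d" using P by (auto simp: orth_def extensional_def)
  qed
  then show ?thesis using K cl by (simp add: compact_Int_closed)
qed

text \<open>The 2x2 Jacobi step. A rotation keeps the trace \<open>a + b\<close>; with the right
  angle the difference of the diagonal entries grows from \<open>a - b\<close> to \<rho>, the square
  root of \<open>(a - b)^2 + 4 * x^2\<close>. Hence the sum of the squared diagonal entries rises by
  exactly \<open>2 * x^2\<close>.\<close>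

lemma rotation_increases_diagonal:
  fixes a b x :: real
  assumes "x \<noteq> 0"
  obtains c s where "c\<^sup>2 + s\<^sup>2 = 1"
    "a\<^sup>2 + b\<^sup>2 < (c\<^sup>2 * a + 2 * c * s * x + s\<^sup>2 * b)\<^sup>2 + (s\<^sup>2 * a - 2 * c * s * x + c\<^sup>2 * b)\<^sup>2"
proof -
  define u where "u = a - b"
  define \<rho> where "\<rho> = sqrt (u\<^sup>2 + (2 * x)\<^sup>2)"
  have \<rho>: "\<rho>\<^sup>2 = u\<^sup>2 + (2 * x)\<^sup>2" "\<rho> > 0" using assms
    by (auto simp: \<rho>_def add_nonneg_pos)
  have "u\<^sup>2 + (2 * x)\<^sup>2 \<noteq> 0" using \<rho> by (metis less_irrefl power_zero_numeral zero_less_power)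
  then have "(u/\<rho>)\<^sup>2 + (2*x/\<rho>)\<^sup>2 = 1"
    by (simp add: power_divide add_divide_distrib[symmetric] \<rho>(1) del: power_mult_distrib)
  \<comment> \<open>The normalised pair lies on the unit circle and so is the cosine and sine of
    some t. Half of this angle is the Jacobi rotation, through the double angle formulas.\<close>
  then obtain t where t: "u/\<rho> = cos t" "2*x/\<rho> = sin t"
    using sincos_total_2pi by metis
  define c where "c = cos (t/2)"
  define s where "s = sin (t/2)"
  have ct: "cos t = c\<^sup>2 - s\<^sup>2" "sin t = 2 * s * c"
    using cos_double[of "t/2"] sin_double[of "t/2"] by (simp_all add: c_def s_def)
  have cs: "c\<^sup>2 + s\<^sup>2 = 1" "u = \<rho> * (c\<^sup>2 - s\<^sup>2)" "2*x = \<rho> * (2 * s * c)"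
    using t \<rho>(2) unfolding ct[symmetric] by (simp_all add: c_def s_def field_simps)
  let ?A = "c\<^sup>2 * a + 2 * c * s * x + s\<^sup>2 * b" and ?B = "s\<^sup>2 * a - 2 * c * s * x + c\<^sup>2 * b"
  have sum: "?A + ?B = a + b" using cs(1) by (metis (no_types, opaque_lifting) add.commute
      add_diff_cancel_left' distrib_right mult.left_neutral add.left_commute add_diff_eq diff_add_eq diff_add_cancel)
  have "?A - ?B = (c\<^sup>2 - s\<^sup>2) * u + (2 * s * c) * (2 * x)" by (simp add: u_def algebra_simps)
  also have "\<dots> = \<rho> * ((c\<^sup>2 - s\<^sup>2)\<^sup>2 + (2 * s * c)\<^sup>2)" unfolding cs(2) cs(3) by (simp add: algebra_simps power2_eq_square)
  also have "(c\<^sup>2 - s\<^sup>2)\<^sup>2 + (2 * s * c)\<^sup>2 = (c\<^sup>2 + s\<^sup>2)\<^sup>2" by (simp add: algebra_simps power2_eq_square)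
  finally have diff: "?A - ?B = \<rho>" using cs(1) by simp
  have "2 * (?A\<^sup>2 + ?B\<^sup>2) = (?A + ?B)\<^sup>2 + (?A - ?B)\<^sup>2" by (simp add: algebra_simps power2_eq_square)
  also have "\<dots> = (a+b)\<^sup>2 + u\<^sup>2 + (2 * x)\<^sup>2" unfolding sum diff \<rho> by simp
  also have "\<dots> = 2 * (a\<^sup>2 + b\<^sup>2) + (2 * x)\<^sup>2" by (simp add: u_def algebra_simps power2_eq_square)
  also have "\<dots> > 2 * (a\<^sup>2 + b\<^sup>2)" using assms by simp
  finally show ?thesis using that[OF cs(1)] by simp
qed

text \<open>An orthogonal matrix maximising the sum of the squared diagonal entries of \<open>P' S P\<close>
  diagonalises \<open>S\<close>, since a Jacobi rotation increases this sum if an off-diagonal entry is nonzero.\<close>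

lemma orth_diagonalizes:
  assumes S: "symm d S"
  obtains P where "P \<in> orth d"
    "\<And>a b. a < d \<Longrightarrow> b < d \<Longrightarrow> a \<noteq> b \<Longrightarrow> bf d S (\<lambda>r. P (r,a)) (\<lambda>r. P (r,b)) = 0"
proof -
  define g where "g P = (\<Sum>i<d. (bf d S (\<lambda>r. P (r,i)) (\<lambda>r. P (r,i)))\<^sup>2)" for P :: rmat
  have cont: "continuous_on (orth d) g"
    unfolding g_def bf_def
    by (intro continuous_intros continuous_on_subset[OF continuous_on_product_coordinates]) auto
  have "restrict (\<lambda>(i,l). if i = l then 1 else 0) ({0..<d} \<times> {0..<d}) \<in> orth d"
    by (auto simp: orth_def if_distrib[of "\<lambda>x. _ * x"] if_distrib[of "\<lambda>x. x * _"] cong: if_cong)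
  then obtain P where P: "P \<in> orth d" "\<And>Q. Q \<in> orth d \<Longrightarrow> g Q \<le> g P"
    using continuous_attains_sup[OF compact_orth _ cont] by auto
  have "bf d S (\<lambda>r. P (r,a)) (\<lambda>r. P (r,b)) = 0" if ab: "a < d" "b < d" "a \<noteq> b" for a b
  proof (rule ccontr)
    define p where "p k = (\<lambda>r. P (r,k))" for k
    assume "bf d S (\<lambda>r. P (r,a)) (\<lambda>r. P (r,b)) \<noteq> 0"
    then have nz: "bf d S (p a) (p b) \<noteq> 0" by (simp add: p_def)
    from rotation_increases_diagonal[OF nz, of "bf d S (p a) (p a)" "bf d S (p b) (p b)"]
    obtain c s where cs: "c\<^sup>2 + s\<^sup>2 = 1" and
      gt: "(bf d S (p a) (p a))\<^sup>2 + (bf d S (p b) (p b))\<^sup>2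
        < (c\<^sup>2 * bf d S (p a) (p a) + 2 * c * s * bf d S (p a) (p b) + s\<^sup>2 * bf d S (p b) (p b))\<^sup>2
         + (s\<^sup>2 * bf d S (p a) (p a) - 2 * c * s * bf d S (p a) (p b) + c\<^sup>2 * bf d S (p b) (p b))\<^sup>2" by metis
    define q where "q k = (if k = a then (\<lambda>r. c * p a r + s * p b r) else if k = b then (\<lambda>r. - s * p a r + c * p b r) else p k)" for k
    define Q where "Q = restrict (\<lambda>(r,k). q k r) ({0..<d} \<times> {0..<d})"
    have ip: "(\<Sum>r<d. p i r * p l r) = (if i = l then 1 else 0)" if "i < d" "l < d" for i l
      using P(1) that by (auto simp: orth_def p_def)
    define ip where "ip u v = (\<Sum>r<d. u r * v r :: real)" for u v
    have ipl: "ip (\<lambda>r. x * u r + y * w r) v = x * ip u v + y * ip w v"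
      and ipr: "ip v (\<lambda>r. x * u r + y * w r) = x * ip v u + y * ip v w" for x y u w v
      unfolding ip_def sum_distrib_left sum.distrib[symmetric] by (auto intro!: sum.cong simp: algebra_simps)
    have ipm: "ip (\<lambda>r. x * u r - y * w r) v = x * ip u v - y * ip w v"
      "ip v (\<lambda>r. x * u r - y * w r) = x * ip v u - y * ip v w" for x y u w v
      using ipl[of x u "-y" w v] ipr[of v x u "-y" w] by simp_all
    have ipp: "ip (p i) (p l) = (if i = l then 1 else 0)" if "i < d" "l < d" for i l
      using ip[OF that] by (simp add: ip_def)
    have ipq: "ip (q i) (q l) = (if i = l then 1 else 0)" if "i < d" "l < d" for i l
    proof -
      have cs': "c * c + s * s = 1" using cs by (simp add: power2_eq_square)
      show ?thesis using that ab cs' unfolding q_def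
        by (auto simp: ipl ipr ipm ipp algebra_simps)
    qed
    have "Q \<in> orth d"
      using ipq by (auto simp: orth_def Q_def ip_def)
    then have le: "g Q \<le> g P" by (rule P(2))
    have bq: "bf d S (\<lambda>r. Q (r,i)) (\<lambda>r. Q (r,i)) = bf d S (q i) (q i)" if "i < d" for i
      unfolding bf_def Q_def using that by (intro sum.cong refl) auto
    have split: "(\<Sum>i<d. f i) = f a + f b + (\<Sum>i\<in>{..<d}-{a,b}. f i)" for f :: "nat \<Rightarrow> real"
    proof -
      have "(\<Sum>i<d. f i) = sum f {a,b} + (\<Sum>i\<in>{..<d}-{a,b}. f i)"
        using ab by (subst sum.subset_diff[of "{a,b}"]) auto
      then show ?thesis using ab by simp
    qed
    have "g Q = (\<Sum>i<d. (bf d S (q i) (q i))\<^sup>2)" unfolding g_def using bq by simp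
    also have "\<dots> = (bf d S (q a) (q a))\<^sup>2 + (bf d S (q b) (q b))\<^sup>2 + (\<Sum>i\<in>{..<d}-{a,b}. (bf d S (p i) (p i))\<^sup>2)"
      unfolding split by (auto simp: q_def intro!: sum.cong)
    also have "bf d S (q a) (q a) = c\<^sup>2 * bf d S (p a) (p a) + 2 * c * s * bf d S (p a) (p b) + s\<^sup>2 * bf d S (p b) (p b)"
      using bf_sym[OF S, of "p b" "p a"] unfolding q_def by (simp add: bf_lin_left bf_lin_right algebra_simps power2_eq_square)
    also have "bf d S (q b) (q b) = s\<^sup>2 * bf d S (p a) (p a) - 2 * c * s * bf d S (p a) (p b) + c\<^sup>2 * bf d S (p b) (p b)"
    proof -
      have "q b = (\<lambda>r. (-s) * p a r + c * p b r)" using ab by (auto simp: q_def)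
      then show ?thesis
      using bf_sym[OF S, of "p b" "p a"] by (simp only: bf_lin_left bf_lin_right) (simp add: algebra_simps power2_eq_square)
    qed
    finally have "g Q > (bf d S (p a) (p a))\<^sup>2 + (bf d S (p b) (p b))\<^sup>2 + (\<Sum>i\<in>{..<d}-{a,b}. (bf d S (p i) (p i))\<^sup>2)"
      using gt by simp
    also have "(bf d S (p a) (p a))\<^sup>2 + (bf d S (p b) (p b))\<^sup>2 + (\<Sum>i\<in>{..<d}-{a,b}. (bf d S (p i) (p i))\<^sup>2) = g P"
      unfolding g_def p_def by (subst split) simp
    finally show False using le by simp
  qed
  then show ?thesis using that P(1) by blast
qed

text \<open>\<open>orth\<close> asks for orthonormal columns. For a square matrix a left inverse is
  also a right inverse, which yields orthonormal rows.\<close>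

lemma orth_rows:
  assumes P: "P \<in> orth d" and "i < d" "l < d"
  shows "(\<Sum>k<d. P (i,k) * P (l,k)) = (if i = l then 1 else 0)"
proof -
  define A where "A = mat d d P"
  have A: "A \<in> carrier_mat d d" by (simp add: A_def)
  have "transpose_mat A * A = 1\<^sub>m d"
    using P by (intro eq_matI) (auto simp: A_def orth_def scalar_prod_def atLeast0LessThan)
  then have "A * transpose_mat A = 1\<^sub>m d"
    using mat_mult_left_right_inverse[of "transpose_mat A" d A] A by simp
  then have "(A * transpose_mat A) $$ (i,l) = (if i = l then 1 else 0)" using assms by simp
  then show ?thesis using assms by (simp add: A_def scalar_prod_def atLeast0LessThan)
qed

text \<open>In S = P (P'SP) P' the middle matrix has the entries \<open>B a b\<close> and only its
  diagonal survives; orthonormality of the rows of P then returns the entry of S. That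
  \<open>D k\<close> is a value of the quadratic form is recorded because bounds on the form thereby
  become bounds on the eigenvalues.\<close>

theorem spectral:
  assumes S: "symm d S"
  obtains P D where "P \<in> orth d"
    "\<And>i l. i < d \<Longrightarrow> l < d \<Longrightarrow> S (i,l) = (\<Sum>k<d. P (i,k) * D k * P (l,k))"
    "\<And>k. k < d \<Longrightarrow> D k = bf d S (\<lambda>r. P (r,k)) (\<lambda>r. P (r,k))"
proof -
  obtain P where P: "P \<in> orth d" and off:
    "\<And>a b. a < d \<Longrightarrow> b < d \<Longrightarrow> a \<noteq> b \<Longrightarrow> bf d S (\<lambda>r. P (r,a)) (\<lambda>r. P (r,b)) = 0"
    using orth_diagonalizes[OF S] by metis
  define B where "B a b = bf d S (\<lambda>r. P (r,a)) (\<lambda>r. P (r,b))" for a b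
  have "S (i,l) = (\<Sum>k<d. P (i,k) * B k k * P (l,k))" if il: "i < d" "l < d" for i l
  proof -
    have "(\<Sum>k<d. P (i,k) * B k k * P (l,k)) = (\<Sum>a<d. \<Sum>b<d. P (i,a) * B a b * P (l,b))"
    proof (intro sum.cong refl)
      fix a assume a: "a \<in> {..<d}"
      have "(\<Sum>b<d. P (i,a) * B a b * P (l,b)) = (\<Sum>b<d. if b = a then P (i,a) * B a a * P (l,a) else 0)"
        using off a by (intro sum.cong refl) (auto simp: B_def)
      then show "P (i,a) * B a a * P (l,a) = (\<Sum>b<d. P (i,a) * B a b * P (l,b))" using a by simp
    qed
    also have "\<dots> = (\<Sum>a<d. \<Sum>b<d. \<Sum>r<d. \<Sum>c<d. P (i,a) * P (r,a) * S (r,c) * (P (l,b) * P (c,b)))"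
      unfolding B_def bf_def by (simp add: sum_distrib_left sum_distrib_right algebra_simps)
    also have "\<dots> = (\<Sum>a<d. \<Sum>r<d. \<Sum>b<d. \<Sum>c<d. P (i,a) * P (r,a) * S (r,c) * (P (l,b) * P (c,b)))"
      by (intro sum.cong refl sum.swap)
    also have "\<dots> = (\<Sum>r<d. \<Sum>a<d. \<Sum>c<d. \<Sum>b<d. P (i,a) * P (r,a) * S (r,c) * (P (l,b) * P (c,b)))"
      by (subst sum.swap) (intro sum.cong refl sum.swap)
    also have "\<dots> = (\<Sum>r<d. \<Sum>c<d. \<Sum>a<d. \<Sum>b<d. P (i,a) * P (r,a) * S (r,c) * (P (l,b) * P (c,b)))"
      by (intro sum.cong refl sum.swap)
    also have "\<dots> = (\<Sum>r<d. \<Sum>c<d. (\<Sum>a<d. P (i,a) * P (r,a)) * S (r,c) * (\<Sum>b<d. P (l,b) * P (c,b)))"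
      by (simp add: sum_distrib_left sum_distrib_right algebra_simps)
    also have "\<dots> = (\<Sum>r<d. \<Sum>c<d. (if r = i then 1 else 0) * S (r,c) * (if c = l then 1 else 0))"
      using il orth_rows[OF P] by (intro sum.cong refl) auto
    also have "\<dots> = S (i,l)" using il
      by (simp add: if_distrib[of "\<lambda>x. x * _"] if_distrib[of "\<lambda>x. _ * x"] cong: if_cong)
    finally show ?thesis by simp
  qed
  then show ?thesis using that[OF P, of "\<lambda>k. B k k"] by (simp add: B_def)
qed

text \<open>The congruence A' diag(c) A. With W and V as in the locale below, it represents both W
  diag(E) W' and the inverse V' diag(1/E) V.\<close>

definition cg :: "nat \<Rightarrow> rmat \<Rightarrow> (nat \<Rightarrow> real) \<Rightarrow> rmat" where
  "cg d A c = (\<lambda>(i,l). \<Sum>k<d. A (k,i) * c k * A (k,l))"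

lemma bf_cg: "bf d (cg d A c) v v = (\<Sum>k<d. c k * (mv d A v k)\<^sup>2)"
proof -
  have "bf d (cg d A c) v v = (\<Sum>i<d. \<Sum>l<d. \<Sum>k<d. c k * (A (k,i) * v i) * (A (k,l) * v l))"
    unfolding bf_def cg_def by (simp add: sum_distrib_left sum_distrib_right algebra_simps)
  also have "\<dots> = (\<Sum>i<d. \<Sum>k<d. \<Sum>l<d. c k * (A (k,i) * v i) * (A (k,l) * v l))"
    by (intro sum.cong refl sum.swap)
  also have "\<dots> = (\<Sum>k<d. \<Sum>i<d. \<Sum>l<d. c k * (A (k,i) * v i) * (A (k,l) * v l))"
    by (rule sum.swap)
  also have "\<dots> = (\<Sum>k<d. c k * (mv d A v k)\<^sup>2)"
    unfolding mv_def power2_eq_square sum_product by (simp add: sum_distrib_left mult_ac)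
  finally show ?thesis .
qed

lemma bf_cong: "(\<And>i l. i < d \<Longrightarrow> l < d \<Longrightarrow> S (i,l) = T (i,l)) \<Longrightarrow> (\<And>i. i < d \<Longrightarrow> u i = u' i) \<Longrightarrow> (\<And>i. i < d \<Longrightarrow> v i = v' i)
  \<Longrightarrow> bf d S u v = bf d T u' v'"
  unfolding bf_def by (intro sum.cong refl) auto

section \<open>From functions on index pairs to matrices; simultaneous diagonalisation of two
  covariances\<close>

lemma mat_mult_index:
  assumes "A \<in> carrier_mat d d" "B \<in> carrier_mat d d" "i < d" "l < d"
  shows "(A * B) $$ (i,l) = (\<Sum>k<d. A $$ (i,k) * B $$ (k,l))"
  using assms by (simp add: scalar_prod_def atLeast0LessThan)

definition dg :: "nat \<Rightarrow> (nat \<Rightarrow> real) \<Rightarrow> real mat" where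
  "dg d c = mat d d (\<lambda>(i,l). if i = l then c i else 0)"

lemma dg_carrier [simp]: "dg d c \<in> carrier_mat d d" by (simp add: dg_def)

lemma det_dg: "det (dg d c) = (\<Prod>k<d. c k)"
proof -
  have "det (dg d c) = prod_list (diag_mat (dg d c))"
    by (rule det_upper_triangular[of _ d]) (auto simp: dg_def)
  also have "\<dots> = (\<Prod>k<d. c k)"
    unfolding prod_list_diag_prod by (auto simp: dg_def atLeast0LessThan intro!: prod.cong)
  finally show ?thesis .
qed

lemma mat_mult_dg_index:
  assumes "A \<in> carrier_mat d d" "i < d" "l < d"
  shows "(A * dg d c) $$ (i,l) = A $$ (i,l) * c l"
  using assms by (subst mat_mult_index[of _ d])
    (auto simp: dg_def if_distrib[of "\<lambda>x. _ * x"] cong: if_cong)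

lemma mat_cg: "mat d d (cg d A c) = transpose_mat (mat d d A) * dg d c * mat d d A"
proof (intro eq_matI)
  fix i l assume "i < dim_row (transpose_mat (mat d d A) * dg d c * mat d d A)"
    "l < dim_col (transpose_mat (mat d d A) * dg d c * mat d d A)"
  then have il: "i < d" "l < d" by auto
  show "mat d d (cg d A c) $$ (i,l) = (transpose_mat (mat d d A) * dg d c * mat d d A) $$ (i,l)"
    using il by (subst mat_mult_index[of _ d]) 
      (auto simp: cg_def mat_mult_dg_index[of _ d] intro!: mult_carrier_mat[of _ d d])
qed auto

lemma det_cg: "det (mat d d (cg d A c)) = (det (mat d d A))\<^sup>2 * (\<Prod>k<d. c k)"
  unfolding mat_cg
  by (subst det_mult[of _ d], auto intro!: mult_carrier_mat[of _ d d])
    (subst det_mult[of _ d], auto simp: det_transpose[of _ d] det_dg power2_eq_square)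

text \<open>S0 = W W' and S1 = W diag(E) W' for one invertible W with inverse V. In the coordinates
  V y the first covariance is the identity and the second is diagonal, so comparing the two Gaussian
  laws splits into one-dimensional comparisons of variance 1 with variance
  \<open>E k\<close>.\<close>

locale simdiag =
  fixes d :: nat and S0 S1 W V :: rmat and E :: "nat \<Rightarrow> real"
  assumes VW: "\<And>i l. i < d \<Longrightarrow> l < d \<Longrightarrow> (\<Sum>k<d. V (i,k) * W (k,l)) = (if i = l then 1 else 0)"
    and WV: "\<And>i l. i < d \<Longrightarrow> l < d \<Longrightarrow> (\<Sum>k<d. W (i,k) * V (k,l)) = (if i = l then 1 else 0)"
    and S0: "\<And>i l. i < d \<Longrightarrow> l < d \<Longrightarrow> S0 (i,l) = (\<Sum>k<d. W (i,k) * W (l,k))"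
    and S1: "\<And>i l. i < d \<Longrightarrow> l < d \<Longrightarrow> S1 (i,l) = (\<Sum>k<d. W (i,k) * E k * W (l,k))"
    and E_pos: "\<And>k. k < d \<Longrightarrow> 0 < E k"

lemma mv_mv:
  assumes "\<And>i l. i < d \<Longrightarrow> l < d \<Longrightarrow> (\<Sum>k<d. A (i,k) * B (k,l)) = (if i = l then 1 else 0)" "i < d"
  shows "mv d A (mv d B x) i = x i"
proof -
  have "mv d A (mv d B x) i = (\<Sum>k<d. \<Sum>l<d. A (i,k) * B (k,l) * x l)"
    unfolding mv_def by (simp add: sum_distrib_left mult.assoc)
  also have "\<dots> = (\<Sum>l<d. (\<Sum>k<d. A (i,k) * B (k,l)) * x l)"
    by (subst sum.swap) (simp add: sum_distrib_right)
  also have "\<dots> = x i" using assms by (simp add: if_distrib[of "\<lambda>x. x * _"] cong: if_cong)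
  finally show ?thesis .
qed

lemma mult_carrier_square [simp]: "A \<in> carrier_mat d d \<Longrightarrow> B \<in> carrier_mat d d \<Longrightarrow> A * B \<in> carrier_mat d d"
  by (rule mult_carrier_mat)

lemma spectral_ex:
  assumes S: "symm d S"
  shows "\<exists>P D. P \<in> orth d \<and> (\<forall>i<d. \<forall>l<d. S (i,l) = (\<Sum>k<d. P (i,k) * D k * P (l,k))) \<and>
    (\<forall>k<d. D k = bf d S (\<lambda>r. P (r,k)) (\<lambda>r. P (r,k)))"
proof (rule spectral[OF S])
  fix P D
  assume "P \<in> orth d"
    "\<And>i l. i < d \<Longrightarrow> l < d \<Longrightarrow> S (i,l) = (\<Sum>k<d. P (i,k) * D k * P (l,k))"
    "\<And>k. k < d \<Longrightarrow> D k = bf d S (\<lambda>r. P (r,k)) (\<lambda>r. P (r,k))"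
  then show ?thesis by (intro exI[of _ P] exI[of _ D] conjI allI impI)
qed

text \<open>First whiten: T = P sqrt(D) satisfies T T' = S0 and has the inverse U. Then diagonalise
  the symmetric matrix U S1 U' as Q diag(E) Q'. The matrices sought are W = T Q and V = Q'
  U.\<close>

lemma ex_simdiag:
  assumes S0: "spd d S0" and S1: "spd d S1"
  obtains W V E where "simdiag d S0 S1 W V E"
proof -
  have "symm d S0" using S0 by (simp add: spd_def)
  then obtain P D where P: "P \<in> orth d" and SD: "\<forall>i<d. \<forall>l<d. S0 (i,l) = (\<Sum>k<d. P (i,k) * D k * P (l,k))"
    and D: "\<forall>k<d. D k = bf d S0 (\<lambda>r. P (r,k)) (\<lambda>r. P (r,k))"
    by (elim exE conjE spectral_ex[elim_format]) (rule that)
  have Dpos: "D k > 0" if k: "k < d" for k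
  proof -
    obtain a where a: "a > 0" "\<And>v. a * sq d v \<le> bf d S0 v v" using S0 by (auto simp: spd_def)
    have "sq d (\<lambda>r. P (r,k)) = 1" using P k by (simp add: orth_def sq_def power2_eq_square)
    then show ?thesis using a(1) a(2)[of "\<lambda>r. P (r,k)"] D k by simp
  qed
  define T where "T = mat d d (\<lambda>(i,k). P (i,k) * sqrt (D k))"
  define U where "U = mat d d (\<lambda>(k,i). P (i,k) / sqrt (D k))"
  define A1 where "A1 = mat d d S1"
  have car [simp]: "T \<in> carrier_mat d d" "U \<in> carrier_mat d d" "A1 \<in> carrier_mat d d"
    by (auto simp: T_def U_def A1_def)
  have TU: "T * U = 1\<^sub>m d"
  proof (intro eq_matI)
    fix i l assume "i < dim_row (1\<^sub>m d :: real mat)" "l < dim_col (1\<^sub>m d :: real mat)"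
    then have il: "i < d" "l < d" by auto
    have "(T * U) $$ (i,l) = (\<Sum>k<d. P (i,k) * sqrt (D k) * (P (l,k) / sqrt (D k)))"
      using il by (subst mat_mult_index[of _ d]) (auto simp: T_def U_def)
    also have "\<dots> = (\<Sum>k<d. P (i,k) * P (l,k))"
      using Dpos by (intro sum.cong refl) (simp add: field_simps less_imp_neq[THEN not_sym])
    also have "\<dots> = 1\<^sub>m d $$ (i,l)" using orth_rows[OF P] il by simp
    finally show "(T * U) $$ (i,l) = 1\<^sub>m d $$ (i,l)" .
  qed (auto simp: T_def U_def)
  have UT: "U * T = 1\<^sub>m d" using mat_mult_left_right_inverse[OF _ _ TU] by simp
  define C where "C = U * A1 * transpose_mat U"
  have A1sym: "transpose_mat A1 = A1"
    using S1 by (intro eq_matI) (auto simp: A1_def spd_def symm_def)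
  have Ccar [simp]: "C \<in> carrier_mat d d" by (auto simp: C_def intro!: mult_carrier_mat[of _ d d])
  have "transpose_mat C = C"
  proof -
    have "transpose_mat C = transpose_mat (transpose_mat U) * transpose_mat (U * A1)"
      unfolding C_def by (rule transpose_mult[of _ d d _ d]) (auto intro!: mult_carrier_mat[of _ d d])
    also have "transpose_mat (U * A1) = A1 * transpose_mat U"
      by (subst transpose_mult[of _ d d _ d]) (auto simp: A1sym)
    finally show ?thesis by (simp add: C_def assoc_mult_mat[of _ d d _ d _ d])
  qed
  then have Csym: "symm d (\<lambda>x. C $$ x)" unfolding symm_def
    by (metis Ccar carrier_matD index_transpose_mat(1))
  obtain Q E where Q: "Q \<in> orth d" and CE: "\<forall>i<d. \<forall>l<d. C $$ (i,l) = (\<Sum>k<d. Q (i,k) * E k * Q (l,k))"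
    using spectral_ex[OF Csym] by (elim exE conjE) (rule that)
  define QM where "QM = mat d d Q"
  have [simp]: "QM \<in> carrier_mat d d" by (simp add: QM_def)
  have QQ: "QM * transpose_mat QM = 1\<^sub>m d"
  proof (intro eq_matI)
    fix i l assume "i < dim_row (1\<^sub>m d :: real mat)" "l < dim_col (1\<^sub>m d :: real mat)"
    then show "(QM * transpose_mat QM) $$ (i,l) = 1\<^sub>m d $$ (i,l)"
      using orth_rows[OF Q] by (subst mat_mult_index[of _ d]) (auto simp: QM_def)
  qed (auto simp: QM_def)
  have QQ': "transpose_mat QM * QM = 1\<^sub>m d" using mat_mult_left_right_inverse[OF _ _ QQ] by simp
  have CQ: "C = QM * dg d E * transpose_mat QM"
  proof (intro eq_matI)
    fix i l assume "i < dim_row (QM * dg d E * transpose_mat QM)" "l < dim_col (QM * dg d E * transpose_mat QM)"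
    then have "i < d" "l < d" by (auto simp: QM_def)
    then show "C $$ (i,l) = (QM * dg d E * transpose_mat QM) $$ (i,l)"
      using CE by (subst mat_mult_index[of _ d])
       (auto simp: QM_def mat_mult_dg_index[of _ d] intro!: mult_carrier_mat[of _ d d])
  qed (auto simp: C_def U_def QM_def)
  define WM where "WM = T * QM"
  define VM where "VM = transpose_mat QM * U"
  have wv [simp]: "WM \<in> carrier_mat d d" "VM \<in> carrier_mat d d" by (auto simp: WM_def VM_def)
  have cancel: "X * (Y * Z) = Z" if "X * Y = 1\<^sub>m d" "X \<in> carrier_mat d d" "Y \<in> carrier_mat d d" "Z \<in> carrier_mat d d"
    for X Y Z :: "real mat"
    using that by (metis assoc_mult_mat left_mult_one_mat)
  have VWm: "VM * WM = 1\<^sub>m d"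
    unfolding VM_def WM_def by (simp add: assoc_mult_mat[of _ d d _ d _ d] cancel[OF UT] QQ')
  have WVm: "WM * VM = 1\<^sub>m d" using mat_mult_left_right_inverse[OF _ _ VWm] by simp
  have TUt: "transpose_mat U * transpose_mat T = 1\<^sub>m d"
    using arg_cong[OF TU, of transpose_mat] by (simp add: transpose_mult[of _ d d _ d])
  have "T * C * transpose_mat T = A1"
    unfolding C_def by (simp add: assoc_mult_mat[of _ d d _ d _ d] cancel[OF TU] TUt right_mult_one_mat[of A1 d d])
  then have A1W: "A1 = WM * dg d E * transpose_mat WM"
    unfolding CQ WM_def by (simp add: transpose_mult[of _ d d _ d] assoc_mult_mat[of _ d d _ d _ d])
  have WW: "WM * transpose_mat WM = T * transpose_mat T"
    unfolding WM_def by (simp add: transpose_mult[of _ d d _ d] assoc_mult_mat[of _ d d _ d _ d] cancel[OF QQ])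
  define W V where "W = (\<lambda>x. WM $$ x)" and "V = (\<lambda>x. VM $$ x)"
  have e1: "S1 (i,l) = (\<Sum>k<d. W (i,k) * E k * W (l,k))" if "i < d" "l < d" for i l
  proof -
    have "S1 (i,l) = A1 $$ (i,l)" using that by (simp add: A1_def)
    also have "\<dots> = (\<Sum>k<d. W (i,k) * E k * W (l,k))" unfolding A1W using that carrier_matD[OF wv(1)]
      by (subst mat_mult_index[of _ d]) (auto simp: W_def mat_mult_dg_index[of _ d] intro!: mult_carrier_mat[of _ d d])
    finally show ?thesis .
  qed
  have e0: "S0 (i,l) = (\<Sum>k<d. W (i,k) * W (l,k))" if "i < d" "l < d" for i l
  proof -
    have "(\<Sum>k<d. W (i,k) * W (l,k)) = (WM * transpose_mat WM) $$ (i,l)"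
      using that carrier_matD[OF wv(1)] by (subst mat_mult_index[of _ d]) (auto simp: W_def)
    also have "\<dots> = (\<Sum>k<d. P (i,k) * sqrt (D k) * (P (l,k) * sqrt (D k)))" unfolding WW
      using that by (subst mat_mult_index[of _ d]) (auto simp: T_def)
    also have "\<dots> = (\<Sum>k<d. P (i,k) * D k * P (l,k))"
      using Dpos by (intro sum.cong refl) (auto simp: less_imp_le algebra_simps simp flip: power2_eq_square)
    finally show ?thesis using SD that by simp
  qed
  have vw: "(\<Sum>k<d. V (i,k) * W (k,l)) = (if i = l then 1 else 0)" if "i < d" "l < d" for i l
    using arg_cong[OF VWm, of "\<lambda>M. M $$ (i,l)"] that by (subst (asm) mat_mult_index[of _ d]) (auto simp: W_def V_def)
  have wv': "(\<Sum>k<d. W (i,k) * V (k,l)) = (if i = l then 1 else 0)" if "i < d" "l < d" for i l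
    using arg_cong[OF WVm, of "\<lambda>M. M $$ (i,l)"] that by (subst (asm) mat_mult_index[of _ d]) (auto simp: W_def V_def)
  \<comment> \<open>Row k of V is dual to the columns of W, so the form of \<open>S1\<close> at this
    vector is \<open>E k\<close>; coercivity of \<open>S1\<close> makes it positive.\<close>
  have Epos: "E k > 0" if k: "k < d" for k
  proof -
    obtain a where a: "a > 0" "\<And>v. a * sq d v \<le> bf d S1 v v" using S1 by (auto simp: spd_def)
    define v where "v i = V (k,i)" for i
    have "bf d S1 v v = bf d (cg d (tr W) E) v v"
      using e1 by (intro bf_cong refl) (auto simp: cg_def)
    also have "\<dots> = (\<Sum>j<d. E j * (mv d (tr W) v j)\<^sup>2)" by (rule bf_cg)
    also have "\<dots> = (\<Sum>j<d. if j = k then E k else 0)"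
      using vw k by (intro sum.cong refl) (auto simp: mv_def v_def mult.commute)
    finally have b: "bf d S1 v v = E k" using k by simp
    have "sq d v \<noteq> 0"
    proof
      assume "sq d v = 0"
      then have "\<forall>i<d. V (k,i) = 0" by (simp add: sq_def v_def sum_nonneg_eq_0_iff)
      then show False using vw[OF k k] by simp
    qed
    then have "0 < a * sq d v" using a(1) sq_nonneg[of d v] by (simp add: less_le)
    then show ?thesis using a(2)[of v] b by simp
  qed
  show ?thesis by (rule that[of W V E], unfold_locales) (use e0 e1 vw wv' Epos in auto)
qed

section \<open>Gaussian densities and their affinities\<close>

lemma sqrt_prod: "sqrt (\<Prod>i\<in>A. f i) = (\<Prod>i\<in>A. sqrt (f i))"
  by (induct A rule: infinite_finite_induct) (auto simp: real_sqrt_mult)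

lemma component_borel:
  "i \<in> I \<Longrightarrow> (\<lambda>x. x i) \<in> borel_measurable (PiM I (\<lambda>_. lborel :: real measure))"
  using measurable_component_singleton[of i I "\<lambda>_. lborel :: real measure"] by simp

lemma mv_diff: "mv d A (\<lambda>i. x i - y i) k = mv d A x k - mv d A y k"
  by (simp add: mv_def right_diff_distrib sum_subtractf)

context simdiag
begin

lemma bf_S1: "bf d S1 v v = (\<Sum>k<d. E k * (mv d (tr W) v k)\<^sup>2)"
proof -
  have "bf d S1 v v = bf d (cg d (tr W) E) v v"
    using S1 by (intro bf_cong refl) (auto simp: cg_def)
  then show ?thesis by (simp add: bf_cg)
qed

text \<open>Carries every fact about \<open>S1\<close> over to \<open>S0\<close>, with all variances
  equal to 1.\<close>

lemma simdiag_id: "simdiag d S0 S0 W V (\<lambda>_. 1)"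
  by unfold_locales (use VW WV S0 in auto)

lemma bf_S0: "bf d S0 v v = (\<Sum>k<d. (mv d (tr W) v k)\<^sup>2)"
  using simdiag.bf_S1[OF simdiag_id] by simp

lemma mv_VW: "k < d \<Longrightarrow> mv d V (mv d W x) k = x k"
  by (rule mv_mv[OF VW])

lemma mv_WV: "k < d \<Longrightarrow> mv d W (mv d V x) k = x k"
  by (rule mv_mv[OF WV])

lemma mv_trW_trV: "k < d \<Longrightarrow> mv d (tr W) (mv d (tr V) x) k = x k"
  by (rule mv_mv) (use VW in \<open>auto simp: mult.commute\<close>)

lemma VWm: "mat d d V * mat d d W = 1\<^sub>m d"
proof (intro eq_matI)
  fix i l assume "i < dim_row (1\<^sub>m d :: real mat)" "l < dim_col (1\<^sub>m d :: real mat)"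
  then show "(mat d d V * mat d d W) $$ (i,l) = 1\<^sub>m d $$ (i,l)"
    using VW by (subst mat_mult_index[of _ d]) auto
qed auto

lemma det_VW: "det (mat d d V) * det (mat d d W) = 1"
  using arg_cong[OF VWm, of det] by (simp add: det_mult[of _ d])

lemma det_W_nz: "det (mat d d W) \<noteq> 0" "det (mat d d V) = 1 / det (mat d d W)"
proof -
  show nz: "det (mat d d W) \<noteq> 0" using det_VW by auto
  show "det (mat d d V) = 1 / det (mat d d W)" using det_VW nz by (simp add: nonzero_eq_divide_eq)
qed

lemma mat_S1: "mat d d S1 = mat d d W * dg d E * transpose_mat (mat d d W)"
proof -
  have "mat d d S1 = mat d d (cg d (tr W) E)"
    using S1 by (intro eq_matI) (auto simp: cg_def)
  also have "\<dots> = transpose_mat (mat d d (tr W)) * dg d E * mat d d (tr W)" by (rule mat_cg)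
  also have "mat d d (tr W) = transpose_mat (mat d d W)" by (intro eq_matI) auto
  finally show ?thesis by simp
qed

lemma det_S1: "det (mat d d S1) = (det (mat d d W))\<^sup>2 * (\<Prod>k<d. E k)"
  unfolding mat_S1
  by (subst det_mult[of _ d], auto intro!: mult_carrier_mat[of _ d d])
    (subst det_mult[of _ d], auto simp: det_transpose[of _ d] det_dg power2_eq_square)

text \<open>\<open>mat_inverse\<close> is an algorithm with an optional result. Being a unit of the
  matrix ring excludes \<open>None\<close>, and uniqueness of inverses identifies the result with
  the congruence V' diag(1/E) V.\<close>

lemma mat_inverse_S1: "mat_inverse (mat d d S1) = Some (mat d d (cg d V (\<lambda>k. 1 / E k)))"
proof -
  define WM VM where "WM = mat d d W" and "VM = mat d d V"
  have [simp]: "WM \<in> carrier_mat d d" "VM \<in> carrier_mat d d" by (auto simp: WM_def VM_def)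
  have cancel: "X * (Y * Z) = Z" if "X * Y = 1\<^sub>m d" "X \<in> carrier_mat d d" "Y \<in> carrier_mat d d" "Z \<in> carrier_mat d d"
    for X Y Z :: "real mat"
    using that by (metis assoc_mult_mat left_mult_one_mat)
  have VW1: "VM * WM = 1\<^sub>m d" using VWm by (simp add: WM_def VM_def)
  have WV1: "WM * VM = 1\<^sub>m d" using mat_mult_left_right_inverse[OF _ _ VW1] by simp
  have tt: "transpose_mat WM * transpose_mat VM = 1\<^sub>m d"
    using arg_cong[OF VW1, of transpose_mat] by (simp add: transpose_mult[of _ d d _ d])
  have dd: "dg d E * dg d (\<lambda>k. 1 / E k) = 1\<^sub>m d"
  proof (intro eq_matI)
    fix i l assume "i < dim_row (1\<^sub>m d :: real mat)" "l < dim_col (1\<^sub>m d :: real mat)"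
    then show "(dg d E * dg d (\<lambda>k. 1 / E k)) $$ (i,l) = 1\<^sub>m d $$ (i,l)"
      using E_pos[of l] by (subst mat_mult_dg_index[of _ d]) (auto simp: dg_def)
  qed (auto simp: dg_def)
  let ?A = "mat d d S1" and ?X = "mat d d (cg d V (\<lambda>k. 1 / E k))"
  have "?A * ?X = WM * dg d E * transpose_mat WM * (transpose_mat VM * dg d (\<lambda>k. 1 / E k) * VM)"
    unfolding mat_S1 mat_cg WM_def VM_def ..
  also have "\<dots> = 1\<^sub>m d"
    by (simp add: assoc_mult_mat[of _ d d _ d _ d] cancel[OF tt] cancel[OF dd] WV1)
  finally have AX: "?A * ?X = 1\<^sub>m d" .
  have XA: "?X * ?A = 1\<^sub>m d" using mat_mult_left_right_inverse[OF _ _ AX] by simp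
  have "?A \<in> Units (ring_mat TYPE(real) d ())"
    unfolding Units_def using AX XA by (auto simp: ring_mat_def intro!: bexI[of _ ?X])
  then obtain B where B: "mat_inverse ?A = Some B"
    using mat_inverse(1)[of ?A d "()"] by (cases "mat_inverse ?A") auto
  have BA: "B * ?A = 1\<^sub>m d" "B \<in> carrier_mat d d" using mat_inverse(2)[OF _ B, of d] by auto
  have "B = B * (?A * ?X)" using BA by (simp add: AX)
  also have "\<dots> = (B * ?A) * ?X" using BA by (subst assoc_mult_mat[of _ d d _ d _ d]) auto
  finally show ?thesis using B BA by simp
qed

lemma gauss_dens_eq:
  "gauss_dens d m S1 y = (1 / sqrt (2 * pi)) ^ d * (1 / \<bar>det (mat d d W)\<bar>) * (\<Prod>k<d. 1 / sqrt (E k))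
     * exp (- (\<Sum>k<d. (mv d V (\<lambda>i. y i - m i) k)\<^sup>2 / E k) / 2)"
proof -
  define r where "r = vec d (\<lambda>k. y k - m k)"
  define X where "X = mat d d (cg d V (\<lambda>k. 1 / E k))"
  have "r \<bullet> (X *\<^sub>v r) = bf d (cg d V (\<lambda>k. 1 / E k)) (\<lambda>i. y i - m i) (\<lambda>i. y i - m i)"
    by (auto simp: bf_def r_def X_def scalar_prod_def atLeast0LessThan sum_distrib_left mult.assoc intro!: sum.cong)
  also have "\<dots> = (\<Sum>k<d. (mv d V (\<lambda>i. y i - m i) k)\<^sup>2 / E k)" by (simp add: bf_cg)
  finally have q: "r \<bullet> (X *\<^sub>v r) = (\<Sum>k<d. (mv d V (\<lambda>i. y i - m i) k)\<^sup>2 / E k)" .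
  have "(\<Prod>k<d. E k) > 0" using E_pos by (intro prod_pos) auto
  then have "(det (mat d d S1)) powr (- 1 / 2) = 1 / sqrt ((det (mat d d W))\<^sup>2 * (\<Prod>k<d. E k))"
    using det_W_nz by (simp add: det_S1 powr_minus powr_half_sqrt inverse_eq_divide)
  also have "\<dots> = 1 / \<bar>det (mat d d W)\<bar> * (\<Prod>k<d. 1 / sqrt (E k))"
    using E_pos by (simp add: real_sqrt_mult prod_dividef) (simp add: sqrt_prod)
  finally have e: "(det (mat d d S1)) powr (- 1 / 2) = 1 / \<bar>det (mat d d W)\<bar> * (\<Prod>k<d. 1 / sqrt (E k))" .
  have "(2 * pi) powr (- real d / 2) = ((2 * pi) powr (1/2)) powr (- real d)" by (simp add: powr_powr)
  also have "\<dots> = (1 / sqrt (2 * pi)) ^ d"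
    by (simp add: powr_half_sqrt powr_minus powr_realpow power_one_over inverse_eq_divide)
  finally have p: "(2 * pi) powr (- real d / 2) = (1 / sqrt (2 * pi)) ^ d" .
  show ?thesis
    unfolding gauss_dens_def Let_def mat_inverse_S1 option.case e p
    using q by (simp add: X_def r_def mult.assoc)
qed

end

section \<open>The multivariate Gaussian integral\<close>

lemma nn_integral_gauss_1d:
  fixes \<alpha> t :: real
  assumes "\<alpha> > 0"
  shows "(\<integral>\<^sup>+ y. ennreal (exp (- \<alpha> * (y - t)\<^sup>2 / 2)) \<partial>lborel) = ennreal (sqrt (2 * pi / \<alpha>))"
proof -
  define \<sigma> where "\<sigma> = 1 / sqrt \<alpha>"
  have \<sigma>: "\<sigma> > 0" "\<sigma>\<^sup>2 = 1 / \<alpha>" using assms by (auto simp: \<sigma>_def power_divide)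
  have dens: "exp (- \<alpha> * (y - t)\<^sup>2 / 2) = sqrt (2 * pi / \<alpha>) * normal_density t \<sigma> y" for y
    using assms by (simp add: normal_density_def \<sigma>(2) algebra_simps)
  have "(\<integral>\<^sup>+ y. ennreal (normal_density t \<sigma> y) \<partial>lborel) = 1"
    using prob_space.emeasure_space_1[OF prob_space_normal_density[OF \<sigma>(1), of t]]
    by (simp add: emeasure_density)
  then show ?thesis unfolding dens using assms
    by (simp add: ennreal_mult nn_integral_cmult)
qed

text \<open>Multiplying from the right by a unit lower triangular matrix clears the last row left of
  the corner and leaves the Schur complement in the leading block. This is the determinant side of
  the induction in \<open>gauss_int\<close>.\<close>

lemma det_schur:
  fixes A :: rmat
  assumes sym: "symm (Suc d) A" and \<alpha>: "A (d,d) \<noteq> 0"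
  shows "det (mat (Suc d) (Suc d) A) = A (d,d) * det (mat d d (\<lambda>(i,l). A (i,l) - A (i,d) * A (l,d) / A (d,d)))"
proof -
  define A' where "A' = (\<lambda>(i,l). A (i,l) - A (i,d) * A (l,d) / A (d,d))"
  define M where "M = mat (Suc d) (Suc d) (\<lambda>(i,l). if i = l then 1 else if i = d \<and> l < d then - A (d,l) / A (d,d) else 0)"
  define N where "N = four_block_mat (mat d d A') (mat d 1 (\<lambda>(i,_). A (i,d))) (0\<^sub>m 1 d) (mat 1 1 (\<lambda>_. A (d,d)))"
  have detM: "det M = 1"
  proof -
    have "det M = prod_list (diag_mat M)"
      by (rule det_lower_triangular[of "Suc d"]) (auto simp: M_def)
    also have "\<dots> = 1" unfolding prod_list_diag_prod by (auto simp: M_def intro!: prod.neutral)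
    finally show ?thesis .
  qed
  have Ncar: "N \<in> carrier_mat (Suc d) (Suc d)"
    unfolding N_def by (metis Suc_eq_plus1 four_block_carrier_mat mat_carrier)
  have "mat (Suc d) (Suc d) A * M = N"
  proof (intro eq_matI)
    fix i l assume "i < dim_row N" "l < dim_col N"
    then have il: "i < Suc d" "l < Suc d" using Ncar by auto
    have "(mat (Suc d) (Suc d) A * M) $$ (i,l) = (\<Sum>k<Suc d. A (i,k) * M $$ (k,l))"
      using il by (subst mat_mult_index[of _ "Suc d"]) (auto simp: M_def)
    also have "\<dots> = (\<Sum>k<d. if k = l then A (i,k) else 0) + A (i,d) * M $$ (d,l)"
    proof -
      have "A (i,k) * M $$ (k,l) = (if k = l then A (i,k) else 0)" if "k < d" for k
        using il that by (auto simp: M_def)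
      then show ?thesis by simp
    qed
    also have "\<dots> = N $$ (i,l)"
    proof (cases "l = d")
      case True
      then show ?thesis using il by (auto simp: M_def N_def less_Suc_eq)
    next
      case False
      then have l: "l < d" using il by simp
      have sy: "A (d,l) = A (l,d)" using sym l by (auto simp: symm_def)
      show ?thesis
      proof (cases "i < d")
        case True then show ?thesis using l sy by (auto simp: M_def N_def A'_def)
      next
        case False
        then have "i = d" using il by simp
        then show ?thesis using l \<alpha> by (auto simp: M_def N_def)
      qed
    qed
    finally show "(mat (Suc d) (Suc d) A * M) $$ (i,l) = N $$ (i,l)" .
  qed (use Ncar in \<open>auto simp: M_def\<close>)
  then have "det (mat (Suc d) (Suc d) A) * det M = det N"
    by (subst det_mult[of _ "Suc d", symmetric]) (auto simp: M_def)
  also have "det N = det (mat d d A') * det (mat 1 1 (\<lambda>_. A (d,d)))"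
    unfolding N_def by (rule det_four_block_mat_lower_left_zero[of _ d _ 1]) auto
  also have "det (mat 1 1 (\<lambda>_. A (d,d))) = A (d,d)" by (subst det_single) auto
  finally show ?thesis by (simp add: detM A'_def)
qed

lemma bf_measurable:
  assumes [measurable]: "\<And>i. i < d \<Longrightarrow> (\<lambda>x. u x i) \<in> borel_measurable M"
  shows "(\<lambda>x. bf d A (u x) (u x)) \<in> borel_measurable M"
  unfolding bf_def by (intro borel_measurable_sum borel_measurable_times borel_measurable_const assms) auto

text \<open>Induction on the dimension. Completing the square in the last variable splits the form
  into a one-dimensional Gaussian exponent and the form of the Schur complement \<open>A'\<close> in
  the remaining variables, so each integration contributes one pivot of the determinant. The
  injection \<open>h\<close> names the coordinates, since the integrals needed later run over one
  row of the sample matrix.\<close>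

lemma gauss_int:
  assumes "symm d A" "\<And>v. (\<exists>i<d. v i \<noteq> 0) \<Longrightarrow> 0 < bf d A v v" "inj_on h {..<d}"
  shows "0 < det (mat d d A) \<and>
    (\<integral>\<^sup>+ y. ennreal (exp (- bf d A (\<lambda>k. y (h k) - m k) (\<lambda>k. y (h k) - m k) / 2)) \<partial>PiM (h ` {..<d}) (\<lambda>_. lborel))
     = ennreal (sqrt (2 * pi) ^ d / sqrt (det (mat d d A)))"
  using assms
proof (induction d arbitrary: A)
  case 0
  interpret product_sigma_finite "\<lambda>_. lborel :: real measure" by standard
  have "det (mat 0 0 A) = 1" by (simp add: det_def)
  then show ?case by (simp add: bf_def nn_integral_empty del: nn_integral_const)
next
  case (Suc d A)
  interpret product_sigma_finite "\<lambda>_. lborel :: real measure" by standard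
  define \<alpha> where "\<alpha> = A (d,d)"
  define A' where "A' = (\<lambda>(i,l). A (i,l) - A (i,d) * A (l,d) / \<alpha>)"
  have \<alpha>: "\<alpha> > 0"
  proof -
    have "bf (Suc d) A (\<lambda>i. if i = d then 1 else 0) (\<lambda>i. if i = d then 1 else 0) = \<alpha>"
      by (simp add: bf_def \<alpha>_def)
    moreover have "bf (Suc d) A (\<lambda>i. if i = d then 1 else 0) (\<lambda>i. if i = d then 1 else 0) > 0"
      by (rule Suc.prems(2)) auto
    ultimately show ?thesis by simp
  qed
  have sy: "A (d,l) = A (l,d)" if "l < d" for l using Suc.prems(1) that by (auto simp: symm_def)
  have split: "bf (Suc d) A v v = \<alpha> * (v d + (\<Sum>i<d. A (i,d) * v i) / \<alpha>)\<^sup>2 + bf d A' v v" for v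
  proof -
    define c where "c = (\<Sum>i<d. A (i,d) * v i)"
    have "bf (Suc d) A v v = bf d A v v + (\<Sum>i<d. v i * A (i,d) * v d) + (\<Sum>l<d. v d * A (d,l) * v l) + v d * \<alpha> * v d"
      by (simp add: bf_def sum.distrib \<alpha>_def)
    also have "(\<Sum>i<d. v i * A (i,d) * v d) = c * v d" by (simp add: c_def sum_distrib_left sum_distrib_right mult_ac)
    also have "(\<Sum>l<d. v d * A (d,l) * v l) = c * v d" using sy by (simp add: c_def sum_distrib_left sum_distrib_right mult_ac)
    also have "bf d A v v = bf d A' v v + c\<^sup>2 / \<alpha>"
    proof -
      have "bf d A' v v = bf d A v v - (\<Sum>i<d. \<Sum>l<d. (A (i,d) * v i) * (A (l,d) * v l) / \<alpha>)"
        unfolding bf_def A'_def sum_subtractf[symmetric]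
        by (intro sum.cong refl) (simp add: algebra_simps)
      also have "(\<Sum>i<d. \<Sum>l<d. (A (i,d) * v i) * (A (l,d) * v l) / \<alpha>) = c\<^sup>2 / \<alpha>"
        by (simp add: c_def power2_eq_square sum_product sum_divide_distrib)
      finally show ?thesis by simp
    qed
    finally show ?thesis unfolding c_def[symmetric] using \<alpha> by (simp add: field_simps power2_eq_square)
  qed
  have A's: "symm d A'" using Suc.prems(1) by (auto simp: symm_def A'_def)
  have A'p: "0 < bf d A' v v" if "\<exists>i<d. v i \<noteq> 0" for v
  proof -
    \<comment> \<open>The last coordinate is chosen so that the completed square vanishes; the form
      of A at this vector is then the Schur form, which must be positive.\<close>
    define v' where "v' = v(d := - (\<Sum>i<d. A (i,d) * v i) / \<alpha>)"
    have "bf d A' v' v' = bf d A' v v" by (intro bf_cong) (auto simp: v'_def)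
    moreover have "(\<Sum>i<d. A (i,d) * v' i) = (\<Sum>i<d. A (i,d) * v i)" by (intro sum.cong) (auto simp: v'_def)
    ultimately have "bf (Suc d) A v' v' = bf d A' v v" unfolding split by (simp add: v'_def)
    moreover have "0 < bf (Suc d) A v' v'" using that by (intro Suc.prems(2)) (auto simp: v'_def intro: less_SucI)
    ultimately show ?thesis by simp
  qed
  have inj: "inj_on h {..<d}" using Suc.prems(3) by (auto simp: inj_on_def)
  note IH = Suc.IH[OF A's A'p inj]
  have hd: "h d \<notin> h ` {..<d}"
  proof
    assume "h d \<in> h ` {..<d}"
    then obtain x where "x < d" "h d = h x" by auto
    then show False using inj_onD[OF Suc.prems(3), of d x] by simp
  qed
  have det: "det (mat (Suc d) (Suc d) A) = \<alpha> * det (mat d d A')"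
    using det_schur[OF Suc.prems(1)] \<alpha> by (simp add: \<alpha>_def A'_def)
  have ins: "h ` {..<Suc d} = insert (h d) (h ` {..<d})" by (simp add: lessThan_Suc)
  define F where "F y = bf (Suc d) A (\<lambda>k. y (h k) - m k) (\<lambda>k. y (h k) - m k)" for y
  have [measurable]: "F \<in> borel_measurable (PiM (insert (h d) (h ` {..<d})) (\<lambda>_. lborel))"
  proof -
    have "(\<lambda>y. y (h i) - m i) \<in> borel_measurable (PiM (insert (h d) (h ` {..<d})) (\<lambda>_. lborel))" if "i < Suc d" for i
    proof -
      have "h i \<in> insert (h d) (h ` {..<d})" using that by (cases "i = d") auto
      then show ?thesis by (intro borel_measurable_diff component_borel borel_measurable_const)
    qed
    then show ?thesis unfolding F_def by (rule bf_measurable)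
  qed
  have "(\<integral>\<^sup>+ y. ennreal (exp (- F y / 2)) \<partial>PiM (h ` {..<Suc d}) (\<lambda>_. lborel))
    = (\<integral>\<^sup>+ x. (\<integral>\<^sup>+ y. ennreal (exp (- F (x(h d := y)) / 2)) \<partial>lborel) \<partial>PiM (h ` {..<d}) (\<lambda>_. lborel))"
    unfolding ins
  proof (rule product_nn_integral_insert[of "h ` {..<d}" "h d" "\<lambda>y. ennreal (exp (- F y / 2))"])
    show "(\<lambda>y. ennreal (exp (- F y / 2))) \<in> borel_measurable (PiM (insert (h d) (h ` {..<d})) (\<lambda>_. lborel))"
      by measurable
  qed (use hd in simp_all)
  also have "\<dots> = (\<integral>\<^sup>+ x. ennreal (sqrt (2 * pi / \<alpha>)) * ennreal (exp (- bf d A' (\<lambda>k. x (h k) - m k) (\<lambda>k. x (h k) - m k) / 2)) \<partial>PiM (h ` {..<d}) (\<lambda>_. lborel))"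
  proof (rule nn_integral_cong)
    fix x
    define t where "t = m d - (\<Sum>i<d. A (i,d) * (x (h i) - m i)) / \<alpha>"
    define R where "R = bf d A' (\<lambda>k. x (h k) - m k) (\<lambda>k. x (h k) - m k)"
    have F: "F (x(h d := y)) = \<alpha> * (y - t)\<^sup>2 + R" for y
    proof -
      have ne: "h i \<noteq> h d" if "i < d" for i using hd that by (metis image_eqI lessThan_iff)
      have "bf d A' (\<lambda>k. (x(h d := y)) (h k) - m k) (\<lambda>k. (x(h d := y)) (h k) - m k) = R"
        unfolding R_def by (intro bf_cong) (auto simp: ne)
      moreover have "(\<Sum>i<d. A (i,d) * ((x(h d := y)) (h i) - m i)) = (\<Sum>i<d. A (i,d) * (x (h i) - m i))"
        by (intro sum.cong) (auto simp: ne)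
      ultimately show ?thesis unfolding F_def split by (simp add: t_def algebra_simps)
    qed
    have "ennreal (exp (- F (x(h d := y)) / 2)) = ennreal (exp (- \<alpha> * (y - t)\<^sup>2 / 2)) * ennreal (exp (- R / 2))" for y
      unfolding F by (simp add: ennreal_mult[symmetric] exp_add[symmetric] field_simps)
    then have "(\<integral>\<^sup>+ y. ennreal (exp (- F (x(h d := y)) / 2)) \<partial>lborel)
      = (\<integral>\<^sup>+ y. ennreal (exp (- \<alpha> * (y - t)\<^sup>2 / 2)) \<partial>lborel) * ennreal (exp (- R / 2))"
      by (simp add: nn_integral_multc)
    also have "\<dots> = ennreal (sqrt (2 * pi / \<alpha>)) * ennreal (exp (- R / 2))"
      by (subst nn_integral_gauss_1d[OF \<alpha>]) simp
    finally show "(\<integral>\<^sup>+ y. ennreal (exp (- F (x(h d := y)) / 2)) \<partial>lborel)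
      = ennreal (sqrt (2 * pi / \<alpha>)) * ennreal (exp (- bf d A' (\<lambda>k. x (h k) - m k) (\<lambda>k. x (h k) - m k) / 2))"
      by (simp add: R_def)
  qed
  also have "\<dots> = ennreal (sqrt (2 * pi / \<alpha>)) * ennreal (sqrt (2 * pi) ^ d / sqrt (det (mat d d A')))"
  proof (subst nn_integral_cmult)
    have [measurable]: "(\<lambda>x. bf d A' (\<lambda>k. x (h k) - m k) (\<lambda>k. x (h k) - m k)) \<in> borel_measurable (PiM (h ` {..<d}) (\<lambda>_. lborel))"
    proof (rule bf_measurable)
      fix i assume "i < d"
      then have "h i \<in> h ` {..<d}" by simp
      then show "(\<lambda>y. y (h i) - m i) \<in> borel_measurable (PiM (h ` {..<d}) (\<lambda>_. lborel))"
        by (intro borel_measurable_diff component_borel borel_measurable_const)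
    qed
    show "(\<lambda>x. ennreal (exp (- bf d A' (\<lambda>k. x (h k) - m k) (\<lambda>k. x (h k) - m k) / 2))) \<in> borel_measurable (PiM (h ` {..<d}) (\<lambda>_. lborel))"
      by measurable
  qed (use IH in simp)
  also have "\<dots> = ennreal (sqrt (2 * pi) ^ Suc d / sqrt (det (mat (Suc d) (Suc d) A)))"
    using IH \<alpha> by (simp add: det ennreal_mult[symmetric] real_sqrt_mult real_sqrt_divide)
  finally show ?case using IH \<alpha> by (simp add: F_def det)
qed

section \<open>Adjoints and Hellinger affinities of two Gaussian laws\<close>

lemma sum_mv_tr: "(\<Sum>i<d. u i * mv d A z i) = (\<Sum>k<d. mv d (tr A) u k * z k)"
proof -
  have "(\<Sum>i<d. u i * mv d A z i) = (\<Sum>i<d. \<Sum>k<d. A (i,k) * u i * z k)"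
    by (simp add: mv_def sum_distrib_left mult_ac)
  also have "\<dots> = (\<Sum>k<d. \<Sum>i<d. A (i,k) * u i * z k)" by (rule sum.swap)
  also have "\<dots> = (\<Sum>k<d. mv d (tr A) u k * z k)" by (simp add: mv_def sum_distrib_right)
  finally show ?thesis .
qed

text \<open>A matrix and its transpose have the same operator norm: write the squared norm of A z as
  the inner product of A'(A z) with z, apply Cauchy-Schwarz and cancel.\<close>

lemma sq_adjoint_bound:
  assumes "\<And>u. sq d (mv d (tr A) u) \<le> b * sq d u" "b \<ge> 0"
  shows "sq d (mv d A z) \<le> b * sq d z"
proof (cases "sq d (mv d A z) = 0")
  case True then show ?thesis using assms(2) by simp
next
  case False
  define u where "u = mv d A z"
  have "sq d u = (\<Sum>i<d. u i * mv d A z i)" by (simp add: sq_def u_def power2_eq_square)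
  also have "\<dots> = (\<Sum>k<d. mv d (tr A) u k * z k)" by (rule sum_mv_tr)
  finally have "(sq d u)\<^sup>2 \<le> sq d (mv d (tr A) u) * sq d z"
    using Cauchy_Schwarz_ineq_sum[of "mv d (tr A) u" z "{..<d}"] by (simp add: sq_def)
  also have "\<dots> \<le> b * sq d u * sq d z" by (intro mult_right_mono assms) simp
  finally have "sq d u * sq d u \<le> sq d u * (b * sq d z)" by (simp add: power2_eq_square mult_ac)
  moreover have "sq d u > 0" using False sq_nonneg[of d u] by (simp add: u_def less_le)
  ultimately show ?thesis by (simp add: u_def)
qed

text \<open>The left side is the affinity of N(0,1) and N(0,E). With r = sqrt E its square is 1 -
  (1-r)^2/(1+r^2), and 1 - x is at most exp(-x). The fraction is compared with (E-1)^2 by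
  multiplying with (1+r)^2; the constant 18 is 2 from (1+r)^2 \<le> 2(1+r^2) times 9 from 1+E \<le>
  3, and the square root doubles it. The truncation at 1 reflects that the affinity decays only
  polynomially for large E.\<close>

lemma hellinger_1d:
  fixes E :: real assumes "E > 0"
  shows "sqrt (2 * sqrt E / (1 + E)) \<le> exp (- min 1 ((E - 1)\<^sup>2) / 36)"
proof -
  define r where "r = sqrt E"
  have r: "r > 0" "r\<^sup>2 = E" using assms by (auto simp: r_def)
  have "2 * r / (1 + r\<^sup>2) = 1 - (1 - r)\<^sup>2 / (1 + r\<^sup>2)"
  proof -
    have "1 + r\<^sup>2 \<noteq> 0" using r(1) by (simp add: add_pos_nonneg less_imp_neq[THEN not_sym])
    moreover have "(1 - r)\<^sup>2 = (1 + r\<^sup>2) - 2 * r" by (simp add: power2_eq_square algebra_simps)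
    ultimately show ?thesis by (simp add: diff_divide_distrib)
  qed
  also have "\<dots> \<le> exp (- ((1 - r)\<^sup>2 / (1 + r\<^sup>2)))" using exp_ge_add_one_self[of "- ((1 - r)\<^sup>2 / (1 + r\<^sup>2))"] by simp
  finally have 1: "2 * sqrt E / (1 + E) \<le> exp (- ((1 - r)\<^sup>2 / (1 + r\<^sup>2)))" by (simp add: r r_def[symmetric])
  have 2: "min 1 ((E - 1)\<^sup>2) / 18 \<le> (1 - r)\<^sup>2 / (1 + r\<^sup>2)"
  proof -
    have "(1 + r)\<^sup>2 \<le> 2 * (1 + r\<^sup>2)" using sum_squares_ge_zero[of "1 - r" 0] by (simp add: power2_eq_square algebra_simps)
    then have "(1 + r)\<^sup>2 * (1 + r\<^sup>2) \<le> (2 * (1 + r\<^sup>2)) * (1 + r\<^sup>2)" by (rule mult_right_mono) simp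
    then have a: "(1 + r)\<^sup>2 * (1 + r\<^sup>2) \<le> 2 * (1 + E)\<^sup>2"
      unfolding r(2) by (simp only: power2_eq_square mult.assoc)
    have b: "(1 - r)\<^sup>2 * (1 + r)\<^sup>2 = (E - 1)\<^sup>2" by (simp add: r(2)[symmetric] power2_eq_square algebra_simps)
    have c: "min 1 ((E - 1)\<^sup>2) * (1 + E)\<^sup>2 \<le> 9 * (E - 1)\<^sup>2"
    proof (cases "E \<le> 2")
      case True
      then have "(1 + E)\<^sup>2 \<le> 3\<^sup>2" using assms by (intro power_mono) auto
      then show ?thesis using mult_mono[of "min 1 ((E - 1)\<^sup>2)" "(E - 1)\<^sup>2" "(1 + E)\<^sup>2" 9] by simp
    next
      case False
      have "(1 + E)\<^sup>2 \<le> (3 * (E - 1))\<^sup>2" using False by (intro power_mono) auto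
      also have "\<dots> = 9 * (E - 1)\<^sup>2" unfolding power_mult_distrib by simp
      finally have "(1 + E)\<^sup>2 \<le> 9 * (E - 1)\<^sup>2" .
      moreover have "min 1 ((E - 1)\<^sup>2) * (1 + E)\<^sup>2 \<le> 1 * (1 + E)\<^sup>2" by (intro mult_right_mono) auto
      ultimately show ?thesis by simp
    qed
    have pos: "0 < (1 + r)\<^sup>2" "0 < 1 + r\<^sup>2" using r by (auto intro: add_pos_nonneg)
    have "min 1 ((E - 1)\<^sup>2) * (1 + r\<^sup>2) * (1 + r)\<^sup>2 \<le> min 1 ((E - 1)\<^sup>2) * (2 * (1 + E)\<^sup>2)"
      using mult_left_mono[OF a, of "min 1 ((E - 1)\<^sup>2)"] by (simp add: mult_ac)
    also have "\<dots> \<le> 18 * ((1 - r)\<^sup>2 * (1 + r)\<^sup>2)" unfolding b using c by linarith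
    also have "\<dots> = 18 * (1 - r)\<^sup>2 * (1 + r)\<^sup>2" by simp
    finally have "min 1 ((E - 1)\<^sup>2) * (1 + r\<^sup>2) \<le> 18 * (1 - r)\<^sup>2" using pos(1) by (simp add: mult_le_cancel_right)
    then show ?thesis using pos by (simp add: field_simps)
  qed
  have "2 * sqrt E / (1 + E) \<le> exp (- (min 1 ((E - 1)\<^sup>2) / 18))" using 1 2 by (smt (verit) exp_le_cancel_iff)
  also have "\<dots> = (exp (- min 1 ((E - 1)\<^sup>2) / 36))\<^sup>2" by (simp add: power2_eq_square exp_add[symmetric])
  finally show ?thesis by (intro real_le_lsqrt) (use assms in auto)
qed

lemma nn_integral_scaled:
  fixes f I :: "'a \<Rightarrow> real"
  assumes "\<And>y. f y = K * I y" "(\<integral>\<^sup>+ y. ennreal (I y) \<partial>M) = ennreal c" "K * c = r" "0 \<le> K" "I \<in> borel_measurable M"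
  shows "(\<integral>\<^sup>+ y. ennreal (f y) \<partial>M) = ennreal r"
  unfolding assms(1) assms(3)[symmetric] ennreal_mult'[OF assms(4)] assms(2)[symmetric]
  by (rule nn_integral_cmult) (use assms(5) in simp)

lemma min_1_sum_le:
  fixes x :: "nat \<Rightarrow> real" assumes "\<And>k. k < d \<Longrightarrow> 0 \<le> x k"
  shows "min 1 (\<Sum>k<d. x k) \<le> (\<Sum>k<d. min 1 (x k))"
  using assms
proof (induction d)
  case (Suc d)
  have A: "min 1 (s + t) \<le> min 1 s + min 1 t" if "0 \<le> s" "0 \<le> t" for s t :: real
    using that by (auto simp: min_def)
  have "min 1 ((\<Sum>k<d. x k) + x d) \<le> min 1 (\<Sum>k<d. x k) + min 1 (x d)"
    by (rule A) (use Suc.prems in \<open>auto intro!: sum_nonneg\<close>)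
  then show ?case using Suc by fastforce
qed simp

context simdiag
begin

lemma gauss_integral:
  assumes h: "inj_on h {..<d}" and c: "\<And>k. k < d \<Longrightarrow> 0 < c k"
  shows "(\<integral>\<^sup>+ y. ennreal (exp (- (\<Sum>k<d. c k * (mv d V (\<lambda>i. y (h i)) k - t k)\<^sup>2) / 2)) \<partial>PiM (h ` {..<d}) (\<lambda>_. lborel))
    = ennreal (sqrt (2 * pi) ^ d * \<bar>det (mat d d W)\<bar> / sqrt (\<Prod>k<d. c k))"
proof -
  define m where "m = mv d W t"
  have e: "(\<Sum>k<d. c k * (mv d V (\<lambda>i. y (h i)) k - t k)\<^sup>2) =
     bf d (cg d V c) (\<lambda>i. y (h i) - m i) (\<lambda>i. y (h i) - m i)" for y
    unfolding bf_cg mv_diff m_def by (intro sum.cong refl) (simp add: mv_VW)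
  have s: "symm d (cg d V c)" by (auto simp: symm_def cg_def mult_ac)
  have p: "0 < bf d (cg d V c) v v" if v: "\<exists>i<d. v i \<noteq> 0" for v
  proof -
    have "\<exists>k<d. mv d V v k \<noteq> 0"
    proof (rule ccontr)
      assume "\<not> ?thesis"
      then have "mv d W (mv d V v) i = 0" for i by (auto simp: mv_def[of d W])
      then show False using v mv_WV by metis
    qed
    then obtain j where "j < d" "mv d V v j \<noteq> 0" by auto
    then show ?thesis unfolding bf_cg using c by (intro sum_pos2[of _ j]) (auto intro!: mult_nonneg_nonneg intro: less_imp_le)
  qed
  have "det (mat d d (cg d V c)) = (1 / det (mat d d W))\<^sup>2 * (\<Prod>k<d. c k)"
    unfolding det_cg det_W_nz(2) ..
  then have "sqrt (2 * pi) ^ d / sqrt (det (mat d d (cg d V c))) = sqrt (2 * pi) ^ d * \<bar>det (mat d d W)\<bar> / sqrt (\<Prod>k<d. c k)"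
    by (simp add: real_sqrt_mult real_sqrt_divide power_divide)
  then show ?thesis unfolding e using gauss_int[OF s p h] by simp
qed

lemma gauss_dens_pos: "0 < gauss_dens d m S1 y"
  unfolding gauss_dens_eq using E_pos det_W_nz by (intro mult_pos_pos prod_pos) auto

lemma nn_integral_gauss_dens:
  assumes h: "inj_on h {..<d}"
  shows "(\<integral>\<^sup>+ y. ennreal (gauss_dens d m S1 (\<lambda>k. y (h k))) \<partial>PiM (h ` {..<d}) (\<lambda>_. lborel)) = 1"
proof -
  define K where "K = (1 / sqrt (2 * pi)) ^ d * (1 / \<bar>det (mat d d W)\<bar>) * (\<Prod>k<d. 1 / sqrt (E k))"
  define I where "I y = exp (- (\<Sum>k<d. 1 / E k * (mv d V (\<lambda>i. y (h i)) k - mv d V m k)\<^sup>2) / 2)" for y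
  have E0: "E k \<noteq> 0" if "k < d" for k using E_pos[OF that] by simp
  have pos: "(\<Prod>k<d. sqrt (E k)) > 0" by (intro prod_pos) (auto simp: E_pos)
  have K0: "K \<ge> 0" unfolding K_def by (intro mult_nonneg_nonneg prod_nonneg) (auto intro!: less_imp_le[OF E_pos])
  have "gauss_dens d m S1 (\<lambda>k. y (h k)) = K * I y" for y
    unfolding gauss_dens_eq K_def I_def mv_diff by simp
  moreover have "(\<integral>\<^sup>+ y. ennreal (I y) \<partial>PiM (h ` {..<d}) (\<lambda>_. lborel))
     = ennreal (sqrt (2 * pi) ^ d * \<bar>det (mat d d W)\<bar> / sqrt (\<Prod>k<d. 1 / E k))"
    unfolding I_def by (rule gauss_integral[OF h]) (simp add: E_pos)
  moreover have "K * (sqrt (2 * pi) ^ d * \<bar>det (mat d d W)\<bar> / sqrt (\<Prod>k<d. 1 / E k)) = 1"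
    unfolding K_def sqrt_prod using det_W_nz pos E0 by (simp add: prod_dividef real_sqrt_divide power_divide)
  moreover have "I \<in> borel_measurable (PiM (h ` {..<d}) (\<lambda>_. lborel))"
    unfolding I_def mv_def
    by (intro borel_measurable_exp[THEN measurable_compose[rotated]] borel_measurable_sum borel_measurable_divide borel_measurable_times borel_measurable_power
       borel_measurable_diff component_borel borel_measurable_uminus borel_measurable_const) auto
  ultimately show ?thesis using K0 nn_integral_scaled[of "\<lambda>y. gauss_dens d m S1 (\<lambda>k. y (h k))" K I _ _ 1]
    by (simp only: ennreal_1)
qed

text \<open>Completing the square in each coordinate of V y: for variances 1 and \<open>E k\<close>
  and mean difference \<open>w k\<close>, the two exponents add up to
  \<open>(w k)^2 / (1 + E k)\<close> and a square centred at \<open>t k\<close> with weight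
  \<open>c k\<close>. The square is integrated by \<open>gauss_integral\<close>. The first factor of
  the result measures the covariances, the second the means.\<close>

lemma affinity_eq:
  fixes m0 m1 :: "nat \<Rightarrow> real"
  assumes h: "inj_on h {..<d}"
  defines "w \<equiv> mv d V (\<lambda>i. m1 i - m0 i)"
  shows "(\<integral>\<^sup>+ y. ennreal (sqrt (gauss_dens d m0 S0 (\<lambda>k. y (h k)) * gauss_dens d m1 S1 (\<lambda>k. y (h k)))) \<partial>PiM (h ` {..<d}) (\<lambda>_. lborel))
    = ennreal ((\<Prod>k<d. sqrt (2 * sqrt (E k) / (1 + E k))) * exp (- (\<Sum>k<d. (w k)\<^sup>2 / (1 + E k)) / 4))"
proof -
  define D where "D = \<bar>det (mat d d W)\<bar>"
  have D: "D > 0" using det_W_nz by (simp add: D_def)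
  define c where "c k = (1 + E k) / (2 * E k)" for k
  have cpos: "c k > 0" if "k < d" for k using E_pos[OF that] by (simp add: c_def)
  define t where "t k = mv d V m0 k + w k / (1 + E k)" for k
  define K where "K = (1 / sqrt (2 * pi)) ^ d * (1 / D) * (\<Prod>k<d. 1 / sqrt (sqrt (E k))) * exp (- (\<Sum>k<d. (w k)\<^sup>2 / (1 + E k)) / 4)"
  define I where "I y = exp (- (\<Sum>k<d. c k * (mv d V (\<lambda>i. y (h i)) k - t k)\<^sup>2) / 2)" for y
  have K0: "K \<ge> 0" unfolding K_def using D by (intro mult_nonneg_nonneg prod_nonneg) (auto intro!: less_imp_le[OF E_pos])
  have "sqrt (gauss_dens d m0 S0 (\<lambda>k. y (h k)) * gauss_dens d m1 S1 (\<lambda>k. y (h k))) = K * I y" for y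
  proof -
    define x where "x k = mv d V (\<lambda>i. y (h i)) k - mv d V m0 k" for k
    have g0: "gauss_dens d m0 S0 (\<lambda>k. y (h k)) = (1 / sqrt (2 * pi)) ^ d * (1 / D) * exp (- (\<Sum>k<d. (x k)\<^sup>2) / 2)"
      unfolding simdiag.gauss_dens_eq[OF simdiag_id] D_def mv_diff x_def by simp
    have g1: "gauss_dens d m1 S1 (\<lambda>k. y (h k)) = (1 / sqrt (2 * pi)) ^ d * (1 / D) * (\<Prod>k<d. 1 / sqrt (E k)) * exp (- (\<Sum>k<d. (x k - w k)\<^sup>2 / E k) / 2)"
      unfolding gauss_dens_eq D_def mv_diff x_def w_def by (simp add: algebra_simps)
    have sc: "(x k)\<^sup>2 / 2 + (x k - w k)\<^sup>2 / E k / 2 = (w k)\<^sup>2 / (1 + E k) / 2 + c k * (mv d V (\<lambda>i. y (h i)) k - t k)\<^sup>2" if "k < d" for k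
    proof -
      define xx ww e where "xx = x k" and "ww = w k" and "e = E k"
      have e: "e > 0" using E_pos[OF that] by (simp add: e_def)
      have "mv d V (\<lambda>i. y (h i)) k - t k = xx - ww / (1 + e)" by (simp add: t_def x_def xx_def ww_def e_def)
      moreover have "xx\<^sup>2 / 2 + (xx - ww)\<^sup>2 / e / 2 = ww\<^sup>2 / (1 + e) / 2 + (1 + e) / (2 * e) * (xx - ww / (1 + e))\<^sup>2"
      proof -
        have "(1 + e) \<noteq> 0" "e \<noteq> 0" using e by auto
        then have "(xx - ww / (1 + e)) = ((1 + e) * xx - ww) / (1 + e)" by (simp add: field_simps)
        then have "(1 + e) / (2 * e) * (xx - ww / (1 + e))\<^sup>2 = ((1 + e) * xx - ww)\<^sup>2 / (2 * e * (1 + e))"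
          using e by (simp add: power_divide power2_eq_square)
        then show ?thesis using e by (simp add: divide_simps) (simp add: power2_eq_square algebra_simps)
      qed
      ultimately show ?thesis by (simp add: xx_def ww_def e_def c_def)
    qed
    have "(\<Sum>k<d. (x k)\<^sup>2) / 2 + (\<Sum>k<d. (x k - w k)\<^sup>2 / E k) / 2 = (\<Sum>k<d. (w k)\<^sup>2 / (1 + E k)) / 2 + (\<Sum>k<d. c k * (mv d V (\<lambda>i. y (h i)) k - t k)\<^sup>2)"
      unfolding sum_divide_distrib sum.distrib[symmetric] by (intro sum.cong refl) (use sc in simp)
    then have ee: "exp (- (\<Sum>k<d. (x k)\<^sup>2) / 2) * exp (- (\<Sum>k<d. (x k - w k)\<^sup>2 / E k) / 2) =
       (exp (- (\<Sum>k<d. (w k)\<^sup>2 / (1 + E k)) / 4) * I y)\<^sup>2"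
      unfolding I_def power2_eq_square exp_add[symmetric] by simp
    have "gauss_dens d m0 S0 (\<lambda>k. y (h k)) * gauss_dens d m1 S1 (\<lambda>k. y (h k)) = ((1 / sqrt (2 * pi)) ^ d * (1 / D))\<^sup>2 * (\<Prod>k<d. 1 / sqrt (E k)) * 
       (exp (- (\<Sum>k<d. (x k)\<^sup>2) / 2) * exp (- (\<Sum>k<d. (x k - w k)\<^sup>2 / E k) / 2))"
      unfolding g0 g1 by (simp add: power2_eq_square mult_ac)
    then have "gauss_dens d m0 S0 (\<lambda>k. y (h k)) * gauss_dens d m1 S1 (\<lambda>k. y (h k)) = ((1 / sqrt (2 * pi)) ^ d * (1 / D) * (exp (- (\<Sum>k<d. (w k)\<^sup>2 / (1 + E k)) / 4) * I y))\<^sup>2 * (\<Prod>k<d. 1 / sqrt (E k))"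
      unfolding ee by (simp only: power_mult_distrib mult_ac)
    then have "sqrt (gauss_dens d m0 S0 (\<lambda>k. y (h k)) * gauss_dens d m1 S1 (\<lambda>k. y (h k))) = ((1 / sqrt (2 * pi)) ^ d * (1 / D) * (exp (- (\<Sum>k<d. (w k)\<^sup>2 / (1 + E k)) / 4) * I y)) * (\<Prod>k<d. sqrt (1 / sqrt (E k)))"
      using D by (simp add: real_sqrt_mult sqrt_prod I_def)
    then show ?thesis by (simp add: K_def mult_ac real_sqrt_divide)
  qed
  moreover have "(\<integral>\<^sup>+ y. ennreal (I y) \<partial>PiM (h ` {..<d}) (\<lambda>_. lborel))
     = ennreal (sqrt (2 * pi) ^ d * D / sqrt (\<Prod>k<d. c k))"
    unfolding I_def D_def by (rule gauss_integral[OF h cpos])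
  moreover have "K * (sqrt (2 * pi) ^ d * D / sqrt (\<Prod>k<d. c k)) = (\<Prod>k<d. sqrt (2 * sqrt (E k) / (1 + E k))) * exp (- (\<Sum>k<d. (w k)\<^sup>2 / (1 + E k)) / 4)"
  proof -
    have "sqrt (2 * sqrt (E k) / (1 + E k)) = 1 / sqrt (sqrt (E k)) / sqrt (c k)" if k: "k < d" for k
    proof -
      have "2 * sqrt (E k) / (1 + E k) = 1 / sqrt (E k) / c k"
      proof -
        obtain s where s: "s > 0" "E k = s\<^sup>2" using E_pos[OF k] by (metis real_sqrt_gt_zero real_sqrt_pow2 less_imp_le)
        have "1 + s\<^sup>2 \<noteq> 0" using s(1) by (simp add: add_pos_nonneg less_imp_neq[THEN not_sym])
        then show ?thesis using s by (simp add: c_def divide_simps) (simp add: power2_eq_square)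
      qed
      then show ?thesis by (simp add: real_sqrt_divide real_sqrt_mult)
    qed
    then have "(\<Prod>k<d. sqrt (2 * sqrt (E k) / (1 + E k))) = (\<Prod>k<d. 1 / sqrt (sqrt (E k))) / sqrt (\<Prod>k<d. c k)"
      by (simp add: sqrt_prod prod_dividef prod.distrib)
    then show ?thesis using D by (simp add: K_def power_divide)
  qed
  moreover have "I \<in> borel_measurable (PiM (h ` {..<d}) (\<lambda>_. lborel))"
    unfolding I_def mv_def
    by (intro borel_measurable_exp[THEN measurable_compose[rotated]] borel_measurable_sum borel_measurable_divide borel_measurable_times borel_measurable_power
       borel_measurable_diff component_borel borel_measurable_uminus borel_measurable_const) auto
  ultimately show ?thesis using K0
    nn_integral_scaled[of "\<lambda>y. sqrt (gauss_dens d m0 S0 (\<lambda>k. y (h k)) * gauss_dens d m1 S1 (\<lambda>k. y (h k)))" K I]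
    by blast
qed

lemma prod_affinity_le_1: "(\<Prod>k<d. sqrt (2 * sqrt (E k) / (1 + E k))) \<le> exp (- min 1 (\<Sum>k<d. (E k - 1)\<^sup>2) / 36)"
proof -
  have "(\<Prod>k<d. sqrt (2 * sqrt (E k) / (1 + E k))) \<le> (\<Prod>k<d. exp (- min 1 ((E k - 1)\<^sup>2) / 36))"
  proof (intro prod_mono conjI)
    fix k assume "k \<in> {..<d}"
    then have "E k > 0" by (simp add: E_pos)
    then show "0 \<le> sqrt (2 * sqrt (E k) / (1 + E k))" "sqrt (2 * sqrt (E k) / (1 + E k)) \<le> exp (- min 1 ((E k - 1)\<^sup>2) / 36)"
      by (simp_all only: hellinger_1d) simp
  qed
  also have "\<dots> = exp (- (\<Sum>k<d. min 1 ((E k - 1)\<^sup>2)) / 36)"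
    by (simp add: exp_sum[symmetric] sum_negf sum_divide_distrib)
  also have "\<dots> \<le> exp (- min 1 (\<Sum>k<d. (E k - 1)\<^sup>2) / 36)"
    using min_1_sum_le[of d "\<lambda>k. (E k - 1)\<^sup>2"] by simp
  finally show ?thesis .
qed

text \<open>The difference is W diag(E - 1) W', and W W' = \<open>S0\<close> bounds the squared
  operator norm of W by b. Applying W from the left and estimating its columns cost a factor b
  each.\<close>

lemma frob2_le:
  assumes b: "\<And>v. bf d S0 v v \<le> b * sq d v" "b > 0"
  shows "frob2 {0..<d} {0..<d} (\<lambda>il. S1 il - S0 il) \<le> b\<^sup>2 * (\<Sum>k<d. (E k - 1)\<^sup>2)"
proof -
  have W: "sq d (mv d W z) \<le> b * sq d z" for z
    by (rule sq_adjoint_bound) (use b in \<open>auto simp: bf_S0 sq_def\<close>)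
  have "frob2 {0..<d} {0..<d} (\<lambda>il. S1 il - S0 il) = (\<Sum>i<d. \<Sum>l<d. (mv d W (\<lambda>k. (E k - 1) * W (l,k)) i)\<^sup>2)"
    unfolding frob2_def atLeast0LessThan
    by (intro sum.cong refl) (simp add: S0 S1 mv_def sum_subtractf[symmetric] algebra_simps)
  also have "\<dots> = (\<Sum>l<d. sq d (mv d W (\<lambda>k. (E k - 1) * W (l,k))))"
    unfolding sq_def by (rule sum.swap)
  also have "\<dots> \<le> (\<Sum>l<d. b * sq d (\<lambda>k. (E k - 1) * W (l,k)))" by (intro sum_mono W)
  also have "\<dots> = b * (\<Sum>l<d. \<Sum>k<d. (E k - 1)\<^sup>2 * (W (l,k))\<^sup>2)"
    by (simp add: sq_def sum_distrib_left power_mult_distrib)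
  also have "\<dots> = b * (\<Sum>k<d. (E k - 1)\<^sup>2 * sq d (\<lambda>l. W (l,k)))"
    by (subst sum.swap) (simp add: sq_def sum_distrib_left)
  also have "\<dots> \<le> b * (\<Sum>k<d. (E k - 1)\<^sup>2 * b)"
  proof (intro mult_left_mono sum_mono)
    fix k assume k: "k \<in> {..<d}"
    have "mv d W (\<lambda>j. if j = k then 1 else 0) i = W (i,k)" for i
      using k by (simp add: mv_def if_distrib[of "\<lambda>x. _ * x"] cong: if_cong)
    moreover have "sq d (\<lambda>j. if j = k then 1 else 0) = 1"
      using k by (simp add: sq_def if_distrib[of "\<lambda>x. x\<^sup>2"] cong: if_cong)
    ultimately show "sq d (\<lambda>l. W (l,k)) \<le> b" using W[of "\<lambda>j. if j = k then 1 else 0"] by (simp add: sq_def)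
  qed (use b in auto)
  also have "\<dots> = b\<^sup>2 * (\<Sum>k<d. (E k - 1)\<^sup>2)" by (simp add: sum_distrib_right[symmetric] power2_eq_square)
  finally show ?thesis .
qed

text \<open>The right side is the quadratic form of the inverse of S0 + S1 at u, and S0 + S1 \<le> B
  bounds this inverse below by 1/B. The proof is Cauchy-Schwarz with the weights
  \<open>sqrt (1 + E k)\<close> and their reciprocals.\<close>

lemma parallel_sum_ge:
  assumes B: "\<And>v. bf d S0 v v + bf d S1 v v \<le> B * sq d v" "B > 0"
  shows "sq d u / B \<le> (\<Sum>k<d. (mv d V u k)\<^sup>2 / (1 + E k))"
proof (cases "sq d u = 0")
  case True then show ?thesis by (auto intro!: sum_nonneg divide_nonneg_nonneg simp: less_imp_le[OF E_pos])
next
  case False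
  then have pos: "sq d u > 0" using sq_nonneg[of d u] by (simp add: less_le)
  define w where "w = mv d V u"
  define R where "R = (\<Sum>k<d. (w k)\<^sup>2 / (1 + E k))"
  have E1: "1 + E k > 0" if "k < d" for k using E_pos[OF that] by simp
  have "sq d u = (\<Sum>i<d. u i * mv d W w i)" using mv_WV by (simp add: sq_def w_def power2_eq_square)
  also have "\<dots> = (\<Sum>k<d. (sqrt (1 + E k) * mv d (tr W) u k) * (w k / sqrt (1 + E k)))"
    unfolding sum_mv_tr using E1 by (intro sum.cong refl) (simp add: less_imp_neq[THEN not_sym])
  finally have "(sq d u)\<^sup>2 \<le> (\<Sum>k<d. (sqrt (1 + E k) * mv d (tr W) u k)\<^sup>2) * (\<Sum>k<d. (w k / sqrt (1 + E k))\<^sup>2)"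
    using Cauchy_Schwarz_ineq_sum by metis
  also have "(\<Sum>k<d. (w k / sqrt (1 + E k))\<^sup>2) = R"
    unfolding R_def using E1 by (intro sum.cong refl) (simp add: power_divide less_imp_le)
  also have "(\<Sum>k<d. (sqrt (1 + E k) * mv d (tr W) u k)\<^sup>2) = bf d S0 u u + bf d S1 u u"
    unfolding bf_S0 bf_S1 sum.distrib[symmetric] using E1
    by (intro sum.cong refl) (simp add: power_mult_distrib less_imp_le algebra_simps)
  also have "(bf d S0 u u + bf d S1 u u) * R \<le> B * sq d u * R"
    by (intro mult_right_mono B) (auto simp: R_def intro!: sum_nonneg divide_nonneg_nonneg less_imp_le[OF E1])
  finally have "sq d u * sq d u \<le> sq d u * (B * R)" by (simp add: power2_eq_square mult_ac)
  then have "sq d u \<le> B * R" using pos by simp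
  then show ?thesis using B(2) by (simp add: R_def w_def field_simps)
qed

text \<open>V'V is the inverse of \<open>S0\<close>; the bound is obtained for the transpose first
  and moved over by \<open>sq_adjoint_bound\<close>.\<close>

lemma V_contract:
  assumes a: "\<And>v. a * sq d v \<le> bf d S0 v v" "a > 0"
  shows "sq d (mv d V u) \<le> sq d u / a"
proof -
  have "sq d (mv d (tr V) x) \<le> 1 / a * sq d x" for x
  proof -
    have "a * sq d (mv d (tr V) x) \<le> bf d S0 (mv d (tr V) x) (mv d (tr V) x)" by (rule a)
    also have "\<dots> = sq d x" unfolding bf_S0 sq_def by (intro sum.cong refl) (simp add: mv_trW_trV)
    finally show ?thesis using a(2) by (simp add: field_simps)
  qed
  then show ?thesis using sq_adjoint_bound[of d V "1/a" u] a(2) by simp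
qed

text \<open>The image of the k-th unit vector under the transpose of V is a vector at which the form
  of \<open>S0\<close> equals 1 and that of \<open>S1\<close> equals \<open>E k\<close>.\<close>

lemma E_between:
  assumes "\<And>v. l * bf d S0 v v \<le> bf d S1 v v" "\<And>v. bf d S1 v v \<le> \<kappa> * bf d S0 v v" "k < d"
  shows "l \<le> E k" "E k \<le> \<kappa>"
proof -
  define e where "e = (\<lambda>j. if j = k then 1 else 0 :: real)"
  have "bf d S0 (mv d (tr V) e) (mv d (tr V) e) = (\<Sum>j<d. (e j)\<^sup>2)"
    unfolding bf_S0 by (intro sum.cong refl) (simp add: mv_trW_trV)
  also have "\<dots> = 1" using assms(3) by (simp add: e_def if_distrib[of "\<lambda>x. x\<^sup>2"] cong: if_cong)
  finally have 0: "bf d S0 (mv d (tr V) e) (mv d (tr V) e) = 1" .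
  have "bf d S1 (mv d (tr V) e) (mv d (tr V) e) = (\<Sum>j<d. E j * (e j)\<^sup>2)"
    unfolding bf_S1 by (intro sum.cong refl) (simp add: mv_trW_trV)
  also have "\<dots> = E k" using assms(3) by (simp add: e_def if_distrib[of "\<lambda>x. x\<^sup>2"] if_distrib[of "\<lambda>x. _ * x"] cong: if_cong)
  finally have 1: "bf d S1 (mv d (tr V) e) (mv d (tr V) e) = E k" .
  show "l \<le> E k" "E k \<le> \<kappa>" using assms(1,2)[of "mv d (tr V) e"] by (simp_all add: 0 1)
qed

text \<open>Surplus variance absorbs a shift of the mean: (x + \<delta>)^2/(1 + \<eta>) \<le> x^2 +
  \<delta>^2/\<eta>, which is a square after clearing denominators. The shift costs the exponential
  factor and the normalising constants cost at most sqrt \<kappa> per dimension. Since the bound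
  holds at every y, likelihoods can be compared sample by sample.\<close>

lemma gauss_dens_dominated:
  assumes lo: "\<And>v. (1 + \<eta>) * bf d S0 v v \<le> bf d S1 v v" and hi: "\<And>v. bf d S1 v v \<le> \<kappa> * bf d S0 v v"
    and a: "\<And>v. a * sq d v \<le> bf d S0 v v" "a > 0" and \<eta>: "\<eta> > 0" and \<kappa>: "\<kappa> > 0"
  shows "gauss_dens d m S0 y \<le> sqrt \<kappa> ^ d * exp (sq d (\<lambda>i. m i - m' i) / (2 * a * \<eta>)) * gauss_dens d m' S1 y"
proof -
  define D where "D = (1 / sqrt (2 * pi)) ^ d * (1 / \<bar>det (mat d d W)\<bar>)"
  have D: "D \<ge> 0" by (simp add: D_def)
  define x where "x k = mv d V (\<lambda>i. y i - m i) k" for k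
  define \<delta> where "\<delta> k = mv d V (\<lambda>i. m i - m' i) k" for k
  have x': "mv d V (\<lambda>i. y i - m' i) k = x k + \<delta> k" for k
    by (simp add: x_def \<delta>_def mv_diff)
  have trm: "(x k + \<delta> k)\<^sup>2 / E k \<le> (x k)\<^sup>2 + (\<delta> k)\<^sup>2 / \<eta>" if k: "k < d" for k
  proof -
    have "(x k + \<delta> k)\<^sup>2 / E k \<le> (x k + \<delta> k)\<^sup>2 / (1 + \<eta>)"
      using E_between(1)[OF lo hi k] \<eta> by (intro divide_left_mono) auto
    also have "\<dots> \<le> (x k)\<^sup>2 + (\<delta> k)\<^sup>2 / \<eta>"
    proof -
      have "0 \<le> (\<eta> * x k - \<delta> k)\<^sup>2" by simp
      then have "\<eta> * (x k + \<delta> k)\<^sup>2 \<le> (1 + \<eta>) * (\<eta> * (x k)\<^sup>2 + (\<delta> k)\<^sup>2)"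
        by (simp add: power2_eq_square algebra_simps)
      then show ?thesis using \<eta> by (simp add: field_simps)
    qed
    finally show ?thesis .
  qed
  have "(\<Sum>k<d. (x k + \<delta> k)\<^sup>2 / E k) \<le> (\<Sum>k<d. (x k)\<^sup>2 + (\<delta> k)\<^sup>2 / \<eta>)"
    by (intro sum_mono) (use trm in auto)
  also have "\<dots> = (\<Sum>k<d. (x k)\<^sup>2) + sq d (mv d V (\<lambda>i. m i - m' i)) / \<eta>"
    by (simp add: sum.distrib sum_divide_distrib sq_def \<delta>_def)
  also have "\<dots> \<le> (\<Sum>k<d. (x k)\<^sup>2) + sq d (\<lambda>i. m i - m' i) / a / \<eta>"
    using V_contract[OF a] \<eta> by (intro add_left_mono divide_right_mono) auto
  finally have ex: "- (\<Sum>k<d. (x k)\<^sup>2) / 2 \<le> sq d (\<lambda>i. m i - m' i) / (2 * a * \<eta>) + - (\<Sum>k<d. (x k + \<delta> k)\<^sup>2 / E k) / 2"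
    by (simp add: field_simps)
  have pr: "1 \<le> sqrt \<kappa> ^ d * (\<Prod>k<d. 1 / sqrt (E k))"
  proof -
    have "sqrt \<kappa> ^ d * (\<Prod>k<d. 1 / sqrt (E k)) = (\<Prod>k<d. sqrt \<kappa> / sqrt (E k))"
      by (simp add: prod_dividef)
    moreover have "1 \<le> (\<Prod>k<d. sqrt \<kappa> / sqrt (E k))"
      using E_between(2)[OF lo hi] E_pos by (intro prod_ge_1) (auto simp: field_simps)
    ultimately show ?thesis by simp
  qed
  have "gauss_dens d m S0 y = D * exp (- (\<Sum>k<d. (x k)\<^sup>2) / 2)"
    unfolding simdiag.gauss_dens_eq[OF simdiag_id] D_def x_def by simp
  also have "\<dots> \<le> D * ((sqrt \<kappa> ^ d * (\<Prod>k<d. 1 / sqrt (E k))) * exp (sq d (\<lambda>i. m i - m' i) / (2 * a * \<eta>) + - (\<Sum>k<d. (x k + \<delta> k)\<^sup>2 / E k) / 2))"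
    using mult_mono[OF pr, of "exp (- (\<Sum>k<d. (x k)\<^sup>2) / 2)"] ex pr by (intro mult_left_mono D) auto
  also have "\<dots> = sqrt \<kappa> ^ d * exp (sq d (\<lambda>i. m i - m' i) / (2 * a * \<eta>)) * gauss_dens d m' S1 y"
    unfolding gauss_dens_eq D_def x' exp_add by (simp add: mult_ac)
  finally show ?thesis .
qed

end

lemma gauss_dens_pos:
  assumes "spd d S" shows "0 < gauss_dens d m S y"
  by (rule ex_simdiag[OF assms assms]) (rule simdiag.gauss_dens_pos)

lemma nn_integral_gauss_dens:
  assumes "spd d S" "inj_on h {..<d}"
  shows "(\<integral>\<^sup>+ y. ennreal (gauss_dens d m S (\<lambda>k. y (h k))) \<partial>PiM (h ` {..<d}) (\<lambda>_. lborel)) = 1"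
  by (rule ex_simdiag[OF assms(1) assms(1)]) (rule simdiag.nn_integral_gauss_dens[OF _ assms(2)])

lemma gauss_dens_dominated:
  assumes "spd d S" "spd d S'"
    and "\<And>v. (1 + \<eta>) * bf d S v v \<le> bf d S' v v" "\<And>v. bf d S' v v \<le> \<kappa> * bf d S v v"
    and "\<And>v. a * sq d v \<le> bf d S v v" "a > 0" "\<eta> > 0" "\<kappa> > 0"
  shows "gauss_dens d m S y \<le> sqrt \<kappa> ^ d * exp (sq d (\<lambda>i. m i - m' i) / (2 * a * \<eta>)) * gauss_dens d m' S' y"
  by (rule ex_simdiag[OF assms(1,2)]) (rule simdiag.gauss_dens_dominated[OF _ assms(3-8)])

text \<open>Keeps the covariance factor of \<open>affinity_eq\<close> and bounds the mean factor by
  1. It asks for an upper bound on \<open>S0\<close> alone, so it serves for candidates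
  \<open>S1\<close> with arbitrarily large eigenvalues.\<close>

lemma affinity_cov:
  assumes S: "spd d S0" "spd d S1" and h: "inj_on h {..<d}"
    and b: "\<And>v. bf d S0 v v \<le> b * sq d v" "b > 0"
  shows "(\<integral>\<^sup>+ y. ennreal (sqrt (gauss_dens d m0 S0 (\<lambda>k. y (h k)) * gauss_dens d m1 S1 (\<lambda>k. y (h k)))) \<partial>PiM (h ` {..<d}) (\<lambda>_. lborel))
    \<le> ennreal (exp (- min 1 (frob2 {0..<d} {0..<d} (\<lambda>il. S1 il - S0 il) / b\<^sup>2) / 36))"
proof (rule ex_simdiag[OF S])
  fix W V E assume "simdiag d S0 S1 W V E"
  then interpret simdiag d S0 S1 W V E .
  define R where "R = (\<Sum>k<d. (mv d V (\<lambda>i. m1 i - m0 i) k)\<^sup>2 / (1 + E k))"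
  have R: "R \<ge> 0" unfolding R_def by (auto intro!: sum_nonneg divide_nonneg_nonneg simp: less_imp_le[OF E_pos])
  have F: "frob2 {0..<d} {0..<d} (\<lambda>il. S1 il - S0 il) / b\<^sup>2 \<le> (\<Sum>k<d. (E k - 1)\<^sup>2)"
    using frob2_le[OF b] b(2) by (simp add: field_simps)
  have "(\<Prod>k<d. sqrt (2 * sqrt (E k) / (1 + E k))) * exp (- R / 4)
    \<le> exp (- min 1 (frob2 {0..<d} {0..<d} (\<lambda>il. S1 il - S0 il) / b\<^sup>2) / 36) * 1"
  proof (intro mult_mono)
    show "(\<Prod>k<d. sqrt (2 * sqrt (E k) / (1 + E k))) \<le> exp (- min 1 (frob2 {0..<d} {0..<d} (\<lambda>il. S1 il - S0 il) / b\<^sup>2) / 36)"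
      by (rule order_trans[OF prod_affinity_le_1]) (use F in auto)
  qed (use R in auto)
  then show ?thesis unfolding affinity_eq[OF h] R_def by (intro ennreal_leI) simp
qed

text \<open>The opposite choice: the mean factor is kept. The price is an upper bound on both
  covariances, available once \<open>S1\<close> is known to be near the truth.\<close>

lemma affinity_mean:
  assumes S: "spd d S0" "spd d S1" and h: "inj_on h {..<d}"
    and B: "\<And>v. bf d S0 v v + bf d S1 v v \<le> B * sq d v" "B > 0"
  shows "(\<integral>\<^sup>+ y. ennreal (sqrt (gauss_dens d m0 S0 (\<lambda>k. y (h k)) * gauss_dens d m1 S1 (\<lambda>k. y (h k)))) \<partial>PiM (h ` {..<d}) (\<lambda>_. lborel))
    \<le> ennreal (exp (- sq d (\<lambda>i. m1 i - m0 i) / (4 * B)))"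
proof (rule ex_simdiag[OF S])
  fix W V E assume "simdiag d S0 S1 W V E"
  then interpret simdiag d S0 S1 W V E .
  define R where "R = (\<Sum>k<d. (mv d V (\<lambda>i. m1 i - m0 i) k)\<^sup>2 / (1 + E k))"
  have "(\<Prod>k<d. sqrt (2 * sqrt (E k) / (1 + E k))) * exp (- R / 4) \<le> 1 * exp (- sq d (\<lambda>i. m1 i - m0 i) / (4 * B))"
  proof (intro mult_mono)
    show "(\<Prod>k<d. sqrt (2 * sqrt (E k) / (1 + E k))) \<le> 1"
      by (rule order_trans[OF prod_affinity_le_1]) (auto simp: min_def sum_nonneg)
    show "exp (- R / 4) \<le> exp (- sq d (\<lambda>i. m1 i - m0 i) / (4 * B))"
      using parallel_sum_ge[OF B, of "\<lambda>i. m1 i - m0 i"] B(2) by (simp add: R_def field_simps)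
  qed auto
  then show ?thesis unfolding affinity_eq[OF h] R_def by (intro ennreal_leI) simp
qed

text \<open>Fubini for functions of disjoint blocks of coordinates, by splitting off one block at a
  time. It is applied to the rows of the sample and to the blocks of the slab density.\<close>

lemma nn_integral_prod_blocks:
  fixes f :: "'t \<Rightarrow> ('i \<Rightarrow> real) \<Rightarrow> ennreal"
  assumes "finite T" "\<And>t. t \<in> T \<Longrightarrow> finite (C t)"
    "\<And>t s. t \<in> T \<Longrightarrow> s \<in> T \<Longrightarrow> t \<noteq> s \<Longrightarrow> C t \<inter> C s = {}"
    "\<And>t. t \<in> T \<Longrightarrow> f t \<in> borel_measurable (PiM (C t) (\<lambda>_. lborel))"
    "\<And>t x y. t \<in> T \<Longrightarrow> (\<And>i. i \<in> C t \<Longrightarrow> x i = y i) \<Longrightarrow> f t x = f t y"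
  shows "(\<integral>\<^sup>+ x. (\<Prod>t\<in>T. f t x) \<partial>PiM (\<Union>t\<in>T. C t) (\<lambda>_. lborel)) = (\<Prod>t\<in>T. \<integral>\<^sup>+ x. f t x \<partial>PiM (C t) (\<lambda>_. lborel))"
  using assms
proof (induction T rule: finite_induct)
  case empty
  interpret product_sigma_finite "\<lambda>_. lborel :: real measure" by standard
  show ?case by (simp add: nn_integral_empty del: nn_integral_const)
next
  case (insert t T)
  interpret product_sigma_finite "\<lambda>_. lborel :: real measure" by standard
  define U where "U = (\<Union>s\<in>T. C s)"
  have disj: "C t \<inter> U = {}" using insert.prems(2)[of t] insert.hyps by (auto simp: U_def)
  have fin: "finite (C t)" "finite U" using insert.hyps(1) insert.prems(1) by (simp_all add: U_def)
  have meas: "f s \<in> borel_measurable (PiM J (\<lambda>_. lborel))" if "s \<in> insert t T" "C s \<subseteq> J" for s J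
  proof -
    have "f s = (\<lambda>x. f s (restrict x (C s)))" by (intro ext insert.prems(4)[OF that(1)]) simp
    moreover have "(\<lambda>x. f s (restrict x (C s))) \<in> borel_measurable (PiM J (\<lambda>_. lborel))"
      by (rule measurable_compose[OF measurable_restrict_subset[OF that(2)] insert.prems(3)[OF that(1)]])
    ultimately show ?thesis by simp
  qed
  define g where "g x = (\<Prod>s\<in>insert t T. f s x)" for x
  have gm: "g \<in> borel_measurable (PiM (C t \<union> U) (\<lambda>_. lborel))"
    unfolding g_def by (intro borel_measurable_prod_ennreal meas) (auto simp: U_def)
  have Um: "(\<lambda>y. \<Prod>s\<in>T. f s y) \<in> borel_measurable (PiM U (\<lambda>_. lborel))"
    by (intro borel_measurable_prod_ennreal meas) (auto simp: U_def)
  have gmerge: "g (merge (C t) U (x, y)) = f t x * (\<Prod>s\<in>T. f s y)" for x y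
  proof -
    have "f t (merge (C t) U (x, y)) = f t x"
      by (rule insert.prems(4)) (auto simp: merge_def)
    moreover have "f s (merge (C t) U (x, y)) = f s y" if "s \<in> T" for s
      using that disj by (intro insert.prems(4)) (auto simp: merge_def U_def)
    ultimately show ?thesis using insert.hyps by (simp add: g_def)
  qed
  have "(\<integral>\<^sup>+ x. (\<Prod>s\<in>insert t T. f s x) \<partial>PiM (\<Union>s\<in>insert t T. C s) (\<lambda>_. lborel)) = integral\<^sup>N (PiM (C t \<union> U) (\<lambda>_. lborel)) g"
    by (simp add: U_def g_def[abs_def])
  also have "\<dots> = (\<integral>\<^sup>+ x. (\<integral>\<^sup>+ y. g (merge (C t) U (x, y)) \<partial>PiM U (\<lambda>_. lborel)) \<partial>PiM (C t) (\<lambda>_. lborel))"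
    by (rule product_nn_integral_fold[OF disj fin gm])
  also have "\<dots> = (\<integral>\<^sup>+ x. f t x \<partial>PiM (C t) (\<lambda>_. lborel)) * (\<integral>\<^sup>+ y. (\<Prod>s\<in>T. f s y) \<partial>PiM U (\<lambda>_. lborel))"
    unfolding gmerge nn_integral_cmult[OF Um] by (rule nn_integral_multc) (rule insert.prems(3), simp)
  also have "(\<integral>\<^sup>+ y. (\<Prod>s\<in>T. f s y) \<partial>PiM U (\<lambda>_. lborel)) = (\<Prod>s\<in>T. \<integral>\<^sup>+ x. f s x \<partial>PiM (C s) (\<lambda>_. lborel))"
    unfolding U_def
  proof (rule insert.IH)
    fix r and x y :: "'i \<Rightarrow> real" assume "r \<in> T" "\<And>i. i \<in> C r \<Longrightarrow> x i = y i"
    then show "f r x = f r y" by (intro insert.prems(4)) simp_all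
  qed (simp_all add: insert.prems(1-3))
  finally show ?case using insert.hyps by simp
qed

lemma nn_integral_rows:
  fixes f :: "nat \<Rightarrow> (nat \<Rightarrow> real) \<Rightarrow> ennreal"
  assumes m: "\<And>i. i < n \<Longrightarrow> (\<lambda>y. f i (\<lambda>k. y (i,k))) \<in> borel_measurable (PiM (Pair i ` {..<d}) (\<lambda>_. lborel))"
    and c: "\<And>i x y. i < n \<Longrightarrow> (\<And>k. k < d \<Longrightarrow> x k = y k) \<Longrightarrow> f i x = f i y"
  shows "(\<integral>\<^sup>+ Y. (\<Prod>i<n. f i (\<lambda>k. Y (i,k))) \<partial>PiM ({0..<n} \<times> {0..<d}) (\<lambda>_. lborel))
    = (\<Prod>i<n. \<integral>\<^sup>+ y. f i (\<lambda>k. y (i,k)) \<partial>PiM (Pair i ` {..<d}) (\<lambda>_. lborel))"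
proof -
  have e: "{0..<n} \<times> {0..<d} = (\<Union>i\<in>{..<n}. Pair i ` {..<d})" by auto
  show ?thesis unfolding e
  proof (rule nn_integral_prod_blocks[where f = "\<lambda>i y. f i (\<lambda>k. y (i,k))"])
    fix t and x y :: "nat \<times> nat \<Rightarrow> real" assume "t \<in> {..<n}" "\<And>i. i \<in> Pair t ` {..<d} \<Longrightarrow> x i = y i"
    then show "f t (\<lambda>k. x (t,k)) = f t (\<lambda>k. y (t,k))" by (intro c) auto
  qed (use m in auto)
qed

section \<open>Measurability, and the likelihood of the whole sample as a product over rows\<close>

lemma gauss_dens_cong:
  assumes "\<And>k. k < d \<Longrightarrow> y k = y' k" shows "gauss_dens d m S y = gauss_dens d m S y'"
proof -
  have "vec d (\<lambda>k. y k - m k) = vec d (\<lambda>k. y' k - m k)" using assms by (intro eq_vecI) auto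
  then show ?thesis by (simp add: gauss_dens_def)
qed

lemma det_measurable:
  assumes "\<And>x. A x \<in> carrier_mat d d" "\<And>i l. i < d \<Longrightarrow> l < d \<Longrightarrow> (\<lambda>x. A x $$ (i,l)) \<in> borel_measurable M"
  shows "(\<lambda>x. det (A x) :: real) \<in> borel_measurable M"
proof -
  have e: "(\<lambda>x. A x $$ (i, q i)) \<in> borel_measurable M" if "q \<in> {q. q permutes {0..<d}}" "i \<in> {0..<d}" for q i
    using assms(2)[of i "q i"] that permutes_in_image[of q "{0..<d}" i] by simp
  show ?thesis unfolding det_def'[OF assms(1)]
    by (intro borel_measurable_sum borel_measurable_times borel_measurable_const borel_measurable_prod e)
qed

text \<open>The adjugate formula turns the result of the inversion algorithm into polynomials in the
  entries divided by the determinant, with \<open>None\<close> matching determinant 0. Measurability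
  in \<Sigma> and nonnegativity are read off this form.\<close>

lemma gauss_dens_adj:
  fixes S :: rmat and d :: nat
  defines "A \<equiv> mat d d S"
  shows "gauss_dens d m S y = (if det A = 0 then 0 else (2 * pi) powr (- real d / 2) * det A powr (- 1 / 2)
    * exp (- (\<Sum>i<d. \<Sum>l<d. (y i - m i) * (adj_mat A $$ (i,l) / det A) * (y l - m l)) / 2))"
proof -
  have A: "A \<in> carrier_mat d d" by (simp add: A_def)
  show ?thesis
  proof (cases "det A = 0")
    case True
    have "mat_inverse A = None"
    proof (cases "mat_inverse A")
      case (Some B)
      then have "det (A * B) = 1" "B \<in> carrier_mat d d" using mat_inverse(2)[OF A Some] by auto
      then show ?thesis using True A by (simp add: det_mult[of _ d])
    qed
    then show ?thesis using True by (simp add: gauss_dens_def A_def)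
  next
    case False
    define X where "X = (1 / det A) \<cdot>\<^sub>m adj_mat A"
    have X: "X \<in> carrier_mat d d" using adj_mat(1)[OF A] by (simp add: X_def)
    have AX: "A * X = 1\<^sub>m d"
    proof -
      have "A * X = (1 / det A) \<cdot>\<^sub>m (A * adj_mat A)"
        unfolding X_def by (rule mult_smult_distrib[OF A adj_mat(1)[OF A]])
      also have "\<dots> = (1 / det A) \<cdot>\<^sub>m (det A \<cdot>\<^sub>m 1\<^sub>m d)" by (simp add: adj_mat(2)[OF A])
      also have "\<dots> = 1\<^sub>m d" using False by (intro eq_matI) auto
      finally show ?thesis .
    qed
    have XA: "X * A = 1\<^sub>m d" using mat_mult_left_right_inverse[OF A X AX] .
    have "A \<in> Units (ring_mat TYPE(real) d ())"
      unfolding Units_def using AX XA A X by (auto simp: ring_mat_def intro!: bexI[of _ X])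
    then obtain B where B: "mat_inverse A = Some B"
      using mat_inverse(1)[OF A, of "()"] by (cases "mat_inverse A") auto
    have BA: "B * A = 1\<^sub>m d" "B \<in> carrier_mat d d" using mat_inverse(2)[OF A B] by auto
    have "B = B * (A * X)" using BA by (simp add: AX)
    also have "\<dots> = (B * A) * X" using BA A X by (subst assoc_mult_mat[of _ d d _ d _ d]) auto
    finally have BX: "B = X" using BA X by simp
    define r where "r = vec d (\<lambda>k. y k - m k)"
    have "r \<bullet> (X *\<^sub>v r) = (\<Sum>i<d. \<Sum>l<d. (y i - m i) * (adj_mat A $$ (i,l) / det A) * (y l - m l))"
      using adj_mat(1)[OF A] by (auto simp: r_def X_def scalar_prod_def atLeast0LessThan sum_distrib_left mult.assoc intro!: sum.cong)
    then show ?thesis using False B BX unfolding gauss_dens_def Let_def A_def[symmetric] r_def[symmetric] by simp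
  qed
qed

lemma gauss_dens_measurable:
  assumes m: "\<And>k. k < d \<Longrightarrow> (\<lambda>x. m x k) \<in> borel_measurable M"
    and S: "\<And>i l. i < d \<Longrightarrow> l < d \<Longrightarrow> (\<lambda>x. S x (i,l)) \<in> borel_measurable M"
    and y: "\<And>k. k < d \<Longrightarrow> (\<lambda>x. y x k) \<in> borel_measurable M"
  shows "(\<lambda>x. gauss_dens d (m x) (S x) (y x)) \<in> borel_measurable M"
proof -
  have det [measurable]: "(\<lambda>x. det (mat d d (S x))) \<in> borel_measurable M"
    by (rule det_measurable) (auto simp: S)
  have adj: "(\<lambda>x. adj_mat (mat d d (S x)) $$ (i,l)) \<in> borel_measurable M" if il: "i < d" "l < d" for i l
  proof -
    have "(\<lambda>x. det (mat_delete (mat d d (S x)) l i)) \<in> borel_measurable M"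
    proof (rule det_measurable[where d = "d - 1"])
      fix a b assume ab: "a < d - 1" "b < d - 1"
      have "(\<lambda>x. mat_delete (mat d d (S x)) l i $$ (a,b)) = (\<lambda>x. S x (if a < l then a else Suc a, if b < i then b else Suc b))"
        using ab by (intro ext) (auto simp: mat_delete_def)
      moreover have "(if a < l then a else Suc a) < d" "(if b < i then b else Suc b) < d" using ab by auto
      ultimately show "(\<lambda>x. mat_delete (mat d d (S x)) l i $$ (a,b)) \<in> borel_measurable M"
        using S by metis
    qed (auto simp: mat_delete_def)
    then have "(\<lambda>x. (- 1) ^ (l + i) * det (mat_delete (mat d d (S x)) l i)) \<in> borel_measurable M" by measurable
    moreover have "adj_mat (mat d d (S x)) $$ (i,l) = (- 1) ^ (l + i) * det (mat_delete (mat d d (S x)) l i)" for x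
      using il by (simp add: adj_mat_def cofactor_def)
    ultimately show ?thesis by simp
  qed
  have "(\<lambda>x. \<Sum>i<d. \<Sum>l<d. (y x i - m x i) * (adj_mat (mat d d (S x)) $$ (i,l) / det (mat d d (S x))) * (y x l - m x l)) \<in> borel_measurable M"
    by (intro borel_measurable_sum borel_measurable_times borel_measurable_divide borel_measurable_diff y m adj det) auto
  note [measurable] = this
  show ?thesis unfolding gauss_dens_adj by measurable
qed

definition fit :: "nat \<Rightarrow> rmat \<Rightarrow> rmat \<Rightarrow> nat \<Rightarrow> nat \<Rightarrow> real" where
  "fit p X \<beta> i k = (\<Sum>l<p. X (i,l) * \<beta> (l,k))"

definition xdist :: "nat \<Rightarrow> nat \<Rightarrow> nat \<Rightarrow> rmat \<Rightarrow> rmat \<Rightarrow> rmat \<Rightarrow> real" where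
  "xdist n p d X \<beta> \<beta>' = frob2 {0..<n} {0..<d} (mmul {0..<n} {0..<p} {0..<d} X (\<lambda>lk. \<beta> lk - \<beta>' lk))"

lemma xdist_fit: "xdist n p d X \<beta> \<beta>' = (\<Sum>i<n. sq d (\<lambda>k. fit p X \<beta> i k - fit p X \<beta>' i k))"
  unfolding xdist_def frob2_def mmul_def sq_def fit_def atLeast0LessThan
  by (intro sum.cong refl) (simp add: sum_subtractf[symmetric] algebra_simps)

lemma lik_fit: "lik n p d X \<beta> S Y = (\<Prod>i<n. gauss_dens d (fit p X \<beta> i) S (\<lambda>k. Y (i,k)))"
  unfolding lik_def fit_def ..

lemma lik_pos: "spd d S \<Longrightarrow> 0 < lik n p d X \<beta> S Y"
  unfolding lik_fit by (intro prod_pos) (simp add: gauss_dens_pos)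

lemma gauss_dens_nonneg: "0 \<le> gauss_dens d m S y"
  unfolding gauss_dens_adj by (auto intro!: mult_nonneg_nonneg)

lemma lik_nonneg: "0 \<le> lik n p d X \<beta> S Y"
  unfolding lik_fit by (intro prod_nonneg) (simp add: gauss_dens_nonneg)

lemma gauss_dens_row_measurable:
  "(\<lambda>y. gauss_dens d m S (\<lambda>k. y (i,k))) \<in> borel_measurable (PiM (Pair i ` {..<d}) (\<lambda>_. lborel))"
  by (intro gauss_dens_measurable component_borel) auto

lemma nn_integral_lik:
  assumes "spd d S"
  shows "(\<integral>\<^sup>+ Y. ennreal (lik n p d X \<beta> S Y) \<partial>PiM ({0..<n} \<times> {0..<d}) (\<lambda>_. lborel)) = 1"
proof -
  have "(\<integral>\<^sup>+ Y. ennreal (lik n p d X \<beta> S Y) \<partial>PiM ({0..<n} \<times> {0..<d}) (\<lambda>_. lborel))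
    = (\<integral>\<^sup>+ Y. (\<Prod>i<n. ennreal (gauss_dens d (fit p X \<beta> i) S (\<lambda>k. Y (i,k)))) \<partial>PiM ({0..<n} \<times> {0..<d}) (\<lambda>_. lborel))"
    unfolding lik_fit by (simp add: prod_ennreal gauss_dens_nonneg)
  also have "\<dots> = (\<Prod>i<n. \<integral>\<^sup>+ y. ennreal (gauss_dens d (fit p X \<beta> i) S (\<lambda>k. y (i,k))) \<partial>PiM (Pair i ` {..<d}) (\<lambda>_. lborel))"
  proof (rule nn_integral_rows[where f = "\<lambda>i y. ennreal (gauss_dens d (fit p X \<beta> i) S y)"])
    fix i x y assume e: "\<And>k. k < d \<Longrightarrow> x k = (y k :: real)"
    show "ennreal (gauss_dens d (fit p X \<beta> i) S x) = ennreal (gauss_dens d (fit p X \<beta> i) S y)"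
      using gauss_dens_cong[of d x y, OF e] by simp
  next
    fix i
    note [measurable] = gauss_dens_row_measurable
    show "(\<lambda>y. ennreal (gauss_dens d (fit p X \<beta> i) S (\<lambda>k. y (i,k)))) \<in> borel_measurable (PiM (Pair i ` {..<d}) (\<lambda>_. lborel))"
      by measurable
  qed
  also have "\<dots> = 1" by (intro prod.neutral ballI nn_integral_gauss_dens assms) (auto simp: inj_on_def)
  finally show ?thesis .
qed

lemma nn_integral_sqrt_lik:
  "(\<integral>\<^sup>+ Y. ennreal (sqrt (lik n p d X \<beta> S Y * lik n p d X \<beta>' S' Y)) \<partial>PiM ({0..<n} \<times> {0..<d}) (\<lambda>_. lborel))
    = (\<Prod>i<n. \<integral>\<^sup>+ y. ennreal (sqrt (gauss_dens d (fit p X \<beta> i) S (\<lambda>k. y (i,k)) * gauss_dens d (fit p X \<beta>' i) S' (\<lambda>k. y (i,k)))) \<partial>PiM (Pair i ` {..<d}) (\<lambda>_. lborel))"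
proof -
  have "(\<integral>\<^sup>+ Y. ennreal (sqrt (lik n p d X \<beta> S Y * lik n p d X \<beta>' S' Y)) \<partial>PiM ({0..<n} \<times> {0..<d}) (\<lambda>_. lborel))
    = (\<integral>\<^sup>+ Y. (\<Prod>i<n. ennreal (sqrt (gauss_dens d (fit p X \<beta> i) S (\<lambda>k. Y (i,k)) * gauss_dens d (fit p X \<beta>' i) S' (\<lambda>k. Y (i,k))))) \<partial>PiM ({0..<n} \<times> {0..<d}) (\<lambda>_. lborel))"
    unfolding lik_fit prod.distrib[symmetric] sqrt_prod by (simp add: prod_ennreal gauss_dens_nonneg)
  also have "\<dots> = (\<Prod>i<n. \<integral>\<^sup>+ y. ennreal (sqrt (gauss_dens d (fit p X \<beta> i) S (\<lambda>k. y (i,k)) * gauss_dens d (fit p X \<beta>' i) S' (\<lambda>k. y (i,k)))) \<partial>PiM (Pair i ` {..<d}) (\<lambda>_. lborel))"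
  proof (rule nn_integral_rows[where f = "\<lambda>i y. ennreal (sqrt (gauss_dens d (fit p X \<beta> i) S y * gauss_dens d (fit p X \<beta>' i) S' y))"])
    fix i x y assume e: "\<And>k. k < d \<Longrightarrow> x k = (y k :: real)"
    show "ennreal (sqrt (gauss_dens d (fit p X \<beta> i) S x * gauss_dens d (fit p X \<beta>' i) S' x)) =
      ennreal (sqrt (gauss_dens d (fit p X \<beta> i) S y * gauss_dens d (fit p X \<beta>' i) S' y))"
      using gauss_dens_cong[of d x y, OF e] by simp
  next
    fix i
    note [measurable] = gauss_dens_row_measurable
    show "(\<lambda>y. ennreal (sqrt (gauss_dens d (fit p X \<beta> i) S (\<lambda>k. y (i,k)) * gauss_dens d (fit p X \<beta>' i) S' (\<lambda>k. y (i,k))))) \<in> borel_measurable (PiM (Pair i ` {..<d}) (\<lambda>_. lborel))"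
      by measurable
  qed
  finally show ?thesis .
qed

lemma lik_affinity_cov:
  assumes S: "spd d S0" "spd d S1" and b: "\<And>v. bf d S0 v v \<le> b * sq d v" "b > 0"
  shows "(\<integral>\<^sup>+ Y. ennreal (sqrt (lik n p d X \<beta>0 S0 Y * lik n p d X \<beta>1 S1 Y)) \<partial>PiM ({0..<n} \<times> {0..<d}) (\<lambda>_. lborel))
    \<le> ennreal (exp (- real n * min 1 (frob2 {0..<d} {0..<d} (\<lambda>il. S1 il - S0 il) / b\<^sup>2) / 36))"
proof -
  have "(\<integral>\<^sup>+ Y. ennreal (sqrt (lik n p d X \<beta>0 S0 Y * lik n p d X \<beta>1 S1 Y)) \<partial>PiM ({0..<n} \<times> {0..<d}) (\<lambda>_. lborel))
    \<le> (\<Prod>i<n. ennreal (exp (- min 1 (frob2 {0..<d} {0..<d} (\<lambda>il. S1 il - S0 il) / b\<^sup>2) / 36)))"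
    unfolding nn_integral_sqrt_lik by (intro prod_mono_ennreal affinity_cov S b) (auto simp: inj_on_def)
  also have "\<dots> = ennreal (exp (- real n * min 1 (frob2 {0..<d} {0..<d} (\<lambda>il. S1 il - S0 il) / b\<^sup>2) / 36))"
    by (simp add: prod_ennreal exp_of_nat_mult[symmetric] ennreal_power)
  finally show ?thesis .
qed

lemma lik_affinity_mean:
  assumes S: "spd d S0" "spd d S1" and B: "\<And>v. bf d S0 v v + bf d S1 v v \<le> B * sq d v" "B > 0"
  shows "(\<integral>\<^sup>+ Y. ennreal (sqrt (lik n p d X \<beta>0 S0 Y * lik n p d X \<beta>1 S1 Y)) \<partial>PiM ({0..<n} \<times> {0..<d}) (\<lambda>_. lborel))
    \<le> ennreal (exp (- xdist n p d X \<beta>1 \<beta>0 / (4 * B)))"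
proof -
  have "(\<integral>\<^sup>+ Y. ennreal (sqrt (lik n p d X \<beta>0 S0 Y * lik n p d X \<beta>1 S1 Y)) \<partial>PiM ({0..<n} \<times> {0..<d}) (\<lambda>_. lborel))
    \<le> (\<Prod>i<n. ennreal (exp (- sq d (\<lambda>k. fit p X \<beta>1 i k - fit p X \<beta>0 i k) / (4 * B))))"
    unfolding nn_integral_sqrt_lik by (intro prod_mono_ennreal affinity_mean S B) (auto simp: inj_on_def)
  also have "\<dots> = ennreal (exp (- xdist n p d X \<beta>1 \<beta>0 / (4 * B)))"
    by (simp add: prod_ennreal exp_sum[symmetric] xdist_fit sum_negf sum_divide_distrib)
  finally show ?thesis .
qed

lemma lik_dominated:
  assumes "spd d S" "spd d S'"
    and "\<And>v. (1 + \<eta>) * bf d S v v \<le> bf d S' v v" "\<And>v. bf d S' v v \<le> \<kappa> * bf d S v v"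
    and "\<And>v. a * sq d v \<le> bf d S v v" "a > 0" "\<eta> > 0" "\<kappa> > 0"
  shows "lik n p d X \<beta> S Y \<le> sqrt \<kappa> ^ (n * d) * exp (xdist n p d X \<beta> \<beta>' / (2 * a * \<eta>)) * lik n p d X \<beta>' S' Y"
proof -
  have "lik n p d X \<beta> S Y \<le> (\<Prod>i<n. sqrt \<kappa> ^ d * exp (sq d (\<lambda>k. fit p X \<beta> i k - fit p X \<beta>' i k) / (2 * a * \<eta>)) * gauss_dens d (fit p X \<beta>' i) S' (\<lambda>k. Y (i,k)))"
    unfolding lik_fit by (intro prod_mono conjI gauss_dens_dominated[OF assms] gauss_dens_nonneg)
  also have "\<dots> = sqrt \<kappa> ^ (n * d) * exp (xdist n p d X \<beta> \<beta>' / (2 * a * \<eta>)) * lik n p d X \<beta>' S' Y"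
    by (simp add: prod.distrib lik_fit exp_sum[symmetric] xdist_fit sum_divide_distrib power_mult mult.commute)
  finally show ?thesis .
qed

lemma lik_measurable:
  assumes "\<And>l k. l < p \<Longrightarrow> k < d \<Longrightarrow> (\<lambda>x. \<beta> x (l,k)) \<in> borel_measurable M"
    and "\<And>i l. i < d \<Longrightarrow> l < d \<Longrightarrow> (\<lambda>x. S x (i,l)) \<in> borel_measurable M"
    and "\<And>i k. i < n \<Longrightarrow> k < d \<Longrightarrow> (\<lambda>x. Y x (i,k)) \<in> borel_measurable M"
  shows "(\<lambda>x. lik n p d X (\<beta> x) (S x) (Y x)) \<in> borel_measurable M"
  unfolding lik_fit
proof (rule borel_measurable_prod)
  fix i assume i: "i \<in> {..<n}"
  show "(\<lambda>x. gauss_dens d (fit p X (\<beta> x) i) (S x) (\<lambda>k. Y x (i,k))) \<in> borel_measurable M"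
  proof (rule gauss_dens_measurable)
    fix k assume k: "k < d"
    show "(\<lambda>x. fit p X (\<beta> x) i k) \<in> borel_measurable M"
      unfolding fit_def
    proof (rule borel_measurable_sum)
      fix l assume "l \<in> {..<p}"
      then show "(\<lambda>x. X (i,l) * \<beta> x (l,k)) \<in> borel_measurable M"
        using assms(1)[of l k] k by (intro borel_measurable_times borel_measurable_const) auto
    qed
    show "(\<lambda>x. Y x (i,k)) \<in> borel_measurable M" using assms(3) i k by simp
  qed (rule assms(2))
qed

section \<open>The Haar and inverse Gaussian priors\<close>

lemma orth_isometry:
  assumes Q: "Q \<in> orth d"
  shows "(\<Sum>i<d. mv d Q x i * mv d Q y i) = (\<Sum>i<d. x i * y i)"
proof -
  have "(\<Sum>i<d. mv d Q x i * mv d Q y i) = (\<Sum>k<d. mv d (tr Q) (mv d Q x) k * y k)" by (rule sum_mv_tr)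
  also have "\<dots> = (\<Sum>k<d. x k * y k)"
  proof (intro sum.cong refl)
    fix k assume "k \<in> {..<d}"
    then have "mv d (tr Q) (mv d Q x) k = x k"
      by (intro mv_mv) (use Q in \<open>auto simp: orth_def\<close>)
    then show "mv d (tr Q) (mv d Q x) k * y k = x k * y k" by simp
  qed
  finally show ?thesis .
qed

lemma mmul_apply: "i < d \<Longrightarrow> l < d \<Longrightarrow> mmul {0..<d} {0..<d} {0..<d} A B (i,l) = mv d A (\<lambda>k. B (k,l)) i"
  by (simp add: mmul_def mv_def atLeast0LessThan)

lemma orth_mmul:
  assumes "Q \<in> orth d" "P \<in> orth d"
  shows "mmul {0..<d} {0..<d} {0..<d} Q P \<in> orth d"
proof -
  have "(\<Sum>k<d. mmul {0..<d} {0..<d} {0..<d} Q P (k,i) * mmul {0..<d} {0..<d} {0..<d} Q P (k,l)) = (if i = l then 1 else 0)"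
    if il: "i < d" "l < d" for i l
  proof -
    have "(\<Sum>k<d. mmul {0..<d} {0..<d} {0..<d} Q P (k,i) * mmul {0..<d} {0..<d} {0..<d} Q P (k,l))
      = (\<Sum>k<d. mv d Q (\<lambda>k. P (k,i)) k * mv d Q (\<lambda>k. P (k,l)) k)"
      using il by (intro sum.cong refl) (simp add: mmul_apply)
    also have "\<dots> = (if i = l then 1 else 0)" using assms(2) il by (simp add: orth_isometry[OF assms(1)] orth_def)
    finally show ?thesis .
  qed
  then show ?thesis unfolding orth_def by (auto simp: mmul_def)
qed

lemma orth_transpose:
  assumes "P \<in> orth d" shows "restrict (tr P) ({0..<d} \<times> {0..<d}) \<in> orth d"
  using orth_rows[OF assms] by (auto simp: orth_def)

lemma orth_entry_le_1:
  assumes "P \<in> orth d" "i < d" "l < d" shows "\<bar>P (i,l)\<bar> \<le> 1"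
proof -
  have "(P (i,l))\<^sup>2 \<le> (\<Sum>k<d. P (k,l) * P (k,l))"
    using assms by (subst power2_eq_square) (rule member_le_sum, auto)
  also have "\<dots> = 1" using assms by (auto simp: orth_def)
  finally show ?thesis by (simp add: abs_square_le_1)
qed

lemma frob2_mmul_orth:
  assumes Q: "Q \<in> orth d"
  shows "frob2 {0..<d} {0..<d} (\<lambda>x. mmul {0..<d} {0..<d} {0..<d} Q A x - mmul {0..<d} {0..<d} {0..<d} Q B x)
    = frob2 {0..<d} {0..<d} (\<lambda>x. A x - B x)"
proof -
  have "frob2 {0..<d} {0..<d} (\<lambda>x. mmul {0..<d} {0..<d} {0..<d} Q A x - mmul {0..<d} {0..<d} {0..<d} Q B x)
     = (\<Sum>i<d. \<Sum>l<d. (mv d Q (\<lambda>k. A (k,l) - B (k,l)) i)\<^sup>2)"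
    unfolding frob2_def atLeast0LessThan
    by (intro sum.cong refl) (simp add: mmul_apply[unfolded atLeast0LessThan] mv_diff)
  also have "\<dots> = (\<Sum>l<d. \<Sum>i<d. (mv d Q (\<lambda>k. A (k,l) - B (k,l)) i)\<^sup>2)" by (rule sum.swap)
  also have "\<dots> = (\<Sum>l<d. \<Sum>k<d. (A (k,l) - B (k,l))\<^sup>2)"
    by (simp add: power2_eq_square orth_isometry[OF Q])
  also have "\<dots> = frob2 {0..<d} {0..<d} (\<lambda>x. A x - B x)"
    unfolding frob2_def atLeast0LessThan by (rule sum.swap)
  finally show ?thesis .
qed

lemma mspace_component:
  "x \<in> R \<times> C \<Longrightarrow> (\<lambda>A. A x) \<in> borel_measurable (mspace R C)"
  unfolding mspace_def by (rule measurable_component_singleton)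

lemma frob2_measurable:
  "(\<lambda>A. frob2 R C (\<lambda>x. A x - B x)) \<in> borel_measurable (mspace R C)"
  unfolding frob2_def
  by (intro borel_measurable_sum borel_measurable_power borel_measurable_diff mspace_component borel_measurable_const) auto

lemma floor_eq_close:
  fixes x y m :: real
  assumes "m > 0" "\<lfloor>x * m\<rfloor> = \<lfloor>y * m\<rfloor>" shows "\<bar>x - y\<bar> \<le> 1 / m"
proof -
  have "\<bar>x * m - y * m\<bar> \<le> 1" using assms(2) by linarith
  then have "\<bar>x - y\<bar> * m \<le> 1" using assms(1) by (metis abs_mult abs_of_pos left_diff_distrib)
  then show ?thesis using assms(1) by (simp add: field_simps)
qed

text \<open>By invariance all translates of a ball have the same mass, and a partition of the orthogonal
  group into few small cells shows that this mass is not too small.\<close>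

lemma haar_ball:
  assumes H: "haar_orth d H" and P0: "P0 \<in> orth d" and r: "r > 0" and d: "d \<ge> 1"
  shows "ennreal (1 / (2 * (real d / r) + 3) ^ (d * d))
    \<le> emeasure H {P \<in> space (mspace {0..<d} {0..<d}). P \<in> orth d \<and> (\<forall>i<d. \<forall>l<d. \<bar>P (i,l) - P0 (i,l)\<bar> \<le> r)}"
proof -
  let ?I = "{0..<d} \<times> {0..<d}" and ?M = "mspace {0..<d} {0..<d}"
  have sH: "sets H = sets ?M" and spH: "space H = space ?M" and eH: "emeasure H (orth d) = 1"
    and inv: "\<And>Q. Q \<in> orth d \<Longrightarrow> distr H ?M (mmul {0..<d} {0..<d} {0..<d} Q) = H"
    using H sets_eq_imp_space_eq[of H ?M] by (auto simp: haar_orth_def)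
  have oH: "orth d \<in> sets H" using eH emeasure_notin_sets[of "orth d" H] by auto
  \<comment> \<open>Cells of side 1/m = r/d: the d^2 squared entry differences, each at most
    (r/d)^2, sum to at most r^2.\<close>
  define m where "m = real d / r"
  have m: "m > 0" using r d by (simp add: m_def)
  define K where "K = \<lceil>m\<rceil>"
  define B where "B = {P \<in> space ?M. P \<in> orth d \<and> frob2 {0..<d} {0..<d} (\<lambda>x. P x - P0 x) \<le> r\<^sup>2}"
  have Bs: "B \<in> sets H"
  proof -
    have "B = orth d \<inter> {P \<in> space ?M. frob2 {0..<d} {0..<d} (\<lambda>x. P x - P0 x) \<le> r\<^sup>2}"
      using sets.sets_into_space[OF oH] by (auto simp: B_def spH)
    moreover have "{P \<in> space ?M. frob2 {0..<d} {0..<d} (\<lambda>x. P x - P0 x) \<le> r\<^sup>2} \<in> sets ?M"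
      by (rule borel_measurable_le[OF frob2_measurable borel_measurable_const])
    ultimately show ?thesis using oH by (simp add: sH)
  qed
  define cell where "cell c = {P \<in> orth d. restrict (\<lambda>x. \<lfloor>P x * m\<rfloor>) ?I = c}" for c
  define CC where "CC = (PiE ?I (\<lambda>_. {-K..K}))"
  have cs: "cell c \<in> sets H" if "c \<in> CC" for c
  proof -
    have "cell c = orth d \<inter> {P \<in> space ?M. \<forall>x\<in>?I. \<lfloor>P x * m\<rfloor> = c x}"
      using that sets.sets_into_space[OF oH]
      by (auto simp: cell_def CC_def spH fun_eq_iff restrict_def PiE_iff extensional_def)
    moreover have "{P \<in> space ?M. \<forall>x\<in>?I. \<lfloor>P x * m\<rfloor> = c x} \<in> sets ?M"
    proof (rule sets.sets_Collect_finite_All)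
      fix x assume "x \<in> ?I"
      then have [measurable]: "(\<lambda>P. P x) \<in> borel_measurable ?M" by (rule mspace_component)
      show "{P \<in> space ?M. \<lfloor>P x * m\<rfloor> = c x} \<in> sets ?M" by measurable
    qed simp
    ultimately show ?thesis using oH by (simp add: sH)
  qed
  have cb: "emeasure H (cell c) \<le> emeasure H B" if c: "c \<in> CC" for c
  proof (cases "cell c = {}")
    case False
    then obtain Q1 where Q1: "Q1 \<in> orth d" "restrict (\<lambda>x. \<lfloor>Q1 x * m\<rfloor>) ?I = c" by (auto simp: cell_def)
    \<comment> \<open>Left multiplication by \<open>P0\<close> times the transpose of
      \<open>Q1\<close> moves the point \<open>Q1\<close> of the cell to \<open>P0\<close> and
      preserves Frobenius distances, so it maps the whole cell into the ball around
      \<open>P0\<close>.\<close>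
    define Q where "Q = mmul {0..<d} {0..<d} {0..<d} P0 (restrict (tr Q1) ?I)"
    have Q: "Q \<in> orth d" unfolding Q_def by (intro orth_mmul P0 orth_transpose Q1)
    have QQ: "mmul {0..<d} {0..<d} {0..<d} Q Q1 x = P0 x" if xI: "x \<in> ?I" for x
    proof -
      obtain i l where x: "x = (i,l)" "i < d" "l < d" using xI by (cases x) auto
      have "mmul {0..<d} {0..<d} {0..<d} Q Q1 (i,l) = (\<Sum>k<d. Q (i,k) * Q1 (k,l))"
        using x by (simp add: mmul_apply mv_def)
      also have "\<dots> = (\<Sum>k<d. \<Sum>a<d. P0 (i,a) * (Q1 (k,a) * Q1 (k,l)))"
        using x by (intro sum.cong refl) (simp add: Q_def mmul_apply mv_def sum_distrib_right mult.assoc)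
      also have "\<dots> = (\<Sum>a<d. P0 (i,a) * (\<Sum>k<d. Q1 (k,a) * Q1 (k,l)))"
        by (subst sum.swap) (simp add: sum_distrib_left)
      also have "\<dots> = (\<Sum>a<d. if a = l then P0 (i,a) else 0)"
        using Q1(1) x by (intro sum.cong refl) (simp add: orth_def)
      finally show ?thesis using x by simp
    qed
    have mm: "mmul {0..<d} {0..<d} {0..<d} Q \<in> measurable H ?M"
      unfolding mmul_def mspace_def
    proof (rule measurable_restrict)
      fix x assume x: "x \<in> ?I"
      show "(\<lambda>B. case x of (i, j) \<Rightarrow> \<Sum>k\<in>{0..<d}. Q (i,k) * B (k,j)) \<in> borel_measurable H"
        unfolding measurable_cong_sets[OF sH refl] using x
        by (auto intro!: borel_measurable_sum borel_measurable_times mspace_component)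
    qed
    have "emeasure H (cell c) \<le> emeasure H (mmul {0..<d} {0..<d} {0..<d} Q -` B \<inter> space H)"
    proof (rule emeasure_mono)
      show "cell c \<subseteq> mmul {0..<d} {0..<d} {0..<d} Q -` B \<inter> space H"
      proof
        fix P assume P: "P \<in> cell c"
        then have Po: "P \<in> orth d" and Pc: "restrict (\<lambda>x. \<lfloor>P x * m\<rfloor>) ?I = c" by (auto simp: cell_def)
        have "\<bar>P x - Q1 x\<bar> \<le> 1 / m" if "x \<in> ?I" for x
          using Pc Q1(2) that by (intro floor_eq_close m) (metis (mono_tags, lifting) restrict_apply')
        then have sm: "(P x - Q1 x)\<^sup>2 \<le> (1 / m)\<^sup>2" if "x \<in> ?I" for x
          using that by (metis abs_ge_zero power2_abs power_mono)
        have "frob2 {0..<d} {0..<d} (\<lambda>x. mmul {0..<d} {0..<d} {0..<d} Q P x - P0 x)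
          = frob2 {0..<d} {0..<d} (\<lambda>x. mmul {0..<d} {0..<d} {0..<d} Q P x - mmul {0..<d} {0..<d} {0..<d} Q Q1 x)"
          unfolding frob2_def by (intro sum.cong refl) (simp add: QQ)
        also have "\<dots> = frob2 {0..<d} {0..<d} (\<lambda>x. P x - Q1 x)" by (rule frob2_mmul_orth[OF Q])
        also have "\<dots> \<le> (\<Sum>i\<in>{0..<d}. \<Sum>j\<in>{0..<d}. (1 / m)\<^sup>2)"
          unfolding frob2_def by (intro sum_mono sm) auto
        also have "\<dots> = r\<^sup>2" using d r by (simp add: m_def field_simps power2_eq_square)
        finally show "P \<in> mmul {0..<d} {0..<d} {0..<d} Q -` B \<inter> space H"
          using measurable_space[OF mm] orth_mmul[OF Q Po] sets.sets_into_space[OF oH] Po by (auto simp: B_def spH)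
      qed
      show "mmul {0..<d} {0..<d} {0..<d} Q -` B \<inter> space H \<in> sets H"
        using mm Bs by (intro measurable_sets[OF mm]) (simp add: sH)
    qed
    also have "\<dots> = emeasure (distr H ?M (mmul {0..<d} {0..<d} {0..<d} Q)) B"
      using Bs by (subst emeasure_distr[OF mm]) (simp_all add: sH)
    finally show ?thesis by (simp add: inv[OF Q])
  qed simp
  have fin: "finite CC" unfolding CC_def by (intro finite_PiE) auto
  have cov: "orth d \<subseteq> (\<Union>c\<in>CC. cell c)"
  proof
    fix P assume P: "P \<in> orth d"
    have "restrict (\<lambda>x. \<lfloor>P x * m\<rfloor>) ?I \<in> CC"
      unfolding CC_def
    proof (rule restrict_PiE_iff[THEN iffD2], intro ballI)
      fix x assume "x \<in> ?I"
      then have "\<bar>P x\<bar> \<le> 1" using orth_entry_le_1[OF P] by auto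
      then have "\<bar>P x * m\<bar> \<le> m" using m by (simp add: abs_mult mult_left_le_one_le)
      then have "\<bar>P x * m\<bar> \<le> of_int K" unfolding K_def by (rule order_trans) (rule le_of_int_ceiling)
      then show "\<lfloor>P x * m\<rfloor> \<in> {-K..K}" by (simp add: abs_le_iff) linarith
    qed
    then show "P \<in> (\<Union>c\<in>CC. cell c)" using P by (auto simp: cell_def)
  qed
  have "1 = emeasure H (orth d)" using eH by simp
  also have "\<dots> \<le> emeasure H (\<Union>c\<in>CC. cell c)"
    using cov cs fin by (intro emeasure_mono) auto
  also have "\<dots> \<le> (\<Sum>c\<in>CC. emeasure H (cell c))"
    using cs fin by (intro emeasure_subadditive_finite) auto
  also have "\<dots> \<le> (\<Sum>c\<in>CC. emeasure H B)" by (intro sum_mono cb)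
  also have "\<dots> = of_nat (card CC) * emeasure H B" by simp
  finally have le: "1 \<le> of_nat (card CC) * emeasure H B" .
  define N where "N = (2 * (real d / r) + 3) ^ (d * d)"
  have N0: "N > 0" unfolding N_def using r by (intro zero_less_power add_nonneg_pos) auto
  have "real (card CC) = real (nat (2 * K + 1)) ^ (d * d)"
    unfolding CC_def by (simp add: card_PiE)
  also have "\<dots> \<le> N" unfolding N_def
  proof (rule power_mono)
    have "K \<ge> 0" "of_int K < m + 1" unfolding K_def using m by (simp, linarith)
    then show "real (nat (2 * K + 1)) \<le> 2 * (real d / r) + 3" by (simp add: m_def[symmetric])
  qed simp
  finally have card: "real (card CC) \<le> N" .
  have "1 \<le> ennreal N * emeasure H B"
    by (rule order_trans[OF le]) (intro mult_right_mono, simp_all add: ennreal_of_nat_eq_real_of_nat ennreal_leI[OF card])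
  then have "ennreal (1 / N) * 1 \<le> ennreal (1 / N) * (ennreal N * emeasure H B)" by (intro mult_left_mono) auto
  also have "\<dots> = emeasure H B" using N0 by (simp add: mult.assoc[symmetric] ennreal_mult[symmetric])
  also have "\<dots> \<le> emeasure H {P \<in> space ?M. P \<in> orth d \<and> (\<forall>i<d. \<forall>l<d. \<bar>P (i,l) - P0 (i,l)\<bar> \<le> r)}"
  proof (rule emeasure_mono)
    show "B \<subseteq> {P \<in> space ?M. P \<in> orth d \<and> (\<forall>i<d. \<forall>l<d. \<bar>P (i,l) - P0 (i,l)\<bar> \<le> r)}"
    proof clarify
      fix P assume P: "P \<in> B"
      have "\<bar>P (i,l) - P0 (i,l)\<bar> \<le> r" if il: "i < d" "l < d" for i l
      proof -
        have "(P (i,l) - P0 (i,l))\<^sup>2 \<le> (\<Sum>l\<in>{0..<d}. (P (i,l) - P0 (i,l))\<^sup>2)" using il by (intro member_le_sum) auto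
        also have "\<dots> \<le> (\<Sum>i\<in>{0..<d}. \<Sum>l\<in>{0..<d}. (P (i,l) - P0 (i,l))\<^sup>2)" using il
          by (intro member_le_sum[of i "{0..<d}" "\<lambda>i. \<Sum>l\<in>{0..<d}. (P (i,l) - P0 (i,l))\<^sup>2"]) (auto intro: sum_nonneg)
        also have "\<dots> \<le> r\<^sup>2" using P by (simp add: B_def frob2_def)
        finally show ?thesis using r by (metis abs_le_square_iff abs_of_pos)
      qed
      then show "P \<in> space ?M \<and> P \<in> orth d \<and> (\<forall>i<d. \<forall>l<d. \<bar>P (i,l) - P0 (i,l)\<bar> \<le> r)"
        using P by (auto simp: B_def)
    qed
    have "{P \<in> space ?M. P \<in> orth d \<and> (\<forall>i<d. \<forall>l<d. \<bar>P (i,l) - P0 (i,l)\<bar> \<le> r)}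
      = orth d \<inter> {P \<in> space ?M. \<forall>x\<in>?I. \<bar>P x - P0 x\<bar> \<le> r}"
      using sets.sets_into_space[OF oH] by (auto simp: spH)
    moreover have "{P \<in> space ?M. \<forall>x\<in>?I. \<bar>P x - P0 x\<bar> \<le> r} \<in> sets ?M"
    proof (rule sets.sets_Collect_finite_All)
      fix x assume "x \<in> ?I"
      then have [measurable]: "(\<lambda>P. P x) \<in> borel_measurable ?M" by (rule mspace_component)
      show "{P \<in> space ?M. \<bar>P x - P0 x\<bar> \<le> r} \<in> sets ?M" by measurable
    qed simp
    ultimately show "{P \<in> space ?M. P \<in> orth d \<and> (\<forall>i<d. \<forall>l<d. \<bar>P (i,l) - P0 (i,l)\<bar> \<le> r)} \<in> sets H"
      using oH by (simp add: sH)
  qed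
  finally show ?thesis by (simp add: N_def)
qed

section \<open>Inverse Gaussian eigenvalues: tails and mass of intervals\<close>

definition ig :: "real \<Rightarrow> real \<Rightarrow> real measure" where
  "ig mu nu = density lborel (\<lambda>x. ennreal (ig_dens mu nu x))"

lemma ig_dens_measurable [measurable]: "ig_dens mu nu \<in> borel_measurable borel"
  unfolding ig_dens_def[abs_def] by measurable

text \<open>Expanding the square gives the exponents nu/mu, -nu x/(2 mu^2) and -nu/(2x). Half of the
  last one, nu/(4x), is spent on absorbing the singular factor x^(-3/2) into a constant; the other
  half remains in the bound.\<close>

lemma ig_dens_upper:
  assumes "mu > 0" "nu > 0"
  obtains C where "C > 0" "\<And>x. x > 0 \<Longrightarrow> ig_dens mu nu x \<le> C * exp (- (nu / (2 * mu\<^sup>2)) * x) * exp (- (nu / 4) / x)"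
proof
  define b where "b = nu / 4"
  have b: "b > 0" using assms by (simp add: b_def)
  define C where "C = sqrt (nu / (2 * pi)) * exp (nu / mu) * (1 + 2 / b\<^sup>2)"
  show "C > 0" unfolding C_def using assms b by (intro mult_pos_pos add_pos_pos) auto
  fix x :: real assume x: "x > 0"
  define u where "u = 1 / x"
  have u: "u > 0" using x by (simp add: u_def)
  have s: "sqrt (u ^ 3) \<le> 1 + u\<^sup>2"
  proof (rule real_le_lsqrt)
    have "(u\<^sup>2 - u / 2)\<^sup>2 = u ^ 4 - u ^ 3 + u\<^sup>2 / 4" by (simp add: power2_eq_square power3_eq_cube power4_eq_xxxx algebra_simps)
    moreover have "0 \<le> (u\<^sup>2 - u / 2)\<^sup>2" "0 \<le> u\<^sup>2" by simp_all
    moreover have "(1 + u\<^sup>2)\<^sup>2 = 1 + 2 * u\<^sup>2 + u ^ 4" by (simp add: power2_eq_square power4_eq_xxxx algebra_simps)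
    ultimately show "u ^ 3 \<le> (1 + u\<^sup>2)\<^sup>2" by linarith
  qed (use u in auto)
  have "(b * u)\<^sup>2 / 2 \<le> exp (b * u)" 
    using exp_lower_Taylor_quadratic[of "b * u"] mult_nonneg_nonneg[of b u] b u by linarith
  then have e2: "u\<^sup>2 \<le> 2 / b\<^sup>2 * exp (b * u)" using b by (simp add: field_simps power_mult_distrib)
  have "1 \<le> exp (b * u)" using b u by simp
  then have "sqrt (u ^ 3) \<le> (1 + 2 / b\<^sup>2) * exp (b * u)" using s e2 unfolding distrib_right by linarith
  then have k: "sqrt (u ^ 3) * exp (- (b * u)) \<le> 1 + 2 / b\<^sup>2"
    by (simp add: exp_minus field_simps)
  have ex: "- nu * (x - mu)\<^sup>2 / (2 * mu\<^sup>2 * x) = nu / mu + - (nu / (2 * mu\<^sup>2)) * x + (- b * u) + (- b / x)"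
    using assms x by (simp add: u_def b_def field_simps power2_eq_square)
  have "ig_dens mu nu x = sqrt (nu / (2 * pi)) * sqrt (u ^ 3) * (exp (nu / mu) * exp (- (nu / (2 * mu\<^sup>2)) * x) * exp (- b * u) * exp (- b / x))"
    using x unfolding ig_dens_def ex exp_add by (simp add: u_def real_sqrt_divide real_sqrt_mult power_divide)
  also have "\<dots> = (sqrt (nu / (2 * pi)) * exp (nu / mu) * exp (- (nu / (2 * mu\<^sup>2)) * x) * exp (- b / x)) * (sqrt (u ^ 3) * exp (- (b * u)))"
    by simp
  also have "\<dots> \<le> (sqrt (nu / (2 * pi)) * exp (nu / mu) * exp (- (nu / (2 * mu\<^sup>2)) * x) * exp (- b / x)) * (1 + 2 / b\<^sup>2)"
    by (rule mult_left_mono[OF k]) (use assms in simp)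
  finally show "ig_dens mu nu x \<le> C * exp (- (nu / (2 * mu\<^sup>2)) * x) * exp (- (nu / 4) / x)"
    by (simp add: C_def b_def mult_ac)
qed

lemma nn_integral_exp_half_line:
  fixes a :: real assumes "a > 0"
  shows "(\<integral>\<^sup>+ x. ennreal (exp (- a * x)) * indicator {0<..} x \<partial>lborel) \<le> ennreal (1 / a)"
proof -
  have "(\<integral>\<^sup>+ x. ennreal (exp (- a * x)) * indicator {0<..} x \<partial>lborel) \<le> (\<integral>\<^sup>+ x. ennreal (1 / a) * ennreal (erlang_density 0 a x) \<partial>lborel)"
    using assms by (intro nn_integral_mono) (auto simp: erlang_density_def ennreal_mult[symmetric] mult.commute split: split_indicator)
  also have "\<dots> = ennreal (1 / a) * (\<integral>\<^sup>+ x. ennreal (erlang_density 0 a x) \<partial>lborel)" by (rule nn_integral_cmult) simp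
  also have "(\<integral>\<^sup>+ x. ennreal (erlang_density 0 a x) \<partial>lborel) = 1"
    using nn_integral_erlang_ith_moment[OF assms, of 0 0] by simp
  finally show ?thesis by simp
qed

text \<open>Half of the linear exponent is kept for integrability. The other half together with the
  exponent in 1/x bounds the integrand on the set in question: it is of order exp(-c t) both for x >
  t and for x < 1/t.\<close>

lemma ig_tails:
  assumes "mu > 0" "nu > 0"
  obtains C c where "C \<ge> 1" "c > 0" "emeasure (ig mu nu) UNIV \<le> ennreal C"
    "\<And>t. t > 0 \<Longrightarrow> emeasure (ig mu nu) (- {1 / t..t}) \<le> ennreal (C * exp (- c * t))"
proof -
  obtain C0 where C0: "C0 > 0" "\<And>x. x > 0 \<Longrightarrow> ig_dens mu nu x \<le> C0 * exp (- (nu / (2 * mu\<^sup>2)) * x) * exp (- (nu / 4) / x)"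
    using ig_dens_upper[OF assms] by metis
  define a where "a = nu / (2 * mu\<^sup>2)"
  define b where "b = nu / 4"
  have ab: "a > 0" "b > 0" using assms by (auto simp: a_def b_def)
  define C where "C = max 1 (C0 * (2 / a))"
  define c where "c = min (a / 2) b"
  have cp: "c > 0" using ab by (simp add: c_def)
  have gen: "emeasure (ig mu nu) S \<le> ennreal (C * w)"
    if S: "S \<in> sets borel" and w: "w \<ge> 0" "\<And>x. x > 0 \<Longrightarrow> x \<in> S \<Longrightarrow> exp (- (a / 2) * x) * exp (- b / x) \<le> w" for S w
  proof -
    have "emeasure (ig mu nu) S = (\<integral>\<^sup>+ x. ennreal (ig_dens mu nu x) * indicator S x \<partial>lborel)"
      unfolding ig_def using S by (subst emeasure_density) auto
    also have "\<dots> \<le> (\<integral>\<^sup>+ x. ennreal (C0 * w) * (ennreal (exp (- (a / 2) * x)) * indicator {0<..} x) \<partial>lborel)"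
    proof (rule nn_integral_mono)
      fix x :: real
      show "ennreal (ig_dens mu nu x) * indicator S x \<le> ennreal (C0 * w) * (ennreal (exp (- (a / 2) * x)) * indicator {0<..} x)"
      proof (cases "x > 0 \<and> x \<in> S")
        case True
        have "ig_dens mu nu x \<le> C0 * exp (- a * x) * exp (- b / x)" using C0(2) True by (simp add: a_def b_def)
        also have "exp (- a * x) = exp (- (a / 2) * x) * exp (- (a / 2) * x)" by (simp add: exp_add[symmetric])
        also have "C0 * (exp (- (a / 2) * x) * exp (- (a / 2) * x)) * exp (- b / x) = C0 * exp (- (a / 2) * x) * (exp (- (a / 2) * x) * exp (- b / x))" by simp
        also have "\<dots> \<le> C0 * exp (- (a / 2) * x) * w" using w(2) True C0(1) by (intro mult_left_mono) auto
        finally have "ig_dens mu nu x \<le> C0 * w * exp (- (a / 2) * x)" by (simp add: mult_ac)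
        then show ?thesis using True C0(1) w(1) by (simp add: ennreal_mult[symmetric] ennreal_leI)
      next
        case False
        then show ?thesis by (auto simp: ig_dens_def)
      qed
    qed
    also have "\<dots> = ennreal (C0 * w) * (\<integral>\<^sup>+ x. ennreal (exp (- (a / 2) * x)) * indicator {0<..} x \<partial>lborel)"
      by (rule nn_integral_cmult) measurable
    also have "\<dots> \<le> ennreal (C0 * w) * ennreal (1 / (a / 2))"
      using ab by (intro mult_left_mono nn_integral_exp_half_line) auto
    also have "\<dots> \<le> ennreal (C * w)"
    proof -
      have "C0 * w * (1 / (a / 2)) \<le> C * w" unfolding C_def using mult_right_mono[OF max.cobounded2 w(1), of "C0 * (2 / a)" 1] by (simp add: mult_ac)
      then show ?thesis using C0(1) w(1) ab by (subst ennreal_mult[symmetric]) (auto intro!: ennreal_leI)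
    qed
    finally show ?thesis .
  qed
  have "exp (- (a / 2) * x) * exp (- b / x) \<le> 1" if "x > 0" for x
    using that ab by (intro mult_le_one) auto
  then have 1: "emeasure (ig mu nu) UNIV \<le> ennreal C" using gen[of UNIV 1] by auto
  have 2: "emeasure (ig mu nu) (- {1 / t..t}) \<le> ennreal (C * exp (- c * t))" if t: "t > 0" for t
  proof (rule gen)
    fix x :: real assume x: "x > 0" "x \<in> - {1 / t..t}"
    show "exp (- (a / 2) * x) * exp (- b / x) \<le> exp (- c * t)"
    proof (cases "x > t")
      case True
      have "c * t \<le> a / 2 * x" using True t ab by (intro mult_mono) (auto simp: c_def)
      moreover have "0 \<le> b / x" using ab x by simp
      ultimately show ?thesis unfolding exp_add[symmetric] by simp
    next
      case False
      then have "x < 1 / t" using x by auto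
      then have "t < 1 / x" using x t by (simp add: field_simps)
      then have "c * t \<le> b * (1 / x)" using t ab by (intro mult_mono) (auto simp: c_def)
      moreover have "0 \<le> a / 2 * x" using ab x by simp
      ultimately show ?thesis unfolding exp_add[symmetric] by simp
    qed
  qed auto
  show ?thesis by (rule that[OF _ cp 1 2]) (simp add: C_def)
qed

lemma ig_lower:
  assumes "mu > 0" "nu > 0" "0 < l" "l \<le> u"
  obtains c where "c > 0" "\<And>x y. l \<le> x \<Longrightarrow> x \<le> y \<Longrightarrow> y \<le> u \<Longrightarrow> ennreal (c * (y - x)) \<le> emeasure (ig mu nu) {x..y}"
proof
  \<comment> \<open>Each factor of the density is replaced by its worst value for x between l and u;
    the distance of x from mu is at most u + mu.\<close>
  define c where "c = sqrt (nu / (2 * pi * u ^ 3)) * exp (- nu * (u + mu)\<^sup>2 / (2 * mu\<^sup>2 * l))"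
  show "c > 0" using assms by (simp add: c_def)
  have low: "c \<le> ig_dens mu nu z" if z: "l \<le> z" "z \<le> u" for z
  proof -
    have z0: "z > 0" using z assms by simp
    have "nu / (2 * pi * u ^ 3) \<le> nu / (2 * pi * z ^ 3)"
      using assms z z0 by (intro divide_left_mono mult_left_mono power_mono mult_pos_pos) auto
    moreover have "nu * (z - mu)\<^sup>2 / (2 * mu\<^sup>2 * z) \<le> nu * (u + mu)\<^sup>2 / (2 * mu\<^sup>2 * l)"
    proof (intro frac_le mult_left_mono)
      have "\<bar>z - mu\<bar> \<le> \<bar>u + mu\<bar>" using assms z z0 by auto
      then show "(z - mu)\<^sup>2 \<le> (u + mu)\<^sup>2" by (rule abs_le_square_iff[THEN iffD1])
    qed (use assms z in auto)
    moreover have "0 \<le> nu / (2 * pi * z ^ 3)" using assms z0 by (intro divide_nonneg_nonneg) auto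
    ultimately show ?thesis using z0 unfolding c_def ig_dens_def by (auto intro!: mult_mono simp del: zero_le_divide_iff)
  qed
  fix x y assume xy: "l \<le> x" "x \<le> y" "y \<le> u"
  have "ennreal (c * (y - x)) = ennreal c * emeasure lborel {x..y}"
    using xy assms by (simp add: c_def ennreal_mult)
  also have "\<dots> = (\<integral>\<^sup>+ z. ennreal c * indicator {x..y} z \<partial>lborel)" by (simp add: nn_integral_cmult_indicator)
  also have "\<dots> \<le> (\<integral>\<^sup>+ z. ennreal (ig_dens mu nu z) * indicator {x..y} z \<partial>lborel)"
    using low xy by (intro nn_integral_mono) (auto split: split_indicator intro!: ennreal_leI)
  also have "\<dots> = emeasure (ig mu nu) {x..y}" unfolding ig_def by (subst emeasure_density) auto
  finally show "ennreal (c * (y - x)) \<le> emeasure (ig mu nu) {x..y}" .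
qed

section \<open>The joint law of eigenvectors and eigenvalues\<close>

lemma product_sigma_finite_ig:
  assumes "mu > 0" "nu > 0"
  shows "product_sigma_finite (\<lambda>_. ig mu nu)"
proof
  fix i
  obtain C :: real where "emeasure (ig mu nu) UNIV \<le> ennreal C" using ig_tails[OF assms] by metis
  then have "emeasure (ig mu nu) (space (ig mu nu)) < \<infinity>" by (simp add: ig_def top_unique less_top) (metis ennreal_less_top le_less_trans less_top)
  then have "finite_measure (ig mu nu)" by (intro finite_measureI) auto
  then interpret finite_measure "ig mu nu" .
  show "\<exists>A. countable A \<and> A \<subseteq> sets (ig mu nu) \<and> \<Union> A = space (ig mu nu) \<and> (\<forall>a\<in>A. emeasure (ig mu nu) a \<noteq> \<infinity>)"
    by (rule sigma_finite_countable)
qed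

text \<open>The law of (P, D) before P D P' is formed. Events about the spectrum of \<Sigma> are
  product sets in these coordinates, so their mass factorises.\<close>

definition PD :: "nat \<Rightarrow> rmat measure \<Rightarrow> real \<Rightarrow> real \<Rightarrow> (rmat \<times> (nat \<Rightarrow> real)) measure" where
  "PD d H mu nu = H \<Otimes>\<^sub>M PiM {0..<d} (\<lambda>_. ig mu nu)"

definition SigPD :: "nat \<Rightarrow> rmat \<times> (nat \<Rightarrow> real) \<Rightarrow> rmat" where
  "SigPD d x = restrict (\<lambda>(i,l). \<Sum>k<d. fst x (i,k) * snd x k * fst x (l,k)) ({0..<d} \<times> {0..<d})"

lemma prior_Sigma_PD: "prior_Sigma d H mu nu = distr (PD d H mu nu) (mspace {0..<d} {0..<d}) (SigPD d)"
  unfolding prior_Sigma_def PD_def ig_def SigPD_def by (simp add: case_prod_beta')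

lemma sets_ig [simp]: "sets (ig mu nu) = sets borel" and space_ig [simp]: "space (ig mu nu) = UNIV"
  by (auto simp: ig_def)

lemma haar_orth_facts:
  assumes "haar_orth d H"
  shows "sets H = sets (mspace {0..<d} {0..<d})" "space H = space (mspace {0..<d} {0..<d})"
    "prob_space H" "emeasure H (orth d) = 1" "orth d \<in> sets H"
  using assms sets_eq_imp_space_eq[of H "mspace {0..<d} {0..<d}"] emeasure_notin_sets[of "orth d" H]
  by (auto simp: haar_orth_def)

lemma ig_component: "k \<in> I \<Longrightarrow> (\<lambda>D. D k) \<in> borel_measurable (PiM I (\<lambda>_. ig mu nu))"
  using measurable_component_singleton[of k I "\<lambda>_. ig mu nu"] measurable_cong_sets[OF refl sets_ig] by blast

lemma PD_measurable_fst:
  assumes "haar_orth d H" "i < d" "k < d" shows "(\<lambda>x. fst x (i,k)) \<in> borel_measurable (PD d H mu nu)"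
proof -
  have "(\<lambda>P. P (i,k)) \<in> borel_measurable H"
    unfolding measurable_cong_sets[OF haar_orth_facts(1)[OF assms(1)] refl] using assms(2,3) by (intro mspace_component) simp
  then show ?thesis unfolding PD_def by (rule measurable_compose[OF measurable_fst])
qed

lemma PD_measurable_snd:
  assumes "k < d" shows "(\<lambda>x. snd x k) \<in> borel_measurable (PD d H mu nu)"
  unfolding PD_def using assms by (intro measurable_compose[OF measurable_snd ig_component]) simp

lemma SigPD_measurable:
  assumes H: "haar_orth d H"
  shows "SigPD d \<in> measurable (PD d H mu nu) (mspace {0..<d} {0..<d})"
  unfolding SigPD_def[abs_def] mspace_def
proof (rule measurable_restrict)
  fix x assume "x \<in> {0..<d} \<times> {0..<d}"
  then obtain i l where x: "x = (i,l)" "i < d" "l < d" by (cases x) auto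
  have "(\<lambda>y. \<Sum>k<d. fst y (i,k) * snd y k * fst y (l,k)) \<in> borel_measurable (PD d H mu nu)"
    by (intro borel_measurable_sum borel_measurable_times PD_measurable_fst[OF H] PD_measurable_snd) (use x in auto)
  then show "(\<lambda>y. case x of (i, l) \<Rightarrow> \<Sum>k<d. fst y (i,k) * snd y k * fst y (l,k)) \<in> borel_measurable (PD d H mu nu)"
    by (simp add: x)
qed

lemma symm_SigPD: "symm d (SigPD d x)"
  by (auto simp: symm_def SigPD_def mult_ac)

lemma bf_SigPD: "bf d (SigPD d x) v v = (\<Sum>k<d. snd x k * (mv d (tr (fst x)) v k)\<^sup>2)"
proof -
  have "bf d (SigPD d x) v v = bf d (cg d (tr (fst x)) (snd x)) v v"
    by (intro bf_cong) (auto simp: SigPD_def cg_def)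
  then show ?thesis by (simp add: bf_cg)
qed

lemma sq_trP:
  assumes "P \<in> orth d" shows "sq d (mv d (tr P) v) = sq d v"
proof -
  have "mv d P (mv d (tr P) v) i = v i" if "i < d" for i
    by (rule mv_mv) (use orth_rows[OF assms] that in auto)
  then have "(\<Sum>i<d. v i * v i) = (\<Sum>i<d. mv d P (mv d (tr P) v) i * mv d P (mv d (tr P) v) i)" by simp
  also have "\<dots> = (\<Sum>i<d. mv d (tr P) v i * mv d (tr P) v i)" by (rule orth_isometry[OF assms])
  finally show ?thesis by (simp add: sq_def power2_eq_square)
qed

lemma SigPD_bounds:
  assumes "fst x \<in> orth d" "\<And>k. k < d \<Longrightarrow> lo \<le> snd x k \<and> snd x k \<le> hi"
  shows "lo * sq d v \<le> bf d (SigPD d x) v v" "bf d (SigPD d x) v v \<le> hi * sq d v"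
proof -
  have "lo * sq d v = (\<Sum>k<d. lo * (mv d (tr (fst x)) v k)\<^sup>2)"
    using sq_trP[OF assms(1), of v] by (simp add: sq_def sum_distrib_left[symmetric])
  also have "\<dots> \<le> bf d (SigPD d x) v v" unfolding bf_SigPD using assms(2) by (intro sum_mono mult_right_mono) auto
  finally show "lo * sq d v \<le> bf d (SigPD d x) v v" .
  have "bf d (SigPD d x) v v \<le> (\<Sum>k<d. hi * (mv d (tr (fst x)) v k)\<^sup>2)"
    unfolding bf_SigPD using assms(2) by (intro sum_mono mult_right_mono) auto
  also have "\<dots> = hi * sq d v" using sq_trP[OF assms(1), of v] by (simp add: sq_def sum_distrib_left[symmetric])
  finally show "bf d (SigPD d x) v v \<le> hi * sq d v" .
qed

lemma emeasure_PD_Times: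
  assumes "mu > 0" "nu > 0" "A \<in> sets H" "\<And>k. k < d \<Longrightarrow> B k \<in> sets borel"
  shows "A \<times> PiE {0..<d} B \<in> sets (PD d H mu nu)"
    "emeasure (PD d H mu nu) (A \<times> PiE {0..<d} B) = emeasure H A * (\<Prod>k<d. emeasure (ig mu nu) (B k))"
proof -
  interpret product_sigma_finite "\<lambda>_. ig mu nu" by (rule product_sigma_finite_ig[OF assms(1,2)])
  interpret S: sigma_finite_measure "PiM {0..<d} (\<lambda>_. ig mu nu)" by (rule sigma_finite) simp
  have B: "PiE {0..<d} B \<in> sets (PiM {0..<d} (\<lambda>_. ig mu nu))"
    by (rule sets_PiM_I_finite) (use assms(4) in auto)
  show "A \<times> PiE {0..<d} B \<in> sets (PD d H mu nu)" unfolding PD_def using assms(3) B by simp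
  have "emeasure (PD d H mu nu) (A \<times> PiE {0..<d} B) = emeasure H A * emeasure (PiM {0..<d} (\<lambda>_. ig mu nu)) (PiE {0..<d} B)"
    unfolding PD_def by (rule S.emeasure_pair_measure_Times[OF assms(3) B])
  also have "emeasure (PiM {0..<d} (\<lambda>_. ig mu nu)) (PiE {0..<d} B) = (\<Prod>k<d. emeasure (ig mu nu) (B k))"
    by (subst emeasure_PiM) (use assms(4) in \<open>auto simp: atLeast0LessThan\<close>)
  finally show "emeasure (PD d H mu nu) (A \<times> PiE {0..<d} B) = emeasure H A * (\<Prod>k<d. emeasure (ig mu nu) (B k))" .
qed

definition PDgood :: "nat \<Rightarrow> real \<Rightarrow> (rmat \<times> (nat \<Rightarrow> real)) set" where
  "PDgood d t = orth d \<times> PiE {0..<d} (\<lambda>_. {1/t..t})"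

lemma space_PD: "haar_orth d H \<Longrightarrow> space (PD d H mu nu) = space H \<times> PiE {0..<d} (\<lambda>_. UNIV)"
  by (simp add: PD_def space_pair_measure space_PiM)

text \<open>The complement of the good set is covered by the non-orthogonal P, which form a null
  set, and by d cylinders, one for each eigenvalue out of range. Every remaining factor contributes
  its mass bound C.\<close>

lemma PD_mass_tail:
  assumes H: "haar_orth d H" and mn: "mu > 0" "nu > 0"
    and C: "C \<ge> 1" "emeasure (ig mu nu) UNIV \<le> ennreal C"
    and tl: "emeasure (ig mu nu) (- {1 / t..t}) \<le> ennreal (C * \<tau>)" "\<tau> \<ge> 0"
  shows "emeasure (PD d H mu nu) (space (PD d H mu nu)) \<le> ennreal (C ^ d)"
    and "PDgood d t \<in> sets (PD d H mu nu)"
    and "emeasure (PD d H mu nu) (space (PD d H mu nu) - PDgood d t) \<le> ennreal (real d * C ^ d * \<tau>)"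
proof -
  note Hf = haar_orth_facts[OF H]
  interpret HP: prob_space H by (rule Hf(3))
  have "emeasure (PD d H mu nu) (space (PD d H mu nu)) = emeasure H (space H) * (\<Prod>k<d. emeasure (ig mu nu) UNIV)"
    unfolding space_PD[OF H] by (rule emeasure_PD_Times(2)[OF mn]) auto
  also have "\<dots> \<le> 1 * (\<Prod>k<d. ennreal C)"
    by (intro mult_mono prod_mono_ennreal C(2)) (auto simp: HP.emeasure_space_1)
  also have "\<dots> = ennreal (C ^ d)" using C(1) by (simp add: ennreal_power)
  finally show "emeasure (PD d H mu nu) (space (PD d H mu nu)) \<le> ennreal (C ^ d)" .
  show good: "PDgood d t \<in> sets (PD d H mu nu)"
    unfolding PDgood_def by (rule emeasure_PD_Times(1)[OF mn Hf(5)]) auto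
  define B0 where "B0 = (space H - orth d) \<times> PiE {0..<d} (\<lambda>_. UNIV :: real set)"
  define B where "B j = space H \<times> PiE {0..<d} (\<lambda>k. if k = j then - {1/t..t} else UNIV)" for j
  have B0s: "B0 \<in> sets (PD d H mu nu)" "emeasure (PD d H mu nu) B0 = 0"
  proof -
    have "emeasure H (space H - orth d) = 0"
      using Hf(4,5) by (subst emeasure_compl) (auto simp: HP.emeasure_space_1)
    then show "B0 \<in> sets (PD d H mu nu)" "emeasure (PD d H mu nu) B0 = 0"
      unfolding B0_def using emeasure_PD_Times[OF mn, of "space H - orth d" H d "\<lambda>_. UNIV"] Hf(5) by auto
  qed
  have Bs: "B j \<in> sets (PD d H mu nu)" for j
    unfolding B_def by (rule emeasure_PD_Times(1)[OF mn]) auto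
  have Be: "emeasure (PD d H mu nu) (B j) \<le> ennreal (C ^ d * \<tau>)" if j: "j < d" for j
  proof -
    have "emeasure (PD d H mu nu) (B j) = emeasure H (space H) * (\<Prod>k<d. emeasure (ig mu nu) (if k = j then - {1/t..t} else UNIV))"
      unfolding B_def by (rule emeasure_PD_Times(2)[OF mn]) auto
    also have "\<dots> \<le> 1 * (\<Prod>k<d. ennreal (if k = j then C * \<tau> else C))"
      by (intro mult_mono prod_mono_ennreal) (use C tl in \<open>auto simp: HP.emeasure_space_1\<close>)
    also have "\<dots> = (\<Prod>k<d. ennreal ((if k = j then \<tau> else 1) * C))"
      unfolding mult_1 by (intro prod.cong) (auto simp: mult.commute)
    also have "\<dots> = ennreal (\<Prod>k<d. (if k = j then \<tau> else 1) * C)"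
      using C tl by (intro prod_ennreal) auto
    also have "(\<Prod>k<d. (if k = j then \<tau> else 1) * C) = C ^ d * \<tau>"
      using j by (simp add: prod.distrib mult.commute)
    finally show ?thesis .
  qed
  have "space (PD d H mu nu) - PDgood d t \<subseteq> B0 \<union> (\<Union>j<d. B j)"
    unfolding space_PD[OF H] PDgood_def B0_def B_def by (auto simp: PiE_iff)
  then have "emeasure (PD d H mu nu) (space (PD d H mu nu) - PDgood d t) \<le> emeasure (PD d H mu nu) (B0 \<union> (\<Union>j<d. B j))"
    using B0s Bs by (intro emeasure_mono) auto
  also have "\<dots> \<le> emeasure (PD d H mu nu) B0 + emeasure (PD d H mu nu) (\<Union>j<d. B j)"
    using B0s Bs by (intro emeasure_subadditive) auto
  also have "\<dots> \<le> 0 + (\<Sum>j<d. emeasure (PD d H mu nu) (B j))"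
    using B0s Bs by (intro add_mono emeasure_subadditive_finite) auto
  also have "\<dots> \<le> (\<Sum>j<d. ennreal (C ^ d * \<tau>))" unfolding add_0 by (intro sum_mono Be) simp
  also have "\<dots> = ennreal (real d * C ^ d * \<tau>)"
    using C tl by (simp add: ennreal_mult[symmetric] ennreal_of_nat_eq_real_of_nat mult.assoc)
  finally show "emeasure (PD d H mu nu) (space (PD d H mu nu) - PDgood d t) \<le> ennreal (real d * C ^ d * \<tau>)" .
qed

lemma H0_set_facts:
  assumes "S \<in> H0_set d b1 b2" "b1 > 0"
  shows "spd d S" "b1 * sq d v \<le> bf d S v v" "bf d S v v \<le> b2 * sq d v"
  using assms by (auto simp: H0_set_def spd_def symm_def bf_def sq_def)

text \<open>The entrywise error e is multiplied by the squared sum of the absolute coordinates,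
  which Cauchy-Schwarz bounds by d times the squared norm.\<close>

lemma bf_perturb:
  assumes "\<And>i l. i < d \<Longrightarrow> l < d \<Longrightarrow> \<bar>S (i,l) - T (i,l)\<bar> \<le> e" "e \<ge> 0"
  shows "\<bar>bf d S v v - bf d T v v\<bar> \<le> real d * e * sq d v"
proof -
  have "\<bar>bf d S v v - bf d T v v\<bar> = \<bar>\<Sum>i<d. \<Sum>l<d. v i * (S (i,l) - T (i,l)) * v l\<bar>"
    by (simp add: bf_def sum_subtractf[symmetric] algebra_simps)
  also have "\<dots> \<le> (\<Sum>i<d. \<Sum>l<d. \<bar>v i * (S (i,l) - T (i,l)) * v l\<bar>)"
    by (rule order_trans[OF sum_abs]) (intro sum_mono sum_abs)
  also have "\<dots> \<le> (\<Sum>i<d. \<Sum>l<d. e * (\<bar>v i\<bar> * \<bar>v l\<bar>))"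
  proof (intro sum_mono)
    fix i l assume "i \<in> {..<d}" "l \<in> {..<d}"
    then have "\<bar>S (i,l) - T (i,l)\<bar> * (\<bar>v i\<bar> * \<bar>v l\<bar>) \<le> e * (\<bar>v i\<bar> * \<bar>v l\<bar>)"
      by (intro mult_right_mono assms(1)) auto
    then show "\<bar>v i * (S (i,l) - T (i,l)) * v l\<bar> \<le> e * (\<bar>v i\<bar> * \<bar>v l\<bar>)" by (simp add: abs_mult mult_ac)
  qed
  also have "\<dots> = e * (\<Sum>i<d. \<bar>v i\<bar>)\<^sup>2"
  proof -
    have "(\<Sum>i<d. \<bar>v i\<bar>)\<^sup>2 = (\<Sum>i<d. \<Sum>l<d. \<bar>v i\<bar> * \<bar>v l\<bar>)" unfolding power2_eq_square sum_product ..
    then show ?thesis by (simp add: sum_distrib_left)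
  qed
  also have "\<dots> \<le> e * (real d * sq d v)"
  proof (rule mult_left_mono[OF _ assms(2)])
    show "(\<Sum>i<d. \<bar>v i\<bar>)\<^sup>2 \<le> real d * sq d v"
      using Cauchy_Schwarz_ineq_sum[of "\<lambda>i. \<bar>v i\<bar>" "\<lambda>_. 1" "{..<d}"] by (simp add: sq_def mult.commute)
  qed
  finally show ?thesis by (simp add: mult_ac)
qed

text \<open>The neighbourhood is centred at (1 + 2 \<eta>) times the truth with \<eta> = 1/n^3:
  eigenvectors near \<open>P0\<close>, eigenvalues slightly above (1 + 2 \<eta>) \<open>D0\<close>.
  The tolerances keep the form within \<eta> b1 |v|^2, hence within \<eta> times the form of the
  truth, of this centre, so that \<Sigma> stays strictly above the truth. Tolerances polynomial in
  1/n cost a factor of order ln n per coordinate in the exponent: d^2 from the Haar ball and d from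
  the eigenvalues.\<close>

lemma PD_lower:
  assumes mn: "mu > 0" "nu > 0" and b: "b1 > 0" "b2 > 0"
  shows "\<exists>C>0. \<forall>n d H S0. n \<ge> 3 \<longrightarrow> 1 \<le> d \<longrightarrow> d \<le> n \<longrightarrow> haar_orth d H \<longrightarrow> S0 \<in> H0_set d b1 b2 \<longrightarrow>
    (\<exists>N\<in>sets (PD d H mu nu). (\<forall>x\<in>N. spd d (SigPD d x) \<and>
       (\<forall>v. (1 + 1 / real n ^ 3) * bf d S0 v v \<le> bf d (SigPD d x) v v \<and>
            bf d (SigPD d x) v v \<le> (1 + 4 / real n ^ 3) * bf d S0 v v)) \<and>
     ennreal (exp (- C * (real d)\<^sup>2 * ln (real n))) \<le> emeasure (PD d H mu nu) N)"
proof -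
  obtain c where c: "c > 0" "\<And>x y. b1 \<le> x \<Longrightarrow> x \<le> y \<Longrightarrow> y \<le> b1 + 4 * b2 \<Longrightarrow> ennreal (c * (y - x)) \<le> emeasure (ig mu nu) {x..y}"
    using ig_lower[OF mn, of b1 "b1 + 4 * b2"] b by (metis add_increasing2 less_eq_real_def mult_pos_pos zero_less_numeral)
  define K where "K = 32 * (b1 + b2) / b1 + 3"
  have K: "K \<ge> 3" using b by (simp add: K_def)
  define k2 where "k2 = max 1 (2 / (c * b1))"
  have k2: "k2 \<ge> 1" "1 / k2 \<le> c * b1 / 2" unfolding k2_def using c b by (auto simp: field_simps max_def)
  \<comment> \<open>The Haar ball costs 6 powers of n per entry and each eigenvalue interval 5; 11
    is rounded up to 12. The constant factors \<open>K\<close> and \<open>k2\<close> are absorbed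
    through ln n \<ge> 1.\<close>
  define CC where "CC = 12 + ln K + ln k2"
  have CC: "CC > 0" using K k2 by (simp add: CC_def add_pos_nonneg)
  show ?thesis
  proof (intro exI[of _ CC] conjI CC allI impI)
    fix n d :: nat and H and S0 :: rmat
    assume n: "n \<ge> 3" and d: "1 \<le> d" "d \<le> n" and H: "haar_orth d H" and S0: "S0 \<in> H0_set d b1 b2"
    note S0f = H0_set_facts[OF S0 b(1)]
    note Hf = haar_orth_facts[OF H]
    define \<eta> where "\<eta> = 1 / real n ^ 3"
    have \<eta>: "\<eta> > 0" "\<eta> \<le> 1" using n by (auto simp: \<eta>_def)
    obtain P0 D0 where P0: "P0 \<in> orth d" and SD: "\<forall>i<d. \<forall>l<d. S0 (i,l) = (\<Sum>k<d. P0 (i,k) * D0 k * P0 (l,k))"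
      and D0: "\<forall>k<d. D0 k = bf d S0 (\<lambda>r. P0 (r,k)) (\<lambda>r. P0 (r,k))"
      using spectral_ex[of d S0, OF S0f(1)[unfolded spd_def, THEN conjunct1]] by (elim exE conjE) (rule that)
    have D0b: "b1 \<le> D0 k" "D0 k \<le> b2" if k: "k < d" for k
    proof -
      have "sq d (\<lambda>r. P0 (r,k)) = 1" using P0 k by (simp add: orth_def sq_def power2_eq_square)
      then show "b1 \<le> D0 k" "D0 k \<le> b2" using S0f(2,3)[of "\<lambda>r. P0 (r,k)"] D0 k by simp_all
    qed
    \<comment> \<open>The errors caused by r in the eigenvectors and by \<delta> in the eigenvalues
      are balanced: each contributes half of the admissible \<eta> b1 / d^2 per summand, and
      \<open>bf_perturb\<close> together with the sum over k restores the factor d^2.\<close>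
    define r where "r = \<eta> * b1 / (16 * (b1 + b2) * (real d)\<^sup>2)"
    define \<delta> where "\<delta> = \<eta> * b1 / (2 * (real d)\<^sup>2)"
    have d2: "(real d)\<^sup>2 \<ge> 1" using d by simp
    have r: "r > 0" unfolding r_def using \<eta> b d by simp
    have \<delta>: "\<delta> > 0" "\<delta> \<le> b1"
    proof -
      show "\<delta> > 0" unfolding \<delta>_def using \<eta> b d by simp
      have "\<eta> * b1 \<le> b1 * (2 * (real d)\<^sup>2)" using mult_mono[of \<eta> "2 * (real d)\<^sup>2" b1 b1] \<eta> b d2 by (simp add: mult.commute)
      then show "\<delta> \<le> b1" unfolding \<delta>_def using d by (simp add: field_simps)
    qed
    define Ds where "Ds k = (1 + 2 * \<eta>) * D0 k" for k
    have Dsb: "b1 \<le> Ds k" "Ds k \<le> 3 * b2" if "k < d" for k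
      using D0b[OF that] \<eta> b mult_mono[of 1 "1 + 2 * \<eta>" b1 "D0 k"] mult_mono[of "1 + 2 * \<eta>" 3 "D0 k" b2]
      by (simp_all add: Ds_def)
    define Hb where "Hb = {P \<in> space (mspace {0..<d} {0..<d}). P \<in> orth d \<and> (\<forall>i<d. \<forall>l<d. \<bar>P (i,l) - P0 (i,l)\<bar> \<le> r)}"
    have hb: "ennreal (1 / (2 * (real d / r) + 3) ^ (d * d)) \<le> emeasure H Hb"
      unfolding Hb_def by (rule haar_ball[OF H P0 r d(1)])
    \<comment> \<open>Measurability is read off the positive mass: a set outside the sigma-algebra
      would have \<open>emeasure\<close> 0.\<close>
    have Hbs: "Hb \<in> sets H"
    proof (rule ccontr)
      assume "Hb \<notin> sets H"
      then have "emeasure H Hb = 0" by (rule emeasure_notin_sets)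
      moreover define q where "q = 1 / (2 * (real d / r) + 3) ^ (d * d)"
      moreover have "q > 0" unfolding q_def using r d by (intro divide_pos_pos zero_less_power add_nonneg_pos) auto
      ultimately show False using hb unfolding q_def[symmetric] by simp
    qed
    define N where "N = Hb \<times> PiE {0..<d} (\<lambda>k. {Ds k..Ds k + \<delta>})"
    have Ns: "N \<in> sets (PD d H mu nu)" unfolding N_def by (rule emeasure_PD_Times(1)[OF mn Hbs]) auto
    have close: "\<bar>bf d (SigPD d x) v v - (1 + 2 * \<eta>) * bf d S0 v v\<bar> \<le> \<eta> * b1 * sq d v" if x: "x \<in> N" for x v
    proof -
      obtain P D where xP: "x = (P,D)" "P \<in> Hb" "D \<in> PiE {0..<d} (\<lambda>k. {Ds k..Ds k + \<delta>})" using x by (auto simp: N_def)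
      have P: "P \<in> orth d" "\<And>i l. i < d \<Longrightarrow> l < d \<Longrightarrow> \<bar>P (i,l) - P0 (i,l)\<bar> \<le> r" using xP(2) by (auto simp: Hb_def)
      have D: "Ds k \<le> D k" "D k \<le> Ds k + \<delta>" if "k < d" for k using xP(3) that by (auto simp: PiE_iff)
      define e where "e = 8 * (b1 + b2) * r + \<delta>"
      have e0: "e \<ge> 0" using r \<delta> b by (simp add: e_def)
      have tb: "\<bar>P (i,k) * D k * P (l,k) - P0 (i,k) * Ds k * P0 (l,k)\<bar> \<le> e" if ikl: "i < d" "k < d" "l < d" for i k l
      proof -
        have p1: "\<bar>P (l,k)\<bar> \<le> 1" "\<bar>P0 (i,k)\<bar> \<le> 1" using orth_entry_le_1 P(1) P0 ikl by blast+
        have pr: "\<bar>P (i,k) - P0 (i,k)\<bar> \<le> r" "\<bar>P (l,k) - P0 (l,k)\<bar> \<le> r" using P(2) ikl by blast+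
        have Db: "\<bar>D k\<bar> \<le> 4 * (b1 + b2)" "\<bar>Ds k\<bar> \<le> 3 * (b1 + b2)" "\<bar>D k - Ds k\<bar> \<le> \<delta>" using D[OF ikl(2)] Dsb[OF ikl(2)] \<delta> b by auto
        have eq: "P (i,k) * D k * P (l,k) - P0 (i,k) * Ds k * P0 (l,k)
          = (P (i,k) - P0 (i,k)) * D k * P (l,k) + P0 (i,k) * (D k - Ds k) * P (l,k) + P0 (i,k) * Ds k * (P (l,k) - P0 (l,k))"
          by (simp add: algebra_simps)
        have "\<bar>P (i,k) * D k * P (l,k) - P0 (i,k) * Ds k * P0 (l,k)\<bar> \<le> \<bar>P (i,k) - P0 (i,k)\<bar> * \<bar>D k\<bar> * \<bar>P (l,k)\<bar> + \<bar>P0 (i,k)\<bar> * \<bar>D k - Ds k\<bar> * \<bar>P (l,k)\<bar> + \<bar>P0 (i,k)\<bar> * \<bar>Ds k\<bar> * \<bar>P (l,k) - P0 (l,k)\<bar>"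
          unfolding eq abs_mult[symmetric] by (rule order_trans[OF abs_triangle_ineq add_right_mono[OF abs_triangle_ineq]])
        also have "\<dots> \<le> r * (4 * (b1 + b2)) * 1 + 1 * \<delta> * 1 + 1 * (3 * (b1 + b2)) * r"
          by (intro add_mono mult_mono pr p1 Db mult_nonneg_nonneg) (use r \<delta> b in simp_all)
        also have "\<dots> \<le> e" using r b by (simp add: e_def algebra_simps)
        finally show ?thesis .
      qed
      have "\<bar>SigPD d x (i,l) - (1 + 2 * \<eta>) * S0 (i,l)\<bar> \<le> real d * e" if il: "i < d" "l < d" for i l
      proof -
        have eq: "SigPD d x (i,l) - (1 + 2 * \<eta>) * S0 (i,l) = (\<Sum>k<d. P (i,k) * D k * P (l,k) - P0 (i,k) * Ds k * P0 (l,k))"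
          using il SD by (simp add: SigPD_def xP(1) sum_subtractf Ds_def sum_distrib_left mult_ac)
        have "\<bar>SigPD d x (i,l) - (1 + 2 * \<eta>) * S0 (i,l)\<bar> \<le> (\<Sum>k<d. \<bar>P (i,k) * D k * P (l,k) - P0 (i,k) * Ds k * P0 (l,k)\<bar>)" unfolding eq by (rule sum_abs)
        also have "\<dots> \<le> (\<Sum>k<d. e)" using tb il by (intro sum_mono) auto
        finally show ?thesis by simp
      qed
      then have "\<bar>bf d (SigPD d x) v v - bf d (\<lambda>il. (1 + 2 * \<eta>) * S0 il) v v\<bar> \<le> real d * (real d * e) * sq d v"
        using e0 by (intro bf_perturb) auto
      also have "bf d (\<lambda>il. (1 + 2 * \<eta>) * S0 il) v v = (1 + 2 * \<eta>) * bf d S0 v v"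
        by (simp add: bf_def sum_distrib_left mult_ac)
      also have "real d * (real d * e) = (real d)\<^sup>2 * e" by (simp add: power2_eq_square)
      also have "(real d)\<^sup>2 * e = \<eta> * b1"
      proof -
        have "w * (8 * s * (u / (16 * s * w)) + u / (2 * w)) = u" if "s \<noteq> 0" "w \<noteq> 0" for s w u :: real
          using that by (simp add: field_simps)
        moreover have "(real d)\<^sup>2 \<noteq> 0" "b1 + b2 \<noteq> 0" using d b by auto
        ultimately show ?thesis unfolding e_def r_def \<delta>_def by blast
      qed
      finally show ?thesis .
    qed
    have prp: "spd d (SigPD d x) \<and> (\<forall>v. (1 + 1 / real n ^ 3) * bf d S0 v v \<le> bf d (SigPD d x) v v \<and>
            bf d (SigPD d x) v v \<le> (1 + 4 / real n ^ 3) * bf d S0 v v)" if x: "x \<in> N" for x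
    proof -
      have lohi: "(1 + \<eta>) * bf d S0 v v \<le> bf d (SigPD d x) v v \<and> bf d (SigPD d x) v v \<le> (1 + 4 * \<eta>) * bf d S0 v v" for v
      proof -
        have "\<eta> * b1 * sq d v \<le> \<eta> * bf d S0 v v" using S0f(2)[of v] \<eta> by (simp add: mult.assoc mult_left_mono)
        moreover have "0 \<le> bf d S0 v v" using S0f(2)[of v] b sq_nonneg[of d v] by (meson dual_order.trans mult_nonneg_nonneg less_imp_le)
        moreover then have "0 \<le> \<eta> * bf d S0 v v" using \<eta> by simp
        ultimately show ?thesis using close[OF x, of v] by (simp add: algebra_simps abs_le_iff)
      qed
      have "b1 * sq d v \<le> bf d (SigPD d x) v v" for v
      proof -
        have "0 \<le> bf d S0 v v" using S0f(2)[of v] b sq_nonneg[of d v] by (meson dual_order.trans mult_nonneg_nonneg less_imp_le)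
        then have "bf d S0 v v \<le> (1 + \<eta>) * bf d S0 v v" using \<eta> by (simp add: algebra_simps)
        then show ?thesis using lohi[of v] S0f(2)[of v] by linarith
      qed
      then show ?thesis using lohi b symm_SigPD by (auto simp: spd_def \<eta>_def)
    qed
    have "ennreal (exp (- CC * (real d)\<^sup>2 * ln (real n))) \<le> emeasure (PD d H mu nu) N"
    proof -
      define L where "L = ln (real n)"
      have "exp 1 \<le> (3::real)" by (rule exp_le)
      then have "exp 1 \<le> real n" using n by linarith
      then have L: "L \<ge> 1" unfolding L_def using n by (subst ln_ge_iff) auto
      have expL: "exp L = real n" using n by (simp add: L_def)
      have n1: "real n \<ge> 1" using n by simp
      have dn: "real d \<le> real n" using d by simp
      have h1: "2 * (real d / r) + 3 \<le> K * real n ^ 6"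
      proof -
        have "2 * (real d / r) = 32 * (b1 + b2) / b1 * (real d ^ 3 * real n ^ 3)"
          using d b n by (simp add: r_def \<eta>_def field_simps power2_eq_square power3_eq_cube)
        also have "\<dots> \<le> 32 * (b1 + b2) / b1 * (real n ^ 3 * real n ^ 3)"
          using b dn by (intro mult_left_mono mult_right_mono power_mono) auto
        also have "\<dots> = 32 * (b1 + b2) / b1 * real n ^ 6" by (simp add: power_add[symmetric])
        finally have "2 * (real d / r) \<le> 32 * (b1 + b2) / b1 * real n ^ 6" .
        moreover have "3 \<le> 3 * real n ^ 6" using n1 by simp
        ultimately show ?thesis by (simp add: K_def distrib_right)
      qed
      have h1': "exp (- (6 * L + ln K)) \<le> 1 / (2 * (real d / r) + 3)"
      proof -
        have "exp (6 * L + ln K) = K * real n ^ 6" using K by (simp add: exp_add expL[symmetric] exp_of_nat_mult[symmetric])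
        then have "2 * (real d / r) + 3 \<le> exp (6 * L + ln K)" using h1 by simp
        moreover have "0 < 2 * (real d / r) + 3" using r by (simp add: add_nonneg_pos)
        ultimately show ?thesis unfolding exp_minus inverse_eq_divide by (intro divide_left_mono mult_pos_pos) auto
      qed
      have h2: "exp (- (5 * L + ln k2)) \<le> c * \<delta>"
      proof -
        have "exp (- (5 * L + ln k2)) = 1 / k2 * (1 / real n ^ 5)"
          using k2 unfolding exp_minus exp_add by (simp add: expL[symmetric] exp_of_nat_mult[symmetric] inverse_eq_divide)
        also have "\<dots> \<le> c * b1 / 2 * (1 / real n ^ 5)" using k2 by (intro mult_right_mono) auto
        also have "\<dots> \<le> c * b1 / 2 * (1 / (real n ^ 3 * (real d)\<^sup>2))"
        proof (intro mult_left_mono divide_left_mono)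
          have "real n ^ 3 * (real d)\<^sup>2 \<le> real n ^ 3 * (real n)\<^sup>2" using dn by (intro mult_left_mono power_mono) auto
          then show "real n ^ 3 * (real d)\<^sup>2 \<le> real n ^ 5" by (simp add: power_add[symmetric])
        qed (use c b n d in auto)
        also have "\<dots> = c * \<delta>" by (simp add: \<delta>_def \<eta>_def)
        finally show ?thesis .
      qed
      have "- CC * (real d)\<^sup>2 * L \<le> real (d * d) * (- (6 * L + ln K)) + real d * (- (5 * L + ln k2))"
      proof -
        have dd: "real d \<le> (real d)\<^sup>2" using d by (simp add: power2_eq_square)
        have "real d * (5 * L + ln k2) \<le> (real d)\<^sup>2 * (5 * L + ln k2)" using dd L k2 by (intro mult_right_mono) auto
        moreover have "(real d)\<^sup>2 * ln k2 \<le> (real d)\<^sup>2 * (ln k2 * L)" using L k2 mult_left_mono[of 1 L "ln k2"] by (intro mult_left_mono) auto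
        moreover have "(real d)\<^sup>2 * ln K \<le> (real d)\<^sup>2 * (ln K * L)" using L K mult_left_mono[of 1 L "ln K"] by (intro mult_left_mono) auto
        moreover have "0 \<le> (real d)\<^sup>2 * L" using L by simp
        ultimately show ?thesis by (simp add: CC_def algebra_simps power2_eq_square)
      qed
      then have "exp (- CC * (real d)\<^sup>2 * L) \<le> exp (- (6 * L + ln K)) ^ (d * d) * exp (- (5 * L + ln k2)) ^ d"
        by (simp only: exp_of_nat_mult[symmetric] exp_add[symmetric] exp_le_cancel_iff)
      also have "\<dots> \<le> (1 / (2 * (real d / r) + 3)) ^ (d * d) * (c * \<delta>) ^ d"
        using h1' h2 r by (intro mult_mono power_mono) auto
      finally have "ennreal (exp (- CC * (real d)\<^sup>2 * L)) \<le> ennreal (1 / (2 * (real d / r) + 3) ^ (d * d)) * (\<Prod>k<d. ennreal (c * \<delta>))"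
        using c \<delta> r by (simp add: prod_ennreal ennreal_mult[symmetric] power_one_over ennreal_power)
      also have "\<dots> \<le> emeasure H Hb * (\<Prod>k<d. emeasure (ig mu nu) {Ds k..Ds k + \<delta>})"
      proof (intro mult_mono hb prod_mono_ennreal)
        fix k assume "k \<in> {..<d}"
        then have "ennreal (c * (Ds k + \<delta> - Ds k)) \<le> emeasure (ig mu nu) {Ds k..Ds k + \<delta>}"
          by (intro c(2)) (use Dsb[of k] \<delta> b in auto)
        then show "ennreal (c * \<delta>) \<le> emeasure (ig mu nu) {Ds k..Ds k + \<delta>}" by simp
      qed auto
      also have "\<dots> = emeasure (PD d H mu nu) N"
        unfolding N_def by (rule emeasure_PD_Times(2)[OF mn Hbs, symmetric]) auto
      finally show ?thesis by (simp add: L_def)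
    qed
    then show "\<exists>N\<in>sets (PD d H mu nu). (\<forall>x\<in>N. spd d (SigPD d x) \<and>
       (\<forall>v. (1 + 1 / real n ^ 3) * bf d S0 v v \<le> bf d (SigPD d x) v v \<and>
            bf d (SigPD d x) v v \<le> (1 + 4 / real n ^ 3) * bf d S0 v v)) \<and>
     ennreal (exp (- CC * (real d)\<^sup>2 * ln (real n))) \<le> emeasure (PD d H mu nu) N"
      using Ns prp by blast
  qed
qed

section \<open>The group spike-and-slab prior\<close>

text \<open>The unit ball lies in the cube with edges [-1,1]. The bound 2^q will cancel against the
  volume (2r)^q of a box of half-width r.\<close>

lemma unit_ball_vol_bounds: "0 < unit_ball_vol (real q)" "unit_ball_vol (real q) \<le> 2 ^ q"
proof -
  show "0 < unit_ball_vol (real q)" by (simp add: unit_ball_vol_def Gamma_real_pos)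
  interpret product_sigma_finite "\<lambda>_. lborel :: real measure" by standard
  let ?B = "{f :: nat \<Rightarrow> real. sqrt (\<Sum>i<q. (f i)\<^sup>2) \<le> 1} \<inter> space (PiM {..<q} (\<lambda>_. lborel))"
  have "ennreal (unit_ball_vol (real q)) = emeasure (PiM {..<q} (\<lambda>_. lborel)) ?B"
    using emeasure_cball_aux[of "{..<q}" 1] by simp
  also have "\<dots> \<le> emeasure (PiM {..<q} (\<lambda>_. lborel)) (PiE {..<q} (\<lambda>_. {-1..1::real}))"
  proof (rule emeasure_mono)
    show "?B \<subseteq> PiE {..<q} (\<lambda>_. {-1..1::real})"
    proof
      fix f assume f: "f \<in> ?B"
      have "\<bar>f i\<bar> \<le> 1" if "i < q" for i
      proof -
        have "(f i)\<^sup>2 \<le> (\<Sum>i<q. (f i)\<^sup>2)" using that by (intro member_le_sum) auto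
        also have "\<dots> \<le> 1" using f by simp
        finally show ?thesis by (simp add: abs_square_le_1)
      qed
      then show "f \<in> PiE {..<q} (\<lambda>_. {-1..1::real})" using f by (auto simp: space_PiM PiE_iff abs_le_iff)
    qed
    show "PiE {..<q} (\<lambda>_. {-1..1::real}) \<in> sets (PiM {..<q} (\<lambda>_. lborel))"
      by (rule sets_PiM_I_finite) auto
  qed
  also have "\<dots> = (\<Prod>i<q. emeasure lborel {-1..1::real})" by (rule emeasure_PiM) auto
  also have "\<dots> = ennreal (2 ^ q)" by (simp add: ennreal_power[symmetric])
  finally show "unit_ball_vol (real q) \<le> 2 ^ q" by simp
qed

text \<open>Identifies \<open>a_const\<close> as the normalising constant of the slab: q! times the
  volume of the unit ball is the integral of exp(-|x|) over q-dimensional space.\<close>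

lemma a_const_pow:
  assumes "q \<ge> 1"
  shows "a_const q ^ q = fact q * unit_ball_vol (real q)" "a_const q > 0"
proof -
  define z where "z = Gamma (real q + 1) / Gamma (real q / 2 + 1)"
  have z: "z > 0" unfolding z_def by (intro divide_pos_pos Gamma_real_pos) auto
  have "a_const q ^ q = sqrt pi ^ q * (z powr (1 / real q)) ^ q"
    by (simp add: a_const_def z_def power_mult_distrib)
  also have "(z powr (1 / real q)) ^ q = z" using z assms by (simp add: powr_realpow[symmetric] powr_powr)
  also have "sqrt pi ^ q = pi powr (real q / 2)" by (simp add: powr_realpow[symmetric] powr_half_sqrt[symmetric] powr_powr)
  also have "pi powr (real q / 2) * z = fact q * unit_ball_vol (real q)"
    by (simp add: z_def unit_ball_vol_def Gamma_fact[symmetric] add.commute)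
  finally show "a_const q ^ q = fact q * unit_ball_vol (real q)" .
  show "a_const q > 0" unfolding a_const_def z_def[symmetric] using z by simp
qed

lemma nn_integral_exp_tail:
  fixes w \<rho> :: real assumes "w > 0"
  shows "(\<integral>\<^sup>+ t. ennreal (w * exp (- w * t)) * indicator {\<rho>..} t \<partial>lborel) = ennreal (exp (- w * \<rho>))"
proof -
  have "((\<lambda>t. - exp (- w * t)) \<longlongrightarrow> 0) at_top"
  proof -
    have "filterlim (\<lambda>t. - w * t) at_bot at_top"
      using assms by (intro filterlim_tendsto_neg_mult_at_bot[OF tendsto_const] filterlim_ident) simp
    then have "((\<lambda>t. exp (- w * t)) \<longlongrightarrow> 0) at_top" by (rule filterlim_compose[OF exp_at_bot])
    then show ?thesis using tendsto_minus by fastforce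
  qed
  then have "(\<integral>\<^sup>+ t. ennreal (w * exp (- w * t)) * indicator {\<rho>..} t \<partial>lborel) = ennreal (0 - (- exp (- w * \<rho>)))"
    using assms by (intro nn_integral_FTC_atLeast) (auto intro!: derivative_eq_intros)
  then show ?thesis by simp
qed

text \<open>Layer cake: exp(-w \<rho>) is the integral of w exp(-w t) over t \<ge> \<rho>. After
  Fubini the inner integral is the volume of a ball of radius t, and a moment of the exponential
  distribution remains. The point t = 0 is removed as a null set because the ball volume formula
  asks for a positive radius.\<close>

lemma radial_integral:
  fixes w :: real and C :: "'i set"
  assumes C: "finite C" "C \<noteq> {}" and w: "w > 0"
  shows "(\<integral>\<^sup>+ b. ennreal (exp (- w * sqrt (\<Sum>c\<in>C. (b c)\<^sup>2))) \<partial>PiM C (\<lambda>_. lborel))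
    = ennreal (fact (card C) * unit_ball_vol (real (card C)) / w ^ card C)"
proof -
  interpret product_sigma_finite "\<lambda>_. lborel :: real measure" by standard
  interpret P: sigma_finite_measure "PiM C (\<lambda>_. lborel :: real measure)" by (rule sigma_finite[OF C(1)])
  interpret pair_sigma_finite "PiM C (\<lambda>_. lborel :: real measure)" "lborel :: real measure" by standard
  define \<rho> where "\<rho> b = sqrt (\<Sum>c\<in>C. (b c)\<^sup>2)" for b :: "'i \<Rightarrow> real"
  define q where "q = card C"
  have q: "q \<ge> 1" using C by (simp add: q_def Suc_leI card_gt_0_iff)
  have [measurable]: "\<rho> \<in> borel_measurable (PiM C (\<lambda>_. lborel))"
    unfolding \<rho>_def[abs_def] by (intro borel_measurable_sqrt[THEN measurable_compose[rotated]] borel_measurable_sum borel_measurable_power component_borel) 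
  have \<rho>0: "\<rho> b \<ge> 0" for b by (simp add: \<rho>_def sum_nonneg)
  have "(\<integral>\<^sup>+ b. ennreal (exp (- w * \<rho> b)) \<partial>PiM C (\<lambda>_. lborel))
    = (\<integral>\<^sup>+ b. \<integral>\<^sup>+ t. ennreal (w * exp (- w * t)) * indicator {\<rho> b..} t \<partial>lborel \<partial>PiM C (\<lambda>_. lborel))"
    unfolding nn_integral_exp_tail[OF w] ..
  also have "\<dots> = (\<integral>\<^sup>+ b. \<integral>\<^sup>+ t. ennreal (w * exp (- w * t)) * indicator {x. \<rho> (fst x) \<le> snd x} (b, t) \<partial>lborel \<partial>PiM C (\<lambda>_. lborel))"
    by (intro nn_integral_cong) (auto split: split_indicator)
  also have "\<dots> = (\<integral>\<^sup>+ t. \<integral>\<^sup>+ b. ennreal (w * exp (- w * t)) * indicator {x. \<rho> (fst x) \<le> snd x} (b, t) \<partial>PiM C (\<lambda>_. lborel) \<partial>lborel)"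
    by (rule Fubini'[symmetric]) measurable
  also have "\<dots> = (\<integral>\<^sup>+ t. ennreal (unit_ball_vol (real q)) * ennreal (erlang_density 0 w t * t ^ q) \<partial>lborel)"
  proof (rule nn_integral_cong_AE)
    have "AE t in lborel. t \<noteq> (0::real)" by (rule AE_lborel_singleton)
    then show "AE t in lborel. (\<integral>\<^sup>+ b. ennreal (w * exp (- w * t)) * indicator {x. \<rho> (fst x) \<le> snd x} (b, t) \<partial>PiM C (\<lambda>_. lborel))
      = ennreal (unit_ball_vol (real q)) * ennreal (erlang_density 0 w t * t ^ q)"
    proof eventually_elim
      fix t :: real assume t: "t \<noteq> 0"
      have "(\<integral>\<^sup>+ b. ennreal (w * exp (- w * t)) * indicator {x. \<rho> (fst x) \<le> snd x} (b, t) \<partial>PiM C (\<lambda>_. lborel))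
        = (\<integral>\<^sup>+ b. ennreal (w * exp (- w * t)) * indicator ({b. \<rho> b \<le> t} \<inter> space (PiM C (\<lambda>_. lborel))) b \<partial>PiM C (\<lambda>_. lborel))"
        by (intro nn_integral_cong) (auto split: split_indicator)
      also have "\<dots> = ennreal (w * exp (- w * t)) * emeasure (PiM C (\<lambda>_. lborel)) ({b. \<rho> b \<le> t} \<inter> space (PiM C (\<lambda>_. lborel)))"
        by (rule nn_integral_cmult_indicator) measurable
      also have "\<dots> = ennreal (unit_ball_vol (real q)) * ennreal (erlang_density 0 w t * t ^ q)"
      proof (cases "t > 0")
        case True
        then show ?thesis using emeasure_cball_aux[OF C(1) True] w unit_ball_vol_bounds(1)[of q]
          by (simp add: \<rho>_def q_def erlang_density_def ennreal_mult[symmetric] mult_ac)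
      next
        case False
        then have "t < 0" using t by simp
        then have "t < \<rho> b" for b using \<rho>0[of b] by linarith
        then have "{b. \<rho> b \<le> t} = {}" by (auto simp: not_le)
        then show ?thesis using False t by (simp add: erlang_density_def)
      qed
      finally show "(\<integral>\<^sup>+ b. ennreal (w * exp (- w * t)) * indicator {x. \<rho> (fst x) \<le> snd x} (b, t) \<partial>PiM C (\<lambda>_. lborel))
        = ennreal (unit_ball_vol (real q)) * ennreal (erlang_density 0 w t * t ^ q)" .
    qed
  qed
  also have "\<dots> = ennreal (unit_ball_vol (real q)) * (\<integral>\<^sup>+ t. ennreal (erlang_density 0 w t * t ^ q) \<partial>lborel)"
    by (rule nn_integral_cmult) measurable
  also have "(\<integral>\<^sup>+ t. ennreal (erlang_density 0 w t * t ^ q) \<partial>lborel) = ennreal (fact q / w ^ q)"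
    using nn_integral_erlang_ith_moment[OF w, of 0 q] by simp
  also have "ennreal (unit_ball_vol (real q)) * ennreal (fact q / w ^ q) = ennreal (fact q * unit_ball_vol (real q) / w ^ q)"
    using unit_ball_vol_bounds(1)[of q] w by (simp add: ennreal_mult[symmetric] mult.commute)
  finally show ?thesis by (simp add: \<rho>_def q_def)
qed

text \<open>The coordinates of one (group, column) pair. These blocks partition
  \<open>coords grp S\<close>, so integrals over the slab factorise along them.\<close>

definition bnd :: "(nat \<Rightarrow> nat set) \<Rightarrow> nat \<times> nat \<Rightarrow> (nat \<times> nat) set" where
  "bnd grp jk = (\<lambda>l. (l, snd jk)) ` grp (fst jk)"

lemma coords_bnd: "coords grp S = (\<Union>jk\<in>S. bnd grp jk)"
  by (force simp: coords_def bnd_def)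

lemma gnorm_bnd: "gnorm grp b j k = sqrt (\<Sum>c\<in>bnd grp (j,k). (b c)\<^sup>2)"
  unfolding gnorm_def bnd_def by (subst sum.reindex) (auto simp: inj_on_def)

lemma card_bnd: "card (bnd grp (j,k)) = card (grp j)"
  unfolding bnd_def by (simp add: card_image inj_on_def)

lemma gnorm_cong: "(\<And>l. l \<in> grp j \<Longrightarrow> b (l,k) = b' (l,k)) \<Longrightarrow> gnorm grp b j k = gnorm grp b' j k"
  unfolding gnorm_def by (metis (mono_tags, lifting) sum.cong)

lemma gnorm_nonneg: "0 \<le> gnorm grp b j k"
  by (simp add: gnorm_def sum_nonneg)

locale groups =
  fixes G p d :: nat and grp :: "nat \<Rightarrow> nat set"
  assumes grp_ne: "\<And>j. j < G \<Longrightarrow> grp j \<noteq> {}"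
    and grp_disj: "\<And>j j'. j < G \<Longrightarrow> j' < G \<Longrightarrow> j \<noteq> j' \<Longrightarrow> grp j \<inter> grp j' = {}"
    and grp_cover: "(\<Union>j<G. grp j) = {0..<p}"
begin

lemma grp_sub: "j < G \<Longrightarrow> grp j \<subseteq> {0..<p}"
  using grp_cover by blast

lemma grp_fin: "j < G \<Longrightarrow> finite (grp j)"
  using grp_sub finite_subset by blast

lemma card_grp: "j < G \<Longrightarrow> 1 \<le> card (grp j)"
  using grp_ne grp_fin by (simp add: Suc_leI card_gt_0_iff)

abbreviation II :: "(nat \<times> nat) set" where "II \<equiv> {0..<G} \<times> {0..<d}"
abbreviation JJ :: "(nat \<times> nat) set" where "JJ \<equiv> {0..<p} \<times> {0..<d}"

lemma coords_sub: "S \<subseteq> II \<Longrightarrow> coords grp S \<subseteq> JJ"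
  using grp_sub by (force simp: coords_def)

lemma coords_fin: "S \<subseteq> II \<Longrightarrow> finite (coords grp S)"
  using coords_sub by (rule finite_subset) auto

lemma bnd_disj:
  assumes "S \<subseteq> II" "t \<in> S" "s \<in> S" "t \<noteq> s" shows "bnd grp t \<inter> bnd grp s = {}"
proof (rule ccontr)
  assume "bnd grp t \<inter> bnd grp s \<noteq> {}"
  then obtain l where l: "l \<in> grp (fst t)" "l \<in> grp (fst s)" "snd t = snd s" by (auto simp: bnd_def)
  then have "fst t \<noteq> fst s" using assms(4) by (metis prod.expand)
  moreover have "fst t < G" "fst s < G" using assms by auto
  ultimately show False using grp_disj l by blast
qed

lemma card_coords:
  assumes "S \<subseteq> II" shows "card (coords grp S) = (\<Sum>(j,k)\<in>S. card (grp j))"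
proof -
  have f: "finite S" using assms finite_subset by blast
  have "card (coords grp S) = (\<Sum>t\<in>S. card (bnd grp t))"
    unfolding coords_bnd using f bnd_disj[OF assms] assms grp_fin
    by (intro card_UN_disjoint) (force simp: bnd_def)+
  also have "\<dots> = (\<Sum>(j,k)\<in>S. card (grp j))" by (intro sum.cong) (auto simp: card_bnd)
  finally show ?thesis .
qed

text \<open>The factor \<open>w\<close> serves to bound exponential moments; \<open>w = 1\<close> gives the normalisation.\<close>

lemma glap_integral_le:
  assumes S: "S \<subseteq> II" and lam: "\<And>k. k < d \<Longrightarrow> 0 \<le> lam k" and w: "w > 0"
  shows "(\<integral>\<^sup>+ b. ennreal (\<Prod>(j,k)\<in>S. (lam k / a_const (card (grp j))) ^ card (grp j) * exp (- w * lam k * gnorm grp b j k))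
      \<partial>PiM (coords grp S) (\<lambda>_. lborel)) \<le> ennreal ((1 / w) ^ card (coords grp S))"
proof -
  have f: "finite S" using S finite_subset by blast
  define f1 where "f1 t b = ennreal ((lam (snd t) / a_const (card (grp (fst t)))) ^ card (grp (fst t)) * exp (- w * lam (snd t) * gnorm grp b (fst t) (snd t)))" for t b
  have ap: "a_const (card (grp j)) > 0" if "j < G" for j using a_const_pow(2)[OF card_grp[OF that]] .
  have "(\<integral>\<^sup>+ b. ennreal (\<Prod>(j,k)\<in>S. (lam k / a_const (card (grp j))) ^ card (grp j) * exp (- w * lam k * gnorm grp b j k)) \<partial>PiM (coords grp S) (\<lambda>_. lborel))
    = (\<integral>\<^sup>+ b. (\<Prod>t\<in>S. f1 t b) \<partial>PiM (\<Union>t\<in>S. bnd grp t) (\<lambda>_. lborel))"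
    unfolding coords_bnd
  proof (rule nn_integral_cong)
    fix b
    show "ennreal (\<Prod>(j,k)\<in>S. (lam k / a_const (card (grp j))) ^ card (grp j) * exp (- w * lam k * gnorm grp b j k)) = (\<Prod>t\<in>S. f1 t b)"
      unfolding f1_def case_prod_beta' using S lam ap
      by (subst prod_ennreal) (auto intro!: mult_nonneg_nonneg zero_le_power divide_nonneg_nonneg dest!: subsetD simp: less_imp_le)
  qed
  also have "\<dots> = (\<Prod>t\<in>S. \<integral>\<^sup>+ b. f1 t b \<partial>PiM (bnd grp t) (\<lambda>_. lborel))"
  proof (rule nn_integral_prod_blocks[OF f])
    show "finite (bnd grp t)" if "t \<in> S" for t using that S grp_fin by (auto simp: bnd_def)
    show "bnd grp t \<inter> bnd grp s = {}" if "t \<in> S" "s \<in> S" "t \<noteq> s" for t s using bnd_disj[OF S that] .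
    show "f1 t \<in> borel_measurable (PiM (bnd grp t) (\<lambda>_. lborel))" if "t \<in> S" for t
    proof -
      have [measurable]: "(\<lambda>b :: rmat. \<Sum>c\<in>bnd grp (fst t, snd t). (b c)\<^sup>2) \<in> borel_measurable (PiM (bnd grp t) (\<lambda>_. lborel))"
        by (intro borel_measurable_sum borel_measurable_power component_borel) auto
      show ?thesis unfolding f1_def[abs_def] gnorm_bnd by measurable
    qed
    show "f1 t x = f1 t y" if "t \<in> S" "\<And>i. i \<in> bnd grp t \<Longrightarrow> x i = y i" for t x y
    proof -
      have "gnorm grp x (fst t) (snd t) = gnorm grp y (fst t) (snd t)"
        by (rule gnorm_cong) (use that in \<open>auto simp: bnd_def\<close>)
      then show ?thesis by (simp add: f1_def)
    qed
  qed
  also have "\<dots> \<le> (\<Prod>t\<in>S. ennreal ((1 / w) ^ card (bnd grp t)))"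
  proof (rule prod_mono_ennreal)
    fix t assume tS: "t \<in> S"
    obtain j k where t: "t = (j,k)" "j < G" "k < d" using tS S by (cases t) auto
    define q where "q = card (grp j)"
    have q: "q \<ge> 1" using card_grp t by (simp add: q_def)
    have cb: "card (bnd grp t) = q" using t by (simp add: card_bnd q_def)
    have fb: "finite (bnd grp t)" "bnd grp t \<noteq> {}" using t grp_fin grp_ne by (auto simp: bnd_def)
    show "(\<integral>\<^sup>+ b. f1 t b \<partial>PiM (bnd grp t) (\<lambda>_. lborel)) \<le> ennreal ((1 / w) ^ card (bnd grp t))"
    \<comment> \<open>A vanishing design norm forces \<lambda> = 0. As q \<ge> 1 the slab density is
      then identically 0, and the estimate persists as an inequality.\<close>
    proof (cases "lam k = 0")
      case True
      then have "f1 t b = 0" for b using q by (simp add: f1_def t q_def)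
      then show ?thesis by simp
    next
      case False
      then have l: "lam k > 0" using lam[OF t(3)] by simp
      define A where "A = (lam k / a_const q) ^ q"
      have A: "A \<ge> 0" using l ap[OF t(2)] by (simp add: A_def q_def)
      have "f1 t b = ennreal A * ennreal (exp (- (w * lam k) * sqrt (\<Sum>c\<in>bnd grp t. (b c)\<^sup>2)))" for b
        using A by (simp add: f1_def t gnorm_bnd A_def q_def ennreal_mult)
      then have "(\<integral>\<^sup>+ b. f1 t b \<partial>PiM (bnd grp t) (\<lambda>_. lborel)) = ennreal A * (\<integral>\<^sup>+ b. ennreal (exp (- (w * lam k) * sqrt (\<Sum>c\<in>bnd grp t. (b c)\<^sup>2))) \<partial>PiM (bnd grp t) (\<lambda>_. lborel))"
      proof (simp only:, intro nn_integral_cmult)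
        have [measurable]: "(\<lambda>b :: rmat. \<Sum>c\<in>bnd grp t. (b c)\<^sup>2) \<in> borel_measurable (PiM (bnd grp t) (\<lambda>_. lborel))"
          by (intro borel_measurable_sum borel_measurable_power component_borel) auto
        show "(\<lambda>b. ennreal (exp (- (w * lam k) * sqrt (\<Sum>c\<in>bnd grp t. (b c)\<^sup>2)))) \<in> borel_measurable (PiM (bnd grp t) (\<lambda>_. lborel))" by measurable
      qed
      also have "\<dots> = ennreal A * ennreal (fact q * unit_ball_vol (real q) / (w * lam k) ^ q)"
        using radial_integral[OF fb, of "w * lam k"] w l by (simp add: cb)
      also have "\<dots> = ennreal (A * (fact q * unit_ball_vol (real q) / (w * lam k) ^ q))"
        by (rule ennreal_mult'[symmetric, OF A])
      also have "A * (fact q * unit_ball_vol (real q) / (w * lam k) ^ q) = (1 / w) ^ q"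
        unfolding a_const_pow(1)[OF q, symmetric] A_def using l w a_const_pow(2)[OF q]
        by (simp add: power_divide power_mult_distrib)
      finally show ?thesis by (simp add: cb)
    qed
  qed
  also have "\<dots> = ennreal ((1 / w) ^ card (coords grp S))"
  proof -
    have "card (coords grp S) = (\<Sum>t\<in>S. card (bnd grp t))"
      unfolding coords_bnd using f bnd_disj[OF S] S grp_fin
      by (intro card_UN_disjoint) (force simp: bnd_def)+
    then show ?thesis using w by (simp add: prod_ennreal power_sum)
  qed
  finally show ?thesis .
qed

definition ext :: "(nat \<times> nat) set \<Rightarrow> rmat \<Rightarrow> rmat" where
  "ext S b = restrict (\<lambda>lk. if lk \<in> coords grp S then b lk else 0) JJ"

lemma ext_measurable:
  assumes "S \<subseteq> II"
  shows "ext S \<in> measurable (PiM (coords grp S) (\<lambda>_. lborel)) (mspace {0..<p} {0..<d})"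
  unfolding ext_def[abs_def] mspace_def
proof (rule measurable_restrict)
  fix x
  show "(\<lambda>b. if x \<in> coords grp S then b x else 0) \<in> borel_measurable (PiM (coords grp S) (\<lambda>_. lborel))"
    by (cases "x \<in> coords grp S") (auto intro: component_borel)
qed

lemma glap_measurable:
  assumes "S \<subseteq> II"
  shows "(\<lambda>b. glap_dens grp lam S b) \<in> borel_measurable (PiM (coords grp S) (\<lambda>_. lborel))"
  unfolding glap_dens_def
proof (rule borel_measurable_prod)
  fix t assume t: "t \<in> S"
  have [measurable]: "(\<lambda>b :: rmat. \<Sum>c\<in>bnd grp (fst t, snd t). (b c)\<^sup>2) \<in> borel_measurable (PiM (coords grp S) (\<lambda>_. lborel))"
    using t by (intro borel_measurable_sum borel_measurable_power component_borel) (auto simp: coords_bnd)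
  show "(\<lambda>b. case t of (j, k) \<Rightarrow> (lam k / a_const (card (grp j))) ^ card (grp j) * exp (- lam k * gnorm grp b j k)) \<in> borel_measurable (PiM (coords grp S) (\<lambda>_. lborel))"
    unfolding case_prod_beta' gnorm_bnd by measurable
qed

lemma emeasure_beta_given_S:
  assumes S: "S \<subseteq> II" and A: "A \<in> sets (mspace {0..<p} {0..<d})"
  shows "emeasure (beta_given_S p d grp lam S) A = (\<integral>\<^sup>+ b. ennreal (glap_dens grp lam S b) * indicator A (ext S b) \<partial>PiM (coords grp S) (\<lambda>_. lborel))"
proof -
  let ?M = "PiM (coords grp S) (\<lambda>_. lborel :: real measure)"
  let ?D = "density ?M (\<lambda>b. ennreal (glap_dens grp lam S b))"
  have m: "ext S \<in> measurable ?D (mspace {0..<p} {0..<d})" using ext_measurable[OF S] by simp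
  have "emeasure (beta_given_S p d grp lam S) A = emeasure ?D (ext S -` A \<inter> space ?D)"
    unfolding beta_given_S_def ext_def[symmetric] by (rule emeasure_distr[OF m A])
  also have "\<dots> = (\<integral>\<^sup>+ b. ennreal (glap_dens grp lam S b) * indicator (ext S -` A \<inter> space ?M) b \<partial>?M)"
    using measurable_sets[OF ext_measurable[OF S] A] glap_measurable[OF S] by (subst emeasure_density) auto
  also have "\<dots> = (\<integral>\<^sup>+ b. ennreal (glap_dens grp lam S b) * indicator A (ext S b) \<partial>?M)"
    by (intro nn_integral_cong) (auto split: split_indicator)
  finally show ?thesis .
qed

lemma sets_beta_given_S [simp]: "sets (beta_given_S p d grp lam S) = sets (mspace {0..<p} {0..<d})"
  by (simp add: beta_given_S_def)

lemma space_beta_given_S [simp]: "space (beta_given_S p d grp lam S) = space (mspace {0..<p} {0..<d})"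
  by (simp add: beta_given_S_def)

lemma beta_given_S_le_1:
  assumes S: "S \<subseteq> II" and lam: "\<And>k. k < d \<Longrightarrow> 0 \<le> lam k"
  shows "emeasure (beta_given_S p d grp lam S) (space (mspace {0..<p} {0..<d})) \<le> 1"
proof -
  have "emeasure (beta_given_S p d grp lam S) (space (mspace {0..<p} {0..<d})) \<le> (\<integral>\<^sup>+ b. ennreal (glap_dens grp lam S b) \<partial>PiM (coords grp S) (\<lambda>_. lborel))"
    by (subst emeasure_beta_given_S[OF S]) (auto intro!: nn_integral_mono split: split_indicator)
  also have "\<dots> \<le> 1" using glap_integral_le[OF S lam, where w = 1] by (simp add: glap_dens_def)
  finally show ?thesis .
qed

lemma gnorm_ext:
  assumes S: "S \<subseteq> II" and jk: "(j,k) \<in> S"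
  shows "gnorm grp (ext S b) j k = gnorm grp b j k"
proof (rule gnorm_cong)
  fix l assume "l \<in> grp j"
  then have c: "(l,k) \<in> coords grp S" using jk by (auto simp: coords_def)
  then have "(l,k) \<in> JJ" using coords_sub[OF S] by blast
  then show "ext S b (l,k) = b (l,k)" using c by (simp add: ext_def)
qed

text \<open>Exponential Markov inequality: on the event the weighted sum of group norms exceeds t,
  so half of the exponent supplies exp(-t/2). The other half is integrated by
  \<open>glap_integral_le\<close> with w = 1/2, at the price of a factor 2 per coordinate.\<close>

lemma beta_given_S_tail:
  assumes S: "S \<subseteq> II" and lam: "\<And>k. k < d \<Longrightarrow> 0 \<le> lam k"
    and A: "A \<in> sets (mspace {0..<p} {0..<d})" "\<And>\<beta>. \<beta> \<in> A \<Longrightarrow> gsupp G d grp \<beta> \<subseteq> S \<Longrightarrow> \<exists>(j,k)\<in>S. t < lam k * gnorm grp \<beta> j k"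
  shows "emeasure (beta_given_S p d grp lam S) A \<le> ennreal (exp (- t / 2) * 2 ^ card (coords grp S))"
proof -
  have f: "finite S" using S finite_subset by blast
  have ap: "a_const (card (grp j)) > 0" if "j < G" for j using a_const_pow(2)[OF card_grp[OF that]] .
  define h where "h b = (\<Prod>(j,k)\<in>S. (lam k / a_const (card (grp j))) ^ card (grp j) * exp (- (1/2) * lam k * gnorm grp b j k))" for b
  have hm: "h \<in> borel_measurable (PiM (coords grp S) (\<lambda>_. lborel))"
    using glap_measurable[OF S, of "\<lambda>k. lam k"] unfolding h_def[abs_def]
  proof -
    show "(\<lambda>b. \<Prod>(j, k)\<in>S. (lam k / a_const (card (grp j))) ^ card (grp j) * exp (- (1/2) * lam k * gnorm grp b j k)) \<in> borel_measurable (PiM (coords grp S) (\<lambda>_. lborel))"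
    proof (rule borel_measurable_prod)
      fix t assume t: "t \<in> S"
      have [measurable]: "(\<lambda>b :: rmat. \<Sum>c\<in>bnd grp (fst t, snd t). (b c)\<^sup>2) \<in> borel_measurable (PiM (coords grp S) (\<lambda>_. lborel))"
        using t by (intro borel_measurable_sum borel_measurable_power component_borel) (auto simp: coords_bnd)
      show "(\<lambda>b. case t of (j, k) \<Rightarrow> (lam k / a_const (card (grp j))) ^ card (grp j) * exp (- (1/2) * lam k * gnorm grp b j k)) \<in> borel_measurable (PiM (coords grp S) (\<lambda>_. lborel))"
        unfolding case_prod_beta' gnorm_bnd by measurable
    qed
  qed
  have pt: "ennreal (glap_dens grp lam S b) * indicator A (ext S b) \<le> ennreal (exp (- t / 2)) * ennreal (h b)" for b
  proof (cases "ext S b \<in> A")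
    case True
    have "gsupp G d grp (ext S b) \<subseteq> S"
    proof
      fix x assume "x \<in> gsupp G d grp (ext S b)"
      then obtain j k l where x: "x = (j,k)" "j < G" "k < d" "l \<in> grp j" "ext S b (l,k) \<noteq> 0" by (auto simp: gsupp_def)
      have "l < p" using grp_sub[OF x(2)] x(4) by auto
      then have "(l,k) \<in> coords grp S" using x by (auto simp: ext_def split: if_splits)
      then obtain j' where j': "(j',k) \<in> S" "l \<in> grp j'" by (auto simp: coords_def)
      moreover have "j' < G" using j'(1) S by auto
      ultimately have "j' = j" using grp_disj[of j' j] x(2,4) by blast
      then show "x \<in> S" using j' x by simp
    qed
    from A(2)[OF True this] obtain j k where jk: "(j,k) \<in> S" "t < lam k * gnorm grp (ext S b) j k" by auto
    then have jk2: "t < lam k * gnorm grp b j k" using gnorm_ext[OF S] by simp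
    have "t < (\<Sum>(j,k)\<in>S. lam k * gnorm grp b j k)"
    proof (rule less_le_trans[OF jk2])
      show "lam k * gnorm grp b j k \<le> (\<Sum>(j,k)\<in>S. lam k * gnorm grp b j k)"
      proof -
        have "0 \<le> (case x of (j,k) \<Rightarrow> lam k * gnorm grp b j k)" if "x \<in> S" for x
          using that S lam[of "snd x"] gnorm_nonneg[of grp b "fst x" "snd x"] by (cases x) auto
        then show ?thesis using member_le_sum[of "(j,k)" S "\<lambda>(j,k). lam k * gnorm grp b j k"] f jk(1) by simp
      qed
    qed
    then have e: "exp (- (\<Sum>(j,k)\<in>S. lam k * gnorm grp b j k) / 2) \<le> exp (- t / 2)" by simp
    have "glap_dens grp lam S b = h b * exp (- (\<Sum>(j,k)\<in>S. lam k * gnorm grp b j k) / 2)"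
    proof -
      have "exp (- (\<Sum>(j,k)\<in>S. lam k * gnorm grp b j k) / 2) = (\<Prod>(j,k)\<in>S. exp (- (1/2) * lam k * gnorm grp b j k))"
        using f by (simp add: exp_sum[symmetric] sum_negf sum_divide_distrib case_prod_beta')
      then show ?thesis unfolding glap_dens_def h_def
        by (simp add: prod.distrib[symmetric] case_prod_beta' mult.assoc exp_add[symmetric])
    qed
    also have "\<dots> \<le> h b * exp (- t / 2)"
    proof (rule mult_left_mono[OF e])
      show "0 \<le> h b" unfolding h_def
      proof (rule prod_nonneg)
        fix x assume x: "x \<in> S"
        have "0 \<le> lam (snd x)" "0 < a_const (card (grp (fst x)))" using x S lam ap by auto
        then show "0 \<le> (case x of (j,k) \<Rightarrow> (lam k / a_const (card (grp j))) ^ card (grp j) * exp (- (1/2) * lam k * gnorm grp b j k))"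
          by (cases x) (simp add: less_imp_le)
      qed
    qed
    finally have "glap_dens grp lam S b \<le> exp (- t / 2) * h b" by (simp add: mult.commute)
    then show ?thesis using True by (simp add: ennreal_mult'[symmetric] ennreal_leI)
  qed simp
  have "emeasure (beta_given_S p d grp lam S) A \<le> (\<integral>\<^sup>+ b. ennreal (exp (- t / 2)) * ennreal (h b) \<partial>PiM (coords grp S) (\<lambda>_. lborel))"
    unfolding emeasure_beta_given_S[OF S A(1)] by (intro nn_integral_mono pt)
  also have "\<dots> = ennreal (exp (- t / 2)) * (\<integral>\<^sup>+ b. ennreal (h b) \<partial>PiM (coords grp S) (\<lambda>_. lborel))"
    using hm by (intro nn_integral_cmult) simp
  also have "\<dots> \<le> ennreal (exp (- t / 2)) * ennreal (2 ^ card (coords grp S))"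
    using glap_integral_le[OF S lam, where w = "1/2"] unfolding h_def by (intro mult_left_mono) auto
  also have "\<dots> = ennreal (exp (- t / 2) * 2 ^ card (coords grp S))" by (simp add: ennreal_mult)
  finally show ?thesis .
qed

lemma beta_given_S_lower:
  assumes S: "S \<subseteq> II" and A: "A \<in> sets (mspace {0..<p} {0..<d})"
    and box: "\<And>b. (\<And>c. c \<in> coords grp S \<Longrightarrow> \<bar>b c - \<beta>0 c\<bar> \<le> r) \<Longrightarrow> ext S b \<in> A"
    and lam: "\<And>k. k < d \<Longrightarrow> 0 \<le> lam k" and r: "r > 0"
    and low: "\<And>b. (\<And>c. c \<in> coords grp S \<Longrightarrow> \<bar>b c - \<beta>0 c\<bar> \<le> r) \<Longrightarrow> lb \<le> glap_dens grp lam S b" "lb \<ge> 0"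
  shows "ennreal (lb * (2 * r) ^ card (coords grp S)) \<le> emeasure (beta_given_S p d grp lam S) A"
proof -
  interpret product_sigma_finite "\<lambda>_. lborel :: real measure" by standard
  define Bx where "Bx = PiE (coords grp S) (\<lambda>c. {\<beta>0 c - r..\<beta>0 c + r})"
  have Bs: "Bx \<in> sets (PiM (coords grp S) (\<lambda>_. lborel))"
    unfolding Bx_def using coords_fin[OF S] by (intro sets_PiM_I_finite) auto
  have "emeasure (PiM (coords grp S) (\<lambda>_. lborel)) Bx = (\<Prod>c\<in>coords grp S. emeasure lborel {\<beta>0 c - r..\<beta>0 c + r})"
    unfolding Bx_def using coords_fin[OF S] by (intro emeasure_PiM) auto
  also have "\<dots> = ennreal ((2 * r) ^ card (coords grp S))" using r by (simp add: ennreal_power)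
  finally have v: "emeasure (PiM (coords grp S) (\<lambda>_. lborel)) Bx = ennreal ((2 * r) ^ card (coords grp S))" .
  have "ennreal (lb * (2 * r) ^ card (coords grp S)) = ennreal lb * emeasure (PiM (coords grp S) (\<lambda>_. lborel)) Bx"
    using low(2) r by (simp add: v ennreal_mult)
  also have "\<dots> = (\<integral>\<^sup>+ b. ennreal lb * indicator Bx b \<partial>PiM (coords grp S) (\<lambda>_. lborel))"
    using Bs by (simp add: nn_integral_cmult_indicator)
  also have "\<dots> \<le> emeasure (beta_given_S p d grp lam S) A"
    unfolding emeasure_beta_given_S[OF S A]
  proof (rule nn_integral_mono)
    fix b
    show "ennreal lb * indicator Bx b \<le> ennreal (glap_dens grp lam S b) * indicator A (ext S b)"
    proof (cases "b \<in> Bx")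
      case True
      then have "\<bar>b c - \<beta>0 c\<bar> \<le> r" if "c \<in> coords grp S" for c using that by (auto simp: Bx_def PiE_iff abs_le_iff)
      then show ?thesis using True box low(1) by (simp add: ennreal_leI)
    qed simp
  qed
  finally show ?thesis .
qed

end

text \<open>The kernel need not be a subprobability off the support of \<open>M\<close>; those arguments form a null set
  and do not contribute to \<open>bind\<close>.\<close>

lemma emeasure_bind_support:
  fixes M :: "'a pmf" and f :: "'a \<Rightarrow> 'b measure"
  assumes sub: "\<And>x. x \<in> set_pmf M \<Longrightarrow> subprob_space (f x)" and sets: "\<And>x. sets (f x) = sets N"
    and N: "space N \<noteq> {}" and A: "A \<in> sets N"
  shows "emeasure (measure_pmf M \<bind> f) A = (\<integral>\<^sup>+ x. emeasure (f x) A \<partial>measure_pmf M)"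
    "sets (measure_pmf M \<bind> f) = sets N"
proof -
  define f' where "f' x = (if x \<in> set_pmf M then f x else null_measure N)" for x
  have sets': "sets (f' x) = sets N" for x by (simp add: f'_def sets)
  have sub': "subprob_space (f' x)" for x
    using sub N by (auto simp: f'_def intro!: subprob_spaceI)
  have alg: "subprob_algebra (f x) = subprob_algebra N" "subprob_algebra (f' y) = subprob_algebra N" for x y
    by (rule subprob_algebra_cong, rule sets, rule subprob_algebra_cong, rule sets')
  have "distr (measure_pmf M) (subprob_algebra N) f = distr (measure_pmf M) (subprob_algebra N) f'"
    unfolding distr_def
  proof (rule measure_of_eq)
    fix B
    have "AE x in measure_pmf M. (x \<in> f -` B \<inter> space (measure_pmf M)) = (x \<in> f' -` B \<inter> space (measure_pmf M))"
      by (auto simp: AE_measure_pmf_iff f'_def)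
    then show "emeasure (measure_pmf M) (f -` B \<inter> space (measure_pmf M)) = emeasure (measure_pmf M) (f' -` B \<inter> space (measure_pmf M))"
      by (rule emeasure_eq_AE) auto
  qed (rule sets.space_closed)
  then have eq: "measure_pmf M \<bind> f = measure_pmf M \<bind> f'"
    unfolding bind_def alg by simp
  have m: "f' \<in> measurable (measure_pmf M) (subprob_algebra N)"
    using sub' sets' by (auto simp: measurable_def space_subprob_algebra)
  have "emeasure (measure_pmf M \<bind> f) A = (\<integral>\<^sup>+ x. emeasure (f' x) A \<partial>measure_pmf M)"
    unfolding eq by (rule emeasure_bind[OF _ m A]) simp
  also have "\<dots> = (\<integral>\<^sup>+ x. emeasure (f x) A \<partial>measure_pmf M)"
    by (rule nn_integral_cong_AE) (auto simp: AE_measure_pmf_iff f'_def)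
  finally show "emeasure (measure_pmf M \<bind> f) A = (\<integral>\<^sup>+ x. emeasure (f x) A \<partial>measure_pmf M)" .
  show "sets (measure_pmf M \<bind> f) = sets N" unfolding eq by (rule sets_bind[OF sets']) simp
qed

text \<open>The subtracted term makes the induction close: \<rho> \<le> 1/2 gives \<rho>^m \<le> 2
  \<rho>^m - 2 \<rho>^(m+1).\<close>

lemma geometric_tail:
  fixes \<rho> :: real assumes "0 \<le> \<rho>" "\<rho> \<le> 1/2" "a \<le> m"
  shows "(\<Sum>s\<in>{a..<m}. \<rho> ^ s) \<le> 2 * \<rho> ^ a - 2 * \<rho> ^ m"
  using assms(3)
proof (induction m rule: dec_induct)
  case (step m)
  have "\<rho> * \<rho> ^ m \<le> 1/2 * \<rho> ^ m" using assms by (intro mult_right_mono) auto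
  then show ?case using step by simp
qed simp

section \<open>The prior on the model dimension\<close>

locale dim_prior =
  fixes N :: nat and pr :: "nat pmf" and lo \<rho> :: real
  assumes supp: "set_pmf pr \<subseteq> {0..N}"
    and ratio: "\<And>s. s \<in> {1..N} \<Longrightarrow> lo \<le> pmf pr s / pmf pr (s - 1) \<and> pmf pr s / pmf pr (s - 1) \<le> \<rho>"
    and lo: "0 < lo" and rho: "0 \<le> \<rho>" "\<rho> \<le> 1/2"
begin

text \<open>The lower bound \<open>lo\<close> makes the quotient positive, which rules out a
  vanishing denominator; the quotients may then be cleared.\<close>

lemma pmf_step:
  assumes "Suc s \<le> N"
  shows "pmf pr (Suc s) \<le> \<rho> * pmf pr s" "lo * pmf pr s \<le> pmf pr (Suc s)"
proof -
  have r: "lo \<le> pmf pr (Suc s) / pmf pr s" "pmf pr (Suc s) / pmf pr s \<le> \<rho>"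
    using ratio[of "Suc s"] assms by auto
  then have "0 < pmf pr (Suc s) / pmf pr s" using lo by linarith
  then have "0 < pmf pr s" by (simp add: zero_less_divide_iff)
  then show "pmf pr (Suc s) \<le> \<rho> * pmf pr s" "lo * pmf pr s \<le> pmf pr (Suc s)"
    using r by (simp_all add: field_simps)
qed

lemma pmf_le: "s \<le> N \<Longrightarrow> pmf pr s \<le> \<rho> ^ s * pmf pr 0"
proof (induction s)
  case (Suc s)
  then have "pmf pr (Suc s) \<le> \<rho> * (\<rho> ^ s * pmf pr 0)"
    using pmf_step(1)[of s] rho mult_left_mono[of "pmf pr s" "\<rho> ^ s * pmf pr 0" \<rho>] by simp
  then show ?case by simp
qed simp

lemma pmf_ge: "s \<le> N \<Longrightarrow> lo ^ s * pmf pr 0 \<le> pmf pr s"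
proof (induction s)
  case (Suc s)
  then have "lo * (lo ^ s * pmf pr 0) \<le> lo * pmf pr s" using lo by (intro mult_left_mono) auto
  also have "\<dots> \<le> pmf pr (Suc s)" using pmf_step(2)[OF Suc.prems] .
  finally have "lo * (lo ^ s * pmf pr 0) \<le> pmf pr (Suc s)" .
  then show ?case by simp
qed simp

text \<open>The masses are dominated by a geometric sequence starting at \<open>pmf pr 0\<close>
  whose ratio is at most 1/2, and they sum to 1.\<close>

lemma pmf_0_ge: "1 / 2 \<le> pmf pr 0"
proof -
  have "1 = (\<Sum>s\<in>{0..N}. pmf pr s)" using supp by (simp add: sum_pmf_eq_1)
  also have "\<dots> \<le> (\<Sum>s\<in>{0..N}. \<rho> ^ s * pmf pr 0)" by (intro sum_mono pmf_le) auto
  also have "\<dots> = (\<Sum>s\<in>{0..<Suc N}. \<rho> ^ s) * pmf pr 0" by (simp add: sum_distrib_right atLeastLessThanSuc_atLeastAtMost)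
  also have "\<dots> \<le> 2 * pmf pr 0"
  proof (rule mult_right_mono)
    show "(\<Sum>s\<in>{0..<Suc N}. \<rho> ^ s) \<le> 2"
      using geometric_tail[OF rho, of 0 "Suc N"] zero_le_power[OF rho(1), of "Suc N"] by (simp del: power_Suc sum.op_ivl_Suc)
  qed simp
  finally show ?thesis by simp
qed

lemma pmf_ge':
  assumes "s \<le> N" shows "lo ^ s / 2 \<le> pmf pr s"
proof -
  have "lo ^ s / 2 = lo ^ s * (1 / 2)" by simp
  also have "\<dots> \<le> lo ^ s * pmf pr 0" using lo by (intro mult_left_mono pmf_0_ge) auto
  also have "\<dots> \<le> pmf pr s" by (rule pmf_ge[OF assms])
  finally show ?thesis .
qed

lemma dim_tail: "emeasure (measure_pmf pr) {s. s1 < s} \<le> ennreal (2 * \<rho> ^ Suc s1)"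
proof -
  have "emeasure (measure_pmf pr) {s. s1 < s} = emeasure (measure_pmf pr) {Suc s1..N}"
    by (rule emeasure_eq_AE) (use supp in \<open>auto simp: AE_measure_pmf_iff\<close>)
  also have "\<dots> = ennreal (\<Sum>s\<in>{Suc s1..N}. pmf pr s)"
    by (simp add: emeasure_measure_pmf_finite)
  also have "\<dots> \<le> ennreal (2 * \<rho> ^ Suc s1)"
  proof (rule ennreal_leI)
    have "(\<Sum>s\<in>{Suc s1..N}. pmf pr s) \<le> (\<Sum>s\<in>{Suc s1..N}. \<rho> ^ s * 1)"
    proof (rule sum_mono)
      fix s assume "s \<in> {Suc s1..N}"
      then have "pmf pr s \<le> \<rho> ^ s * pmf pr 0" by (intro pmf_le) auto
      also have "\<dots> \<le> \<rho> ^ s * 1" using rho by (intro mult_left_mono pmf_le_1) auto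
      finally show "pmf pr s \<le> \<rho> ^ s * 1" .
    qed
    also have "\<dots> = (\<Sum>s\<in>{Suc s1..<Suc N}. \<rho> ^ s)" by (simp add: atLeastLessThanSuc_atLeastAtMost)
    also have "\<dots> \<le> 2 * \<rho> ^ Suc s1"
    proof (cases "Suc s1 \<le> Suc N")
      case True
      then show ?thesis using geometric_tail[OF rho True] zero_le_power[OF rho(1), of "Suc N"] by linarith
    next
      case False
      then have "{Suc s1..<Suc N} = {}" by auto
      then show ?thesis using rho by (simp del: power_Suc)
    qed
    finally show "(\<Sum>s\<in>{Suc s1..N}. pmf pr s) \<le> 2 * \<rho> ^ Suc s1" .
  qed
  finally show ?thesis .
qed

end

lemma space_mspace_ne: "space (mspace R C) \<noteq> {}"
  unfolding mspace_def space_PiM by (auto simp: PiE_eq_empty_iff)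

section \<open>The mixture over supports\<close>

context groups
begin

definition models :: "nat \<Rightarrow> (nat \<times> nat) set set" where
  "models s = {S. S \<subseteq> II \<and> card S = s}"

lemma models_props:
  assumes "s \<le> G * d" shows "finite (models s)" "models s \<noteq> {}" "card (models s) = (G * d) choose s"
proof -
  have "finite (Pow II)" by simp
  then show "finite (models s)" by (rule rev_finite_subset) (auto simp: models_def)
  show "models s \<noteq> {}"
    using obtain_subset_with_card_n[of s II] assms by (auto simp: models_def)
  show "card (models s) = (G * d) choose s"
    using n_subsets[of II s] by (simp add: models_def)
qed

lemma supp_pmf_models: "supp_pmf pr G d = bind_pmf pr (\<lambda>s. pmf_of_set (models s))"
  by (simp add: supp_pmf_def models_def)

lemma set_supp_pmf:
  assumes "set_pmf pr \<subseteq> {0..G * d}"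
  shows "set_pmf (supp_pmf pr G d) \<subseteq> Pow II"
proof
  fix S assume "S \<in> set_pmf (supp_pmf pr G d)"
  then obtain s where s: "s \<in> set_pmf pr" "S \<in> set_pmf (pmf_of_set (models s))" by (auto simp: supp_pmf_models)
  then have "s \<le> G * d" using assms by auto
  then show "S \<in> Pow II" using s models_props[of s] by (auto simp: set_pmf_of_set models_def)
qed

lemma emeasure_prior_beta:
  assumes "set_pmf pr \<subseteq> {0..G * d}" and lam: "\<And>k. k < d \<Longrightarrow> 0 \<le> lam k" and A: "A \<in> sets (mspace {0..<p} {0..<d})"
  shows "emeasure (prior_beta pr G p d grp lam) A = (\<integral>\<^sup>+ S. emeasure (beta_given_S p d grp lam S) A \<partial>supp_pmf pr G d)"
    "sets (prior_beta pr G p d grp lam) = sets (mspace {0..<p} {0..<d})"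
proof -
  have sub: "subprob_space (beta_given_S p d grp lam S)" if "S \<in> set_pmf (supp_pmf pr G d)" for S
  proof (rule subprob_spaceI)
    have "S \<subseteq> II" using set_supp_pmf[OF assms(1)] that by auto
    then show "emeasure (beta_given_S p d grp lam S) (space (beta_given_S p d grp lam S)) \<le> 1"
      using beta_given_S_le_1[OF _ lam, of S] by simp
  qed (simp add: space_mspace_ne)
  show "emeasure (prior_beta pr G p d grp lam) A = (\<integral>\<^sup>+ S. emeasure (beta_given_S p d grp lam S) A \<partial>supp_pmf pr G d)"
    "sets (prior_beta pr G p d grp lam) = sets (mspace {0..<p} {0..<d})"
    unfolding prior_beta_def
    by (rule emeasure_bind_support[OF sub sets_beta_given_S space_mspace_ne A], assumption)
      (rule emeasure_bind_support[OF sub sets_beta_given_S space_mspace_ne A], assumption)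
qed

text \<open>Conditionally on the support every slab has mass at most 1, so supports larger than
  \<open>s1\<close> contribute at most their own prior probability; for the others the assumed bound
  \<tau> is averaged.\<close>

lemma prior_beta_tail:
  assumes "set_pmf pr \<subseteq> {0..G * d}" and lam: "\<And>k. k < d \<Longrightarrow> 0 \<le> lam k" and A: "A \<in> sets (mspace {0..<p} {0..<d})"
    and small: "\<And>S. S \<subseteq> II \<Longrightarrow> card S \<le> s1 \<Longrightarrow> emeasure (beta_given_S p d grp lam S) A \<le> \<tau>"
  shows "emeasure (prior_beta pr G p d grp lam) A \<le> emeasure (measure_pmf pr) {s. s1 < s} + \<tau>"
proof -
  have e: "emeasure (prior_beta pr G p d grp lam) A = (\<integral>\<^sup>+ S. emeasure (beta_given_S p d grp lam S) A \<partial>supp_pmf pr G d)"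
    by (rule emeasure_prior_beta(1)[OF assms(1) lam A])
  have "emeasure (prior_beta pr G p d grp lam) A \<le> (\<integral>\<^sup>+ S. indicator {S. s1 < card S} S + \<tau> \<partial>supp_pmf pr G d)"
    unfolding e
  proof (rule nn_integral_mono_AE, rule AE_pmfI)
    fix S assume "S \<in> set_pmf (supp_pmf pr G d)"
    then have S: "S \<subseteq> II" using set_supp_pmf[OF assms(1)] by auto
    show "emeasure (beta_given_S p d grp lam S) A \<le> indicator {S. s1 < card S} S + \<tau>"
    proof (cases "card S \<le> s1")
      case True then show ?thesis using small[OF S] by simp
    next
      case False
      have "emeasure (beta_given_S p d grp lam S) A \<le> emeasure (beta_given_S p d grp lam S) (space (mspace {0..<p} {0..<d}))"
        using A sets.sets_into_space by (intro emeasure_mono) auto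
      also have "\<dots> \<le> 1" by (rule beta_given_S_le_1[OF S lam])
      also have "\<dots> \<le> 1 + \<tau>" by simp
      finally show ?thesis using False by simp
    qed
  qed
  also have "\<dots> = emeasure (measure_pmf (supp_pmf pr G d)) {S. s1 < card S} + \<tau>"
    by (simp add: nn_integral_add)
  also have "emeasure (measure_pmf (supp_pmf pr G d)) {S. s1 < card S} = (\<integral>\<^sup>+ s. emeasure (measure_pmf (pmf_of_set (models s))) {S. s1 < card S} \<partial>pr)"
    unfolding supp_pmf_models by (rule emeasure_bind_pmf)
  also have "\<dots> \<le> (\<integral>\<^sup>+ s. indicator {s. s1 < s} s \<partial>pr)"
  proof (rule nn_integral_mono_AE, rule AE_pmfI)
    fix s assume "s \<in> set_pmf pr"
    then have s: "s \<le> G * d" using assms(1) by auto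
    show "emeasure (measure_pmf (pmf_of_set (models s))) {S. s1 < card S} \<le> indicator {s. s1 < s} s"
    proof (cases "s1 < s")
      case True then show ?thesis by (simp add: measure_pmf.emeasure_le_1)
    next
      case False
      then have "AE S in measure_pmf (pmf_of_set (models s)). S \<notin> {S. s1 < card S}"
        using models_props[OF s] by (auto simp: AE_measure_pmf_iff set_pmf_of_set models_def)
      then have "emeasure (measure_pmf (pmf_of_set (models s))) {S. s1 < card S} = 0"
        using emeasure_eq_0_AE[of "\<lambda>S. s1 < card S" "measure_pmf (pmf_of_set (models s))"] by simp
      then show ?thesis by simp
    qed
  qed
  also have "\<dots> = emeasure (measure_pmf pr) {s. s1 < s}" by simp
  finally show ?thesis by simp
qed

lemma prior_beta_le_1:
  assumes "set_pmf pr \<subseteq> {0..G * d}" and lam: "\<And>k. k < d \<Longrightarrow> 0 \<le> lam k"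
  shows "emeasure (prior_beta pr G p d grp lam) (space (prior_beta pr G p d grp lam)) \<le> 1"
proof -
  have e: "emeasure (prior_beta pr G p d grp lam) (space (mspace {0..<p} {0..<d})) = (\<integral>\<^sup>+ S. emeasure (beta_given_S p d grp lam S) (space (mspace {0..<p} {0..<d})) \<partial>supp_pmf pr G d)"
    "sets (prior_beta pr G p d grp lam) = sets (mspace {0..<p} {0..<d})"
    by (rule emeasure_prior_beta[OF assms(1) lam sets.top], assumption)+
  have "emeasure (prior_beta pr G p d grp lam) (space (mspace {0..<p} {0..<d})) \<le> (\<integral>\<^sup>+ S. 1 \<partial>supp_pmf pr G d)"
    unfolding e(1)
  proof (rule nn_integral_mono_AE, rule AE_pmfI)
    fix S assume "S \<in> set_pmf (supp_pmf pr G d)"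
    then have S: "S \<subseteq> II" using set_supp_pmf[OF assms(1)] by auto
    show "emeasure (beta_given_S p d grp lam S) (space (mspace {0..<p} {0..<d})) \<le> 1" by (rule beta_given_S_le_1[OF S lam])
  qed
  then show ?thesis using sets_eq_imp_space_eq[OF e(2)] by simp
qed

text \<open>A single support is kept from the mixture. Its probability is that of its size divided
  by the number of supports of this size.\<close>

lemma prior_beta_lower:
  assumes "set_pmf pr \<subseteq> {0..G * d}" and lam: "\<And>k. k < d \<Longrightarrow> 0 \<le> lam k" and A: "A \<in> sets (mspace {0..<p} {0..<d})"
    and S: "S \<subseteq> II" "card S = s"
  shows "ennreal (pmf pr s / real ((G * d) choose s)) * emeasure (beta_given_S p d grp lam S) A \<le> emeasure (prior_beta pr G p d grp lam) A"
proof -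
  have s: "s \<le> G * d" using card_mono[OF _ S(1)] S(2) by simp
  have "ennreal (pmf pr s / real ((G * d) choose s)) = ennreal (pmf pr s) * ennreal (pmf (pmf_of_set (models s)) S)"
    using models_props[OF s] S by (simp add: pmf_of_set indicator_def models_def[of s] ennreal_mult[symmetric])
  also have "\<dots> = (\<integral>\<^sup>+ t. ennreal (pmf (pmf_of_set (models s)) S) * indicator {s} t \<partial>pr)"
    by (subst nn_integral_cmult_indicator) (simp_all add: emeasure_pmf_single mult.commute)
  also have "\<dots> \<le> (\<integral>\<^sup>+ t. ennreal (pmf (pmf_of_set (models t)) S) \<partial>pr)"
    by (intro nn_integral_mono) (auto split: split_indicator)
  also have "\<dots> = ennreal (pmf (supp_pmf pr G d) S)" unfolding supp_pmf_models by (rule ennreal_pmf_bind[symmetric])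
  finally have 1: "ennreal (pmf pr s / real ((G * d) choose s)) \<le> ennreal (pmf (supp_pmf pr G d) S)" .
  have "ennreal (pmf (supp_pmf pr G d) S) * emeasure (beta_given_S p d grp lam S) A
    = (\<integral>\<^sup>+ T. emeasure (beta_given_S p d grp lam S) A * indicator {S} T \<partial>supp_pmf pr G d)"
    by (subst nn_integral_cmult_indicator) (simp_all add: emeasure_pmf_single mult.commute)
  also have "\<dots> \<le> (\<integral>\<^sup>+ T. emeasure (beta_given_S p d grp lam T) A \<partial>supp_pmf pr G d)"
    by (intro nn_integral_mono) (auto split: split_indicator)
  also have "\<dots> = emeasure (prior_beta pr G p d grp lam) A" by (rule emeasure_prior_beta(1)[OF assms(1) lam A, symmetric])
  finally show ?thesis using mult_right_mono[OF 1, of "emeasure (beta_given_S p d grp lam S) A"] by (meson order_trans zero_le)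
qed

end

section \<open>The design norm and the prediction error\<close>

lemma L2_set_sum_le: "L2_set (\<lambda>i. \<Sum>j\<in>J. f j i) A \<le> (\<Sum>j\<in>J. L2_set (f j) A)"
proof (induction J rule: infinite_finite_induct)
  case (insert j J)
  have "L2_set (\<lambda>i. \<Sum>j\<in>insert j J. f j i) A = L2_set (\<lambda>i. f j i + (\<Sum>j\<in>J. f j i)) A" using insert.hyps by simp
  also have "\<dots> \<le> L2_set (f j) A + L2_set (\<lambda>i. \<Sum>j\<in>J. f j i) A" by (rule L2_set_triangle_ineq)
  finally show ?case using insert by simp
qed (simp_all add: L2_set_def)

text \<open>\<open>spec_norm\<close> is a real supremum, so it is informative only once the set is
  shown bounded and nonempty: Cauchy-Schwarz bounds it by the Frobenius norm, and a coordinate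
  vector is a member. General v are reached by scaling to unit length.\<close>

lemma spec_norm_bound:
  fixes A :: rmat
  assumes C: "finite C" "C \<noteq> {}"
  shows "sqrt (\<Sum>i\<in>R. (\<Sum>l\<in>C. A (i,l) * v l)\<^sup>2) \<le> spec_norm R C A * sqrt (\<Sum>l\<in>C. (v l)\<^sup>2)" "0 \<le> spec_norm R C A"
proof -
  define T where "T = {sqrt (\<Sum>i\<in>R. (\<Sum>l\<in>C. A (i,l) * v l)\<^sup>2) | v. (\<Sum>l\<in>C. (v l)\<^sup>2) = 1}"
  have "x \<le> sqrt (\<Sum>i\<in>R. \<Sum>l\<in>C. (A (i,l))\<^sup>2)" if x: "x \<in> T" for x
  proof -
    obtain v where v: "(\<Sum>l\<in>C. (v l)\<^sup>2) = 1" "x = sqrt (\<Sum>i\<in>R. (\<Sum>l\<in>C. A (i,l) * v l)\<^sup>2)" using x by (auto simp: T_def)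
    have "(\<Sum>l\<in>C. A (i,l) * v l)\<^sup>2 \<le> (\<Sum>l\<in>C. (A (i,l))\<^sup>2)" for i
      using Cauchy_Schwarz_ineq_sum[of "\<lambda>l. A (i,l)" v C] v(1) by simp
    then show ?thesis unfolding v(2) by (intro real_sqrt_le_mono sum_mono)
  qed
  then have bdd: "bdd_above T" by (auto simp: bdd_above_def)
  obtain l0 where l0: "l0 \<in> C" using C by auto
  have "sqrt (\<Sum>i\<in>R. (\<Sum>l\<in>C. A (i,l) * (if l = l0 then 1 else 0))\<^sup>2) \<in> T"
    unfolding T_def using C l0 by (auto simp: if_distrib[of "\<lambda>x. x\<^sup>2"] cong: if_cong intro!: exI[of _ "\<lambda>l. if l = l0 then 1 else 0"])
  from cSup_upper[OF this bdd] show nn: "0 \<le> spec_norm R C A"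
    unfolding spec_norm_def T_def[symmetric] by (rule order_trans[rotated]) (simp add: sum_nonneg)
  define w where "w = sqrt (\<Sum>l\<in>C. (v l)\<^sup>2)"
  show "sqrt (\<Sum>i\<in>R. (\<Sum>l\<in>C. A (i,l) * v l)\<^sup>2) \<le> spec_norm R C A * sqrt (\<Sum>l\<in>C. (v l)\<^sup>2)"
  proof (cases "w = 0")
    case True
    then have "\<forall>l\<in>C. v l = 0" using C(1) by (simp add: w_def sum_nonneg_eq_0_iff)
    then show ?thesis using nn by (simp add: sum_nonneg)
  next
    case False
    moreover have "w \<ge> 0" by (simp add: w_def sum_nonneg)
    ultimately have w: "w > 0" by simp
    have w2: "(\<Sum>l\<in>C. (v l)\<^sup>2) = w\<^sup>2" by (simp add: w_def sum_nonneg)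
    have "(\<Sum>l\<in>C. (v l / w)\<^sup>2) = 1" using w w2 by (simp add: power_divide sum_divide_distrib[symmetric])
    then have "sqrt (\<Sum>i\<in>R. (\<Sum>l\<in>C. A (i,l) * (v l / w))\<^sup>2) \<in> T"
      unfolding T_def by (intro CollectI exI[of _ "\<lambda>l. v l / w"] conjI refl)
    then have "sqrt (\<Sum>i\<in>R. (\<Sum>l\<in>C. A (i,l) * (v l / w))\<^sup>2) \<le> spec_norm R C A"
      unfolding spec_norm_def T_def[symmetric] by (rule cSup_upper[OF _ bdd])
    moreover have "sqrt (\<Sum>i\<in>R. (\<Sum>l\<in>C. A (i,l) * (v l / w))\<^sup>2) = sqrt (\<Sum>i\<in>R. (\<Sum>l\<in>C. A (i,l) * v l)\<^sup>2) / w"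
    proof -
      have "(\<Sum>i\<in>R. (\<Sum>l\<in>C. A (i,l) * (v l / w))\<^sup>2) = (\<Sum>i\<in>R. (\<Sum>l\<in>C. A (i,l) * v l)\<^sup>2) / w\<^sup>2"
        by (simp add: sum_divide_distrib[symmetric] power_divide)
      then show ?thesis using w by (simp add: real_sqrt_divide)
    qed
    ultimately have "sqrt (\<Sum>i\<in>R. (\<Sum>l\<in>C. A (i,l) * v l)\<^sup>2) / w \<le> spec_norm R C A" by (simp only:)
    then show ?thesis using w by (simp only: w_def[symmetric] pos_divide_le_eq)
  qed
qed

context groups
begin

definition gdist :: "rmat \<Rightarrow> rmat \<Rightarrow> real" where
  "gdist \<beta> \<beta>' = (\<Sum>k<d. \<Sum>j<G. gnorm grp (\<lambda>x. \<beta> x - \<beta>' x) j k)"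

lemma gdist_nonneg: "0 \<le> gdist \<beta> \<beta>'"
  by (simp add: gdist_def sum_nonneg gnorm_nonneg)

lemma circ_norm_ge: "j < G \<Longrightarrow> spec_norm {0..<n} (grp j) X \<le> circ_norm n G grp X"
  unfolding circ_norm_def by (intro Max_ge) auto

lemma circ_norm_nonneg: "G \<ge> 1 \<Longrightarrow> 0 \<le> circ_norm n G grp X"
  using circ_norm_ge[of 0 n X] spec_norm_bound(2)[OF grp_fin grp_ne, of 0 "{0..<n}" X] by simp

text \<open>Within a column the triangle inequality over groups applies, with the spectral norm of
  each group's submatrix. Over the columns the Euclidean norm is bounded by the sum. The constant is
  the norm that also scales the bounds on \<lambda>.\<close>

lemma xdist_le_gdist:
  assumes "G \<ge> 1"
  shows "xdist n p d X \<beta> \<beta>' \<le> (circ_norm n G grp X * gdist \<beta> \<beta>')\<^sup>2"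
proof -
  define c where "c = circ_norm n G grp X"
  define \<delta> where "\<delta> x = \<beta> x - \<beta>' x" for x
  define g where "g k = (\<Sum>j<G. gnorm grp \<delta> j k)" for k
  have g0: "g k \<ge> 0" for k by (simp add: g_def sum_nonneg gnorm_nonneg)
  have c0: "c \<ge> 0" unfolding c_def by (rule circ_norm_nonneg[OF assms])
  have col: "(\<Sum>i<n. (fit p X \<beta> i k - fit p X \<beta>' i k)\<^sup>2) \<le> (c * g k)\<^sup>2" for k
  proof -
    have f: "fit p X \<beta> i k - fit p X \<beta>' i k = (\<Sum>j<G. \<Sum>l\<in>grp j. X (i,l) * \<delta> (l,k))" for i
    proof -
      have "fit p X \<beta> i k - fit p X \<beta>' i k = (\<Sum>l\<in>(\<Union>j<G. grp j). X (i,l) * \<delta> (l,k))"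
        unfolding fit_def grp_cover \<delta>_def by (simp add: sum_subtractf[symmetric] right_diff_distrib atLeast0LessThan)
      also have "\<dots> = (\<Sum>j<G. \<Sum>l\<in>grp j. X (i,l) * \<delta> (l,k))"
        by (rule sum.UNION_disjoint) (use grp_fin grp_disj in auto)
      finally show ?thesis .
    qed
    have "sqrt (\<Sum>i<n. (fit p X \<beta> i k - fit p X \<beta>' i k)\<^sup>2) \<le> (\<Sum>j<G. L2_set (\<lambda>i. \<Sum>l\<in>grp j. X (i,l) * \<delta> (l,k)) {..<n})"
      unfolding f using L2_set_sum_le[of "\<lambda>j i. \<Sum>l\<in>grp j. X (i,l) * \<delta> (l,k)" "{..<G}" "{..<n}"] by (simp add: L2_set_def)
    also have "\<dots> \<le> (\<Sum>j<G. c * gnorm grp \<delta> j k)"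
    proof (rule sum_mono)
      fix j assume "j \<in> {..<G}"
      then have j: "j < G" by simp
      have "L2_set (\<lambda>i. \<Sum>l\<in>grp j. X (i,l) * \<delta> (l,k)) {..<n} \<le> spec_norm {0..<n} (grp j) X * gnorm grp \<delta> j k"
        using spec_norm_bound(1)[OF grp_fin[OF j] grp_ne[OF j], of X "\<lambda>l. \<delta> (l,k)" "{0..<n}"] by (simp add: L2_set_def gnorm_def atLeast0LessThan)
      also have "\<dots> \<le> c * gnorm grp \<delta> j k" unfolding c_def by (intro mult_right_mono circ_norm_ge[OF j] gnorm_nonneg)
      finally show "L2_set (\<lambda>i. \<Sum>l\<in>grp j. X (i,l) * \<delta> (l,k)) {..<n} \<le> c * gnorm grp \<delta> j k" .
    qed
    also have "\<dots> = c * g k" by (simp add: g_def sum_distrib_left)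
    finally show ?thesis by (simp add: sqrt_le_D)
  qed
  have "xdist n p d X \<beta> \<beta>' = (\<Sum>k<d. \<Sum>i<n. (fit p X \<beta> i k - fit p X \<beta>' i k)\<^sup>2)"
    unfolding xdist_fit sq_def by (rule sum.swap)
  also have "\<dots> \<le> (\<Sum>k<d. (c * g k)\<^sup>2)" by (intro sum_mono col)
  also have "\<dots> \<le> (\<Sum>k<d. c * g k)\<^sup>2"
  proof -
    have "L2_set (\<lambda>k. c * g k) {..<d} \<le> (\<Sum>k<d. c * g k)" by (rule L2_set_le_sum) (simp add: c0 g0)
    then show ?thesis unfolding L2_set_def by (rule sqrt_le_D)
  qed
  also have "(\<Sum>k<d. c * g k) = c * gdist \<beta> \<beta>'" by (simp add: gdist_def g_def \<delta>_def[abs_def] sum_distrib_left)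
  finally show ?thesis by (simp add: c_def)
qed

lemma gdist_le:
  assumes S: "S \<subseteq> II" and r: "\<And>x. x \<in> coords grp S \<Longrightarrow> \<bar>\<beta> x - \<beta>' x\<bar> \<le> r" "r \<ge> 0"
    and z: "\<And>x. x \<in> JJ \<Longrightarrow> x \<notin> coords grp S \<Longrightarrow> \<beta> x = \<beta>' x"
  shows "gdist \<beta> \<beta>' \<le> real (card (coords grp S)) * r"
proof -
  have f: "finite S" using S finite_subset by blast
  have g: "gnorm grp (\<lambda>x. \<beta> x - \<beta>' x) j k \<le> (if (j,k) \<in> S then real (card (grp j)) * r else 0)" if jk: "j < G" "k < d" for j k
  proof (cases "(j,k) \<in> S")
    case True
    have "gnorm grp (\<lambda>x. \<beta> x - \<beta>' x) j k \<le> (\<Sum>l\<in>grp j. \<bar>\<beta> (l,k) - \<beta>' (l,k)\<bar>)"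
      unfolding gnorm_def using L2_set_le_sum_abs[of "\<lambda>l. \<beta> (l,k) - \<beta>' (l,k)" "grp j"] by (simp add: L2_set_def)
    also have "\<dots> \<le> (\<Sum>l\<in>grp j. r)" using True by (intro sum_mono r(1)) (auto simp: coords_def)
    finally show ?thesis using True by simp
  next
    case False
    have "\<beta> (l,k) - \<beta>' (l,k) = 0" if l: "l \<in> grp j" for l
    proof -
      have "(l,k) \<notin> coords grp S"
      proof
        assume "(l,k) \<in> coords grp S"
        then obtain j' where j': "(j',k) \<in> S" "l \<in> grp j'" by (auto simp: coords_def)
        then have "j' < G" using S by auto
        then have "j' = j" using grp_disj[of j' j] jk l j' by blast
        then show False using False j' by simp
      qed
      moreover have "(l,k) \<in> JJ" using grp_sub[OF jk(1)] l jk by auto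
      ultimately show ?thesis using z by simp
    qed
    then show ?thesis using False by (simp add: gnorm_def)
  qed
  have "gdist \<beta> \<beta>' \<le> (\<Sum>k<d. \<Sum>j<G. if (j,k) \<in> S then real (card (grp j)) * r else 0)"
    unfolding gdist_def by (intro sum_mono g) auto
  also have "\<dots> = (\<Sum>j<G. \<Sum>k<d. if (j,k) \<in> S then real (card (grp j)) * r else 0)" by (rule sum.swap)
  also have "\<dots> = (\<Sum>x\<in>II. if x \<in> S then real (card (grp (fst x))) * r else 0)"
    by (simp add: sum.cartesian_product atLeast0LessThan case_prod_beta')
  also have "\<dots> = (\<Sum>x\<in>S. real (card (grp (fst x))) * r)"
    using S by (simp add: sum.inter_restrict[symmetric] Int_absorb1)
  also have "\<dots> = real (card (coords grp S)) * r"
    by (simp add: card_coords[OF S] sum_distrib_right case_prod_beta')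
  finally show ?thesis .
qed

end

section \<open>Prior mass near the truth\<close>

text \<open>One fixed sample size. The conditions \<open>n3\<close>, \<open>dn\<close>,
  \<open>pm_n\<close> and \<open>rho_half\<close> hold for all large n under the asymptotic
  assumptions. \<open>Lg\<close> is the logarithmic cost per active group in which all exponents for
  \<beta> are measured.\<close>

locale model = groups G p d grp for G p d :: nat and grp +
  fixes n s0 :: nat and X :: rmat and pr :: "nat pmf" and lam :: "nat \<Rightarrow> real" and H :: "rmat measure"
    and A1 A2 A3 A4 B1 B2 B3 :: real
  fixes L Lg circ :: real and pm :: nat
  defines "L \<equiv> ln (real n)" and "pm \<equiv> pmax G grp" and "Lg \<equiv> max (ln (real G)) (real (pmax G grp) * ln (real n))"
    and "circ \<equiv> circ_norm n G grp X"
  assumes cpos: "A1 > 0" "A2 > 0" "A3 > 0" "A4 > 0" "B1 > 0" "B2 > 0" "B3 > 0"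
    and d1: "1 \<le> d" and dn: "d \<le> n" and n3: "3 \<le> n" and G1: "1 \<le> G" and pm_n: "pm \<le> n"
    and supp: "set_pmf pr \<subseteq> {0..G * d}"
    and ratio: "\<And>s. s \<in> {1..G * d} \<Longrightarrow>
          A1 * max (real G) (real n ^ pm) powr (- A3) \<le> pmf pr s / pmf pr (s - 1) \<and>
          pmf pr s / pmf pr (s - 1) \<le> A2 * max (real G) (real n ^ pm) powr (- A4)"
    and lam: "\<And>k. k < d \<Longrightarrow> circ / (B1 * max (real G powr (1 / real pm)) (real n) powr B2) \<le> lam k \<and>
          lam k \<le> B3 * circ * sqrt Lg"
    and rho_half: "A2 * exp (- A4 * Lg) \<le> 1 / 2"
    and haar: "haar_orth d H"
begin

lemma L1: "1 \<le> L"
proof -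
  have "exp 1 \<le> real n" using exp_le n3 by linarith
  then show ?thesis unfolding L_def using n3 by (subst ln_ge_iff) auto
qed

lemma expL: "exp L = real n"
  using n3 by (simp add: L_def)

lemma card_grp_le_pm: "j < G \<Longrightarrow> card (grp j) \<le> pm"
  unfolding pm_def pmax_def by (intro Max_ge) auto

lemma pm1: "1 \<le> pm"
  using card_grp_le_pm[of 0] card_grp[of 0] G1 by simp

lemma Lg_ge: "ln (real G) \<le> Lg" "real pm * L \<le> Lg" "L \<le> Lg" "1 \<le> Lg" "real pm \<le> Lg"
proof -
  show "ln (real G) \<le> Lg" and a: "real pm * L \<le> Lg" by (auto simp: Lg_def pm_def L_def)
  have "1 * L \<le> real pm * L" using pm1 L1 by (intro mult_right_mono) auto
  then show "L \<le> Lg" using a by simp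
  then show "1 \<le> Lg" using L1 by simp
  have "real pm * 1 \<le> real pm * L" using L1 by (intro mult_left_mono) auto
  then show "real pm \<le> Lg" using a by simp
qed

lemma exp_Lg: "max (real G) (real n ^ pm) = exp Lg"
proof -
  have "real n ^ pm = exp (real pm * L)" using expL by (simp add: exp_of_nat_mult)
  moreover have "real G = exp (ln (real G))" using G1 by simp
  ultimately have "max (real G) (real n ^ pm) = max (exp (ln (real G))) (exp (real pm * L))" by simp
  also have "\<dots> = exp Lg" by (auto simp: Lg_def L_def pm_def max_def)
  finally show ?thesis .
qed

text \<open>The polynomial factor in the lower bound on \<lambda>, raised to a group size of at most
  \<open>pm\<close>, therefore costs at most \<open>exp (- B2 * Lg)\<close> per group.\<close>

lemma Lg_pm: "real pm * ln (max (real G powr (1 / real pm)) (real n)) = Lg"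
proof -
  have "ln (max (real G powr (1 / real pm)) (real n)) = max (ln (real G powr (1 / real pm))) (ln (real n))"
  proof -
    have "ln (max a b) = max (ln a) (ln b)" if "0 < a" "0 < b" for a b :: real
      using that by (auto simp: max_def)
    then show ?thesis using G1 n3 by simp
  qed
  also have "\<dots> = max (ln (real G) / real pm) L" using G1 by (simp add: ln_powr L_def)
  finally have "real pm * ln (max (real G powr (1 / real pm)) (real n)) = max (real pm * (ln (real G) / real pm)) (real pm * L)"
    by (simp add: max_mult_distrib_left)
  then show ?thesis using pm1 by (simp add: Lg_def pm_def L_def)
qed

lemma circ_nonneg: "0 \<le> circ"
  unfolding circ_def by (rule circ_norm_nonneg[OF G1])

lemma M_pos: "0 < max (real G powr (1 / real pm)) (real n)"
  using n3 by (simp add: less_max_iff_disj)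

lemma lam_nonneg: "k < d \<Longrightarrow> 0 \<le> lam k"
proof -
  assume k: "k < d"
  have "0 \<le> circ / (B1 * max (real G powr (1 / real pm)) (real n) powr B2)"
    using circ_nonneg cpos by (intro divide_nonneg_nonneg mult_nonneg_nonneg) auto
  then show ?thesis using lam[OF k] by linarith
qed

sublocale dim_prior "G * d" pr "A1 * exp (- A3 * Lg)" "A2 * exp (- A4 * Lg)"
proof
  fix s assume "s \<in> {1..G * d}"
  from ratio[OF this] show "A1 * exp (- A3 * Lg) \<le> pmf pr s / pmf pr (s - 1) \<and> pmf pr s / pmf pr (s - 1) \<le> A2 * exp (- A4 * Lg)"
    unfolding exp_Lg by (simp add: powr_def)
qed (use supp cpos rho_half in auto)

definition rate :: real where "rate = max (real s0 * Lg) ((real d)\<^sup>2 * L)"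

lemma rate_ge: "real s0 * Lg \<le> rate" "(real d)\<^sup>2 * L \<le> rate" "L \<le> rate" "1 \<le> rate" "real d \<le> rate" "real s0 * real pm \<le> rate"
proof -
  show "real s0 * Lg \<le> rate" and dL: "(real d)\<^sup>2 * L \<le> rate" by (auto simp: rate_def)
  have d: "1 \<le> (real d)\<^sup>2" "real d \<le> (real d)\<^sup>2" using d1 one_le_power[of "real d" 2] by (simp_all add: power2_eq_square)
  have "1 * L \<le> (real d)\<^sup>2 * L" using d L1 by (intro mult_right_mono) auto
  then show "L \<le> rate" using dL by simp
  then show "1 \<le> rate" using L1 by simp
  have "real d * 1 \<le> (real d)\<^sup>2 * L" using d L1 by (intro mult_mono) auto
  then show "real d \<le> rate" using dL by simp
  have "real s0 * real pm \<le> real s0 * Lg" using Lg_ge(5) by (intro mult_left_mono) auto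
  then show "real s0 * real pm \<le> rate" by (auto simp: rate_def)
qed

text \<open>Exponent of the prior mass near the true coefficients: \<bar>ln A1\<bar> + A3 + 2 for
  the probability of the support, with 2 for the binomial coefficient; 4 + ln (max 1 B1) + B2 + B3
  for the slab volume and the perturbation of its density; 1 for the size of the coefficients; and 1
  for the factor 1/2 in \<open>pmf_ge'\<close>.\<close>

definition C1 :: real where "C1 = 8 + \<bar>ln A1\<bar> + A3 + ln (max 1 B1) + B2 + B3"

lemma gnorm_triangle: "gnorm grp b j k \<le> gnorm grp b' j k + gnorm grp (\<lambda>x. b x - b' x) j k"
  using L2_set_triangle_ineq[of "\<lambda>l. b' (l,k)" "\<lambda>l. b (l,k) - b' (l,k)" "grp j"]
  by (simp add: gnorm_def L2_set_def)

text \<open>The support is fixed at the true one and the active coordinates vary in a box of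
  half-width \<open>r\<close>, small enough for a prediction error of at most n^(-4). Three costs
  arise, each of order \<open>s0 * Lg\<close>: the probability of the support, the volume of the box
  under the slab, and the decay of the slab density at the truth. The last is where the norm bound
  in \<open>B0_set\<close> enters, through \<open>wsum\<close>.\<close>

lemma prior_beta_near:
  assumes \<beta>0: "\<beta>0 \<in> B0_set n G p d grp lam s0" and rn: "rate \<le> real n"
  shows "\<exists>A\<in>sets (mspace {0..<p} {0..<d}). (\<forall>\<beta>\<in>A. xdist n p d X \<beta>0 \<beta> \<le> 1 / real n ^ 4) \<and>
    ennreal (exp (- C1 * rate)) \<le> emeasure (prior_beta pr G p d grp lam) A"
proof -
  define S where "S = gsupp G d grp \<beta>0"
  have S: "S \<subseteq> II" by (auto simp: S_def gsupp_def)
  have fS: "finite S" using S finite_subset by blast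
  have cS: "card S = s0" using \<beta>0 by (simp add: S_def B0_set_def)
  have s0: "s0 \<le> G * d" using card_mono[OF _ S] cS by simp
  have B: "(\<Sum>k<d. \<Sum>j<G. gnorm grp \<beta>0 j k) \<le> real s0 * Lg / Max (lam ` {0..<d})"
    using \<beta>0 by (simp add: B0_set_def Lg_def)
  have lmax: "lam k \<le> Max (lam ` {0..<d})" if "k < d" for k using that by (intro Max_ge) auto
  have lm0: "0 \<le> Max (lam ` {0..<d})" using order_trans[OF lam_nonneg[of 0] lmax[of 0]] d1 by simp
  have wsum: "(\<Sum>(j,k)\<in>S. lam k * gnorm grp \<beta>0 j k) \<le> real s0 * Lg"
  proof -
    have "(\<Sum>(j,k)\<in>S. lam k * gnorm grp \<beta>0 j k) \<le> (\<Sum>(j,k)\<in>II. lam k * gnorm grp \<beta>0 j k)"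
      using S lam_nonneg gnorm_nonneg by (intro sum_mono2) auto
    also have "\<dots> \<le> (\<Sum>(j,k)\<in>II. Max (lam ` {0..<d}) * gnorm grp \<beta>0 j k)"
      using lmax gnorm_nonneg by (intro sum_mono) (auto intro!: mult_right_mono)
    also have "\<dots> = Max (lam ` {0..<d}) * (\<Sum>j<G. \<Sum>k<d. gnorm grp \<beta>0 j k)"
      by (simp add: sum.cartesian_product[symmetric] sum_distrib_left atLeast0LessThan)
    also have "(\<Sum>j<G. \<Sum>k<d. gnorm grp \<beta>0 j k) = (\<Sum>k<d. \<Sum>j<G. gnorm grp \<beta>0 j k)" by (rule sum.swap)
    also have "Max (lam ` {0..<d}) * (\<Sum>k<d. \<Sum>j<G. gnorm grp \<beta>0 j k) \<le> Max (lam ` {0..<d}) * (real s0 * Lg / Max (lam ` {0..<d}))"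
      by (rule mult_left_mono[OF B lm0])
    also have "\<dots> \<le> real s0 * Lg" using Lg_ge(4) by (cases "Max (lam ` {0..<d}) = 0") auto
    finally show ?thesis .
  qed
  \<comment> \<open>If the design norm is 0, the upper bounds force all \<lambda> to vanish. The
    quotient in \<open>B0_set\<close> is then a division by zero, hence 0, so the true coefficients
    vanish on every group and the support is empty.\<close>
  have circ_pos: "0 < circ" if Sne: "S \<noteq> {}"
  proof (rule ccontr)
    assume "\<not> 0 < circ"
    then have c0: "circ = 0" using circ_nonneg by simp
    have z: "lam k = 0" if "k < d" for k using lam[OF that] c0 by simp
    have "lam ` {0..<d} = (\<lambda>_. 0) ` {0..<d}" by (intro image_cong refl z) simp
    also have "\<dots> = {0}" using d1 by (simp add: image_constant_conv)
    finally have "lam ` {0..<d} = {0}" .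
    then have "(\<Sum>k<d. \<Sum>j<G. gnorm grp \<beta>0 j k) \<le> 0" using B by simp
    then have z: "(\<Sum>k<d. \<Sum>j<G. gnorm grp \<beta>0 j k) = 0" by (intro antisym sum_nonneg gnorm_nonneg) auto
    obtain j k where jk: "(j,k) \<in> S" using Sne by fastforce
    then obtain l where l: "j < G" "k < d" "l \<in> grp j" "\<beta>0 (l,k) \<noteq> 0" by (auto simp: S_def gsupp_def)
    have "(\<Sum>j<G. gnorm grp \<beta>0 j k) = 0" using z l(2) by (subst (asm) sum_nonneg_eq_0_iff) (auto intro: sum_nonneg gnorm_nonneg)
    then have "gnorm grp \<beta>0 j k = 0" using l(1) by (subst (asm) sum_nonneg_eq_0_iff) (auto intro: gnorm_nonneg)
    then have "(\<Sum>l\<in>grp j. (\<beta>0 (l,k))\<^sup>2) = 0" by (simp add: gnorm_def)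
    then show False using l grp_fin by (subst (asm) sum_nonneg_eq_0_iff) auto
  qed
  \<comment> \<open>For design norm 0 the prediction error vanishes identically and any positive
    width will do. Otherwise at most \<open>s0 * pm \<le> n\<close> active coordinates, each off by
    r, shift the weighted distance by at most 1/n^2.\<close>
  define r where "r = (if circ = 0 then 1 else 1 / (circ * real n ^ 3))"
  have r: "r > 0" using circ_nonneg n3 by (auto simp: r_def)
  have zero: "\<beta>0 x = 0" if x: "x \<in> JJ" "x \<notin> coords grp S" for x
  proof -
    obtain l k where lk: "x = (l,k)" "l < p" "k < d" using x(1) by (cases x) auto
    then have "l \<in> (\<Union>j<G. grp j)" unfolding grp_cover by simp
    then obtain j where j: "j < G" "l \<in> grp j" by auto
    then have "(j,k) \<notin> S" using x(2) lk by (auto simp: coords_def)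
    then show ?thesis using j lk by (auto simp: S_def gsupp_def)
  qed
  define A where "A = {\<beta> \<in> space (mspace {0..<p} {0..<d}). \<forall>x\<in>JJ. \<bar>\<beta> x - \<beta>0 x\<bar> \<le> (if x \<in> coords grp S then r else 0)}"
  have As: "A \<in> sets (mspace {0..<p} {0..<d})"
    unfolding A_def
  proof (rule sets.sets_Collect_finite_All)
    fix x assume "x \<in> JJ"
    then have [measurable]: "(\<lambda>P. P x) \<in> borel_measurable (mspace {0..<p} {0..<d})" by (rule mspace_component)
    show "{\<beta> \<in> space (mspace {0..<p} {0..<d}). \<bar>\<beta> x - \<beta>0 x\<bar> \<le> (if x \<in> coords grp S then r else 0)} \<in> sets (mspace {0..<p} {0..<d})" by measurable
  qed simp
  have ccard: "real (card (coords grp S)) \<le> real s0 * real pm"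
  proof -
    have "card (coords grp S) \<le> (\<Sum>x\<in>S. pm)"
      unfolding card_coords[OF S] using S by (intro sum_mono) (auto intro!: card_grp_le_pm)
    then show ?thesis by (simp add: cS flip: of_nat_mult)
  qed
  have near: "xdist n p d X \<beta>0 \<beta> \<le> 1 / real n ^ 4" if \<beta>: "\<beta> \<in> A" for \<beta>
  proof -
    have Ab: "\<bar>\<beta> x - \<beta>0 x\<bar> \<le> (if x \<in> coords grp S then r else 0)" if "x \<in> JJ" for x
      using \<beta> that unfolding A_def by blast
    have "gdist \<beta>0 \<beta> \<le> real (card (coords grp S)) * r"
    proof (rule gdist_le[OF S])
      show "\<bar>\<beta>0 x - \<beta> x\<bar> \<le> r" if "x \<in> coords grp S" for x
        using Ab[OF subsetD[OF coords_sub[OF S] that]] that by (simp add: abs_minus_commute)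
      show "\<beta>0 x = \<beta> x" if "x \<in> JJ" "x \<notin> coords grp S" for x
        using Ab[OF that(1)] that(2) by simp
    qed (use r in simp)
    then have "circ * gdist \<beta>0 \<beta> \<le> circ * (real (card (coords grp S)) * r)" using circ_nonneg by (rule mult_left_mono)
    also have "\<dots> \<le> real (card (coords grp S)) / real n ^ 3" by (simp add: r_def)
    also have "\<dots> \<le> real n / real n ^ 3"
      using ccard rate_ge(6) rn by (intro divide_right_mono) auto
    also have "\<dots> = 1 / real n ^ 2" using n3 by (simp add: power3_eq_cube power2_eq_square)
    finally have "(circ * gdist \<beta>0 \<beta>)\<^sup>2 \<le> (1 / real n ^ 2)\<^sup>2" using circ_nonneg gdist_nonneg by (intro power_mono) auto
    then show ?thesis using xdist_le_gdist[OF G1, of n X \<beta>0 \<beta>]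
      by (simp add: circ_def power_divide flip: power_mult)
  qed
  define lb where "lb = (\<Prod>(j,k)\<in>S. (lam k / a_const (card (grp j))) ^ card (grp j) * exp (- lam k * (gnorm grp \<beta>0 j k + real (card (grp j)) * r)))"
  have fac0: "0 \<le> (lam k / a_const (card (grp j))) ^ card (grp j) * exp (- lam k * (gnorm grp \<beta>0 j k + real (card (grp j)) * r))" if "j < G" "k < d" for j k
    using lam_nonneg[OF that(2)] a_const_pow(2)[OF card_grp[OF that(1)]] by simp
  have lb0: "lb \<ge> 0" unfolding lb_def using S fac0 by (intro prod_nonneg) auto
  have low: "ennreal (lb * (2 * r) ^ card (coords grp S)) \<le> emeasure (beta_given_S p d grp lam S) A"
  proof (rule beta_given_S_lower[OF S As])
    fix b assume b: "\<And>c. c \<in> coords grp S \<Longrightarrow> \<bar>b c - \<beta>0 c\<bar> \<le> r"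
    show "ext S b \<in> A"
      using b zero coords_sub[OF S] by (auto simp: A_def ext_def mspace_def space_PiM)
    show "lb \<le> glap_dens grp lam S b"
      unfolding lb_def glap_dens_def
    proof (rule prod_mono, rule conjI)
      fix x assume x: "x \<in> S"
      obtain j k where jk: "x = (j,k)" "j < G" "k < d" using x S by (cases x) auto
      show "0 \<le> (case x of (j,k) \<Rightarrow> (lam k / a_const (card (grp j))) ^ card (grp j) * exp (- lam k * (gnorm grp \<beta>0 j k + real (card (grp j)) * r)))"
        using fac0 jk by simp
      have "gnorm grp (\<lambda>x. b x - \<beta>0 x) j k \<le> (\<Sum>l\<in>grp j. \<bar>b (l,k) - \<beta>0 (l,k)\<bar>)"
        unfolding gnorm_def using L2_set_le_sum_abs[of "\<lambda>l. b (l,k) - \<beta>0 (l,k)" "grp j"] by (simp add: L2_set_def)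
      also have "\<dots> \<le> (\<Sum>l\<in>grp j. r)" using x jk by (intro sum_mono b) (auto simp: coords_def)
      finally have "gnorm grp b j k \<le> gnorm grp \<beta>0 j k + real (card (grp j)) * r"
        using gnorm_triangle[of b j k \<beta>0] by simp
      then have "exp (- lam k * (gnorm grp \<beta>0 j k + real (card (grp j)) * r)) \<le> exp (- lam k * gnorm grp b j k)"
        using lam_nonneg[OF jk(3)] by (simp add: mult_left_mono)
      then show "(case x of (j,k) \<Rightarrow> (lam k / a_const (card (grp j))) ^ card (grp j) * exp (- lam k * (gnorm grp \<beta>0 j k + real (card (grp j)) * r)))
        \<le> (case x of (j,k) \<Rightarrow> (lam k / a_const (card (grp j))) ^ card (grp j) * exp (- lam k * gnorm grp b j k))"
        using lam_nonneg[OF jk(3)] a_const_pow(2)[OF card_grp[OF jk(2)]] jk by (simp add: mult_left_mono)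
    qed
  qed (use lam_nonneg r lb0 in auto)
  \<comment> \<open>Exponent per active group in units of \<open>Lg\<close>: 4 powers of n, namely
    three in 1/r and one absorbing \<open>pm\<close>; B1 and B2 from the lower bound on \<lambda>;
    B3 from the upper bound on \<lambda> times the perturbation of the group norm.\<close>
  define c where "c = 4 + ln (max 1 B1) + B2 + B3"
  have lbB: "0 \<le> ln (max 1 B1)" by simp
  have fac: "exp (- (c * Lg) - lam k * gnorm grp \<beta>0 j k) \<le> (lam k / a_const (card (grp j))) ^ card (grp j) * exp (- lam k * (gnorm grp \<beta>0 j k + real (card (grp j)) * r)) * (2 * r) ^ card (grp j)"
    if jkS: "(j,k) \<in> S" for j k
  proof -
    have jk: "j < G" "k < d" using jkS S by auto
    have cp: "circ > 0" using circ_pos jkS by auto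
    define q where "q = card (grp j)"
    have q: "1 \<le> q" "q \<le> pm" using card_grp[OF jk(1)] card_grp_le_pm[OF jk(1)] by (auto simp: q_def)
    define M where "M = max (real G powr (1 / real pm)) (real n)"
    have M: "M > 0" using M_pos by (simp add: M_def)
    \<comment> \<open>A lower bound for \<open>r * lam k / pm\<close>, the contribution of one
      coordinate. It is at most 1, so the q-th power for a group of size q may be replaced by the
      \<open>pm\<close>-th power, whose exponent \<open>Lg_pm\<close> expresses through
      \<open>Lg\<close>.\<close>
    define x where "x = exp (- (4 * L + ln (max 1 B1) + B2 * ln M))"
    have lnM: "0 \<le> ln M" "real pm * ln M = Lg" using n3 Lg_pm by (auto simp: M_def max_def)
    have "0 \<le> 4 * L + ln (max 1 B1) + B2 * ln M"
      using L1 lnM(1) lbB cpos by (intro add_nonneg_nonneg mult_nonneg_nonneg) auto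
    then have x01: "0 < x" "x \<le> 1" by (auto simp: x_def)
    have "x ^ pm = exp (- (4 * (real pm * L) + real pm * ln (max 1 B1) + B2 * Lg))"
      unfolding x_def exp_of_nat_mult[symmetric] lnM(2)[symmetric] by (simp add: algebra_simps)
    moreover have "4 * (real pm * L) + real pm * ln (max 1 B1) + B2 * Lg \<le> (c - B3) * Lg"
      using Lg_ge(2) mult_right_mono[OF Lg_ge(5) lbB] by (simp add: c_def algebra_simps)
    ultimately have xpm: "exp (- ((c - B3) * Lg)) \<le> x ^ pm" by simp
    have xq: "x ^ pm \<le> x ^ q" using x01 q by (intro power_decreasing) auto
    have xl: "x \<le> r * lam k / real pm"
    proof -
      have "x = 1 / (real n ^ 4 * max 1 B1 * M powr B2)"
      proof -
        have "exp (4 * L + ln (max 1 B1) + B2 * ln M) = real n ^ 4 * max 1 B1 * M powr B2"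
          using M by (simp add: exp_add expL[symmetric] exp_of_nat_mult[symmetric] powr_def max_def)
        then show ?thesis unfolding x_def exp_minus by (simp add: inverse_eq_divide)
      qed
      also have "\<dots> \<le> 1 / (real n ^ 3 * real pm * B1 * M powr B2)"
      proof (intro divide_left_mono mult_right_mono)
        have "real n ^ 3 * real pm * B1 \<le> real n ^ 3 * real n * max 1 B1" using pm_n cpos by (intro mult_mono) auto
        then show "real n ^ 3 * real pm * B1 \<le> real n ^ 4 * max 1 B1" by (simp add: power_numeral_reduce mult_ac)
      qed (use n3 pm1 cpos M in \<open>auto intro!: mult_pos_pos\<close>)
      also have "\<dots> = r * (circ / (B1 * M powr B2)) / real pm" using cp by (simp add: r_def)
      also have "\<dots> \<le> r * lam k / real pm"
        using lam[OF jk(2)] r by (intro divide_right_mono mult_left_mono) (auto simp: M_def)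
      finally show ?thesis .
    qed
    have main: "x ^ q \<le> (lam k / a_const q) ^ q * (2 * r) ^ q"
    proof -
      have "x ^ q \<le> (r * lam k / real pm) ^ q" using xl x01 by (intro power_mono) auto
      also have "\<dots> = (2 * r * lam k) ^ q / (real pm ^ q * 2 ^ q)"
        by (simp add: power_divide power_mult_distrib)
      also have "\<dots> \<le> (2 * r * lam k) ^ q / (fact q * unit_ball_vol (real q))"
      proof (intro divide_left_mono mult_mono)
        have "fact q \<le> real (q ^ q)" using fact_le_power[of q, where ?'a = real] by simp
        also have "\<dots> \<le> real pm ^ q" using q by (simp add: power_mono)
        finally show "fact q \<le> real pm ^ q" .
        show "unit_ball_vol (real q) \<le> 2 ^ q" by (rule unit_ball_vol_bounds)
      qed (use unit_ball_vol_bounds(1)[of q] r lam_nonneg[OF jk(2)] pm1 in \<open>auto intro!: mult_pos_pos\<close>)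
      also have "\<dots> = (lam k / a_const q) ^ q * (2 * r) ^ q"
        unfolding a_const_pow(1)[OF q(1), symmetric] by (simp add: power_divide power_mult_distrib)
      finally show ?thesis .
    qed
    have "lam k * (real q * r) \<le> B3 * Lg"
    proof -
      have "lam k * (real q * r) \<le> (B3 * circ * sqrt Lg) * (real n * r)"
        using lam[OF jk(2)] lam_nonneg[OF jk(2)] q pm_n r by (intro mult_mono) auto
      also have "\<dots> = B3 * (sqrt Lg / real n ^ 2)" using cp n3 by (simp add: r_def power3_eq_cube power2_eq_square)
      also have "sqrt Lg / real n ^ 2 \<le> Lg"
      proof -
        have "sqrt Lg \<le> Lg" using Lg_ge(4) by (intro real_le_lsqrt) (auto simp: power2_eq_square)
        moreover have "1 \<le> real n ^ 2" using n3 by simp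
        ultimately have "sqrt Lg * 1 \<le> Lg * real n ^ 2" using Lg_ge(4) by (intro mult_mono) auto
        then show ?thesis using n3 by (simp add: field_simps)
      qed
      finally show ?thesis using cpos by simp
    qed
    then have "exp (- (B3 * Lg) - lam k * gnorm grp \<beta>0 j k) \<le> exp (- lam k * (gnorm grp \<beta>0 j k + real q * r))"
      by (simp add: algebra_simps)
    moreover have "exp (- ((c - B3) * Lg)) \<le> (lam k / a_const q) ^ q * (2 * r) ^ q" using xpm xq main by linarith
    ultimately have "exp (- ((c - B3) * Lg)) * exp (- (B3 * Lg) - lam k * gnorm grp \<beta>0 j k)
       \<le> ((lam k / a_const q) ^ q * (2 * r) ^ q) * exp (- lam k * (gnorm grp \<beta>0 j k + real q * r))"
      by (intro mult_mono) (auto intro: order_trans[OF less_imp_le[OF exp_gt_zero]])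
    moreover have "exp (- ((c - B3) * Lg)) * exp (- (B3 * Lg) - lam k * gnorm grp \<beta>0 j k) = exp (- (c * Lg) - lam k * gnorm grp \<beta>0 j k)"
      by (simp add: exp_add[symmetric] algebra_simps)
    ultimately show ?thesis by (simp add: q_def mult_ac)
  qed
  have "exp (- ((c + 1) * (real s0 * Lg))) \<le> exp (\<Sum>(j,k)\<in>S. - (c * Lg) - lam k * gnorm grp \<beta>0 j k)"
  proof -
    have "(\<Sum>(j,k)\<in>S. - (c * Lg) - lam k * gnorm grp \<beta>0 j k) = - (c * Lg) * real s0 - (\<Sum>(j,k)\<in>S. lam k * gnorm grp \<beta>0 j k)"
      by (simp add: case_prod_beta' sum_subtractf cS mult.commute)
    then show ?thesis using wsum by (simp add: algebra_simps)
  qed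
  also have "\<dots> = (\<Prod>x\<in>S. exp (- (c * Lg) - lam (snd x) * gnorm grp \<beta>0 (fst x) (snd x)))"
    by (simp add: exp_sum fS case_prod_beta')
  also have "\<dots> \<le> (\<Prod>x\<in>S. (lam (snd x) / a_const (card (grp (fst x)))) ^ card (grp (fst x)) * exp (- lam (snd x) * (gnorm grp \<beta>0 (fst x) (snd x) + real (card (grp (fst x))) * r)) * (2 * r) ^ card (grp (fst x)))"
    by (intro prod_mono conjI fac) auto
  also have "\<dots> = lb * (2 * r) ^ card (coords grp S)"
    unfolding lb_def card_coords[OF S] by (simp add: prod.distrib power_sum case_prod_beta')
  finally have g: "exp (- ((c + 1) * (real s0 * Lg))) \<le> lb * (2 * r) ^ card (coords grp S)" .
  have pi: "exp (- 1 - (\<bar>ln A1\<bar> + A3 + 2) * (real s0 * Lg)) \<le> pmf pr s0 / real ((G * d) choose s0)"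
  proof -
    have "(exp (- (\<bar>ln A1\<bar> + A3) * Lg)) ^ s0 \<le> (A1 * exp (- A3 * Lg)) ^ s0"
    proof (rule power_mono)
      have "\<bar>ln A1\<bar> * 1 \<le> \<bar>ln A1\<bar> * Lg" by (intro mult_left_mono Lg_ge) simp
      then have "- (\<bar>ln A1\<bar> * Lg) \<le> ln A1" using abs_ge_minus_self[of "ln A1"] by linarith
      then have "exp (- (\<bar>ln A1\<bar> * Lg)) \<le> exp (ln A1)" by simp
      then have "exp (- (\<bar>ln A1\<bar> * Lg)) \<le> A1" using cpos by simp
      then have "exp (- (\<bar>ln A1\<bar> * Lg)) * exp (- A3 * Lg) \<le> A1 * exp (- A3 * Lg)" by (intro mult_right_mono) auto
      then show "exp (- (\<bar>ln A1\<bar> + A3) * Lg) \<le> A1 * exp (- A3 * Lg)" by (simp add: exp_add[symmetric] algebra_simps)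
    qed simp
    then have 1: "exp (- (\<bar>ln A1\<bar> + A3) * (real s0 * Lg)) / 2 \<le> pmf pr s0"
      using pmf_ge'[OF s0] by (simp add: exp_of_nat_mult[symmetric] mult_ac)
    have bin: "real ((G * d) choose s0) \<le> exp (2 * (real s0 * Lg))" "0 < real ((G * d) choose s0)"
    proof -
      have "real ((G * d) choose s0) \<le> (real G * real d) ^ s0"
        using binomial_le_pow[OF s0] by (metis of_nat_le_iff of_nat_mult of_nat_power)
      also have "\<dots> \<le> (exp Lg * exp Lg) ^ s0"
      proof (intro power_mono mult_mono)
        show "real G \<le> exp Lg" unfolding exp_Lg[symmetric] by simp
        have "real d \<le> exp L" using dn expL by simp
        also have "\<dots> \<le> exp Lg" using Lg_ge(3) by simp
        finally show "real d \<le> exp Lg" .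
      qed auto
      also have "\<dots> = exp (2 * (real s0 * Lg))" by (simp add: exp_add[symmetric] exp_of_nat_mult[symmetric] mult_ac)
      finally show "real ((G * d) choose s0) \<le> exp (2 * (real s0 * Lg))" .
      show "0 < real ((G * d) choose s0)" using s0 by simp
    qed
    have "exp (- 1 - (\<bar>ln A1\<bar> + A3 + 2) * (real s0 * Lg)) = exp (- 1) * exp (- (\<bar>ln A1\<bar> + A3) * (real s0 * Lg)) / exp (2 * (real s0 * Lg))"
      by (simp add: exp_add[symmetric] exp_diff[symmetric] algebra_simps)
    also have "\<dots> \<le> (exp (- (\<bar>ln A1\<bar> + A3) * (real s0 * Lg)) / 2) / exp (2 * (real s0 * Lg))"
    proof (intro divide_right_mono)
      have "exp (- 1 :: real) \<le> 1 / 2" using exp_ge_add_one_self[of "1::real"] by (simp add: exp_minus field_simps)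
      then show "exp (- 1) * exp (- (\<bar>ln A1\<bar> + A3) * (real s0 * Lg)) \<le> exp (- (\<bar>ln A1\<bar> + A3) * (real s0 * Lg)) / 2"
        using mult_right_mono[of "exp (- 1)" "1/2" "exp (- (\<bar>ln A1\<bar> + A3) * (real s0 * Lg))"] by simp
    qed simp
    also have "\<dots> \<le> pmf pr s0 / real ((G * d) choose s0)" using 1 bin by (intro frac_le) auto
    finally show ?thesis .
  qed
  have "exp (- C1 * rate) \<le> exp (- 1 - (\<bar>ln A1\<bar> + A3 + 2) * (real s0 * Lg)) * exp (- ((c + 1) * (real s0 * Lg)))"
  proof -
    have "1 + (\<bar>ln A1\<bar> + A3 + 2) * (real s0 * Lg) + (c + 1) * (real s0 * Lg) \<le> rate + (\<bar>ln A1\<bar> + A3 + 2) * rate + (c + 1) * rate"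
      using rate_ge cpos lbB by (intro add_mono mult_left_mono) (auto simp: c_def)
    also have "\<dots> = C1 * rate" by (simp add: C1_def c_def algebra_simps)
    finally show ?thesis unfolding exp_add[symmetric] by simp
  qed
  also have "\<dots> \<le> pmf pr s0 / real ((G * d) choose s0) * (lb * (2 * r) ^ card (coords grp S))"
    by (intro mult_mono pi g) auto
  finally have "ennreal (exp (- C1 * rate)) \<le> ennreal (pmf pr s0 / real ((G * d) choose s0)) * ennreal (lb * (2 * r) ^ card (coords grp S))"
    using lb0 r by (subst ennreal_mult[symmetric]) (auto intro!: ennreal_leI)
  also have "\<dots> \<le> ennreal (pmf pr s0 / real ((G * d) choose s0)) * emeasure (beta_given_S p d grp lam S) A"
    by (intro mult_left_mono low) auto
  also have "\<dots> \<le> emeasure (prior_beta pr G p d grp lam) A"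
    by (rule prior_beta_lower[OF supp lam_nonneg As S cS])
  finally show ?thesis using As near by blast
qed

end

section \<open>Posterior bounds by affinities\<close>

lemma sqrt_sum_le: "(\<And>j. j \<in> J \<Longrightarrow> 0 \<le> u j) \<Longrightarrow> sqrt (\<Sum>j\<in>J. u j) \<le> (\<Sum>j\<in>J. sqrt (u j))"
proof (induction J rule: infinite_finite_induct)
  case (insert j J)
  then have "sqrt (u j + (\<Sum>j\<in>J. u j)) \<le> sqrt (u j) + sqrt (\<Sum>j\<in>J. u j)"
    by (intro sqrt_add_le_add_sqrt sum_nonneg) auto
  then show ?case using insert by fastforce
qed simp_all

text \<open>The smaller of two nonnegative numbers is at most their geometric mean, which turns two
  bounds on x into an affinity. The term t is left outside the square root because its integral,
  rather than an affinity, is controlled.\<close>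

lemma min_sqrt_bound:
  fixes f l u t \<kappa> :: real
  assumes "0 \<le> l" "0 \<le> u" "0 \<le> t" "0 < \<kappa>" "x \<le> l" "x \<le> (u + t) / \<kappa>"
  shows "x \<le> 1 / sqrt \<kappa> * sqrt (l * u) + 1 / \<kappa> * t"
proof -
  define v where "v = u / \<kappa>"
  have v: "v \<ge> 0" using assms by (simp add: v_def)
  have e: "1 / sqrt \<kappa> * sqrt (l * u) = sqrt (l * v)" using assms by (simp add: v_def real_sqrt_mult real_sqrt_divide)
  show ?thesis
  proof (cases "v \<le> l")
    case True
    have "sqrt (v * v) \<le> sqrt (l * v)" using True v by (intro real_sqrt_le_mono mult_right_mono)
    then have "v \<le> sqrt (l * v)" using v by simp
    then show ?thesis using assms(6) unfolding e by (simp add: v_def add_divide_distrib)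
  next
    case False
    have "sqrt (l * l) \<le> sqrt (l * v)" using False assms by (intro real_sqrt_le_mono mult_left_mono) auto
    then have "l \<le> sqrt (l * v)" using assms by simp
    then have "x \<le> sqrt (l * v)" using assms(5) by linarith
    moreover have "0 \<le> 1 / \<kappa> * t" using assms by simp
    ultimately show ?thesis unfolding e by linarith
  qed
qed

text \<open>Times the true likelihood, the posterior probability is at most \<open>L0 Y\<close> and
  at most (\<Sum> U + T)/\<kappa>; \<open>min_sqrt_bound\<close> combines the two, and the square
  root of the sum is split. The cells are thus paid for by affinities at price 1/sqrt \<kappa>, the
  remainder by its mass at price 1/\<kappa>.\<close>

lemma posterior_bound:
  fixes Pr :: "(rmat \<times> rmat) measure" and \<nu> :: "rmat measure" and L0 :: "rmat \<Rightarrow> real" and J :: "'j set"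
  assumes L0: "\<And>Y. 0 < L0 Y" "L0 \<in> borel_measurable \<nu>"
    and ev: "\<And>Y. Y \<in> space \<nu> \<Longrightarrow> ennreal (\<kappa> * L0 Y) \<le> (\<integral>\<^sup>+ \<theta>. ennreal (Lk \<theta> Y) \<partial>Pr)" and \<kappa>: "\<kappa> > 0"
    and num: "\<And>Y. Y \<in> space \<nu> \<Longrightarrow> (\<integral>\<^sup>+ \<theta>. indicator A \<theta> * ennreal (Lk \<theta> Y) \<partial>Pr) \<le> ennreal (\<Sum>j\<in>J. U j Y) + T Y"
    and U: "\<And>j. j \<in> J \<Longrightarrow> U j \<in> borel_measurable \<nu>" "\<And>j Y. 0 \<le> U j Y"
    and aff: "\<And>j. j \<in> J \<Longrightarrow> (\<integral>\<^sup>+ Y. ennreal (sqrt (L0 Y * U j Y)) \<partial>\<nu>) \<le> ennreal \<eta>" and \<eta>: "\<eta> \<ge> 0"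
    and T: "T \<in> borel_measurable \<nu>" "(\<integral>\<^sup>+ Y. T Y \<partial>\<nu>) \<le> ennreal \<tau>" "\<tau> \<ge> 0"
  shows "(\<integral>Y. posterior Pr Lk A Y \<partial>density \<nu> (\<lambda>Y. ennreal (L0 Y))) \<le> real (card J) * \<eta> / sqrt \<kappa> + \<tau> / \<kappa>"
proof -
  define f where "f = posterior Pr Lk A"
  define R where "R = real (card J) * \<eta> / sqrt \<kappa> + \<tau> / \<kappa>"
  have R0: "R \<ge> 0" using \<eta> T(3) \<kappa> by (simp add: R_def)
  have f0: "f Y \<ge> 0" for Y by (simp add: f_def posterior_def)
  have pt: "ennreal (L0 Y) * ennreal (f Y) \<le> (\<Sum>j\<in>J. ennreal (1 / sqrt \<kappa>) * ennreal (sqrt (L0 Y * U j Y))) + ennreal (1 / \<kappa>) * T Y"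
    if Y: "Y \<in> space \<nu>" for Y
  proof -
    define D where "D = (\<integral>\<^sup>+ \<theta>. ennreal (Lk \<theta> Y) \<partial>Pr)"
    define Nn where "Nn = (\<integral>\<^sup>+ \<theta>. indicator A \<theta> * ennreal (Lk \<theta> Y) \<partial>Pr)"
    have fY: "f Y = enn2real Nn / enn2real D" by (simp add: f_def posterior_def D_def Nn_def)
    have ND: "Nn \<le> D" unfolding Nn_def D_def by (intro nn_integral_mono) (auto split: split_indicator)
    define u where "u = (\<Sum>j\<in>J. U j Y)"
    have u0: "u \<ge> 0" unfolding u_def by (intro sum_nonneg U)
    have Nu: "Nn \<le> ennreal u + T Y" using num[OF Y] by (simp add: Nn_def u_def)
    \<comment> \<open>\<open>enn2real\<close> sends infinity to 0, so an infinite denominator makes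
      the quotient 0; an infinite T makes the right side infinite. Real arithmetic is confined to
      the third case.\<close>
    consider "D = \<infinity>" | "T Y = \<infinity>" | \<delta> t where "D = ennreal \<delta>" "\<delta> \<ge> 0" "T Y = ennreal t" "t \<ge> 0"
      by (cases D; cases "T Y") auto
    then show ?thesis
    proof cases
      case 1 then show ?thesis by (simp add: fY)
    next
      case 2 then show ?thesis using \<kappa> by (simp add: ennreal_mult_top)
    next
      case 3
      have "ennreal (\<kappa> * L0 Y) \<le> ennreal \<delta>" using ev[OF Y] 3 by (simp add: D_def)
      then have \<delta>: "\<kappa> * L0 Y \<le> \<delta>" using 3 by (simp add: ennreal_le_iff)
      have \<delta>0: "\<delta> > 0" using \<delta> mult_pos_pos[OF \<kappa> L0(1)[of Y]] by linarith
      define v where "v = enn2real Nn"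
      have Nfin: "Nn < \<infinity>" using ND 3 by (simp add: le_less_trans)
      have Nv: "Nn = ennreal v" using Nfin by (simp add: v_def)
      have v0: "v \<ge> 0" by (simp add: v_def)
      have vd: "v \<le> \<delta>" using ND 3 v0 by (simp add: Nv ennreal_le_iff)
      have vu: "v \<le> u + t"
        using Nu 3 u0 v0 by (simp add: Nv ennreal_plus[symmetric] ennreal_le_iff del: ennreal_plus)
      have fv: "f Y = v / \<delta>" using 3 by (simp add: fY v_def)
      have a: "L0 Y * f Y \<le> L0 Y" using mult_left_mono[of "v / \<delta>" 1 "L0 Y"] vd \<delta>0 L0(1)[of Y] by (simp add: fv)
      have b: "L0 Y * f Y \<le> (u + t) / \<kappa>"
      proof -
        have "L0 Y * f Y = (\<kappa> * L0 Y) * v / (\<kappa> * \<delta>)" using \<kappa> by (simp add: fv)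
        also have "\<dots> \<le> \<delta> * v / (\<kappa> * \<delta>)" using \<delta> v0 \<kappa> \<delta>0 by (intro divide_right_mono mult_right_mono) auto
        also have "\<dots> = v / \<kappa>" using \<delta>0 by simp
        also have "\<dots> \<le> (u + t) / \<kappa>" using vu \<kappa> by (simp add: divide_right_mono)
        finally show ?thesis .
      qed
      have "L0 Y * f Y \<le> 1 / sqrt \<kappa> * sqrt (L0 Y * u) + 1 / \<kappa> * t"
        by (rule min_sqrt_bound[OF less_imp_le[OF L0(1)] u0 3(4) \<kappa> a b])
      also have "sqrt (L0 Y * u) \<le> (\<Sum>j\<in>J. sqrt (L0 Y * U j Y))"
        unfolding u_def sum_distrib_left by (rule sqrt_sum_le) (simp add: U less_imp_le[OF L0(1)])
      finally have c: "L0 Y * f Y \<le> (\<Sum>j\<in>J. 1 / sqrt \<kappa> * sqrt (L0 Y * U j Y)) + 1 / \<kappa> * t"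
        using \<kappa> by (simp add: sum_distrib_left divide_right_mono)
      have s0: "0 \<le> sqrt (L0 Y * U j Y)" for j using U L0(1)[of Y] by (simp add: less_imp_le)
      have "ennreal (L0 Y) * ennreal (f Y) = ennreal (L0 Y * f Y)"
        using f0 L0(1)[of Y] by (simp add: ennreal_mult less_imp_le)
      also have "\<dots> \<le> ennreal ((\<Sum>j\<in>J. 1 / sqrt \<kappa> * sqrt (L0 Y * U j Y)) + 1 / \<kappa> * t)" by (rule ennreal_leI[OF c])
      also have "\<dots> = ennreal (\<Sum>j\<in>J. 1 / sqrt \<kappa> * sqrt (L0 Y * U j Y)) + ennreal (1 / \<kappa> * t)"
        using s0 \<kappa> 3 by (intro ennreal_plus sum_nonneg mult_nonneg_nonneg) auto
      also have "ennreal (\<Sum>j\<in>J. 1 / sqrt \<kappa> * sqrt (L0 Y * U j Y)) = (\<Sum>j\<in>J. ennreal (1 / sqrt \<kappa> * sqrt (L0 Y * U j Y)))"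
        using s0 \<kappa> by (intro sum_ennreal[symmetric] mult_nonneg_nonneg) auto
      also have "\<dots> = (\<Sum>j\<in>J. ennreal (1 / sqrt \<kappa>) * ennreal (sqrt (L0 Y * U j Y)))"
        using s0 \<kappa> by (intro sum.cong refl ennreal_mult) auto
      also have "ennreal (1 / \<kappa> * t) = ennreal (1 / \<kappa>) * T Y"
        unfolding 3(3) by (rule ennreal_mult) (use 3 \<kappa> in auto)
      finally show ?thesis .
    qed
  qed
  show ?thesis
  \<comment> \<open>A Bochner integral of a non-integrable function is 0, so this case only asks for
    a nonnegative bound. In the other case integrability supplies the measurability of the posterior
    in Y.\<close>
  proof (cases "integrable (density \<nu> (\<lambda>Y. ennreal (L0 Y))) f")
    case False
    then show ?thesis using R0 by (simp add: not_integrable_integral_eq f_def[symmetric] R_def)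
  next
    case True
    then have fm: "f \<in> borel_measurable \<nu>" using borel_measurable_integrable[OF True] by simp
    have "ennreal (\<integral>Y. f Y \<partial>density \<nu> (\<lambda>Y. ennreal (L0 Y))) = (\<integral>\<^sup>+ Y. ennreal (f Y) \<partial>density \<nu> (\<lambda>Y. ennreal (L0 Y)))"
      using True f0 by (intro nn_integral_eq_integral[symmetric]) auto
    also have "\<dots> = (\<integral>\<^sup>+ Y. ennreal (L0 Y) * ennreal (f Y) \<partial>\<nu>)" using L0(2) fm by (intro nn_integral_density) auto
    also have "\<dots> \<le> (\<integral>\<^sup>+ Y. (\<Sum>j\<in>J. ennreal (1 / sqrt \<kappa>) * ennreal (sqrt (L0 Y * U j Y))) + ennreal (1 / \<kappa>) * T Y \<partial>\<nu>)"
      by (intro nn_integral_mono pt)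
    also have "\<dots> = (\<Sum>j\<in>J. ennreal (1 / sqrt \<kappa>) * (\<integral>\<^sup>+ Y. ennreal (sqrt (L0 Y * U j Y)) \<partial>\<nu>)) + ennreal (1 / \<kappa>) * (\<integral>\<^sup>+ Y. T Y \<partial>\<nu>)"
    proof -
      have m: "(\<lambda>Y. ennreal (sqrt (L0 Y * U j Y))) \<in> borel_measurable \<nu>" if "j \<in> J" for j
        using U(1)[OF that] L0(2) by measurable
      have m2: "(\<lambda>Y. \<Sum>j\<in>J. ennreal (1 / sqrt \<kappa>) * ennreal (sqrt (L0 Y * U j Y))) \<in> borel_measurable \<nu>"
        by (intro borel_measurable_sum borel_measurable_times_ennreal m) auto
      have "(\<integral>\<^sup>+ Y. (\<Sum>j\<in>J. ennreal (1 / sqrt \<kappa>) * ennreal (sqrt (L0 Y * U j Y))) + ennreal (1 / \<kappa>) * T Y \<partial>\<nu>)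
        = (\<integral>\<^sup>+ Y. (\<Sum>j\<in>J. ennreal (1 / sqrt \<kappa>) * ennreal (sqrt (L0 Y * U j Y))) \<partial>\<nu>) + (\<integral>\<^sup>+ Y. ennreal (1 / \<kappa>) * T Y \<partial>\<nu>)"
        using m2 T(1) by (intro nn_integral_add) auto
      also have "(\<integral>\<^sup>+ Y. ennreal (1 / \<kappa>) * T Y \<partial>\<nu>) = ennreal (1 / \<kappa>) * (\<integral>\<^sup>+ Y. T Y \<partial>\<nu>)" using T(1) by (rule nn_integral_cmult)
      also have "(\<integral>\<^sup>+ Y. (\<Sum>j\<in>J. ennreal (1 / sqrt \<kappa>) * ennreal (sqrt (L0 Y * U j Y))) \<partial>\<nu>) = (\<Sum>j\<in>J. \<integral>\<^sup>+ Y. ennreal (1 / sqrt \<kappa>) * ennreal (sqrt (L0 Y * U j Y)) \<partial>\<nu>)"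
        using m by (intro nn_integral_sum) auto
      also have "\<dots> = (\<Sum>j\<in>J. ennreal (1 / sqrt \<kappa>) * (\<integral>\<^sup>+ Y. ennreal (sqrt (L0 Y * U j Y)) \<partial>\<nu>))"
        by (intro sum.cong refl nn_integral_cmult m)
      finally show ?thesis .
    qed
    also have "\<dots> \<le> (\<Sum>j\<in>J. ennreal (1 / sqrt \<kappa>) * ennreal \<eta>) + ennreal (1 / \<kappa>) * ennreal \<tau>"
      by (intro add_mono sum_mono mult_left_mono aff T) auto
    also have "\<dots> = ennreal R"
      using \<eta> \<kappa> T(3) by (simp add: R_def ennreal_mult[symmetric] ennreal_of_nat_eq_real_of_nat ennreal_plus[symmetric] del: ennreal_plus)
    finally have "ennreal (\<integral>Y. f Y \<partial>density \<nu> (\<lambda>Y. ennreal (L0 Y))) \<le> ennreal R" .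
    then show ?thesis using R0 by (simp add: ennreal_le_iff f_def[symmetric] R_def)
  qed
qed

lemma emeasure_zero_of_exp_bound:
  fixes x :: ennreal
  assumes "\<And>t. t > 0 \<Longrightarrow> x \<le> ennreal (K * exp (- c * t))" "c > 0"
  shows "x = 0"
proof -
  have "((\<lambda>t. K * exp (- c * t)) \<longlongrightarrow> K * 0) at_top"
  proof (rule tendsto_mult[OF tendsto_const])
    have "filterlim (\<lambda>t. - c * t) at_bot at_top"
      using assms(2) by (intro filterlim_tendsto_neg_mult_at_bot[OF tendsto_const] filterlim_ident) simp
    then show "((\<lambda>t. exp (- c * t)) \<longlongrightarrow> 0) at_top" by (rule filterlim_compose[OF exp_at_bot])
  qed
  then have lim: "((\<lambda>t. ennreal (K * exp (- c * t))) \<longlongrightarrow> ennreal 0) at_top" by (intro tendsto_ennrealI) simp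
  have "x \<le> ennreal 0"
  proof (rule tendsto_lowerbound[OF lim])
    show "\<forall>\<^sub>F t in at_top. x \<le> ennreal (K * exp (- c * t))"
      using eventually_gt_at_top[of 0] by eventually_elim (rule assms(1))
  qed simp
  then show ?thesis by simp
qed

lemma spd_SigPD:
  assumes "x \<in> PDgood d t" "t > 0"
  shows "spd d (SigPD d x)" "1 / t * sq d v \<le> bf d (SigPD d x) v v" "bf d (SigPD d x) v v \<le> t * sq d v"
proof -
  have x: "fst x \<in> orth d" "\<And>k. k < d \<Longrightarrow> 1 / t \<le> snd x k \<and> snd x k \<le> t"
    using assms(1) by (auto simp: PDgood_def PiE_iff)
  show "1 / t * sq d v \<le> bf d (SigPD d x) v v" "bf d (SigPD d x) v v \<le> t * sq d v" for v
    by (rule SigPD_bounds[OF x], assumption)+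
  show "spd d (SigPD d x)" unfolding spd_def
  proof (intro conjI exI[of _ "1 / t"] allI)
    show "1 / t * sq d v \<le> bf d (SigPD d x) v v" for v by (rule SigPD_bounds(1)[OF x])
  qed (use symm_SigPD assms(2) in auto)
qed

section \<open>The joint prior, the evidence, and integration over eigenvector-eigenvalue
  pairs\<close>

context model
begin

abbreviation PB :: "rmat measure" where "PB \<equiv> prior_beta pr G p d grp lam"

lemma sets_PB: "sets PB = sets (mspace {0..<p} {0..<d})"
  by (rule emeasure_prior_beta(2)[OF supp lam_nonneg sets.top])

lemma PB_component: "x \<in> JJ \<Longrightarrow> (\<lambda>\<beta>. \<beta> x) \<in> borel_measurable PB"
  unfolding measurable_cong_sets[OF sets_PB refl] by (rule mspace_component)

lemma finite_measure_PB: "finite_measure PB"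
proof
  have "emeasure PB (space PB) \<le> 1" by (rule prior_beta_le_1[OF supp lam_nonneg])
  then show "emeasure PB (space PB) \<noteq> \<infinity>" by (auto simp: top_unique)
qed

end

text \<open>The tail constants \<open>CI\<close> and \<open>cI\<close> of the eigenvalue law are
  parameters, so that they stay the same for all sample sizes.\<close>

locale model_Sigma = model G p d grp n s0 X pr lam H A1 A2 A3 A4 B1 B2 B3 L Lg circ pm
  for G p d :: nat and grp and n s0 :: nat and X pr lam H A1 A2 A3 A4 B1 B2 B3 L Lg circ pm +
  fixes mu nu b1 b2 CI cI :: real
  assumes mn: "mu > 0" "nu > 0" and b: "b1 > 0" "b2 > 0"
    and CI: "CI \<ge> 1" "emeasure (ig mu nu) UNIV \<le> ennreal CI"
    and cI: "cI > 0" "\<And>t. t > 0 \<Longrightarrow> emeasure (ig mu nu) (- {1 / t..t}) \<le> ennreal (CI * exp (- cI * t))"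
begin

abbreviation PDm :: "(rmat \<times> (nat \<Rightarrow> real)) measure" where "PDm \<equiv> PD d H mu nu"

lemma PD_tail:
  assumes "t > 0"
  shows "PDgood d t \<in> sets PDm" "emeasure PDm (space PDm - PDgood d t) \<le> ennreal (real d * CI ^ d * exp (- cI * t))"
  by (rule PD_mass_tail[OF haar mn CI cI(2)[OF assms]], simp)+

lemma PD_mass: "emeasure PDm (space PDm) \<le> ennreal (CI ^ d)"
  by (rule PD_mass_tail(1)[OF haar mn CI cI(2)[of 1]]) auto

lemma finite_measure_PD: "finite_measure PDm"
  by standard (use PD_mass in \<open>auto simp: top_unique\<close>)

text \<open>The exceptional set lies outside every box \<open>PDgood d (Suc m)\<close>, so its mass
  is below an exponential tail at every level t. Likelihoods are known to integrate to 1 for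
  positive definite covariances, and this makes the statement usable under the prior.\<close>

lemma AE_spd: "AE x in PDm. spd d (SigPD d x)"
proof -
  define Z where "Z = space PDm - (\<Union>m::nat. PDgood d (real (Suc m)))"
  have Zs: "Z \<in> sets PDm" unfolding Z_def using PD_tail(1) by (intro sets.Diff sets.countable_UN) auto
  have Zle: "emeasure PDm Z \<le> ennreal (real d * CI ^ d * exp cI * exp (- cI * t))" if t: "t > 0" for t
  proof -
    define m where "m = nat \<lfloor>t\<rfloor>"
    have m: "t - 1 \<le> real (Suc m) - 1" "real (Suc m) > 0" using t unfolding m_def by linarith+
    have "emeasure PDm Z \<le> emeasure PDm (space PDm - PDgood d (real (Suc m)))"
      unfolding Z_def using PD_tail(1)[OF m(2)] by (intro emeasure_mono) auto
    also have "\<dots> \<le> ennreal (real d * CI ^ d * exp (- cI * real (Suc m)))" by (rule PD_tail(2)[OF m(2)])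
    also have "\<dots> \<le> ennreal (real d * CI ^ d * exp cI * exp (- cI * t))"
    proof (intro ennreal_leI)
      have "exp (- cI * real (Suc m)) \<le> exp (cI + - cI * t)" using mult_left_mono[of t "real m + 2" cI] m cI(1) by (simp add: algebra_simps)
      then have "real d * CI ^ d * exp (- cI * real (Suc m)) \<le> real d * CI ^ d * (exp cI * exp (- cI * t))"
        unfolding exp_add using CI(1) by (intro mult_left_mono) auto
      then show "real d * CI ^ d * exp (- cI * real (Suc m)) \<le> real d * CI ^ d * exp cI * exp (- cI * t)" by (simp only: mult.assoc)
    qed
    finally show ?thesis .
  qed
  have "emeasure PDm Z = 0" by (rule emeasure_zero_of_exp_bound[OF Zle cI(1)])
  then have "AE x in PDm. x \<notin> Z" using Zs by (intro AE_not_in) (auto simp: null_sets_def)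
  then show ?thesis
  proof (rule AE_mp, intro AE_I2 impI)
    fix x assume x: "x \<in> space PDm" "x \<notin> Z"
    then obtain m where "x \<in> PDgood d (real (Suc m))" by (auto simp: Z_def)
    then show "spd d (SigPD d x)" by (rule spd_SigPD(1)) simp
  qed
qed

abbreviation PS :: "rmat measure" where "PS \<equiv> prior_Sigma d H mu nu"
abbreviation Pr :: "(rmat \<times> rmat) measure" where "Pr \<equiv> PB \<Otimes>\<^sub>M PS"
abbreviation Pr' :: "(rmat \<times> rmat \<times> (nat \<Rightarrow> real)) measure" where "Pr' \<equiv> PB \<Otimes>\<^sub>M PDm"
abbreviation YM :: "rmat measure" where "YM \<equiv> PiM ({0..<n} \<times> {0..<d}) (\<lambda>_. lborel)"

lemma SigPD_m: "SigPD d \<in> measurable PDm (mspace {0..<d} {0..<d})"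
  by (rule SigPD_measurable[OF haar])

lemma SigPD_component: "i < d \<Longrightarrow> l < d \<Longrightarrow> (\<lambda>x. SigPD d x (i,l)) \<in> borel_measurable PDm"
  by (rule measurable_compose[OF SigPD_m mspace_component]) auto

lemma sets_PS: "sets PS = sets (mspace {0..<d} {0..<d})"
  by (simp add: prior_Sigma_def)

lemma finite_measure_PS: "finite_measure PS"
  unfolding prior_Sigma_PD using finite_measure_PD SigPD_m by (rule finite_measure.finite_measure_distr)

text \<open>Passes from (\<beta>, \<Sigma>) to (\<beta>, (P, D)), where the sieve is a product of a
  condition on \<beta> and a condition on the spectrum.\<close>

lemma nn_integral_Pr:
  assumes F: "F \<in> borel_measurable Pr"
  shows "(\<integral>\<^sup>+ \<theta>. F \<theta> \<partial>Pr) = (\<integral>\<^sup>+ z. F (fst z, SigPD d (snd z)) \<partial>Pr')"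
    "(\<lambda>z. F (fst z, SigPD d (snd z))) \<in> borel_measurable Pr'"
proof -
  interpret S: finite_measure PS by (rule finite_measure_PS)
  interpret D: finite_measure PDm by (rule finite_measure_PD)
  have m1: "(\<lambda>z. (fst z, SigPD d (snd z))) \<in> measurable Pr' Pr"
  proof (rule measurable_Pair[OF measurable_fst])
    have "SigPD d \<in> measurable PDm PS" using SigPD_m sets_PS measurable_cong_sets by blast
    then show "(\<lambda>z. SigPD d (snd z)) \<in> measurable Pr' PS" by (rule measurable_compose[OF measurable_snd])
  qed
  show m: "(\<lambda>z. F (fst z, SigPD d (snd z))) \<in> borel_measurable Pr'" by (rule measurable_compose[OF m1 F])
  have "(\<integral>\<^sup>+ \<theta>. F \<theta> \<partial>Pr) = (\<integral>\<^sup>+ \<beta>. \<integral>\<^sup>+ S. F (\<beta>, S) \<partial>PS \<partial>PB)" by (rule S.nn_integral_fst[OF F, symmetric])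
  also have "\<dots> = (\<integral>\<^sup>+ \<beta>. \<integral>\<^sup>+ x. F (\<beta>, SigPD d x) \<partial>PDm \<partial>PB)"
  proof (rule nn_integral_cong)
    fix \<beta> assume \<beta>: "\<beta> \<in> space PB"
    have "(\<lambda>S. F (\<beta>, S)) \<in> borel_measurable PS" using F \<beta> by measurable
    then show "(\<integral>\<^sup>+ S. F (\<beta>, S) \<partial>PS) = (\<integral>\<^sup>+ x. F (\<beta>, SigPD d x) \<partial>PDm)"
      unfolding prior_Sigma_PD by (intro nn_integral_distr[OF SigPD_m]) simp
  qed
  also have "\<dots> = (\<integral>\<^sup>+ z. F (fst z, SigPD d (snd z)) \<partial>Pr')"
    using D.nn_integral_fst[OF m] by simp
  finally show "(\<integral>\<^sup>+ \<theta>. F \<theta> \<partial>Pr) = (\<integral>\<^sup>+ z. F (fst z, SigPD d (snd z)) \<partial>Pr')" .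
qed

lemma lik_joint_measurable:
  "(\<lambda>w. lik n p d X (fst (fst w)) (snd (fst w)) (snd w)) \<in> borel_measurable (Pr \<Otimes>\<^sub>M YM)"
proof (rule lik_measurable)
  fix l k assume "l < p" "k < d"
  then have "(\<lambda>\<beta>. \<beta> (l,k)) \<in> borel_measurable PB" by (intro PB_component) auto
  then show "(\<lambda>w. fst (fst w) (l,k)) \<in> borel_measurable (Pr \<Otimes>\<^sub>M YM)" by measurable
next
  fix i l assume "i < d" "l < d"
  then have "(\<lambda>S. S (i,l)) \<in> borel_measurable PS"
    unfolding measurable_cong_sets[OF sets_PS refl] by (intro mspace_component) auto
  then show "(\<lambda>w. snd (fst w) (i,l)) \<in> borel_measurable (Pr \<Otimes>\<^sub>M YM)" by measurable
next
  fix i k assume "i < n" "k < d"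
  then have "(\<lambda>Y. Y (i,k)) \<in> borel_measurable YM" by (intro component_borel) auto
  then show "(\<lambda>w. snd w (i,k)) \<in> borel_measurable (Pr \<Otimes>\<^sub>M YM)" by measurable
qed

lemma lik_measurable_theta: "Y \<in> space YM \<Longrightarrow> (\<lambda>\<theta>. ennreal (lik n p d X (fst \<theta>) (snd \<theta>) Y)) \<in> borel_measurable Pr"
  using measurable_compose[OF _ lik_joint_measurable, of "\<lambda>\<theta>. (\<theta>, Y)" Pr] by simp

lemma lik_measurable_Y: "(\<lambda>Y. lik n p d X \<beta> S Y) \<in> borel_measurable YM"
  by (rule lik_measurable) (auto intro: component_borel)

lemma lik_joint_measurable':
  "(\<lambda>w. lik n p d X (fst (snd w)) (SigPD d (snd (snd w))) (fst w)) \<in> borel_measurable (YM \<Otimes>\<^sub>M Pr')"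
proof (rule lik_measurable)
  fix l k assume "l < p" "k < d"
  then have "(\<lambda>\<beta>. \<beta> (l,k)) \<in> borel_measurable PB" by (intro PB_component) auto
  then show "(\<lambda>w. fst (snd w) (l,k)) \<in> borel_measurable (YM \<Otimes>\<^sub>M Pr')" by measurable
next
  fix i l assume "i < d" "l < d"
  then have "(\<lambda>x. SigPD d x (i,l)) \<in> borel_measurable PDm" by (rule SigPD_component)
  then show "(\<lambda>w. SigPD d (snd (snd w)) (i,l)) \<in> borel_measurable (YM \<Otimes>\<^sub>M Pr')" by measurable
next
  fix i k assume "i < n" "k < d"
  then have "(\<lambda>Y. Y (i,k)) \<in> borel_measurable YM" by (intro component_borel) auto
  then show "(\<lambda>w. fst w (i,k)) \<in> borel_measurable (YM \<Otimes>\<^sub>M Pr')" by measurable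
qed

text \<open>Tonelli: the likelihood integrates to 1 over samples for almost every parameter, so the
  integrated numerator over W is at most the prior mass of W.\<close>

lemma tail_numerator:
  assumes W: "W \<in> sets Pr'"
  defines "T \<equiv> \<lambda>Y. \<integral>\<^sup>+ z. indicator W z * ennreal (lik n p d X (fst z) (SigPD d (snd z)) Y) \<partial>Pr'"
  shows "T \<in> borel_measurable YM" "(\<integral>\<^sup>+ Y. T Y \<partial>YM) \<le> emeasure Pr' W"
proof -
  interpret B: finite_measure PB by (rule finite_measure_PB)
  interpret D: finite_measure PDm by (rule finite_measure_PD)
  interpret BD: pair_sigma_finite PB PDm ..
  interpret ps: product_sigma_finite "\<lambda>_. lborel :: real measure" by standard
  interpret YS: sigma_finite_measure YM by (rule ps.sigma_finite) simp
  interpret YP: pair_sigma_finite YM Pr' ..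
  have m: "(\<lambda>w. indicator W (snd w) * ennreal (lik n p d X (fst (snd w)) (SigPD d (snd (snd w))) (fst w))) \<in> borel_measurable (YM \<Otimes>\<^sub>M Pr')"
    using lik_joint_measurable' W by measurable
  show "T \<in> borel_measurable YM"
    unfolding T_def using BD.P.borel_measurable_nn_integral_fst[OF m] by simp
  have "(\<integral>\<^sup>+ Y. T Y \<partial>YM) = (\<integral>\<^sup>+ z. \<integral>\<^sup>+ Y. indicator W z * ennreal (lik n p d X (fst z) (SigPD d (snd z)) Y) \<partial>YM \<partial>Pr')"
    unfolding T_def using YP.Fubini[OF m] by simp
  also have "\<dots> \<le> (\<integral>\<^sup>+ z. indicator W z \<partial>Pr')"
  proof (rule nn_integral_mono_AE)
    \<comment> \<open>The exceptional set is enlarged to a measurable null set, so that its cylinder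
      is a measurable null set of the product.\<close>
    obtain N where N: "{x \<in> space PDm. \<not> spd d (SigPD d x)} \<subseteq> N" "emeasure PDm N = 0" "N \<in> sets PDm"
      using AE_spd by (rule AE_E)
    have "emeasure Pr' (space PB \<times> N) = 0"
      using N by (simp add: D.emeasure_pair_measure_Times)
    then have "space PB \<times> N \<in> null_sets Pr'" using N by (auto simp: null_sets_def)
    then have "AE z in Pr'. spd d (SigPD d (snd z))"
      by (rule AE_I') (use N(1) in \<open>auto simp: space_pair_measure\<close>)
    then show "AE z in Pr'. (\<integral>\<^sup>+ Y. indicator W z * ennreal (lik n p d X (fst z) (SigPD d (snd z)) Y) \<partial>YM) \<le> indicator W z"
    proof (rule AE_mp, intro AE_I2 impI)
      fix z :: "rmat \<times> rmat \<times> (nat \<Rightarrow> real)" assume s: "spd d (SigPD d (snd z))"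
      have "(\<integral>\<^sup>+ Y. indicator W z * ennreal (lik n p d X (fst z) (SigPD d (snd z)) Y) \<partial>YM)
        = indicator W z * (\<integral>\<^sup>+ Y. ennreal (lik n p d X (fst z) (SigPD d (snd z)) Y) \<partial>YM)"
        using lik_measurable_Y by (intro nn_integral_cmult) simp
      then show "(\<integral>\<^sup>+ Y. indicator W z * ennreal (lik n p d X (fst z) (SigPD d (snd z)) Y) \<partial>YM) \<le> indicator W z"
        by (simp add: nn_integral_lik[OF s])
    qed
  qed
  also have "\<dots> = emeasure Pr' W" using W by simp
  finally show "(\<integral>\<^sup>+ Y. T Y \<partial>YM) \<le> emeasure Pr' W" .
qed

text \<open>On the product of the two neighbourhoods the likelihood dominates the true one for every
  sample. With \<eta> = 1/n^3 the normalising constants cost exp(2 n d \<eta>) \<le> exp 2 and the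
  mean shift of size n^(-4) costs at most exp(1/b1). Both constants are absorbed by rate \<ge> 1,
  which explains the summand 2 + 1/b1 in the exponent.\<close>

lemma evidence:
  assumes \<beta>0: "\<beta>0 \<in> B0_set n G p d grp lam s0" and S0: "S0 \<in> H0_set d b1 b2" and rn: "rate \<le> real n"
    and N: "N \<in> sets PDm" "\<And>x. x \<in> N \<Longrightarrow> spd d (SigPD d x)"
      "\<And>x v. x \<in> N \<Longrightarrow> (1 + 1 / real n ^ 3) * bf d S0 v v \<le> bf d (SigPD d x) v v \<and> bf d (SigPD d x) v v \<le> (1 + 4 / real n ^ 3) * bf d S0 v v"
      "ennreal (exp (- CP * (real d)\<^sup>2 * L)) \<le> emeasure PDm N" and CP: "CP > 0"
    and Y: "Y \<in> space YM"
  shows "ennreal (exp (- (C1 + CP + 2 + 1 / b1) * rate) * lik n p d X \<beta>0 S0 Y) \<le> (\<integral>\<^sup>+ \<theta>. ennreal (lik n p d X (fst \<theta>) (snd \<theta>) Y) \<partial>Pr)"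
proof -
  interpret D: finite_measure PDm by (rule finite_measure_PD)
  obtain A where A: "A \<in> sets (mspace {0..<p} {0..<d})" "\<And>\<beta>. \<beta> \<in> A \<Longrightarrow> xdist n p d X \<beta>0 \<beta> \<le> 1 / real n ^ 4"
    "ennreal (exp (- C1 * rate)) \<le> emeasure PB A" using prior_beta_near[OF \<beta>0 rn] by blast
  note S0f = H0_set_facts[OF S0 b(1)]
  define \<eta> where "\<eta> = 1 / real n ^ 3"
  have \<eta>: "\<eta> > 0" using n3 by (simp add: \<eta>_def)
  define K where "K = exp (- (2 + 1 / b1) * rate)"
  have dom: "K * lik n p d X \<beta>0 S0 Y \<le> lik n p d X \<beta> (SigPD d x) Y" if \<beta>: "\<beta> \<in> A" and x: "x \<in> N" for \<beta> x
  proof -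
    have "lik n p d X \<beta>0 S0 Y \<le> sqrt (1 + 4 * \<eta>) ^ (n * d) * exp (xdist n p d X \<beta>0 \<beta> / (2 * b1 * \<eta>)) * lik n p d X \<beta> (SigPD d x) Y"
    proof (rule lik_dominated[OF S0f(1) N(2)[OF x] _ _ S0f(2) b(1) \<eta>])
      show "(1 + \<eta>) * bf d S0 v v \<le> bf d (SigPD d x) v v" "bf d (SigPD d x) v v \<le> (1 + 4 * \<eta>) * bf d S0 v v" for v
        using N(3)[OF x, of v] by (simp_all add: \<eta>_def)
    qed (use \<eta> in simp)
    also have "\<dots> \<le> exp ((2 + 1 / b1) * rate) * lik n p d X \<beta> (SigPD d x) Y"
    proof (rule mult_right_mono)
      have "sqrt (1 + 4 * \<eta>) ^ (n * d) \<le> exp (2 * \<eta>) ^ (n * d)"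
      proof (rule power_mono)
        have "1 + 4 * \<eta> \<le> exp (4 * \<eta>)" by (rule exp_ge_add_one_self)
        also have "\<dots> = (exp (2 * \<eta>))\<^sup>2" by (simp add: power2_eq_square exp_add[symmetric])
        finally show "sqrt (1 + 4 * \<eta>) \<le> exp (2 * \<eta>)" by (intro real_le_lsqrt) (use \<eta> in auto)
      qed (use \<eta> in auto)
      also have "\<dots> = exp (real (n * d) * (2 * \<eta>))" by (rule exp_of_nat_mult[symmetric])
      also have "\<dots> \<le> exp 2"
      proof -
        have "real (n * d) \<le> real n ^ 3"
        proof -
          have "real n * real d \<le> real n * (real n * real n)"
            using dn n3 mult_mono[of 1 "real n" "real d" "real n"] by (intro mult_left_mono) auto
          then show ?thesis by (simp add: power3_eq_cube mult.assoc)
        qed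
        then have "real (n * d) * (2 * \<eta>) \<le> real n ^ 3 * (2 * \<eta>)" using \<eta> by (intro mult_right_mono) auto
        also have "\<dots> = 2" using n3 by (simp add: \<eta>_def)
        finally show ?thesis by simp
      qed
      finally have 1: "sqrt (1 + 4 * \<eta>) ^ (n * d) \<le> exp 2" .
      have "xdist n p d X \<beta>0 \<beta> / (2 * b1 * \<eta>) \<le> (1 / real n ^ 4) / (2 * b1 * \<eta>)"
        using A(2)[OF \<beta>] b \<eta> by (intro divide_right_mono) auto
      also have "\<dots> = 1 / (2 * b1 * real n)" using n3 by (simp add: \<eta>_def power_numeral_reduce)
      also have "\<dots> \<le> 1 / b1" using b n3 by (intro divide_left_mono) (auto simp: mult_ac)
      finally have "sqrt (1 + 4 * \<eta>) ^ (n * d) * exp (xdist n p d X \<beta>0 \<beta> / (2 * b1 * \<eta>)) \<le> exp 2 * exp (1 / b1)"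
        using 1 by (intro mult_mono) auto
      also have "\<dots> = exp ((2 + 1 / b1) * 1)" by (simp add: exp_add)
      also have "\<dots> \<le> exp ((2 + 1 / b1) * rate)" unfolding exp_le_cancel_iff using rate_ge(4) b by (intro mult_left_mono) auto
      finally show "sqrt (1 + 4 * \<eta>) ^ (n * d) * exp (xdist n p d X \<beta>0 \<beta> / (2 * b1 * \<eta>)) \<le> exp ((2 + 1 / b1) * rate)" .
    qed (rule lik_nonneg)
    finally have "K * lik n p d X \<beta>0 S0 Y \<le> K * (exp ((2 + 1 / b1) * rate) * lik n p d X \<beta> (SigPD d x) Y)"
      by (rule mult_left_mono) (simp add: K_def)
    also have "\<dots> = lik n p d X \<beta> (SigPD d x) Y"
    proof -
      have "K * exp ((2 + 1 / b1) * rate) = 1" unfolding K_def exp_add[symmetric] mult_minus_left left_minus by (rule exp_zero)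
      then show ?thesis by (simp only: mult.assoc[symmetric] mult_1)
    qed
    finally show ?thesis .
  qed
  have AN: "A \<times> N \<in> sets Pr'" using A(1) N(1) sets_PB by (intro pair_measureI) auto
  have "exp (- (C1 + CP + 2 + 1 / b1) * rate) \<le> exp (- C1 * rate) * exp (- CP * (real d)\<^sup>2 * L) * K"
  proof -
    have "CP * ((real d)\<^sup>2 * L) \<le> CP * rate" using CP rate_ge(2) by (intro mult_left_mono) auto
    then show ?thesis unfolding K_def exp_add[symmetric] by (simp add: algebra_simps)
  qed
  then have "ennreal (exp (- (C1 + CP + 2 + 1 / b1) * rate) * lik n p d X \<beta>0 S0 Y)
    \<le> ennreal (exp (- C1 * rate) * exp (- CP * (real d)\<^sup>2 * L) * K * lik n p d X \<beta>0 S0 Y)"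
    by (intro ennreal_leI mult_right_mono lik_nonneg)
  also have "\<dots> = ennreal (exp (- C1 * rate)) * ennreal (exp (- CP * (real d)\<^sup>2 * L)) * ennreal (K * lik n p d X \<beta>0 S0 Y)"
    using lik_nonneg by (simp add: ennreal_mult K_def mult.assoc)
  also have "\<dots> \<le> emeasure PB A * emeasure PDm N * ennreal (K * lik n p d X \<beta>0 S0 Y)"
    by (intro mult_mono A N) auto
  also have "\<dots> = ennreal (K * lik n p d X \<beta>0 S0 Y) * emeasure Pr' (A \<times> N)"
    using A(1) N(1) sets_PB by (subst D.emeasure_pair_measure_Times) (auto simp: mult.commute)
  also have "\<dots> = (\<integral>\<^sup>+ z. ennreal (K * lik n p d X \<beta>0 S0 Y) * indicator (A \<times> N) z \<partial>Pr')"
    using AN by (simp add: nn_integral_cmult_indicator)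
  also have "\<dots> \<le> (\<integral>\<^sup>+ z. ennreal (lik n p d X (fst z) (SigPD d (snd z)) Y) \<partial>Pr')"
    by (intro nn_integral_mono) (auto split: split_indicator intro!: ennreal_leI dom)
  also have "\<dots> = (\<integral>\<^sup>+ \<theta>. ennreal (lik n p d X (fst \<theta>) (snd \<theta>) Y) \<partial>Pr)"
    using nn_integral_Pr(1)[OF lik_measurable_theta[OF Y]] by simp
  finally show ?thesis .
qed

end

section \<open>The sieve and its cells\<close>

lemma frob2_L2: "frob2 R C A = (L2_set A (R \<times> C))\<^sup>2"
  unfolding frob2_def L2_set_def by (simp add: sum_nonneg sum.cartesian_product case_prod_beta')

text \<open>Cauchy-Schwarz between the entries of A and those of the rank one matrix v v'.\<close>

lemma bf_le_frob: "bf d A v v \<le> sqrt (frob2 {0..<d} {0..<d} A) * sq d v"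
proof -
  have "bf d A v v = (\<Sum>x\<in>{0..<d} \<times> {0..<d}. A x * (v (fst x) * v (snd x)))"
    unfolding bf_def by (simp add: sum.cartesian_product atLeast0LessThan case_prod_beta' mult_ac)
  also have "\<dots> \<le> L2_set A ({0..<d} \<times> {0..<d}) * L2_set (\<lambda>x. v (fst x) * v (snd x)) ({0..<d} \<times> {0..<d})"
  proof -
    have "(\<Sum>x\<in>{0..<d} \<times> {0..<d}. A x * (v (fst x) * v (snd x))) \<le> (\<Sum>x\<in>{0..<d} \<times> {0..<d}. \<bar>A x\<bar> * \<bar>v (fst x) * v (snd x)\<bar>)"
      by (intro sum_mono) (metis abs_ge_self abs_mult)
    then show ?thesis by (rule order_trans[OF _ L2_set_mult_ineq])
  qed
  also have "L2_set (\<lambda>x. v (fst x) * v (snd x)) ({0..<d} \<times> {0..<d}) = sq d v"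
  proof -
    have "(\<Sum>x\<in>{0..<d} \<times> {0..<d}. (v (fst x) * v (snd x))\<^sup>2) = (sq d v)\<^sup>2"
      unfolding sq_def power2_eq_square[of "sum _ _"] sum_product
      by (simp add: sum.cartesian_product atLeast0LessThan case_prod_beta' power_mult_distrib)
    then show ?thesis by (simp add: L2_set_def)
  qed
  finally show ?thesis by (simp add: frob2_L2)
qed

text \<open>A nonempty set of size at most k + 1 arises by inserting one element into a set of size
  at most k; each step multiplies the count by at most \<open>card A + 1\<close>.\<close>

lemma card_models_le:
  fixes A :: "'a set"
  assumes "finite A" shows "card {S. S \<subseteq> A \<and> card S \<le> k} \<le> (card A + 1) ^ k"
proof (induction k)
  case 0
  have "S = {}" if "S \<subseteq> A" "card S \<le> 0" for S using finite_subset[OF that(1) assms] that(2) by simp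
  then have "{S. S \<subseteq> A \<and> card S \<le> 0} \<subseteq> {{}}" by blast
  from card_mono[OF _ this] show ?case by simp
next
  case (Suc k)
  let ?P = "\<lambda>k. {S. S \<subseteq> A \<and> card S \<le> k}"
  have fin: "finite (?P k)" using finite_subset[of "?P k" "Pow A"] assms by auto
  have "?P (Suc k) \<subseteq> ?P k \<union> (\<lambda>(a,S). insert a S) ` (A \<times> ?P k)"
  proof
    fix S assume S: "S \<in> ?P (Suc k)"
    show "S \<in> ?P k \<union> (\<lambda>(a,S). insert a S) ` (A \<times> ?P k)"
    proof (cases "S = {}")
      case False
      then obtain a where a: "a \<in> S" by auto
      have fS: "finite S" using S assms finite_subset by auto
      have "S = insert a (S - {a})" using a by auto
      moreover have "S - {a} \<in> ?P k" using S a fS by auto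
      ultimately show ?thesis using S a by (intro UnI2 image_eqI[of _ _ "(a, S - {a})"]) auto
    qed auto
  qed
  then have "card (?P (Suc k)) \<le> card (?P k \<union> (\<lambda>(a,S). insert a S) ` (A \<times> ?P k))"
    using fin assms by (intro card_mono) auto
  also have "\<dots> \<le> card (?P k) + card ((\<lambda>(a,S). insert a S) ` (A \<times> ?P k))" by (rule card_Un_le)
  also have "\<dots> \<le> card (?P k) + card A * card (?P k)"
    using card_image_le[of "A \<times> ?P k" "\<lambda>(a,S). insert a S"] fin assms by (simp add: card_cartesian_product)
  also have "\<dots> = (card A + 1) * card (?P k)" by simp
  also have "\<dots> \<le> (card A + 1) * (card A + 1) ^ k" by (intro mult_left_mono Suc.IH) simp
  finally show ?case by simp
qed

lemma abs_floor_le: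
  fixes x :: real assumes "\<bar>x\<bar> \<le> real K" shows "\<lfloor>x\<rfloor> \<in> {- int K..int K}"
  using assms by (auto simp: abs_le_iff le_floor_iff floor_le_iff)

section \<open>The sieve, the prior mass outside it, and the comparison of likelihoods within a
  cell\<close>

context model_Sigma
begin

definition Ms :: "nat \<Rightarrow> (nat \<times> nat) set set" where "Ms s = {S. S \<subseteq> II \<and> card S \<le> s}"

text \<open>Magnitudes are measured after weighting with \<lambda>, the scale in which the slab has
  exponential tails; the threshold n yields exp(-n/2). The lower bound on \<lambda> converts this
  into a polynomial bound on \<open>circ\<close> times the coefficients.\<close>

definition Sb :: "nat \<Rightarrow> rmat set" where
  "Sb s = {\<beta> \<in> space PB. (\<exists>S\<in>Ms s. \<forall>x\<in>JJ - coords grp S. \<beta> x = 0) \<and> (\<forall>j\<in>{..<G}. \<forall>k\<in>{..<d}. lam k * gnorm grp \<beta> j k \<le> real n)}"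

lemma finite_Ms: "finite (Ms s)"
  by (rule finite_subset[of _ "Pow II"]) (auto simp: Ms_def)

lemma Sb_sets: "Sb s \<in> sets PB"
proof -
  have a: "{\<beta> \<in> space PB. \<forall>x\<in>JJ - coords grp S. \<beta> x = 0} \<in> sets PB" for S
  proof (rule sets.sets_Collect_finite_All)
    fix x assume "x \<in> JJ - coords grp S"
    then have [measurable]: "(\<lambda>\<beta>. \<beta> x) \<in> borel_measurable PB" by (intro PB_component) auto
    show "{\<beta> \<in> space PB. \<beta> x = 0} \<in> sets PB" by measurable
  qed simp
  have b: "{\<beta> \<in> space PB. lam k * gnorm grp \<beta> j k \<le> real n} \<in> sets PB" if "j < G" "k < d" for j k
  proof -
    have "(\<lambda>\<beta>. \<Sum>l\<in>grp j. (\<beta> (l,k))\<^sup>2) \<in> borel_measurable PB"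
      using grp_sub[OF that(1)] that(2) by (intro borel_measurable_sum borel_measurable_power PB_component) auto
    then have [measurable]: "(\<lambda>\<beta>. gnorm grp \<beta> j k) \<in> borel_measurable PB" unfolding gnorm_def by measurable
    show ?thesis by measurable
  qed
  have "{\<beta> \<in> space PB. \<exists>S\<in>Ms s. \<forall>x\<in>JJ - coords grp S. \<beta> x = 0} \<in> sets PB"
    by (rule sets.sets_Collect_finite_Ex[OF a finite_Ms])
  moreover have "{\<beta> \<in> space PB. \<forall>j\<in>{..<G}. \<forall>k\<in>{..<d}. lam k * gnorm grp \<beta> j k \<le> real n} \<in> sets PB"
    by (intro sets.sets_Collect_finite_All b) auto
  ultimately show ?thesis unfolding Sb_def using sets.sets_Collect_conj by fastforce
qed

lemma card_coords_le: "S \<subseteq> II \<Longrightarrow> card (coords grp S) \<le> card S * pm"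
proof -
  assume S: "S \<subseteq> II"
  have "card (coords grp S) \<le> (\<Sum>x\<in>S. pm)"
    unfolding card_coords[OF S] using S by (intro sum_mono) (auto intro!: card_grp_le_pm)
  then show ?thesis by simp
qed

text \<open>The dimension \<open>s1\<close> is close to \<open>K * rate / Lg\<close>. The right-hand
  inequality makes dimensions beyond \<open>s1\<close> cost exp(-(A4/2) K rate). The left-hand one
  limits the active coordinates to K rate, so the factor 2 per coordinate in
  \<open>beta_given_S_tail\<close> stays below exp(K rate).\<close>

lemma PB_tail:
  assumes A2: "A2 * exp (- A4 * Lg) \<le> exp (- (A4 / 2) * Lg)" and K: "K > 0"
    and s1: "real s1 * Lg \<le> K * rate" "K * rate \<le> (real s1 + 1) * Lg"
  shows "emeasure PB (space PB - Sb s1) \<le> ennreal (2 * exp (- (A4 / 2) * K * rate) + exp (K * rate - real n / 2))"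
proof -
  have spm: "real (s1 * pm) \<le> K * rate"
    using s1(1) mult_left_mono[OF Lg_ge(5), of "real s1"] by simp
  have "emeasure PB (space PB - Sb s1) \<le> emeasure (measure_pmf pr) {s. s1 < s} + ennreal (exp (- real n / 2) * exp (K * rate))"
  proof (rule prior_beta_tail[OF supp lam_nonneg])
    show "space PB - Sb s1 \<in> sets (mspace {0..<p} {0..<d})" using Sb_sets sets_PB by auto
  next
    fix S assume S: "S \<subseteq> II" "card S \<le> s1"
    have "emeasure (beta_given_S p d grp lam S) (space PB - Sb s1) \<le> ennreal (exp (- real n / 2) * 2 ^ card (coords grp S))"
    proof (rule beta_given_S_tail[OF S(1) lam_nonneg])
      show "space PB - Sb s1 \<in> sets (mspace {0..<p} {0..<d})" using Sb_sets sets_PB by auto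
    next
      fix \<beta> assume \<beta>: "\<beta> \<in> space PB - Sb s1" "gsupp G d grp \<beta> \<subseteq> S"
      have "\<beta> x = 0" if x: "x \<in> JJ - coords grp S" for x
      proof (rule ccontr)
        assume nz: "\<beta> x \<noteq> 0"
        define l k where "l = fst x" and "k = snd x"
        have lk: "x = (l,k)" "l < p" "k < d" using x by (auto simp: l_def k_def)
        then have "l \<in> (\<Union>j<G. grp j)" unfolding grp_cover by simp
        then obtain j where j: "j < G" "l \<in> grp j" by auto
        then have "(j,k) \<in> S" using \<beta>(2) nz lk by (auto simp: gsupp_def)
        then show False using x j lk by (auto simp: coords_def)
      qed
      moreover have "S \<in> Ms s1" using S by (simp add: Ms_def)
      ultimately have "\<not> (\<forall>j\<in>{..<G}. \<forall>k\<in>{..<d}. lam k * gnorm grp \<beta> j k \<le> real n)" using \<beta>(1) by (auto simp: Sb_def)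
      then obtain j k where jk: "j < G" "k < d" "real n < lam k * gnorm grp \<beta> j k" by (auto simp: not_le)
      then have "gnorm grp \<beta> j k \<noteq> 0" using n3 by auto
      then have "(\<Sum>l\<in>grp j. (\<beta> (l,k))\<^sup>2) \<noteq> 0" by (simp add: gnorm_def)
      then have "\<exists>l\<in>grp j. (\<beta> (l,k))\<^sup>2 \<noteq> 0" by (meson sum.not_neutral_contains_not_neutral)
      then have "\<exists>l\<in>grp j. \<beta> (l,k) \<noteq> 0" by simp
      then have "(j,k) \<in> S" using \<beta>(2) jk by (auto simp: gsupp_def)
      then show "\<exists>(j,k)\<in>S. real n < lam k * gnorm grp \<beta> j k" using jk by auto
    qed
    also have "\<dots> \<le> ennreal (exp (- real n / 2) * exp (K * rate))"
    proof (intro ennreal_leI mult_left_mono)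
      have "card (coords grp S) \<le> s1 * pm" using card_coords_le[OF S(1)] S(2) by (meson le_trans mult_le_mono1)
      then have c: "real (card (coords grp S)) \<le> K * rate" using spm by (meson of_nat_le_iff order_trans)
      have "(2::real) ^ card (coords grp S) \<le> exp 1 ^ card (coords grp S)"
        using exp_ge_add_one_self[of "1::real"] by (intro power_mono) auto
      also have "\<dots> = exp (real (card (coords grp S)))" by (simp add: exp_of_nat_mult[symmetric])
      also have "\<dots> \<le> exp (K * rate)" using c by simp
      finally show "(2::real) ^ card (coords grp S) \<le> exp (K * rate)" .
    qed simp
    finally show "emeasure (beta_given_S p d grp lam S) (space PB - Sb s1) \<le> ennreal (exp (- real n / 2) * exp (K * rate))" .
  qed
  also have "emeasure (measure_pmf pr) {s. s1 < s} \<le> ennreal (2 * exp (- (A4 / 2) * K * rate))"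
  proof (rule order_trans[OF dim_tail], rule ennreal_leI)
    have "(A2 * exp (- A4 * Lg)) ^ Suc s1 \<le> exp (- (A4 / 2) * Lg) ^ Suc s1"
      using A2 cpos by (intro power_mono) auto
    also have "\<dots> = exp (real (Suc s1) * (- (A4 / 2) * Lg))" by (rule exp_of_nat_mult[symmetric])
    also have "\<dots> \<le> exp (- (A4 / 2) * K * rate)"
      using mult_left_mono[OF s1(2), of "A4 / 2"] cpos by (simp add: algebra_simps)
    finally show "2 * (A2 * exp (- A4 * Lg)) ^ Suc s1 \<le> 2 * exp (- (A4 / 2) * K * rate)" by simp
  qed
  also have "ennreal (2 * exp (- (A4 / 2) * K * rate)) + ennreal (exp (- real n / 2) * exp (K * rate))
    = ennreal (2 * exp (- (A4 / 2) * K * rate) + exp (K * rate - real n / 2))"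
    by (subst ennreal_plus[symmetric]) (auto simp: exp_add[symmetric])
  finally show ?thesis by (simp add: add_mono)
qed

definition Good :: "nat \<Rightarrow> (rmat \<times> rmat \<times> (nat \<Rightarrow> real)) set" where
  "Good s = Sb s \<times> PDgood d (real n)"

lemma Good_sets: "Good s \<in> sets Pr'"
  unfolding Good_def using Sb_sets PD_tail(1)[of "real n"] n3 by (intro pair_measureI) auto

lemma CI_pow: "CI ^ d \<le> exp (ln CI * rate)"
proof -
  have "CI ^ d = exp (real d * ln CI)" using CI(1) by (simp add: exp_of_nat_mult)
  also have "\<dots> \<le> exp (rate * ln CI)" using CI(1) rate_ge(5) by (simp add: mult_right_mono)
  finally show ?thesis by (simp add: mult.commute)
qed

lemma Pr'_mass: "emeasure Pr' (space Pr') \<le> ennreal (CI ^ d)"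
proof -
  interpret D: finite_measure PDm by (rule finite_measure_PD)
  have "emeasure Pr' (space Pr') = emeasure PB (space PB) * emeasure PDm (space PDm)"
    unfolding space_pair_measure by (rule D.emeasure_pair_measure_Times) auto
  also have "\<dots> \<le> 1 * ennreal (CI ^ d)"
    by (intro mult_mono PD_mass prior_beta_le_1[OF supp lam_nonneg]) auto
  finally show ?thesis by simp
qed

text \<open>Two strips cover the complement, one failing in \<beta> and one in the spectrum; each is
  a product set. The factors d and \<open>CI ^ d\<close> are turned into exponentials of the
  rate.\<close>

lemma Good_tail:
  assumes A2: "A2 * exp (- A4 * Lg) \<le> exp (- (A4 / 2) * Lg)" and K: "K > 0"
    and s1: "real s1 * Lg \<le> K * rate" "K * rate \<le> (real s1 + 1) * Lg"
  shows "emeasure Pr' (space Pr' - Good s1) \<le> ennreal (exp (ln CI * rate) *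
    (2 * exp (- (A4 / 2) * K * rate) + exp (K * rate - real n / 2) + exp (rate - cI * real n)))"
proof -
  interpret D: finite_measure PDm by (rule finite_measure_PD)
  define x where "x = 2 * exp (- (A4 / 2) * K * rate) + exp (K * rate - real n / 2)"
  have x0: "x \<ge> 0" by (simp add: x_def)
  have np: "real n > 0" using n3 by simp
  define W1 where "W1 = (space PB - Sb s1) \<times> space PDm"
  define W2 where "W2 = space PB \<times> (space PDm - PDgood d (real n))"
  have W: "W1 \<in> sets Pr'" "W2 \<in> sets Pr'" unfolding W1_def W2_def
    using Sb_sets PD_tail(1)[OF np] by (auto intro!: pair_measureI)
  have "space Pr' - Good s1 \<subseteq> W1 \<union> W2" by (auto simp: space_pair_measure Good_def W1_def W2_def)
  then have "emeasure Pr' (space Pr' - Good s1) \<le> emeasure Pr' (W1 \<union> W2)" using W by (intro emeasure_mono) auto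
  also have "\<dots> \<le> emeasure Pr' W1 + emeasure Pr' W2" using W by (rule emeasure_subadditive)
  also have "emeasure Pr' W1 = emeasure PB (space PB - Sb s1) * emeasure PDm (space PDm)"
    unfolding W1_def using Sb_sets by (intro D.emeasure_pair_measure_Times) auto
  also have "emeasure Pr' W2 = emeasure PB (space PB) * emeasure PDm (space PDm - PDgood d (real n))"
    unfolding W2_def using PD_tail(1)[OF np] by (intro D.emeasure_pair_measure_Times) auto
  also have "emeasure PB (space PB - Sb s1) * emeasure PDm (space PDm) + emeasure PB (space PB) * emeasure PDm (space PDm - PDgood d (real n))
    \<le> ennreal x * ennreal (CI ^ d) + 1 * ennreal (real d * CI ^ d * exp (- cI * real n))"
    unfolding x_def by (intro add_mono mult_mono PB_tail[OF A2 K s1] PD_mass PD_tail(2)[OF np] prior_beta_le_1[OF supp lam_nonneg]) auto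
  also have "\<dots> = ennreal (CI ^ d * (x + real d * exp (- cI * real n)))"
    using x0 CI(1) by (simp add: ennreal_mult[symmetric] ennreal_plus[symmetric] algebra_simps del: ennreal_plus)
  also have "\<dots> \<le> ennreal (exp (ln CI * rate) * (x + exp (rate - cI * real n)))"
  proof (intro ennreal_leI mult_mono CI_pow add_left_mono)
    have "real d \<le> exp rate" using rate_ge(5) exp_ge_add_one_self[of rate] by linarith
    then have "real d * exp (- cI * real n) \<le> exp rate * exp (- cI * real n)" by (intro mult_right_mono) auto
    then show "real d * exp (- cI * real n) \<le> exp (rate - cI * real n)" by (simp add: exp_add[symmetric])
  qed (use x0 CI in auto)
  finally show ?thesis by (simp add: x_def)
qed

text \<open>On the sieve the eigenvalues are at least 1/n. An entrywise error n^(-8) changes the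
  form of \<Sigma> by at most n^(-7) |v|^2, and 3 n^(-7) \<le> n^(-5) n^(-1) keeps this inside the
  slack created by \<open>infl\<close>.\<close>

definition mesh :: real where "mesh = real n ^ 8"

text \<open>The label of a point. The coefficients are rounded after multiplication by
  \<open>circ\<close>, the only scale in which they influence the fit through
  \<open>xdist_le_gdist\<close>; the number of labels then does not depend on the scale of the
  design.\<close>

definition cell :: "rmat \<times> rmat \<times> (nat \<Rightarrow> real) \<Rightarrow> (nat \<times> nat \<Rightarrow> int) \<times> (nat \<times> nat \<Rightarrow> int)" where
  "cell z = (restrict (\<lambda>x. \<lfloor>circ * fst z x * mesh\<rfloor>) JJ, restrict (\<lambda>x. \<lfloor>SigPD d (snd z) x * mesh\<rfloor>) ({0..<d} \<times> {0..<d}))"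

lemma mesh_pos: "mesh > 0"
  using n3 by (simp add: mesh_def)

text \<open>Two points of one cell may have different supports, so the comparison runs over the
  union of two admissible supports, with at most 2 n coordinates, each differing by at most 1/mesh
  after scaling. The design norm 0 leaves nothing to show.\<close>

lemma cell_beta:
  assumes z: "z \<in> Good s1" "z' \<in> Good s1" "cell z = cell z'" and s1: "real s1 * real pm \<le> real n"
  shows "xdist n p d X (fst z) (fst z') \<le> 4 / real n ^ 14"
proof -
  obtain S where S: "S \<subseteq> II" "card S \<le> s1" "\<forall>x\<in>JJ - coords grp S. fst z x = 0" using z(1) by (auto simp: Good_def Sb_def Ms_def)
  obtain S' where S': "S' \<subseteq> II" "card S' \<le> s1" "\<forall>x\<in>JJ - coords grp S'. fst z' x = 0" using z(2) by (auto simp: Good_def Sb_def Ms_def)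
  define T where "T = S \<union> S'"
  have T: "T \<subseteq> II" using S S' by (auto simp: T_def)
  have Tc: "coords grp S \<subseteq> coords grp T" "coords grp S' \<subseteq> coords grp T" by (auto simp: T_def coords_def)
  have "card (coords grp T) \<le> 2 * (s1 * pm)"
  proof -
    have "card T \<le> 2 * s1" using card_Un_le[of S S'] S(2) S'(2) by (simp add: T_def)
    then have "card T * pm \<le> 2 * s1 * pm" by (rule mult_le_mono1)
    then show ?thesis using card_coords_le[OF T] unfolding mult.assoc[symmetric] by (rule le_trans[rotated])
  qed
  then have cT: "real (card (coords grp T)) \<le> 2 * real n" using s1
    by (metis (mono_tags, opaque_lifting) mult_left_mono of_nat_le_iff of_nat_mult of_nat_numeral order_trans zero_le_numeral)
  have "circ * gdist (fst z) (fst z') \<le> 2 / real n ^ 7"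
  proof (cases "circ = 0")
    case False
    then have c: "circ > 0" using circ_nonneg by simp
    have "gdist (fst z) (fst z') \<le> real (card (coords grp T)) * (1 / (circ * mesh))"
    proof (rule gdist_le[OF T])
      fix x assume "x \<in> coords grp T"
      then have xJ: "x \<in> JJ" using coords_sub[OF T] by blast
      have "\<lfloor>circ * fst z x * mesh\<rfloor> = \<lfloor>circ * fst z' x * mesh\<rfloor>"
        using fun_cong[OF arg_cong[OF z(3), of fst], of x] xJ by (simp add: cell_def)
      then have "\<bar>circ * fst z x - circ * fst z' x\<bar> \<le> 1 / mesh" by (rule floor_eq_close[OF mesh_pos])
      then have "circ * \<bar>fst z x - fst z' x\<bar> \<le> 1 / mesh" using c by (simp add: abs_mult right_diff_distrib[symmetric])
      then show "\<bar>fst z x - fst z' x\<bar> \<le> 1 / (circ * mesh)" using c mesh_pos by (simp add: field_simps)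
    next
      fix x assume x: "x \<in> JJ" "x \<notin> coords grp T"
      then have "x \<in> JJ - coords grp S" "x \<in> JJ - coords grp S'" using Tc by auto
      then have "fst z x = 0" "fst z' x = 0" using S(3) S'(3) by blast+
      then show "fst z x = fst z' x" by simp
    qed (use c mesh_pos in simp)
    then have "circ * gdist (fst z) (fst z') \<le> circ * (real (card (coords grp T)) * (1 / (circ * mesh)))" using c by (intro mult_left_mono) auto
    also have "\<dots> = real (card (coords grp T)) / mesh" using c by simp
    also have "\<dots> \<le> 2 * real n / mesh" using cT mesh_pos by (intro divide_right_mono) auto
    also have "\<dots> = 2 / real n ^ 7" using n3 by (simp add: mesh_def power_numeral_reduce)
    finally show ?thesis .
  qed simp
  then have "(circ * gdist (fst z) (fst z'))\<^sup>2 \<le> (2 / real n ^ 7)\<^sup>2"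
    using circ_nonneg gdist_nonneg by (intro power_mono) auto
  also have "\<dots> = 4 / real n ^ 14" by (simp add: power_divide power_mult[symmetric])
  finally show ?thesis using xdist_le_gdist[OF G1, of n X "fst z" "fst z'"] by (simp add: circ_def)
qed

lemma cell_Sigma:
  assumes "cell z = cell z'" "i < d" "l < d"
  shows "\<bar>SigPD d (snd z) (i,l) - SigPD d (snd z') (i,l)\<bar> \<le> 1 / mesh"
proof (rule floor_eq_close[OF mesh_pos])
  have "(i,l) \<in> {0..<d} \<times> {0..<d}" using assms by simp
  then show "\<lfloor>SigPD d (snd z) (i,l) * mesh\<rfloor> = \<lfloor>SigPD d (snd z') (i,l) * mesh\<rfloor>"
    using fun_cong[OF arg_cong[OF assms(1), of snd], of "(i,l)"] by (simp add: cell_def)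
qed

text \<open>Inflating the covariance of one point of a cell makes its likelihood dominate, up to a constant
  factor, the likelihoods of all points of the cell; no test functions and no entropy integrals are needed.\<close>

definition infl :: "rmat \<times> (nat \<Rightarrow> real) \<Rightarrow> rmat" where
  "infl x = (\<lambda>il. (1 + 2 / real n ^ 5) * SigPD d x il)"

lemma bf_infl: "bf d (infl x) v v = (1 + 2 / real n ^ 5) * bf d (SigPD d x) v v"
  by (simp add: bf_def infl_def sum_distrib_left mult_ac)

lemma spd_infl:
  assumes "x \<in> PDgood d (real n)" shows "spd d (infl x)"
proof -
  have np: "real n > 0" using n3 by simp
  note s = spd_SigPD[OF assms np]
  show ?thesis unfolding spd_def
  proof (intro conjI exI[of _ "1 / real n"] allI)
    show "symm d (infl x)" using symm_SigPD[of d x] by (auto simp: symm_def infl_def)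
    fix v
    have "0 \<le> 1 / real n * sq d v" using np by simp
    then have "0 \<le> bf d (SigPD d x) v v" using s(2)[of v] by linarith
    then have "1 * bf d (SigPD d x) v v \<le> (1 + 2 / real n ^ 5) * bf d (SigPD d x) v v" by (intro mult_right_mono) auto
    then show "1 / real n * sq d v \<le> bf d (infl x) v v" using s(2)[of v] by (simp add: bf_infl)
  qed (use np in simp)
qed

text \<open>With \<eta> = n^(-5), the inflation 1 + 2 \<eta> of the representative leaves at least 1
  + \<eta> relative to any other point of the cell after the rounding error, and at most 1 + 4
  \<eta>. The constant exp 4 consists of exp 2 for the normalising constants, as 2 n d \<eta> \<le>
  2, and exp 2 for the mean shift, which is at most n^(-14) up to a constant.\<close>

lemma cell_dominated:
  assumes z: "z \<in> Good s1" "z' \<in> Good s1" "cell z = cell z'" and s1: "real s1 * real pm \<le> real n"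
  shows "lik n p d X (fst z) (SigPD d (snd z)) Y \<le> exp 4 * lik n p d X (fst z') (infl (snd z')) Y"
proof -
  have np: "real n \<ge> 3" using n3 by simp
  define \<eta> where "\<eta> = 1 / real n ^ 5"
  have \<eta>: "\<eta> > 0" "\<eta> \<le> 1" using np by (auto simp: \<eta>_def)
  have xg: "snd z \<in> PDgood d (real n)" "snd z' \<in> PDgood d (real n)" using z by (auto simp: Good_def)
  have n0: "real n > 0" using np by simp
  note s = spd_SigPD[OF xg(1) n0] and s' = spd_SigPD[OF xg(2) n0]
  define e where "e = 1 / real n ^ 7"
  have pert: "\<bar>bf d (SigPD d (snd z')) v v - bf d (SigPD d (snd z)) v v\<bar> \<le> e * sq d v" for v
  proof -
    have "\<bar>bf d (SigPD d (snd z')) v v - bf d (SigPD d (snd z)) v v\<bar> \<le> real d * (1 / mesh) * sq d v"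
      by (rule bf_perturb) (use cell_Sigma[OF z(3)] mesh_pos in \<open>auto simp: abs_minus_commute\<close>)
    also have "\<dots> \<le> real n * (1 / mesh) * sq d v" using dn mesh_pos by (intro mult_right_mono) auto
    also have "real n * (1 / mesh) = e" using np by (simp add: mesh_def e_def power_numeral_reduce)
    finally show ?thesis .
  qed
  have eb: "3 * e * sq d v \<le> \<eta> * bf d (SigPD d x) v v" if x: "x \<in> PDgood d (real n)" for x v
  proof -
    have "3 * e \<le> \<eta> * (1 / real n)"
      using np by (simp add: e_def \<eta>_def power_numeral_reduce field_simps)
    then have "3 * e * sq d v \<le> \<eta> * (1 / real n) * sq d v" by (rule mult_right_mono) simp
    also have "\<dots> \<le> \<eta> * bf d (SigPD d x) v v"
      unfolding mult.assoc using \<eta> by (intro mult_left_mono spd_SigPD(2)[OF x n0]) simp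
    finally show ?thesis .
  qed
  have lo: "(1 + \<eta>) * bf d (SigPD d (snd z)) v v \<le> bf d (infl (snd z')) v v" for v
  proof -
    have "(1 + \<eta>) * (bf d (SigPD d (snd z)) v v - bf d (SigPD d (snd z')) v v) \<le> (1 + \<eta>) * (e * sq d v)"
      using pert[of v] \<eta> by (intro mult_left_mono) auto
    also have "\<dots> \<le> 2 * (e * sq d v)" using \<eta> by (intro mult_right_mono) (auto simp: e_def)
    also have "\<dots> \<le> 3 * e * sq d v" unfolding mult.assoc by (intro mult_right_mono) (auto simp: e_def)
    also note eb[OF xg(2), of v]
    finally show ?thesis by (simp add: bf_infl \<eta>_def algebra_simps)
  qed
  have hi: "bf d (infl (snd z')) v v \<le> (1 + 4 * \<eta>) * bf d (SigPD d (snd z)) v v" for v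
  proof -
    have "(1 + 2 * \<eta>) * (bf d (SigPD d (snd z')) v v - bf d (SigPD d (snd z)) v v) \<le> (1 + 2 * \<eta>) * (e * sq d v)"
      using pert[of v] \<eta> by (intro mult_left_mono) auto
    also have "\<dots> \<le> 3 * (e * sq d v)" using \<eta> by (intro mult_right_mono) (auto simp: e_def)
    also have "\<dots> = 3 * e * sq d v" by simp
    also note eb[OF xg(1), of v]
    finally have "(1 + 2 * \<eta>) * bf d (SigPD d (snd z')) v v \<le> (1 + 3 * \<eta>) * bf d (SigPD d (snd z)) v v"
      by (simp add: algebra_simps)
    moreover have "0 \<le> \<eta> * bf d (SigPD d (snd z)) v v"
    proof -
      have "0 \<le> 1 / real n * sq d v" using np by simp
      then have "0 \<le> bf d (SigPD d (snd z)) v v" using s(2)[of v] by linarith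
      then show ?thesis using \<eta> by simp
    qed
    ultimately show ?thesis by (simp add: bf_infl \<eta>_def algebra_simps)
  qed
  have "lik n p d X (fst z) (SigPD d (snd z)) Y
    \<le> sqrt (1 + 4 * \<eta>) ^ (n * d) * exp (xdist n p d X (fst z) (fst z') / (2 * (1 / real n) * \<eta>)) * lik n p d X (fst z') (infl (snd z')) Y"
    by (rule lik_dominated[OF s(1) spd_infl[OF xg(2)] lo hi s(2)]) (use \<eta> np in auto)
  also have "\<dots> \<le> exp 4 * lik n p d X (fst z') (infl (snd z')) Y"
  proof (rule mult_right_mono[OF _ lik_nonneg])
    have "sqrt (1 + 4 * \<eta>) ^ (n * d) \<le> exp (2 * \<eta>) ^ (n * d)"
    proof (rule power_mono)
      have "1 + 4 * \<eta> \<le> exp (4 * \<eta>)" by (rule exp_ge_add_one_self)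
      also have "\<dots> = (exp (2 * \<eta>))\<^sup>2" by (simp add: power2_eq_square exp_add[symmetric])
      finally show "sqrt (1 + 4 * \<eta>) \<le> exp (2 * \<eta>)" by (intro real_le_lsqrt) (use \<eta> in auto)
    qed (use \<eta> in auto)
    also have "\<dots> = exp (real (n * d) * (2 * \<eta>))" by (rule exp_of_nat_mult[symmetric])
    also have "\<dots> \<le> exp 2"
    proof -
      have "real (n * d) \<le> real n ^ 2" using dn by (simp add: power2_eq_square mult_left_mono)
      also have "\<dots> \<le> real n ^ 5" using np by (intro power_increasing) auto
      finally have "real (n * d) * (2 * \<eta>) \<le> real n ^ 5 * (2 * \<eta>)" using \<eta> by (intro mult_right_mono) auto
      also have "\<dots> = 2" using np by (simp add: \<eta>_def)
      finally show ?thesis by simp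
    qed
    finally have 1: "sqrt (1 + 4 * \<eta>) ^ (n * d) \<le> exp 2" .
    have "xdist n p d X (fst z) (fst z') / (2 * (1 / real n) * \<eta>) \<le> (4 / real n ^ 14) / (2 * (1 / real n) * \<eta>)"
      using cell_beta[OF z s1] np \<eta> by (intro divide_right_mono) auto
    also have "\<dots> = 2 / real n ^ 8" using np by (simp add: \<eta>_def power_numeral_reduce)
    also have "\<dots> \<le> 2" using np by (simp add: divide_le_eq)
    finally have "exp (xdist n p d X (fst z) (fst z') / (2 * (1 / real n) * \<eta>)) \<le> exp 2" by simp
    then have "sqrt (1 + 4 * \<eta>) ^ (n * d) * exp (xdist n p d X (fst z) (fst z') / (2 * (1 / real n) * \<eta>)) \<le> exp 2 * exp 2"
      using 1 by (intro mult_mono) auto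
    also have "\<dots> = exp 4" by (simp add: exp_add[symmetric])
    finally show "sqrt (1 + 4 * \<eta>) ^ (n * d) * exp (xdist n p d X (fst z) (fst z') / (2 * (1 / real n) * \<eta>)) \<le> exp 4" .
  qed
  finally show ?thesis .
qed

text \<open>The disjunction lets a single argument serve both claims: each of the two events whose
  posterior probability is bounded lies in it.\<close>

definition far :: "real \<Rightarrow> rmat \<Rightarrow> rmat \<Rightarrow> rmat \<times> rmat \<times> (nat \<Rightarrow> real) \<Rightarrow> bool" where
  "far M \<beta>0 S0 z \<longleftrightarrow> M * rate \<le> xdist n p d X (fst z) \<beta>0 \<or> M * rate / real n \<le> frob2 {0..<d} {0..<d} (\<lambda>il. SigPD d (snd z) il - S0 il)"

text \<open>144 is 36 from \<open>hellinger_1d\<close> times 4 from the inflation, which may halve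
  the Frobenius distance; 12 is 4 from \<open>affinity_mean\<close> times 3 from the bound 3 b2 on
  the sum of the two forms.\<close>

definition c1 :: real where "c1 = min (1 / (144 * b2\<^sup>2)) (1 / (12 * b2))"

lemma SigPD_entry_le:
  assumes "x \<in> PDgood d (real n)" "i < d" "l < d"
  shows "\<bar>SigPD d x (i,l)\<bar> \<le> real n ^ 2"
proof -
  have x: "fst x \<in> orth d" "\<And>k. k < d \<Longrightarrow> 1 / real n \<le> snd x k \<and> snd x k \<le> real n"
    using assms(1) by (auto simp: PDgood_def PiE_iff)
  have "\<bar>SigPD d x (i,l)\<bar> = \<bar>\<Sum>k<d. fst x (i,k) * snd x k * fst x (l,k)\<bar>" using assms by (simp add: SigPD_def)
  also have "\<dots> \<le> (\<Sum>k<d. \<bar>fst x (i,k) * snd x k * fst x (l,k)\<bar>)" by (rule sum_abs)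
  also have "\<dots> \<le> (\<Sum>k<d. real n)"
  proof (rule sum_mono)
    fix k assume "k \<in> {..<d}"
    then have k: "k < d" by simp
    have p1: "\<bar>fst x (i,k)\<bar> \<le> 1" "\<bar>fst x (l,k)\<bar> \<le> 1" using orth_entry_le_1[OF x(1)] assms k by auto
    have "0 \<le> 1 / real n" by simp
    then have "\<bar>snd x k\<bar> \<le> real n" using x(2)[OF k] by linarith
    then have "\<bar>fst x (i,k)\<bar> * \<bar>snd x k\<bar> * \<bar>fst x (l,k)\<bar> \<le> 1 * real n * 1" using p1 by (intro mult_mono) auto
    then show "\<bar>fst x (i,k) * snd x k * fst x (l,k)\<bar> \<le> real n" by (simp add: abs_mult)
  qed
  also have "\<dots> \<le> real n ^ 2" using dn by (simp add: power2_eq_square mult_right_mono)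
  finally show ?thesis .
qed

text \<open>If the covariance is far, inflating it loses at most half of the distance and
  \<open>affinity_cov\<close> applies. If the mean is far, the inflated covariance decides: at
  Frobenius distance at least b2 from the truth the covariance affinity is saturated and already
  exp(-n/36); otherwise its form is at most 2 b2, and \<open>affinity_mean\<close> applies with 3
  b2. The smallness conditions keep the required exponent below the saturation level.\<close>

lemma affinity_far:
  assumes z: "z \<in> Good s1" and S0: "S0 \<in> H0_set d b1 b2" and fz: "far M \<beta>0 S0 z" and M: "M \<ge> 1" and n16: "16 \<le> n"
    and small: "M * rate \<le> 4 * b2\<^sup>2 * real n" "c1 * M * rate \<le> real n / 36"
  shows "(\<integral>\<^sup>+ Y. ennreal (sqrt (lik n p d X \<beta>0 S0 Y * lik n p d X (fst z) (infl (snd z)) Y)) \<partial>YM) \<le> ennreal (exp (- c1 * M * rate))"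
proof -
  have np: "real n \<ge> 3" using n3 by simp
  have xg: "snd z \<in> PDgood d (real n)" using z by (auto simp: Good_def)
  note S0f = H0_set_facts[OF S0 b(1)]
  let ?DD = "{0..<d} \<times> {0..<d}"
  define F where "F = frob2 {0..<d} {0..<d} (\<lambda>il. infl (snd z) il - S0 il)"
  have F0: "F \<ge> 0" by (simp add: F_def frob2_L2)
  have Mr: "M * rate \<ge> 1" using mult_mono[OF M rate_ge(4)] M by simp
  have cov: "(\<integral>\<^sup>+ Y. ennreal (sqrt (lik n p d X \<beta>0 S0 Y * lik n p d X (fst z) (infl (snd z)) Y)) \<partial>YM)
    \<le> ennreal (exp (- real n * min 1 (F / b2\<^sup>2) / 36))"
    unfolding F_def by (rule lik_affinity_cov[OF S0f(1) spd_infl[OF xg] S0f(3) b(2)])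
  show ?thesis
  proof (cases "M * rate / real n \<le> frob2 {0..<d} {0..<d} (\<lambda>il. SigPD d (snd z) il - S0 il)")
    case True
    define q where "q = sqrt (M * rate / real n)"
    have q: "q \<ge> 0" "q\<^sup>2 = M * rate / real n" using Mr by (auto simp: q_def)
    have "q \<le> L2_set (\<lambda>il. SigPD d (snd z) il - S0 il) ?DD"
      using True unfolding frob2_L2 q_def by (intro real_le_lsqrt) (auto simp: L2_set_nonneg)
    also have "\<dots> = L2_set (\<lambda>il. (infl (snd z) il - S0 il) + (SigPD d (snd z) il - infl (snd z) il)) ?DD" by simp
    also have "\<dots> \<le> sqrt F + L2_set (\<lambda>il. SigPD d (snd z) il - infl (snd z) il) ?DD"
      using L2_set_triangle_ineq[of "\<lambda>il. infl (snd z) il - S0 il" "\<lambda>il. SigPD d (snd z) il - infl (snd z) il" ?DD]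
      by (simp add: F_def frob2_L2 L2_set_nonneg)
    also have "L2_set (\<lambda>il. SigPD d (snd z) il - infl (snd z) il) ?DD \<le> q / 2"
    proof -
      have "L2_set (\<lambda>il. SigPD d (snd z) il - infl (snd z) il) ?DD \<le> (\<Sum>il\<in>?DD. \<bar>SigPD d (snd z) il - infl (snd z) il\<bar>)"
        by (rule L2_set_le_sum_abs)
      also have "\<dots> \<le> (\<Sum>il\<in>?DD. 2 / real n ^ 3)"
      proof (rule sum_mono)
        fix il assume "il \<in> ?DD"
        then have "\<bar>SigPD d (snd z) il\<bar> \<le> real n ^ 2" using SigPD_entry_le[OF xg] by auto
        then have "2 / real n ^ 5 * \<bar>SigPD d (snd z) il\<bar> \<le> 2 / real n ^ 5 * real n ^ 2" by (intro mult_left_mono) auto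
        also have "\<dots> = 2 / real n ^ 3" using np by (simp add: power_numeral_reduce)
        finally show "\<bar>SigPD d (snd z) il - infl (snd z) il\<bar> \<le> 2 / real n ^ 3" by (simp add: infl_def algebra_simps abs_mult)
      qed
      also have "\<dots> = (real d)\<^sup>2 * (2 / real n ^ 3)" by (simp add: power2_eq_square)
      finally have le1: "L2_set (\<lambda>il. SigPD d (snd z) il - infl (snd z) il) ?DD \<le> (real d)\<^sup>2 * (2 / real n ^ 3)" .
      have "(real d)\<^sup>2 * (2 / real n ^ 3) \<le> (real n)\<^sup>2 * (2 / real n ^ 3)" using dn by (intro mult_right_mono power_mono) auto
      also have "\<dots> = 2 / real n" using np by (simp add: power_numeral_reduce)
      \<comment> \<open>Here n \<ge> 16 enters: 4/n \<le> 1/sqrt n. The inflation moves the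
        covariance by at most 2/n, while q is at least 1/sqrt n.\<close>
      also have "\<dots> \<le> sqrt (1 / real n) / 2"
      proof -
        have "4 / real n \<le> sqrt (1 / real n)"
        proof (rule real_le_rsqrt)
          show "(4 / real n)\<^sup>2 \<le> 1 / real n" using n16 by (simp add: power2_eq_square field_simps)
        qed
        then show ?thesis by simp
      qed
      also have "\<dots> \<le> q / 2" unfolding q_def using Mr np by (intro divide_right_mono real_sqrt_le_mono) auto
      finally show ?thesis using le1 by linarith
    qed
    finally have "q / 2 \<le> sqrt F" by simp
    then have "(q / 2)\<^sup>2 \<le> F" using q F0 by (metis divide_nonneg_nonneg power_mono real_sqrt_pow2 zero_le_numeral)
    then have "M * rate / (4 * real n) \<le> F" by (simp add: power_divide q(2))
    then have F1: "M * rate / (4 * real n) / b2\<^sup>2 \<le> F / b2\<^sup>2" by (rule divide_right_mono) simp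
    have "M * rate / (4 * real n) / b2\<^sup>2 \<le> 1" using small(1) np b by (simp add: field_simps)
    then have "M * rate / (4 * real n) / b2\<^sup>2 \<le> min 1 (F / b2\<^sup>2)" using F1 by simp
    then have "real n * (M * rate / (4 * real n) / b2\<^sup>2) \<le> real n * min 1 (F / b2\<^sup>2)" using np by (intro mult_left_mono) auto
    moreover have "real n * (M * rate / (4 * real n) / b2\<^sup>2) = 36 * (1 / (144 * b2\<^sup>2) * (M * rate))" using np by (simp add: field_simps)
    moreover have "c1 * (M * rate) \<le> 1 / (144 * b2\<^sup>2) * (M * rate)" using Mr by (intro mult_right_mono) (auto simp: c1_def)
    ultimately have "- real n * min 1 (F / b2\<^sup>2) / 36 \<le> - c1 * M * rate" by (simp add: mult.assoc)
    then show ?thesis using cov by (elim order_trans) (intro ennreal_leI, simp)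
  next
    case False
    then have xd: "M * rate \<le> xdist n p d X (fst z) \<beta>0" using fz by (simp add: far_def)
    show ?thesis
    proof (cases "F / b2\<^sup>2 \<ge> 1")
      case True
      then have "- real n * min 1 (F / b2\<^sup>2) / 36 \<le> - c1 * M * rate" using small(2) by (simp add: min_def)
      then show ?thesis using cov by (elim order_trans) (intro ennreal_leI, simp)
    next
      case False
      then have "F \<le> b2\<^sup>2" using b by (simp add: field_simps)
      then have sF: "sqrt F \<le> b2" using b by (simp add: real_le_lsqrt)
      have B: "bf d S0 v v + bf d (infl (snd z)) v v \<le> 3 * b2 * sq d v" for v
      proof -
        have "bf d (infl (snd z)) v v - bf d S0 v v = bf d (\<lambda>il. infl (snd z) il - S0 il) v v"
          by (simp add: bf_def sum_subtractf[symmetric] algebra_simps)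
        also have "\<dots> \<le> sqrt F * sq d v" unfolding F_def by (rule bf_le_frob)
        also have "\<dots> \<le> b2 * sq d v" using sF by (intro mult_right_mono) auto
        finally show ?thesis using S0f(3)[of v] by simp
      qed
      have "(\<integral>\<^sup>+ Y. ennreal (sqrt (lik n p d X \<beta>0 S0 Y * lik n p d X (fst z) (infl (snd z)) Y)) \<partial>YM)
        \<le> ennreal (exp (- xdist n p d X (fst z) \<beta>0 / (4 * (3 * b2))))"
        by (rule lik_affinity_mean[OF S0f(1) spd_infl[OF xg] B]) (use b in simp)
      also have "\<dots> \<le> ennreal (exp (- c1 * M * rate))"
      proof (intro ennreal_leI)
        have "c1 * (M * rate) \<le> 1 / (12 * b2) * (M * rate)" using Mr by (intro mult_right_mono) (auto simp: c1_def)
        also have "\<dots> \<le> 1 / (12 * b2) * xdist n p d X (fst z) \<beta>0" using xd b by (intro mult_left_mono) auto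
        finally show "exp (- xdist n p d X (fst z) \<beta>0 / (4 * (3 * b2))) \<le> exp (- c1 * M * rate)" by (simp add: mult.assoc)
      qed
      finally show ?thesis .
    qed
  qed
qed

end

section \<open>Counting cells and bounding the posterior\<close>

context model_Sigma
begin

text \<open>K (3 + (ln (2 B1 + 3) + B2 + 9)) + 11: the 3 counts supports, the inner bracket the
  rounded values of the active coefficients, and the 11 the rounded entries of \<Sigma>.\<close>

definition C3 :: "real \<Rightarrow> real" where "C3 K = K * (12 + ln (2 * B1 + 3) + B2) + 11"

text \<open>A label is determined by a support, one bounded integer for each active coordinate,
  zeros elsewhere, and d^2 bounded integers for \<Sigma>. Only \<open>s1 * pm\<close> coordinates
  are active, and each ranges over polynomially many values in max(G^(1/pm), n), so the total
  exponent is a multiple of \<open>s1 * Lg\<close> plus a multiple of d^2 ln n.\<close>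

lemma cell_count:
  assumes s1: "real s1 * Lg \<le> K * rate"
  shows "finite (cell ` Good s1)" "real (card (cell ` Good s1)) \<le> exp (C3 K * rate)"
proof -
  let ?DD = "{0..<d} \<times> {0..<d}"
  define M where "M = max (real G powr (1 / real pm)) (real n)"
  \<comment> \<open>Bound for a scaled coefficient in units of the mesh: \<open>circ\<close> is at
    most B1 M^B2 \<lambda>, the weighted norm is at most n, and the mesh contributes n^8.\<close>
  define w where "w = B1 * M powr B2 * real n ^ 9"
  define K1 where "K1 = nat \<lceil>w\<rceil>"
  define FS where "FS S = PiE JJ (\<lambda>x. if x \<in> coords grp S then {- int K1..int K1} else {0})" for S
  \<comment> \<open>Entries of \<Sigma> are at most n^2 on the sieve, by
    \<open>SigPD_entry_le\<close>, and the mesh contributes n^8.\<close>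
  define V where "V = PiE ?DD (\<lambda>_. {- int (n ^ 10)..int (n ^ 10)})"
  have np: "real n \<ge> 3" using n3 by simp
  have Mn: "M \<ge> real n" by (simp add: M_def)
  have M1: "M \<ge> 1" using np Mn by linarith
  have w0: "w \<ge> 0" using cpos by (simp add: w_def)
  have sub: "cell ` Good s1 \<subseteq> (\<Union>S\<in>Ms s1. FS S) \<times> V"
  proof
    fix c assume "c \<in> cell ` Good s1"
    then obtain z where z: "z \<in> Good s1" "c = cell z" by auto
    obtain S where S: "S \<in> Ms s1" "\<forall>x\<in>JJ - coords grp S. fst z x = 0" using z(1) by (auto simp: Good_def Sb_def)
    have gn: "lam k * gnorm grp (fst z) j k \<le> real n" if "j < G" "k < d" for j k
      using z(1) that by (auto simp: Good_def Sb_def)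
    have xg: "snd z \<in> PDgood d (real n)" using z(1) by (auto simp: Good_def)
    have "\<lfloor>circ * fst z x * mesh\<rfloor> \<in> {- int K1..int K1}" if x: "x \<in> JJ" for x
    proof (rule abs_floor_le)
      obtain l k where lk: "x = (l,k)" "l < p" "k < d" using x by auto
      then have "l \<in> (\<Union>j<G. grp j)" unfolding grp_cover by simp
      then obtain j where j: "j < G" "l \<in> grp j" by auto
      have "(fst z x)\<^sup>2 \<le> (\<Sum>l\<in>grp j. (fst z (l,k))\<^sup>2)"
        unfolding lk(1) using j grp_fin[OF j(1)] by (intro member_le_sum[of l "grp j" "\<lambda>l. (fst z (l,k))\<^sup>2"]) auto
      then have g: "\<bar>fst z x\<bar> \<le> gnorm grp (fst z) j k" unfolding gnorm_def by (rule real_le_rsqrt[of "\<bar>_\<bar>", simplified])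
      have BM: "0 < B1 * M powr B2" using cpos M1 by simp
      have "circ / (B1 * M powr B2) \<le> lam k" using lam[OF lk(3)] by (simp add: M_def)
      then have "circ \<le> B1 * M powr B2 * lam k" using BM by (simp add: divide_le_eq mult.commute)
      then have "circ * \<bar>fst z x\<bar> \<le> B1 * M powr B2 * lam k * gnorm grp (fst z) j k"
        using g circ_nonneg by (intro mult_mono) auto
      also have "\<dots> = B1 * M powr B2 * (lam k * gnorm grp (fst z) j k)" by simp
      also have "\<dots> \<le> B1 * M powr B2 * real n" using gn[OF j(1) lk(3)] BM by (intro mult_left_mono) auto
      finally have "circ * \<bar>fst z x\<bar> * mesh \<le> B1 * M powr B2 * real n * mesh" using mesh_pos by (intro mult_right_mono) auto
      also have "\<dots> = w" by (simp add: w_def mesh_def power_numeral_reduce)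
      also have "\<dots> \<le> real K1" using w0 by (simp add: K1_def)
      finally show "\<bar>circ * fst z x * mesh\<bar> \<le> real K1" using circ_nonneg mesh_pos by (simp add: abs_mult)
    qed
    then have "fst c \<in> FS S" unfolding z(2) cell_def FS_def using S(2) by (auto simp: PiE_iff)
    moreover have "\<lfloor>SigPD d (snd z) x * mesh\<rfloor> \<in> {- int (n ^ 10)..int (n ^ 10)}" if x: "x \<in> ?DD" for x
    proof (rule abs_floor_le)
      have "\<bar>SigPD d (snd z) x\<bar> \<le> real n ^ 2" using SigPD_entry_le[OF xg] x by auto
      then have "\<bar>SigPD d (snd z) x\<bar> * mesh \<le> real n ^ 2 * mesh" using mesh_pos by (intro mult_right_mono) auto
      then show "\<bar>SigPD d (snd z) x * mesh\<bar> \<le> real (n ^ 10)" using mesh_pos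
        by (simp add: abs_mult mesh_def power_add[symmetric])
    qed
    then have "snd c \<in> V" unfolding z(2) cell_def V_def by auto
    ultimately show "c \<in> (\<Union>S\<in>Ms s1. FS S) \<times> V" using S(1) by (auto simp: mem_Times_iff)
  qed
  have fFS: "finite (FS S)" for S unfolding FS_def by (intro finite_PiE) auto
  have fV: "finite V" unfolding V_def by (intro finite_PiE) auto
  have fin: "finite ((\<Union>S\<in>Ms s1. FS S) \<times> V)" using fFS fV finite_Ms by blast
  show "finite (cell ` Good s1)" using sub fin by (rule finite_subset)
  have Lg0: "0 \<le> Lg" using Lg_ge(4) by linarith
  have pM: "real pm * ln M = Lg" using Lg_pm by (simp only: M_def)
  have c0: "ln (2 * B1 + 3) \<ge> 0" using cpos by simp
  have K1e: "real (2 * K1 + 1) ^ pm \<le> exp ((ln (2 * B1 + 3) + B2 + 9) * Lg)"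
  proof -
    have one: "1 \<le> M powr B2 * real n ^ 9"
      using M1 np cpos mult_mono[of 1 "M powr B2" 1 "real n ^ 9"] by (simp add: ge_one_powr_ge_zero)
    have "real (2 * K1 + 1) \<le> 2 * (w + 1) + 1" using w0 unfolding K1_def by simp linarith
    also have "\<dots> \<le> (2 * B1 + 3) * (M powr B2 * real n ^ 9)" using one by (simp add: w_def algebra_simps)
    also have "\<dots> = exp (ln (2 * B1 + 3) + B2 * ln M + 9 * L)"
    proof -
      have "exp (9 * L) = real n ^ 9" using exp_of_nat_mult[of 9 L] by (simp add: expL)
      then show ?thesis using cpos M1 by (simp add: exp_add powr_def)
    qed
    finally have "real (2 * K1 + 1) ^ pm \<le> exp (ln (2 * B1 + 3) + B2 * ln M + 9 * L) ^ pm" by (intro power_mono) auto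
    also have "\<dots> = exp (real pm * (ln (2 * B1 + 3) + B2 * ln M + 9 * L))" by (rule exp_of_nat_mult[symmetric])
    also have "\<dots> = exp (real pm * ln (2 * B1 + 3) + B2 * (real pm * ln M) + 9 * (real pm * L))" by (simp add: algebra_simps)
    also have "\<dots> \<le> exp (Lg * ln (2 * B1 + 3) + B2 * Lg + 9 * Lg)"
      unfolding exp_le_cancel_iff pM using Lg_ge c0 cpos by (intro add_mono mult_right_mono mult_left_mono) auto
    finally show ?thesis by (simp add: algebra_simps)
  qed
  have cFS: "real (card (FS S)) \<le> exp (K * (ln (2 * B1 + 3) + B2 + 9) * rate)" if S: "S \<in> Ms s1" for S
  proof -
    have SI: "S \<subseteq> II" "card S \<le> s1" using S by (auto simp: Ms_def)
    have "card (FS S) = (\<Prod>x\<in>JJ. card (if x \<in> coords grp S then {- int K1..int K1} else {0}))"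
      unfolding FS_def by (rule card_PiE) simp
    also have "\<dots> = (\<Prod>x\<in>JJ. if x \<in> coords grp S then 2 * K1 + 1 else 1)"
      by (rule prod.cong) (auto simp: nat_add_distrib nat_mult_distrib)
    also have "\<dots> = (\<Prod>x\<in>JJ \<inter> coords grp S. 2 * K1 + 1)" by (simp add: prod.inter_restrict[symmetric])
    also have "JJ \<inter> coords grp S = coords grp S" using coords_sub[OF SI(1)] by blast
    also have "(\<Prod>x\<in>coords grp S. 2 * K1 + 1) = (2 * K1 + 1) ^ card (coords grp S)" by simp
    also have "\<dots> \<le> (2 * K1 + 1) ^ (pm * s1)"
    proof (rule power_increasing)
      show "card (coords grp S) \<le> pm * s1"
        using le_trans[OF card_coords_le[OF SI(1)] mult_le_mono1[OF SI(2)]] by (subst mult.commute)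
    qed simp
    finally have "real (card (FS S)) \<le> real ((2 * K1 + 1) ^ (pm * s1))" by (rule of_nat_mono)
    also have "\<dots> = (real (2 * K1 + 1) ^ pm) ^ s1" by (simp only: of_nat_power power_mult)
    also have "\<dots> \<le> exp ((ln (2 * B1 + 3) + B2 + 9) * Lg) ^ s1" by (rule power_mono[OF K1e]) simp
    also have "\<dots> = exp (real s1 * ((ln (2 * B1 + 3) + B2 + 9) * Lg))" by (rule exp_of_nat_mult[symmetric])
    also have "\<dots> \<le> exp (K * (ln (2 * B1 + 3) + B2 + 9) * rate)"
      using mult_left_mono[OF s1, of "ln (2 * B1 + 3) + B2 + 9"] c0 cpos by (simp add: mult_ac)
    finally show ?thesis .
  qed
  have cMs: "real (card (Ms s1)) \<le> exp (3 * K * rate)"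
  proof -
    have "card (Ms s1) \<le> (G * d + 1) ^ s1" using card_models_le[of II s1] by (simp add: Ms_def)
    then have "real (card (Ms s1)) \<le> real ((G * d + 1) ^ s1)" by (rule of_nat_mono)
    also have "\<dots> = real (G * d + 1) ^ s1" by simp
    also have "\<dots> \<le> exp (3 * Lg) ^ s1"
    proof (rule power_mono)
      have "1 * 1 \<le> real G * real n" using G1 np by (intro mult_mono) auto
      then have Gn: "1 \<le> real G * real n" by simp
      have "real (G * d + 1) \<le> real G * real n + real G * real n"
        using mult_left_mono[of "real d" "real n" "real G"] dn Gn by simp
      also have "\<dots> = 2 * (real G * real n)" by simp
      also have "\<dots> \<le> real n * (real G * real n)" using np Gn by (intro mult_right_mono) auto
      also have "\<dots> = exp (ln (real G) + L + L)" using G1 by (simp only: exp_add expL) (simp add: mult_ac)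
      also have "\<dots> \<le> exp (3 * Lg)" using Lg_ge by simp
      finally show "real (G * d + 1) \<le> exp (3 * Lg)" .
    qed simp
    also have "\<dots> = exp (real s1 * (3 * Lg))" by (rule exp_of_nat_mult[symmetric])
    also have "\<dots> \<le> exp (3 * K * rate)" using s1 by simp
    finally show ?thesis .
  qed
  have cV: "real (card V) \<le> exp (11 * rate)"
  proof -
    have "card V = (\<Prod>x\<in>?DD. card {- int (n ^ 10)..int (n ^ 10)})" unfolding V_def by (rule card_PiE) simp
    also have "\<dots> = (2 * n ^ 10 + 1) ^ (d * d)" by (simp add: nat_add_distrib nat_mult_distrib nat_power_eq)
    finally have "real (card V) = (2 * real n ^ 10 + 1) ^ (d * d)" by (simp add: add.commute)
    also have "\<dots> \<le> exp (11 * L) ^ (d * d)"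
    proof (rule power_mono)
      have "1 \<le> real n ^ 10" using np by simp
      then have "2 * real n ^ 10 + 1 \<le> 3 * real n ^ 10" by linarith
      also have "\<dots> \<le> real n * real n ^ 10" using np by (intro mult_right_mono) auto
      also have "\<dots> = exp (11 * L)" using exp_of_nat_mult[of 11 L] by (simp add: expL power_numeral_reduce)
      finally show "2 * real n ^ 10 + 1 \<le> exp (11 * L)" .
    qed simp
    also have "\<dots> = exp (real (d * d) * (11 * L))" by (rule exp_of_nat_mult[symmetric])
    also have "\<dots> \<le> exp (11 * rate)" using rate_ge(2) by (simp add: power2_eq_square)
    finally show ?thesis .
  qed
  have "card (cell ` Good s1) \<le> card ((\<Union>S\<in>Ms s1. FS S) \<times> V)" using sub fin by (rule card_mono[rotated])
  also have "\<dots> = card (\<Union>S\<in>Ms s1. FS S) * card V" by (rule card_cartesian_product)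
  also have "\<dots> \<le> (\<Sum>S\<in>Ms s1. card (FS S)) * card V" by (intro mult_right_mono card_UN_le finite_Ms) simp
  finally have "real (card (cell ` Good s1)) \<le> real ((\<Sum>S\<in>Ms s1. card (FS S)) * card V)" by (rule of_nat_mono)
  also have "\<dots> = (\<Sum>S\<in>Ms s1. real (card (FS S))) * real (card V)" by simp
  also have "\<dots> \<le> (\<Sum>S\<in>Ms s1. exp (K * (ln (2 * B1 + 3) + B2 + 9) * rate)) * exp (11 * rate)"
    by (intro mult_mono sum_mono cFS cV) (auto intro: sum_nonneg)
  also have "\<dots> = real (card (Ms s1)) * exp (K * (ln (2 * B1 + 3) + B2 + 9) * rate) * exp (11 * rate)" by simp
  also have "\<dots> \<le> exp (3 * K * rate) * exp (K * (ln (2 * B1 + 3) + B2 + 9) * rate) * exp (11 * rate)"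
    by (intro mult_right_mono cMs) auto
  also have "\<dots> = exp (C3 K * rate)" by (simp add: exp_add[symmetric] C3_def algebra_simps)
  finally show "real (card (cell ` Good s1)) \<le> exp (C3 K * rate)" .
qed

text \<open>The budget in units of the rate: the evidence is at least exp(-C2 rate). The condition
  on \<open>K\<close> lets the dimension tail beat it with one unit to spare; the condition on
  \<open>M\<close> lets one affinity beat the number of cells, the mass of the prior and half of the
  evidence exponent. The remaining tails are exponential in n and are covered by
  \<open>small\<close>. The constant 5 is 1 for the cells and 4 for the complement of the
  sieve.\<close>

lemma posterior_small:
  assumes \<beta>0: "\<beta>0 \<in> B0_set n G p d grp lam s0" and S0: "S0 \<in> H0_set d b1 b2" and n16: "16 \<le> n"
    and A: "A \<inter> space Pr \<in> sets Pr" "\<And>z. (fst z, SigPD d (snd z)) \<in> A \<Longrightarrow> far M \<beta>0 S0 z"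
    and N: "N \<in> sets PDm" "\<And>x. x \<in> N \<Longrightarrow> spd d (SigPD d x)"
      "\<And>x v. x \<in> N \<Longrightarrow> (1 + 1 / real n ^ 3) * bf d S0 v v \<le> bf d (SigPD d x) v v \<and> bf d (SigPD d x) v v \<le> (1 + 4 / real n ^ 3) * bf d S0 v v"
      "ennreal (exp (- CP * (real d)\<^sup>2 * L)) \<le> emeasure PDm N" and CP: "CP > 0"
    and C2: "C2 = C1 + CP + 2 + 1 / b1"
    and K: "K > 0" "A4 * K / 2 \<ge> C2 + ln CI + 1"
    and M: "M \<ge> 1" "c1 * M \<ge> C3 K + ln CI / 2 + 2 + C2 / 2 + 1"
    and A2: "A2 * exp (- A4 * Lg) \<le> exp (- (A4 / 2) * Lg)"
    and small: "rate \<le> real n" "K * rate \<le> real n" "M * rate \<le> 4 * b2\<^sup>2 * real n" "c1 * M * rate \<le> real n / 36"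
      "(C2 + ln CI + K + 1) * rate \<le> real n / 2" "(C2 + ln CI + 2) * rate \<le> cI * real n"
  shows "(\<integral>Y. posterior Pr (\<lambda>\<theta> Y. lik n p d X (fst \<theta>) (snd \<theta>) Y) A Y \<partial>data_dist n p d X \<beta>0 S0) \<le> 5 * exp (- rate)"
proof -
  have Lg0: "Lg > 0" using Lg_ge(4) by linarith
  have r1: "rate \<ge> 1" by (rule rate_ge(4))
  \<comment> \<open>Rounding down gives both inequalities of \<open>PB_tail\<close>: few active
    coordinates and a small dimension tail.\<close>
  define s1 where "s1 = nat \<lfloor>K * rate / Lg\<rfloor>"
  have q0: "0 \<le> K * rate / Lg" using K r1 Lg0 by simp
  have "real s1 \<le> K * rate / Lg" using q0 by (simp add: s1_def)
  then have s1a: "real s1 * Lg \<le> K * rate" using Lg0 by (simp add: pos_le_divide_eq)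
  have "K * rate / Lg \<le> real s1 + 1" unfolding s1_def using q0 by simp
  then have s1b: "K * rate \<le> (real s1 + 1) * Lg" using Lg0 by (simp add: pos_divide_le_eq)
  have s1n: "real s1 * real pm \<le> real n"
    using mult_left_mono[OF Lg_ge(5), of "real s1"] s1a small(2) by linarith
  note S0f = H0_set_facts[OF S0 b(1)]
  define inA where "inA z \<longleftrightarrow> (fst z, SigPD d (snd z)) \<in> A" for z :: "rmat \<times> rmat \<times> (nat \<Rightarrow> real)"
  define J where "J = cell ` {z \<in> Good s1. inA z}"
  \<comment> \<open>Representatives are taken from the event itself, so each of them is far from the
    truth; cells missing the event are not counted in \<open>J\<close>.\<close>
  define rep where "rep j = (SOME z. z \<in> Good s1 \<and> inA z \<and> cell z = j)" for j
  have rep: "rep j \<in> Good s1" "inA (rep j)" "cell (rep j) = j" if "j \<in> J" for j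
  proof -
    have "\<exists>z. z \<in> Good s1 \<and> inA z \<and> cell z = j" using that by (auto simp: J_def)
    from someI_ex[OF this] show "rep j \<in> Good s1" "inA (rep j)" "cell (rep j) = j" by (auto simp: rep_def)
  qed
  have JG: "J \<subseteq> cell ` Good s1" by (auto simp: J_def)
  have fJ: "finite J" using JG cell_count(1)[OF s1a] by (rule finite_subset)
  define Lr where "Lr j Y = lik n p d X (fst (rep j)) (infl (snd (rep j))) Y" for j Y
  \<comment> \<open>\<open>CI ^ d\<close> bounds the mass of the prior over which a cell's
    likelihood is integrated, and exp 4 is the loss in \<open>cell_dominated\<close>.\<close>
  define e where "e = CI ^ d * exp 4"
  have e0: "e > 0" using CI(1) by (simp add: e_def)
  define U where "U j Y = e * Lr j Y" for j Y
  define W where "W = space Pr' - Good s1"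
  have W: "W \<in> sets Pr'" unfolding W_def using Good_sets by auto
  define T where "T Y = (\<integral>\<^sup>+ z. indicator W z * ennreal (lik n p d X (fst z) (SigPD d (snd z)) Y) \<partial>Pr')" for Y
  define \<tau> where "\<tau> = exp (ln CI * rate) * (2 * exp (- (A4 / 2) * K * rate) + exp (K * rate - real n / 2) + exp (rate - cI * real n))"
  define \<eta> where "\<eta> = sqrt e * exp (- c1 * M * rate)"
  define \<kappa> where "\<kappa> = exp (- C2 * rate)"
  have Lr0: "0 \<le> Lr j Y" for j Y by (simp add: Lr_def lik_nonneg)
  have num: "(\<integral>\<^sup>+ \<theta>. indicator A \<theta> * ennreal (lik n p d X (fst \<theta>) (snd \<theta>) Y) \<partial>Pr) \<le> ennreal (\<Sum>j\<in>J. U j Y) + T Y"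
    if Y: "Y \<in> space YM" for Y
  proof -
    \<comment> \<open>The event is given as a set of arbitrary pairs; intersecting it with the space
      makes its indicator measurable without changing the integral.\<close>
    define F where "F \<theta> = indicator (A \<inter> space Pr) \<theta> * ennreal (lik n p d X (fst \<theta>) (snd \<theta>) Y)" for \<theta>
    have F: "F \<in> borel_measurable Pr" unfolding F_def
      using lik_measurable_theta[OF Y] A(1) by (intro borel_measurable_times_ennreal borel_measurable_indicator) auto
    have Wm: "(\<lambda>z. indicator W z * ennreal (lik n p d X (fst z) (SigPD d (snd z)) Y)) \<in> borel_measurable Pr'"
      using nn_integral_Pr(2)[OF lik_measurable_theta[OF Y]] W by (intro borel_measurable_times_ennreal borel_measurable_indicator) auto
    define u where "u = exp 4 * (\<Sum>j\<in>J. Lr j Y)"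
    have u0: "u \<ge> 0" unfolding u_def using Lr0 by (simp add: sum_nonneg)
    have "(\<integral>\<^sup>+ \<theta>. indicator A \<theta> * ennreal (lik n p d X (fst \<theta>) (snd \<theta>) Y) \<partial>Pr) = (\<integral>\<^sup>+ \<theta>. F \<theta> \<partial>Pr)"
      by (intro nn_integral_cong) (simp add: F_def split: split_indicator)
    also have "\<dots> = (\<integral>\<^sup>+ z. F (fst z, SigPD d (snd z)) \<partial>Pr')" by (rule nn_integral_Pr(1)[OF F])
    also have "\<dots> \<le> (\<integral>\<^sup>+ z. ennreal u + indicator W z * ennreal (lik n p d X (fst z) (SigPD d (snd z)) Y) \<partial>Pr')"
    proof (rule nn_integral_mono)
      fix z assume zs: "z \<in> space Pr'"
      show "F (fst z, SigPD d (snd z)) \<le> ennreal u + indicator W z * ennreal (lik n p d X (fst z) (SigPD d (snd z)) Y)"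
      proof (cases "z \<in> W \<or> \<not> inA z")
        case True
        then show ?thesis by (auto simp: F_def inA_def split: split_indicator)
      next
        case False
        then have z: "z \<in> Good s1" "inA z" using zs by (auto simp: W_def)
        then have jJ: "cell z \<in> J" by (auto simp: J_def)
        have "lik n p d X (fst z) (SigPD d (snd z)) Y \<le> exp 4 * Lr (cell z) Y"
          unfolding Lr_def by (rule cell_dominated[OF z(1) rep(1)[OF jJ] rep(3)[OF jJ, symmetric] s1n])
        also have "\<dots> \<le> u" unfolding u_def
          using member_le_sum[OF jJ, of "\<lambda>j. Lr j Y"] Lr0 fJ by simp
        finally have "ennreal (lik n p d X (fst z) (SigPD d (snd z)) Y) \<le> ennreal u" by (rule ennreal_leI)
        then have "F (fst z, SigPD d (snd z)) \<le> ennreal u" by (auto simp: F_def split: split_indicator)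
        then show ?thesis by (rule add_increasing2[rotated]) simp
      qed
    qed
    also have "\<dots> = ennreal u * emeasure Pr' (space Pr') + T Y"
      unfolding T_def using Wm by (subst nn_integral_add) auto
    also have "\<dots> \<le> ennreal u * ennreal (CI ^ d) + T Y" by (intro add_right_mono mult_left_mono Pr'_mass) simp
    also have "ennreal u * ennreal (CI ^ d) = ennreal (\<Sum>j\<in>J. U j Y)"
      using u0 CI(1) by (simp add: ennreal_mult[symmetric] U_def u_def e_def sum_distrib_left mult_ac)
    finally show ?thesis .
  qed
  have aff: "(\<integral>\<^sup>+ Y. ennreal (sqrt (lik n p d X \<beta>0 S0 Y * U j Y)) \<partial>YM) \<le> ennreal \<eta>" if j: "j \<in> J" for j
  proof -
    have Lm: "(\<lambda>Y. lik n p d X \<beta>0 S0 Y * Lr j Y) \<in> borel_measurable YM" unfolding Lr_def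
      by (intro borel_measurable_times lik_measurable_Y)
    have "(\<integral>\<^sup>+ Y. ennreal (sqrt (lik n p d X \<beta>0 S0 Y * U j Y)) \<partial>YM) = (\<integral>\<^sup>+ Y. ennreal (sqrt e) * ennreal (sqrt (lik n p d X \<beta>0 S0 Y * Lr j Y)) \<partial>YM)"
      using e0 Lr0 lik_nonneg by (intro nn_integral_cong) (simp add: U_def ennreal_mult[symmetric] real_sqrt_mult[symmetric] mult_ac)
    also have "\<dots> = ennreal (sqrt e) * (\<integral>\<^sup>+ Y. ennreal (sqrt (lik n p d X \<beta>0 S0 Y * Lr j Y)) \<partial>YM)"
      using Lm by (intro nn_integral_cmult) auto
    also have "\<dots> \<le> ennreal (sqrt e) * ennreal (exp (- c1 * M * rate))"
      unfolding Lr_def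
      by (intro mult_left_mono affinity_far[OF rep(1)[OF j] S0 A(2)[OF rep(2)[OF j, unfolded inA_def]] M(1) n16 small(3,4)]) simp
    also have "\<dots> = ennreal \<eta>" using e0 by (simp add: \<eta>_def ennreal_mult)
    finally show ?thesis .
  qed
  have main: "(\<integral>Y. posterior Pr (\<lambda>\<theta> Y. lik n p d X (fst \<theta>) (snd \<theta>) Y) A Y \<partial>density YM (\<lambda>Y. ennreal (lik n p d X \<beta>0 S0 Y)))
    \<le> real (card J) * \<eta> / sqrt \<kappa> + \<tau> / \<kappa>"
  proof (rule posterior_bound[where U = U and T = T])
    show "0 < lik n p d X \<beta>0 S0 Y" for Y by (rule lik_pos[OF S0f(1)])
    show "lik n p d X \<beta>0 S0 \<in> borel_measurable YM" by (rule lik_measurable_Y)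
    show "ennreal (\<kappa> * lik n p d X \<beta>0 S0 Y) \<le> (\<integral>\<^sup>+ \<theta>. ennreal (lik n p d X (fst \<theta>) (snd \<theta>) Y) \<partial>Pr)" if "Y \<in> space YM" for Y
      using evidence[OF \<beta>0 S0 small(1) N CP that] by (simp add: \<kappa>_def C2)
    show "U j \<in> borel_measurable YM" for j unfolding U_def Lr_def by (intro borel_measurable_times lik_measurable_Y) simp
    show "0 \<le> U j Y" for j Y using Lr0 e0 by (simp add: U_def)
    show "T \<in> borel_measurable YM" unfolding T_def by (rule tail_numerator(1)[OF W])
    show "(\<integral>\<^sup>+ Y. T Y \<partial>YM) \<le> ennreal \<tau>"
      unfolding T_def \<tau>_def using tail_numerator(2)[OF W] Good_tail[OF A2 K(1) s1a s1b] unfolding W_def by (rule order_trans)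
  qed (use num aff e0 in \<open>auto simp: \<kappa>_def \<eta>_def \<tau>_def\<close>)
  have b1: "real (card J) * \<eta> / sqrt \<kappa> \<le> exp (- rate)"
  proof -
    have cJ: "real (card J) \<le> exp (C3 K * rate)"
      using card_mono[OF cell_count(1)[OF s1a] JG] cell_count(2)[OF s1a] by linarith
    have "e \<le> exp (ln CI * rate) * exp 4" unfolding e_def by (intro mult_right_mono CI_pow) simp
    also have "\<dots> \<le> exp (ln CI * rate) * exp (4 * rate)" using r1 by simp
    also have "\<dots> = (exp ((ln CI / 2 + 2) * rate))\<^sup>2" by (simp add: power2_eq_square exp_add[symmetric] algebra_simps)
    finally have se: "sqrt e \<le> exp ((ln CI / 2 + 2) * rate)" by (intro real_le_lsqrt) (use e0 in auto)
    have sk: "sqrt \<kappa> = exp (- (C2 / 2) * rate)"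
    proof (rule real_sqrt_unique)
      show "(exp (- (C2 / 2) * rate))\<^sup>2 = \<kappa>" by (simp add: \<kappa>_def power2_eq_square exp_add[symmetric])
    qed simp
    have "real (card J) * \<eta> / sqrt \<kappa> \<le> exp (C3 K * rate) * (exp ((ln CI / 2 + 2) * rate) * exp (- c1 * M * rate)) / exp (- (C2 / 2) * rate)"
      unfolding sk \<eta>_def by (intro divide_right_mono mult_mono cJ se) (use e0 in auto)
    also have "\<dots> = exp ((C3 K + ln CI / 2 + 2 + C2 / 2 - c1 * M) * rate)"
      by (simp add: exp_add[symmetric] exp_diff[symmetric] algebra_simps)
    also have "\<dots> \<le> exp (- 1 * rate)" unfolding exp_le_cancel_iff using M(2) r1 by (intro mult_right_mono) auto
    finally show ?thesis by simp
  qed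
  have b2: "\<tau> / \<kappa> \<le> 4 * exp (- rate)"
  proof -
    have "\<tau> / \<kappa> = 2 * exp ((ln CI + C2 - A4 * K / 2) * rate) + exp ((ln CI + C2 + K) * rate - real n / 2) + exp ((ln CI + C2 + 1) * rate - cI * real n)"
    proof -
      have a: "\<tau> / \<kappa> = \<tau> * exp (C2 * rate)" by (simp add: \<kappa>_def exp_minus field_simps)
      have gen: "exp u * (2 * exp v + exp w + exp x) * exp y = 2 * exp (u + v + y) + exp (u + w + y) + exp (u + x + y)" for u v w x y :: real
        by (simp add: exp_add algebra_simps)
      show ?thesis unfolding a unfolding \<tau>_def gen by (simp add: algebra_simps)
    qed
    also have "\<dots> \<le> 2 * exp (- rate) + exp (- rate) + exp (- rate)"
    proof (intro add_mono mult_left_mono)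
      have "(ln CI + C2 - A4 * K / 2) * rate \<le> - 1 * rate" using K(2) r1 by (intro mult_right_mono) auto
      then show "exp ((ln CI + C2 - A4 * K / 2) * rate) \<le> exp (- rate)" by simp
      show "exp ((ln CI + C2 + K) * rate - real n / 2) \<le> exp (- rate)" using small(5) by (simp add: algebra_simps)
      show "exp ((ln CI + C2 + 1) * rate - cI * real n) \<le> exp (- rate)" using small(6) by (simp add: algebra_simps)
    qed simp
    finally show ?thesis by simp
  qed
  show ?thesis unfolding data_dist_def using main b1 b2 by linarith
qed

lemma far_sets:
  "{\<theta>. t \<le> xdist n p d X (fst \<theta>) \<beta>0} \<inter> space Pr \<in> sets Pr"
  "{\<theta>. t \<le> frob2 {0..<d} {0..<d} (\<lambda>il. snd \<theta> il - S0 il)} \<inter> space Pr \<in> sets Pr"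
proof -
  have "(\<lambda>\<theta>. fst \<theta> (l,k)) \<in> borel_measurable Pr" if "l < p" "k < d" for l k
    using that by (intro measurable_compose[OF measurable_fst PB_component]) auto
  then have [measurable]: "(\<lambda>\<theta>. xdist n p d X (fst \<theta>) \<beta>0) \<in> borel_measurable Pr"
    unfolding xdist_fit sq_def fit_def
    by (intro borel_measurable_sum borel_measurable_power borel_measurable_diff borel_measurable_times borel_measurable_const) auto
  have "{\<theta> \<in> space Pr. t \<le> xdist n p d X (fst \<theta>) \<beta>0} \<in> sets Pr" by measurable
  moreover have "{\<theta>. t \<le> xdist n p d X (fst \<theta>) \<beta>0} \<inter> space Pr = {\<theta> \<in> space Pr. t \<le> xdist n p d X (fst \<theta>) \<beta>0}" by blast
  ultimately show "{\<theta>. t \<le> xdist n p d X (fst \<theta>) \<beta>0} \<inter> space Pr \<in> sets Pr" by simp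
  have "(\<lambda>S. S (i,l)) \<in> borel_measurable PS" if "i < d" "l < d" for i l
    unfolding measurable_cong_sets[OF sets_PS refl] using that by (intro mspace_component) auto
  then have [measurable]: "(\<lambda>\<theta>. frob2 {0..<d} {0..<d} (\<lambda>il. snd \<theta> il - S0 il)) \<in> borel_measurable Pr"
    unfolding frob2_def
    by (intro borel_measurable_sum borel_measurable_power borel_measurable_diff borel_measurable_const measurable_compose[OF measurable_snd]) auto
  have "{\<theta> \<in> space Pr. t \<le> frob2 {0..<d} {0..<d} (\<lambda>il. snd \<theta> il - S0 il)} \<in> sets Pr" by measurable
  moreover have "{\<theta>. t \<le> frob2 {0..<d} {0..<d} (\<lambda>il. snd \<theta> il - S0 il)} \<inter> space Pr = {\<theta> \<in> space Pr. t \<le> frob2 {0..<d} {0..<d} (\<lambda>il. snd \<theta> il - S0 il)}" by blast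
  ultimately show "{\<theta>. t \<le> frob2 {0..<d} {0..<d} (\<lambda>il. snd \<theta> il - S0 il)} \<inter> space Pr \<in> sets Pr" by simp
qed

end

section \<open>Contraction\<close>

lemma eps_rate_sq:
  assumes "1 \<le> n" "1 \<le> G"
  shows "real n * (eps_rate n s G m d)\<^sup>2 = max (real s * max (ln (real G)) (real m * ln (real n))) ((real d)\<^sup>2 * ln (real n))"
proof -
  have ms: "max (sqrt x) (sqrt y) = sqrt (max x y)" for x y :: real by (simp add: max_def)
  have "eps_rate n s G m d = sqrt (max (real s * ln (real G) / real n) (max (real s * real m * ln (real n) / real n) ((real d)\<^sup>2 * ln (real n) / real n)))"
    unfolding eps_rate_def ms ..
  moreover have "0 \<le> (real d)\<^sup>2 * ln (real n) / real n" using assms by simp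
  ultimately have "(eps_rate n s G m d)\<^sup>2 = max (real s * ln (real G) / real n) (max (real s * real m * ln (real n) / real n) ((real d)\<^sup>2 * ln (real n) / real n))"
    by (simp add: le_max_iff_disj)
  then have "real n * (eps_rate n s G m d)\<^sup>2 = max (real s * ln (real G)) (max (real s * (real m * ln (real n))) ((real d)\<^sup>2 * ln (real n)))"
    using assms by (simp add: max_mult_distrib_left mult.assoc)
  then show ?thesis by (simp add: max_mult_distrib_left max.assoc)
qed

text \<open>The suprema are expressed by bounds uniform in the true parameters: from one index on,
  both integrals are at most 5/n. The radius is fixed from the constants of the assumptions before n
  is chosen.\<close>

theorem theorem3p1:
  fixes G p d s0 :: "nat \<Rightarrow> nat"
    and grp :: "nat \<Rightarrow> nat \<Rightarrow> nat set"
    and X :: "nat \<Rightarrow> rmat"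
    and pr :: "nat \<Rightarrow> nat pmf"
    and lam :: "nat \<Rightarrow> nat \<Rightarrow> real"
    and H :: "nat \<Rightarrow> rmat measure"
    and A1 A2 A3 A4 B1 B2 B3 b1 b2 c mu nu :: real
  assumes const_pos: "A1 > 0" "A2 > 0" "A3 > 0" "A4 > 0" "B1 > 0" "B2 > 0" "B3 > 0"
      "b1 > 0" "b2 > 0" "mu > 0" "nu > 0" "c > 0"
    and setting: "\<forall>\<^sub>F n in sequentially.
       d n \<ge> 1 \<and>
       (\<forall>j<G n. grp n j \<noteq> {}) \<and>
       (\<forall>j<G n. \<forall>j'<G n. j \<noteq> j' \<longrightarrow> grp n j \<inter> grp n j' = {}) \<and>
       (\<Union>j<G n. grp n j) = {0..<p n} \<and>
       set_pmf (pr n) \<subseteq> {0..G n * d n} \<and>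
       (\<forall>s\<in>{1..G n * d n}.
          A1 * max (real (G n)) (real n ^ pmax (G n) (grp n)) powr (- A3) \<le> pmf (pr n) s / pmf (pr n) (s - 1) \<and>
          pmf (pr n) s / pmf (pr n) (s - 1) \<le> A2 * max (real (G n)) (real n ^ pmax (G n) (grp n)) powr (- A4)) \<and>
       (\<forall>k<d n.
          circ_norm n (G n) (grp n) (X n) / (B1 * max (real (G n) powr (1 / real (pmax (G n) (grp n)))) (real n) powr B2) \<le> lam n k \<and>
          lam n k \<le> B3 * circ_norm n (G n) (grp n) (X n) * sqrt (max (ln (real (G n))) (real (pmax (G n) (grp n)) * ln (real n)))) \<and>
       haar_orth (d n) (H n) \<and>
       real (G n) \<ge> real n powr c"
    and pS0_small: "\<forall>e>0. \<forall>\<^sub>F n in sequentially.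
       \<forall>\<beta>0\<in>B0_set n (G n) (p n) (d n) (grp n) (lam n) (s0 n). real (pS0 (G n) (d n) (grp n) \<beta>0) \<le> e * real n"
    and pmax_small: "(\<lambda>n. real (pmax (G n) (grp n)) / real n) \<longlonglongrightarrow> 0"
    and logG_small: "(\<lambda>n. ln (real (G n)) / real n) \<longlonglongrightarrow> 0"
    and d_small: "(\<lambda>n. (real (d n))\<^sup>2 * ln (real n) / real n) \<longlonglongrightarrow> 0"
    and eps_to_0: "(\<lambda>n. eps_rate n (s0 n) (G n) (pmax (G n) (grp n)) (d n)) \<longlonglongrightarrow> 0"
  shows "\<exists>M1>0.
    (\<forall>e>0. \<forall>\<^sub>F n in sequentially.
       \<forall>\<beta>0\<in>B0_set n (G n) (p n) (d n) (grp n) (lam n) (s0 n). \<forall>Sig0\<in>H0_set (d n) b1 b2.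
         (\<integral>Y. posterior (prior_beta (pr n) (G n) (p n) (d n) (grp n) (lam n) \<Otimes>\<^sub>M prior_Sigma (d n) (H n) mu nu)
                 (\<lambda>\<theta> Y. lik n (p n) (d n) (X n) (fst \<theta>) (snd \<theta>) Y)
                 {\<theta>. frob2 {0..<n} {0..<d n}
                        (mmul {0..<n} {0..<p n} {0..<d n} (X n) (\<lambda>lk. fst \<theta> lk - \<beta>0 lk))
                      \<ge> M1 * real n * (eps_rate n (s0 n) (G n) (pmax (G n) (grp n)) (d n))\<^sup>2}
                 Y
            \<partial>data_dist n (p n) (d n) (X n) \<beta>0 Sig0) \<le> e) \<and>
    (\<forall>e>0. \<forall>\<^sub>F n in sequentially.
       \<forall>\<beta>0\<in>B0_set n (G n) (p n) (d n) (grp n) (lam n) (s0 n). \<forall>Sig0\<in>H0_set (d n) b1 b2.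
         (\<integral>Y. posterior (prior_beta (pr n) (G n) (p n) (d n) (grp n) (lam n) \<Otimes>\<^sub>M prior_Sigma (d n) (H n) mu nu)
                 (\<lambda>\<theta> Y. lik n (p n) (d n) (X n) (fst \<theta>) (snd \<theta>) Y)
                 {\<theta>. frob2 {0..<d n} {0..<d n} (\<lambda>il. snd \<theta> il - Sig0 il)
                      \<ge> M1 * (eps_rate n (s0 n) (G n) (pmax (G n) (grp n)) (d n))\<^sup>2}
                 Y
            \<partial>data_dist n (p n) (d n) (X n) \<beta>0 Sig0) \<le> e)"
proof -
  obtain CI cI where CI: "CI \<ge> 1" "emeasure (ig mu nu) UNIV \<le> ennreal CI"
    and cI: "cI > 0" "\<And>t. t > 0 \<Longrightarrow> emeasure (ig mu nu) (- {1 / t..t}) \<le> ennreal (CI * exp (- cI * t))"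
    using ig_tails[OF const_pos(10,11)] by metis
  obtain CP where CP: "CP > 0"
    and PDl: "\<And>n d H S0. n \<ge> 3 \<Longrightarrow> 1 \<le> d \<Longrightarrow> d \<le> n \<Longrightarrow> haar_orth d H \<Longrightarrow> S0 \<in> H0_set d b1 b2 \<Longrightarrow>
    \<exists>N\<in>sets (PD d H mu nu). (\<forall>x\<in>N. spd d (SigPD d x) \<and>
       (\<forall>v. (1 + 1 / real n ^ 3) * bf d S0 v v \<le> bf d (SigPD d x) v v \<and>
            bf d (SigPD d x) v v \<le> (1 + 4 / real n ^ 3) * bf d S0 v v)) \<and>
     ennreal (exp (- CP * (real d)\<^sup>2 * ln (real n))) \<le> emeasure (PD d H mu nu) N"
    using PD_lower[OF const_pos(10,11,8,9)] by meson
  \<comment> \<open>\<open>C1\<close>, \<open>C3\<close> and \<open>c1\<close> are constants of the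
    locale, which is interpreted only after n is fixed. Their values depend on the given constants
    alone and are written out here, so that K and M can be fixed first.\<close>
  define C2 where "C2 = 8 + \<bar>ln A1\<bar> + A3 + ln (max 1 B1) + B2 + B3 + CP + 2 + 1 / b1"
  define K where "K = 2 * (C2 + ln CI + 1) / A4"
  define a where "a = min (1 / (144 * b2\<^sup>2)) (1 / (12 * b2))"
  define M where "M = max 1 ((K * (12 + ln (2 * B1 + 3) + B2) + 11 + ln CI / 2 + 2 + C2 / 2 + 1) / a)"
  \<comment> \<open>The sum of all ratios occurring in the smallness conditions. Since the rate is n
    times a null sequence, \<open>rate * D \<le> n\<close> holds eventually, and each condition
    follows because D exceeds its ratio.\<close>
  define D where "D = 1 + K + M / (4 * b2\<^sup>2) + 36 * (a * M) + 2 * (C2 + ln CI + K + 1) + (C2 + ln CI + 2) / cI"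
  have C2: "C2 > 0" using const_pos CP by (simp add: C2_def add_pos_nonneg add_nonneg_pos)
  have lCI: "ln CI \<ge> 0" using CI(1) by simp
  have K: "K > 0" "A4 * K / 2 \<ge> C2 + ln CI + 1" using C2 lCI const_pos by (auto simp: K_def)
  have a0: "a > 0" using const_pos by (simp add: a_def)
  have M: "M \<ge> 1" "a * M \<ge> K * (12 + ln (2 * B1 + 3) + B2) + 11 + ln CI / 2 + 2 + C2 / 2 + 1"
  proof -
    show "M \<ge> 1" by (simp add: M_def)
    have "(K * (12 + ln (2 * B1 + 3) + B2) + 11 + ln CI / 2 + 2 + C2 / 2 + 1) / a \<le> M" by (simp add: M_def)
    then show "a * M \<ge> K * (12 + ln (2 * B1 + 3) + B2) + 11 + ln CI / 2 + 2 + C2 / 2 + 1"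
      using a0 by (simp add: pos_divide_le_eq mult.commute)
  qed
  have Dparts: "0 \<le> M / (4 * b2\<^sup>2)" "0 \<le> 36 * (a * M)" "0 \<le> 2 * (C2 + ln CI + K + 1)" "0 \<le> (C2 + ln CI + 2) / cI"
    using M(1) a0 C2 lCI K cI by simp_all
  have Dge: "1 \<le> D" "K \<le> D" "M / (4 * b2\<^sup>2) \<le> D" "36 * (a * M) \<le> D" "2 * (C2 + ln CI + K + 1) \<le> D" "(C2 + ln CI + 2) / cI \<le> D"
    unfolding D_def using Dparts K(1) by linarith+
  note D1 = Dge(1)
  let ?pm = "\<lambda>n. pmax (G n) (grp n)"
  let ?Lg = "\<lambda>n. max (ln (real (G n))) (real (?pm n) * ln (real n))"
  let ?eps = "\<lambda>n. eps_rate n (s0 n) (G n) (?pm n) (d n)"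
  let ?post = "\<lambda>n A Y. posterior (prior_beta (pr n) (G n) (p n) (d n) (grp n) (lam n) \<Otimes>\<^sub>M prior_Sigma (d n) (H n) mu nu)
                 (\<lambda>\<theta> Y. lik n (p n) (d n) (X n) (fst \<theta>) (snd \<theta>) Y) A Y"
  have "(\<lambda>n. (?eps n)\<^sup>2) \<longlonglongrightarrow> 0" using tendsto_power[OF eps_to_0, of 2] by simp
  then have ev_eps: "\<forall>\<^sub>F n in sequentially. (?eps n)\<^sup>2 < 1 / D" by (rule order_tendstoD) (use D1 in simp)
  \<comment> \<open>G \<ge> n^c gives \<open>Lg \<ge> c * ln n\<close>, so half of the exponent
    \<open>A4 * Lg\<close> eventually absorbs the constant \<open>A2\<close>; the other half is what
    remains for the dimension tail.\<close>
  have "(\<lambda>n. real n powr - (A4 / 2 * c)) \<longlonglongrightarrow> 0"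
    using const_pos by (intro tendsto_neg_powr filterlim_real_sequentially) simp
  then have ev_rho: "\<forall>\<^sub>F n in sequentially. real n powr - (A4 / 2 * c) < 1 / (2 * A2)"
    by (rule order_tendstoD) (use const_pos in simp)
  have ev_d: "\<forall>\<^sub>F n in sequentially. (real (d n))\<^sup>2 * ln (real n) / real n < 1"
    and ev_pm: "\<forall>\<^sub>F n in sequentially. real (?pm n) / real n < 1"
    by (rule order_tendstoD(2)[OF d_small] order_tendstoD(2)[OF pmax_small], simp)+
  have main: "\<forall>\<^sub>F n in sequentially. \<forall>\<beta>0\<in>B0_set n (G n) (p n) (d n) (grp n) (lam n) (s0 n). \<forall>Sig0\<in>H0_set (d n) b1 b2.
      (\<integral>Y. ?post n {\<theta>. frob2 {0..<n} {0..<d n} (mmul {0..<n} {0..<p n} {0..<d n} (X n) (\<lambda>lk. fst \<theta> lk - \<beta>0 lk)) \<ge> M * real n * (?eps n)\<^sup>2} Y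
         \<partial>data_dist n (p n) (d n) (X n) \<beta>0 Sig0) \<le> 5 / real n \<and>
      (\<integral>Y. ?post n {\<theta>. frob2 {0..<d n} {0..<d n} (\<lambda>il. snd \<theta> il - Sig0 il) \<ge> M * (?eps n)\<^sup>2} Y
         \<partial>data_dist n (p n) (d n) (X n) \<beta>0 Sig0) \<le> 5 / real n"
    using setting eventually_ge_at_top[of 16] ev_d ev_pm ev_eps ev_rho
  proof eventually_elim
    case (elim n)
    have n16: "16 \<le> n" using elim(2) .
    then have np: "real n > 0" and n3: "3 \<le> n" by auto
    have set: "d n \<ge> 1" "\<And>j. j < G n \<Longrightarrow> grp n j \<noteq> {}"
      "\<And>j j'. j < G n \<Longrightarrow> j' < G n \<Longrightarrow> j \<noteq> j' \<Longrightarrow> grp n j \<inter> grp n j' = {}"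
      "(\<Union>j<G n. grp n j) = {0..<p n}" "set_pmf (pr n) \<subseteq> {0..G n * d n}"
      "\<And>s. s \<in> {1..G n * d n} \<Longrightarrow>
          A1 * max (real (G n)) (real n ^ ?pm n) powr (- A3) \<le> pmf (pr n) s / pmf (pr n) (s - 1) \<and>
          pmf (pr n) s / pmf (pr n) (s - 1) \<le> A2 * max (real (G n)) (real n ^ ?pm n) powr (- A4)"
      "\<And>k. k < d n \<Longrightarrow>
          circ_norm n (G n) (grp n) (X n) / (B1 * max (real (G n) powr (1 / real (?pm n))) (real n) powr B2) \<le> lam n k \<and>
          lam n k \<le> B3 * circ_norm n (G n) (grp n) (X n) * sqrt (?Lg n)"
      "haar_orth (d n) (H n)" and Gc: "real (G n) \<ge> real n powr c"
      using elim(1) by blast+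
    have G1: "1 \<le> G n" using Gc np by (metis One_nat_def Suc_leI less_le_trans of_nat_0_less_iff powr_gt_zero less_irrefl)
    have ln1: "1 \<le> ln (real n)"
    proof -
      have "exp 1 \<le> real n" using exp_le n3 by linarith
      then show ?thesis using np by (subst ln_ge_iff) auto
    qed
    have dn: "d n \<le> n"
    proof -
      have "(real (d n))\<^sup>2 * 1 \<le> (real (d n))\<^sup>2 * ln (real n)" using ln1 by (intro mult_left_mono) auto
      also have "\<dots> \<le> real n" using elim(3) np by (simp add: divide_less_eq)
      finally have "real ((d n)\<^sup>2) \<le> real n" by simp
      then have "(d n)\<^sup>2 \<le> n" by (simp only: of_nat_le_iff)
      moreover have "d n \<le> (d n)\<^sup>2" by (simp add: power2_eq_square)
      ultimately show ?thesis by linarith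
    qed
    have pmn: "?pm n \<le> n" using elim(4) np by (simp add: divide_less_eq)
    have "c * ln (real n) = ln (real n powr c)" using np by (simp add: ln_powr)
    also have "\<dots> \<le> ln (real (G n))" using Gc np G1 by (subst ln_le_cancel_iff) auto
    finally have Lgc: "c * ln (real n) \<le> ?Lg n" by simp
    then have Lg0: "0 \<le> ?Lg n" using ln1 const_pos by (smt (verit) mult_nonneg_nonneg)
    have rho: "A2 * exp (- (A4 / 2) * ?Lg n) \<le> 1 / 2"
    proof -
      have "exp (- (A4 / 2) * ?Lg n) \<le> exp (- (A4 / 2) * (c * ln (real n)))"
        using mult_left_mono[OF Lgc, of "A4 / 2"] const_pos by simp
      also have "\<dots> = real n powr - (A4 / 2 * c)" using np by (simp add: powr_def)
      also have "\<dots> \<le> 1 / (2 * A2)" using elim(6) by simp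
      finally have "A2 * exp (- (A4 / 2) * ?Lg n) \<le> A2 * (1 / (2 * A2))" using const_pos by (intro mult_left_mono) auto
      then show ?thesis using const_pos by simp
    qed
    have rho2: "A2 * exp (- A4 * ?Lg n) \<le> 1 / 2 * exp (- (A4 / 2) * ?Lg n)"
    proof -
      have "exp (- A4 * ?Lg n) = exp (- (A4 / 2) * ?Lg n) * exp (- (A4 / 2) * ?Lg n)" unfolding exp_add[symmetric] by simp
      then show ?thesis using mult_right_mono[OF rho, of "exp (- (A4 / 2) * ?Lg n)"] by (simp add: mult.assoc)
    qed
    have e1: "exp (- (A4 / 2) * ?Lg n) \<le> 1" using Lg0 const_pos by simp
    interpret model_Sigma "G n" "p n" "d n" "grp n" n "s0 n" "X n" "pr n" "lam n" "H n" A1 A2 A3 A4 B1 B2 B3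
      "ln (real n)" "?Lg n" "circ_norm n (G n) (grp n) (X n)" "?pm n" mu nu b1 b2 CI cI
    proof unfold_locales
      show "A2 * exp (- A4 * ?Lg n) \<le> 1 / 2" using rho2 e1 by linarith
    qed (use const_pos set n3 G1 dn pmn CI cI in auto)
    have re: "rate = real n * (?eps n)\<^sup>2" unfolding rate_def using eps_rate_sq[of n "G n"] n3 G1 by simp
    have rD: "rate * D \<le> real n" using elim(5) D1 np by (simp add: re pos_less_divide_eq less_imp_le mult.assoc)
    have sm: "x * rate \<le> y * real n" if "x / y \<le> D" "y > 0" for x y
    proof -
      have "x / y * rate \<le> D * rate" using that rate_ge(4) by (intro mult_right_mono) auto
      also have "\<dots> \<le> real n" using rD by (simp add: mult.commute)
      finally show ?thesis using that(2) by (simp add: field_simps)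
    qed
    have c1a: "c1 = a" by (simp add: c1_def a_def)
    have small: "rate \<le> real n" "K * rate \<le> real n" "M * rate \<le> 4 * b2\<^sup>2 * real n" "c1 * M * rate \<le> real n / 36"
      "(C2 + ln CI + K + 1) * rate \<le> real n / 2" "(C2 + ln CI + 2) * rate \<le> cI * real n"
    proof -
      show "rate \<le> real n" using sm[of 1 1] Dge(1) by simp
      show "K * rate \<le> real n" using sm[of K 1] Dge(2) by simp
      show "M * rate \<le> 4 * b2\<^sup>2 * real n" by (rule sm[OF Dge(3)]) (use const_pos in simp)
      show "c1 * M * rate \<le> real n / 36" using sm[of "a * M" "1 / 36"] Dge(4) by (simp add: c1a mult.commute)
      have "(C2 + ln CI + K + 1) / (1 / 2) \<le> D" using Dge(5) by (simp only: divide_divide_eq_right mult.commute[of _ 2] div_by_1)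
      from sm[OF this] show "(C2 + ln CI + K + 1) * rate \<le> real n / 2" by simp
      show "(C2 + ln CI + 2) * rate \<le> cI * real n" by (rule sm[OF Dge(6) cI(1)])
    qed
    have A2: "A2 * exp (- A4 * ?Lg n) \<le> exp (- (A4 / 2) * ?Lg n)"
    proof -
      have "0 < exp (- (A4 / 2) * ?Lg n)" by simp
      then show ?thesis using rho2 by linarith
    qed
    have C2e: "C2 = C1 + CP + 2 + 1 / b1" by (simp add: C1_def C2_def)
    have Me: "c1 * M \<ge> C3 K + ln CI / 2 + 2 + C2 / 2 + 1" using M(2) by (simp add: c1a C3_def)
    \<comment> \<open>The rate is at least ln n because d \<ge> 1, which makes the bound vanish even
      when the rate grows no faster.\<close>
    have rate_n: "5 * exp (- rate) \<le> 5 / real n"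
    proof -
      have "exp (ln (real n)) \<le> exp rate" using rate_ge(3) by simp
      then have "real n \<le> exp rate" using np by simp
      then show ?thesis using np by (simp add: exp_minus field_simps)
    qed
    have bound: "(\<integral>Y. ?post n A Y \<partial>data_dist n (p n) (d n) (X n) \<beta>0 Sig0) \<le> 5 / real n"
      if \<beta>0: "\<beta>0 \<in> B0_set n (G n) (p n) (d n) (grp n) (lam n) (s0 n)" and S0: "Sig0 \<in> H0_set (d n) b1 b2"
        and A: "A \<inter> space Pr \<in> sets Pr" "\<And>z. (fst z, SigPD (d n) (snd z)) \<in> A \<Longrightarrow> far M \<beta>0 Sig0 z" for A \<beta>0 Sig0
    proof -
      obtain N where N: "N \<in> sets PDm" "\<And>x. x \<in> N \<Longrightarrow> spd (d n) (SigPD (d n) x)"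
        "\<And>x v. x \<in> N \<Longrightarrow> (1 + 1 / real n ^ 3) * bf (d n) Sig0 v v \<le> bf (d n) (SigPD (d n) x) v v \<and>
          bf (d n) (SigPD (d n) x) v v \<le> (1 + 4 / real n ^ 3) * bf (d n) Sig0 v v"
        "ennreal (exp (- CP * (real (d n))\<^sup>2 * ln (real n))) \<le> emeasure PDm N"
        using PDl[OF n3 set(1) dn set(8) S0] by blast
      show ?thesis
        using posterior_small[OF \<beta>0 S0 n16 A N CP C2e K M(1) Me A2 small] rate_n by (rule order_trans)
    qed
    show ?case
    proof (intro ballI conjI)
      fix \<beta>0 Sig0
      assume \<beta>0: "\<beta>0 \<in> B0_set n (G n) (p n) (d n) (grp n) (lam n) (s0 n)" and S0: "Sig0 \<in> H0_set (d n) b1 b2"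
      have e1: "M * real n * (?eps n)\<^sup>2 = M * rate" by (simp add: re)
      have e2: "M * (?eps n)\<^sup>2 = M * rate / real n" using np by (simp add: re)
      show "(\<integral>Y. ?post n {\<theta>. frob2 {0..<n} {0..<d n} (mmul {0..<n} {0..<p n} {0..<d n} (X n) (\<lambda>lk. fst \<theta> lk - \<beta>0 lk)) \<ge> M * real n * (?eps n)\<^sup>2} Y
         \<partial>data_dist n (p n) (d n) (X n) \<beta>0 Sig0) \<le> 5 / real n"
        unfolding e1 xdist_def[symmetric] by (rule bound[OF \<beta>0 S0 far_sets(1)]) (simp add: far_def)
      show "(\<integral>Y. ?post n {\<theta>. frob2 {0..<d n} {0..<d n} (\<lambda>il. snd \<theta> il - Sig0 il) \<ge> M * (?eps n)\<^sup>2} Y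
         \<partial>data_dist n (p n) (d n) (X n) \<beta>0 Sig0) \<le> 5 / real n"
        unfolding e2 by (rule bound[OF \<beta>0 S0 far_sets(2)]) (simp add: far_def)
    qed
  qed
  have ev5: "\<forall>\<^sub>F n in sequentially. 5 / real n \<le> e" if e: "e > 0" for e :: real
  proof -
    have "(\<lambda>n. 5 / real n) \<longlonglongrightarrow> 0" by (rule lim_const_over_n)
    from order_tendstoD(2)[OF this e] show ?thesis by eventually_elim simp
  qed
  show ?thesis
  proof (intro exI[of _ M] conjI allI impI)
    show "M > 0" using M(1) by simp
  next
    fix e :: real assume "e > 0"
    from main ev5[OF this] show "\<forall>\<^sub>F n in sequentially.
       \<forall>\<beta>0\<in>B0_set n (G n) (p n) (d n) (grp n) (lam n) (s0 n). \<forall>Sig0\<in>H0_set (d n) b1 b2.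
         (\<integral>Y. ?post n {\<theta>. frob2 {0..<n} {0..<d n} (mmul {0..<n} {0..<p n} {0..<d n} (X n) (\<lambda>lk. fst \<theta> lk - \<beta>0 lk)) \<ge> M * real n * (?eps n)\<^sup>2} Y
            \<partial>data_dist n (p n) (d n) (X n) \<beta>0 Sig0) \<le> e"
      by eventually_elim (meson order_trans)
  next
    fix e :: real assume "e > 0"
    from main ev5[OF this] show "\<forall>\<^sub>F n in sequentially.
       \<forall>\<beta>0\<in>B0_set n (G n) (p n) (d n) (grp n) (lam n) (s0 n). \<forall>Sig0\<in>H0_set (d n) b1 b2.
         (\<integral>Y. ?post n {\<theta>. frob2 {0..<d n} {0..<d n} (\<lambda>il. snd \<theta> il - Sig0 il) \<ge> M * (?eps n)\<^sup>2} Y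
            \<partial>data_dist n (p n) (d n) (X n) \<beta>0 Sig0) \<le> e"
      by eventually_elim (meson order_trans)
  qed
qed

end
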